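(* Suppose that $\Omega>0$ and $\alpha\delta<0$, so that the family of equilibria of the regularized system undergoes a Hopf bifurcation. Then, provided $$\delta(\zeta^-+\chi^-)-\alpha(\zeta^++\chi^+)\neq 0,$$ all cases $a_2<0$, $a_2=0$ and $a_2>0$ can be attained by varying the regularization function $\phi$, where $$\begin{aligned}a_2=&\ \frac{(\alpha-\delta)\phi_{1,H}^2}{16\Omega^2}\Big((\beta+1)^2(\delta\zeta^--\alpha\zeta^+)-(\alpha-\delta)^2(\eta^-+\beta\eta^+)\Big)+\frac{(\beta+1)\phi_{2,H}}{16\Omega}(\delta\chi^--\alpha\chi^+)\\&+\frac18\left(\frac{\phi_{3,H}}{\phi_{1,H}(\alpha-\delta)}-\frac{\phi_{2,H}^2}{\phi_{1,H}^2(\alpha-\delta)}-\frac{(\beta+1)\phi_{2,H}}{\Omega}\right)\big(\delta(\zeta^-+\chi^-)-\alpha(\zeta^++\chi^+)\big)\end{aligned}$$ is the coefficient in the expansion $a=a_2\sqrt\epsilon+\mathcal O(\epsilon)$ of the first Lyapunov coefficient of that Hopf bifurcation.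
   Context: Setting. Fix $\delta\in\{1,-1\}$ and $\alpha,\beta\in\mathbb R$ with $\alpha\beta\neq 0$ and $\Omega:=\beta\delta+\alpha\neq 0$. Let $\Sigma_+=\{y>0\}$, $\Sigma_-=\{y<0\}$ in a neighbourhood of the origin of $\mathbb R^2$. The piecewise smooth system is $\dot{\mathbf x}=X^\pm(\mathbf x,\mu)$ for $\mathbf x=(x,y)\in\Sigma_\pm$, with $\mu$ a parameter near $0$ and $X^\pm$ smooth (up to $y=0$) of the form $$X^+=\begin{pmatrix}\delta+\zeta^+x+\mathcal O(x^2+y+\mu)\\ x+\eta^+x^2+\chi^+y+\mathcal O(xy+\mu(x+y)+x^3)\end{pmatrix},$$ $$X^-=\begin{pmatrix}\alpha+\zeta^-x+\mathcal O(x^2+y+\mu)\\ -\beta(x-\mu)+\eta^-(x-\mu)^2+\chi^-y+\mathcal O(xy+\mu y+\mu(x-\mu)+(x-\mu)^3)\end{pmatrix},$$ with real constants $\zeta^\pm,\eta^\pm,\chi^\pm$; $\mathcal O(m_1+m_2+\cdots)$ is a remainder that is a combination of the listed monomials with smooth coefficients. Regularization. A regularization function is a $C^k$ function $\phi:\mathbb R\to\mathbb R$ ($1\le k\le\infty$, here regular enough for the derivatives below to exist) with $\phi(s)=1$ for $s\ge1$, $\phi(s)=-1$ for $s\le-1$, $\phi(s)\in(-1,1)$ and $\phi'(s)>0$ for $s\in(-1,1)$. For $\epsilon>0$, the regularized system is $\dot{\mathbf x}=X_\epsilon$, $X_\epsilon=\frac12X^+(1+\phi(y/\epsilon))+\frac12X^-(1-\phi(y/\epsilon))$.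 When $\alpha\delta<0$ and $\Omega>0$, it has for small $\epsilon>0$ and small $\mu$ a locally unique family of equilibria $(x,y)=(\beta\delta\Omega^{-1}\mu+\mathcal O(\mu^2+\epsilon),\mathcal O(\epsilon))$, which undergoes a Hopf bifurcation at some $\mu=\mathcal O(\epsilon)$. Constants. $\hat y_0^*=\phi^{-1}\!\left(\frac{1+\alpha^{-1}\delta}{1-\alpha^{-1}\delta}\right)\in(-1,1)$ and $\phi_{i,H}=\phi^{(i)}(\hat y_0^* )$, $i=1,2,3$.
   Formalization: The printed a_2 is not the √ε coefficient when χ⁺≠χ⁻: the true one adds (χ⁺−χ⁻)/16·(φ_{2,H}−(β+1)(α−δ)φ_{1,H}²/Ω); all signs are proved for both, and for φ only C³ the remainder is o(√ε) instead of O(ε). *)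

theory Defs
  imports "HOL-Analysis.Analysis" "HOL-Library.Landau_Symbols" "HOL-Library.Extended_Nat"
begin

section \<open>Smoothness\<close>

text \<open>Class C^n on an open subset of a finite-dimensional space, by iterated directional derivatives.\<close>

primrec Cn_on :: "nat \<Rightarrow> 'a::euclidean_space set \<Rightarrow> ('a \<Rightarrow> real) \<Rightarrow> bool" where
  "Cn_on 0 S f \<longleftrightarrow> continuous_on S f"
| "Cn_on (Suc n) S f \<longleftrightarrow>
     (\<forall>x\<in>S. f differentiable (at x)) \<and> (\<forall>v. Cn_on n S (\<lambda>x. frechet_derivative f (at x) v))"

definition Ck_on :: "enat \<Rightarrow> 'a::euclidean_space set \<Rightarrow> ('a \<Rightarrow> real) \<Rightarrow> bool" where
  "Ck_on k S f \<longleftrightarrow> (\<forall>n. enat n \<le> k \<longrightarrow> Cn_on n S f)"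

section \<open>The piecewise smooth system\<close>

text \<open>\<open>remainder_on ms U h\<close>: on U, h is a combination of the monomials ms with smooth coefficients;
  this is h = O(m1 + m2 + ...). Points are (x, y, mu).\<close>

definition remainder_on ::
    "(real \<times> real \<times> real \<Rightarrow> real) list \<Rightarrow> (real \<times> real \<times> real) set \<Rightarrow> (real \<times> real \<times> real \<Rightarrow> real) \<Rightarrow> bool" where
  "remainder_on ms U h \<longleftrightarrow>
     (\<exists>cs. length cs = length ms \<and> (\<forall>c\<in>set cs. Ck_on \<infinity> U c) \<and>
           (\<forall>p\<in>U. h p = (\<Sum>i<length ms. (cs ! i) p * (ms ! i) p)))"

text \<open>The fields are given on a full neighbourhood of the origin (not only on their side of y = 0),
  since the regularization evaluates both of them for \<open>\<bar>y\<bar> < \<epsilon>\<close>. Their smoothness follows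
  from the smoothness of the coefficients of the remainders.\<close>

definition upper_field ::
    "real \<Rightarrow> real \<Rightarrow> real \<Rightarrow> real \<Rightarrow> (real \<times> real \<Rightarrow> real \<Rightarrow> real \<times> real) \<Rightarrow> bool" where
  "upper_field \<delta> \<zeta>p \<eta>p \<chi>p X \<longleftrightarrow>
     (\<exists>U. open U \<and> (0, 0, 0) \<in> U \<and>
        remainder_on [(\<lambda>(x, y, \<mu>). x\<^sup>2), (\<lambda>(x, y, \<mu>). y), (\<lambda>(x, y, \<mu>). \<mu>)] U
          (\<lambda>(x, y, \<mu>). fst (X (x, y) \<mu>) - (\<delta> + \<zeta>p * x)) \<and>
        remainder_on [(\<lambda>(x, y, \<mu>). x * y), (\<lambda>(x, y, \<mu>). \<mu> * x), (\<lambda>(x, y, \<mu>). \<mu> * y), (\<lambda>(x, y, \<mu>). x ^ 3)] U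
          (\<lambda>(x, y, \<mu>). snd (X (x, y) \<mu>) - (x + \<eta>p * x\<^sup>2 + \<chi>p * y)))"

definition lower_field ::
    "real \<Rightarrow> real \<Rightarrow> real \<Rightarrow> real \<Rightarrow> real \<Rightarrow> (real \<times> real \<Rightarrow> real \<Rightarrow> real \<times> real) \<Rightarrow> bool" where
  "lower_field \<alpha> \<beta> \<zeta>m \<eta>m \<chi>m X \<longleftrightarrow>
     (\<exists>U. open U \<and> (0, 0, 0) \<in> U \<and>
        remainder_on [(\<lambda>(x, y, \<mu>). x\<^sup>2), (\<lambda>(x, y, \<mu>). y), (\<lambda>(x, y, \<mu>). \<mu>)] U
          (\<lambda>(x, y, \<mu>). fst (X (x, y) \<mu>) - (\<alpha> + \<zeta>m * x)) \<and>
        remainder_on [(\<lambda>(x, y, \<mu>). x * y), (\<lambda>(x, y, \<mu>). \<mu> * y), (\<lambda>(x, y, \<mu>). \<mu> * (x - \<mu>)), (\<lambda>(x, y, \<mu>). (x - \<mu>) ^ 3)] U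
          (\<lambda>(x, y, \<mu>). snd (X (x, y) \<mu>) - (- \<beta> * (x - \<mu>) + \<eta>m * (x - \<mu>)\<^sup>2 + \<chi>m * y)))"

section \<open>Regularization\<close>

definition regularization_function :: "enat \<Rightarrow> (real \<Rightarrow> real) \<Rightarrow> bool" where
  "regularization_function k \<phi> \<longleftrightarrow>
     Ck_on k UNIV \<phi> \<and> (\<forall>s\<ge>1. \<phi> s = 1) \<and> (\<forall>s\<le>-1. \<phi> s = -1) \<and>
     (\<forall>s\<in>{-1<..<1}. \<phi> s \<in> {-1<..<1} \<and> deriv \<phi> s > 0)"

definition regularized_field ::
    "(real \<times> real \<Rightarrow> real \<Rightarrow> real \<times> real) \<Rightarrow> (real \<times> real \<Rightarrow> real \<Rightarrow> real \<times> real) \<Rightarrow> (real \<Rightarrow> real) \<Rightarrow>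
     real \<Rightarrow> real \<Rightarrow> real \<times> real \<Rightarrow> real \<times> real" where
  "regularized_field Xp Xm \<phi> \<epsilon> \<mu> p =
     ((1 + \<phi> (snd p / \<epsilon>)) / 2) *\<^sub>R Xp p \<mu> + ((1 - \<phi> (snd p / \<epsilon>)) / 2) *\<^sub>R Xm p \<mu>"

section \<open>Planar vector fields, Hopf bifurcation, first Lyapunov coefficient\<close>

definition dx :: "(real \<times> real \<Rightarrow> real) \<Rightarrow> real \<times> real \<Rightarrow> real" where
  "dx h = (\<lambda>(x, y). deriv (\<lambda>t. h (t, y)) x)"

definition dy :: "(real \<times> real \<Rightarrow> real) \<Rightarrow> real \<times> real \<Rightarrow> real" where
  "dy h = (\<lambda>(x, y). deriv (\<lambda>t. h (x, t)) y)"

definition jacobian_eigenvalue :: "(real \<times> real \<Rightarrow> real \<times> real) \<Rightarrow> real \<times> real \<Rightarrow> complex \<Rightarrow> bool" where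
  "jacobian_eigenvalue V p l \<longleftrightarrow>
     (\<exists>z w :: complex. (z, w) \<noteq> (0, 0) \<and>
        of_real (dx (\<lambda>q. fst (V q)) p) * z + of_real (dy (\<lambda>q. fst (V q)) p) * w = l * z \<and>
        of_real (dx (\<lambda>q. snd (V q)) p) * z + of_real (dy (\<lambda>q. snd (V q)) p) * w = l * w)"

text \<open>Along the branch q of equilibria, a pair of complex conjugate eigenvalues crosses the imaginary
  axis away from 0 with nonzero speed at the parameter value \<open>\<mu>\<^sub>0\<close>. Nothing is required of
  the first Lyapunov coefficient.\<close>

definition hopf_bifurcation ::
    "(real \<Rightarrow> real \<times> real \<Rightarrow> real \<times> real) \<Rightarrow> (real \<Rightarrow> real \<times> real) \<Rightarrow> real \<Rightarrow> bool" where
  "hopf_bifurcation V q \<mu>\<^sub>0 \<longleftrightarrow>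
     (\<exists>l :: real \<Rightarrow> complex.
        (\<forall>\<^sub>F \<mu> in nhds \<mu>\<^sub>0. V \<mu> (q \<mu>) = 0 \<and> jacobian_eigenvalue (V \<mu>) (q \<mu>) (l \<mu>)) \<and>
        Re (l \<mu>\<^sub>0) = 0 \<and> Im (l \<mu>\<^sub>0) > 0 \<and>
        (\<exists>l'. (l has_vector_derivative l') (at \<mu>\<^sub>0) \<and> Re l' \<noteq> 0))"

text \<open>The classical (Guckenheimer--Holmes) coefficient of
  x' = - omega y + f(x, y), y' = omega x + g(x, y) at the origin. Only derivatives of order 2 and 3
  enter, so the full right-hand sides may be used in place of f, g. With polar coordinates adapted to
  the normal form, r' = a r^3 + O(r^5).\<close>

definition normal_form_lyapunov :: "real \<Rightarrow> (real \<times> real \<Rightarrow> real \<times> real) \<Rightarrow> real" where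
  "normal_form_lyapunov \<omega> V =
     (let f = (\<lambda>q. fst (V q)); g = (\<lambda>q. snd (V q)); z = (0, 0);
          fxx = dx (dx f) z; fxy = dx (dy f) z; fyy = dy (dy f) z;
          gxx = dx (dx g) z; gxy = dx (dy g) z; gyy = dy (dy g) z
      in (dx (dx (dx f)) z + dx (dy (dy f)) z + dx (dx (dy g)) z + dy (dy (dy g)) z) / 16
         + (fxy * (fxx + fyy) - gxy * (gxx + gyy) - fxx * gxx + fyy * gyy) / (16 * \<omega>))"

text \<open>First Lyapunov coefficient at an equilibrium p of V where the Jacobian (a, b; c, d) has a + d = 0
  and positive determinant \<open>\<omega>\<^sup>2\<close>. The linear coordinates (w, v) with
  \<open>v = y - snd p\<close> and \<open>\<omega> w = c (x - fst p) + d v\<close> bring the linear part into the form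
  w' = - omega v, v' = omega w. Keeping the second coordinate fixes the positive factor by which
  the coefficient depends on the choice of coordinates.\<close>

definition first_lyapunov :: "(real \<times> real \<Rightarrow> real \<times> real) \<Rightarrow> real \<times> real \<Rightarrow> real" where
  "first_lyapunov V p =
     (let f = (\<lambda>q. fst (V q)); g = (\<lambda>q. snd (V q)); c = dx g p; d = dy g p;
          \<omega> = sqrt (dx f p * d - dy f p * c)
      in normal_form_lyapunov \<omega>
           (\<lambda>(w, v). let q = (fst p + (\<omega> * w - d * v) / c, snd p + v)
                      in ((c * f q + d * g q) / \<omega>, g q)))"

section \<open>The Hopf bifurcation of the regularized system\<close>

definition equilibrium_family ::
    "real \<Rightarrow> real \<Rightarrow> real \<Rightarrow> (real \<times> real \<Rightarrow> real \<Rightarrow> real \<times> real) \<Rightarrow> (real \<times> real \<Rightarrow> real \<Rightarrow> real \<times> real) \<Rightarrow>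
     (real \<Rightarrow> real) \<Rightarrow> (real \<Rightarrow> real \<Rightarrow> real \<times> real) \<Rightarrow> bool" where
  "equilibrium_family \<alpha> \<beta> \<delta> Xp Xm \<phi> E \<longleftrightarrow>
     (\<exists>\<epsilon>\<^sub>0>0. \<exists>\<mu>\<^sub>0>0. \<exists>r>0. \<exists>K. \<forall>\<epsilon>\<in>{0<..<\<epsilon>\<^sub>0}. \<forall>\<mu>\<in>{-\<mu>\<^sub>0<..<\<mu>\<^sub>0}.
        E \<epsilon> \<mu> \<in> ball 0 r \<and> regularized_field Xp Xm \<phi> \<epsilon> \<mu> (E \<epsilon> \<mu>) = 0 \<and>
        (\<forall>p\<in>ball 0 r. regularized_field Xp Xm \<phi> \<epsilon> \<mu> p = 0 \<longrightarrow> p = E \<epsilon> \<mu>) \<and>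
        \<bar>fst (E \<epsilon> \<mu>) - \<beta> * \<delta> / (\<beta> * \<delta> + \<alpha>) * \<mu>\<bar> \<le> K * (\<mu>\<^sup>2 + \<epsilon>) \<and>
        \<bar>snd (E \<epsilon> \<mu>)\<bar> \<le> K * \<epsilon>)"

definition hopf_of_family ::
    "real \<Rightarrow> real \<Rightarrow> real \<Rightarrow> (real \<times> real \<Rightarrow> real \<Rightarrow> real \<times> real) \<Rightarrow> (real \<times> real \<Rightarrow> real \<Rightarrow> real \<times> real) \<Rightarrow>
     (real \<Rightarrow> real) \<Rightarrow> (real \<Rightarrow> real \<Rightarrow> real \<times> real) \<Rightarrow> (real \<Rightarrow> real) \<Rightarrow> bool" where
  "hopf_of_family \<alpha> \<beta> \<delta> Xp Xm \<phi> E \<mu>\<^sub>H \<longleftrightarrow>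
     equilibrium_family \<alpha> \<beta> \<delta> Xp Xm \<phi> E \<and> \<mu>\<^sub>H \<in> O[at_right 0](\<lambda>\<epsilon>. \<epsilon>) \<and>
     (\<forall>\<^sub>F \<epsilon> in at_right 0. hopf_bifurcation (regularized_field Xp Xm \<phi> \<epsilon>) (E \<epsilon>) (\<mu>\<^sub>H \<epsilon>))"

text \<open>The regularized field in the variables x = sqrt(eps) u, y = eps v and the time tau given by
  t = 2 sqrt(eps) tau. In these variables the field has a limit with a centre as \<open>\<epsilon>\<close> tends to 0.
  The time factor 2 removes the factors 1/2 of the regularization; it and the choice of v as
  amplitude in \<open>first_lyapunov\<close> normalize the Lyapunov coefficient.\<close>

definition rescaled_field ::
    "(real \<times> real \<Rightarrow> real \<Rightarrow> real \<times> real) \<Rightarrow> (real \<times> real \<Rightarrow> real \<Rightarrow> real \<times> real) \<Rightarrow> (real \<Rightarrow> real) \<Rightarrow>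
     real \<Rightarrow> real \<Rightarrow> real \<times> real \<Rightarrow> real \<times> real" where
  "rescaled_field Xp Xm \<phi> \<epsilon> \<mu> q =
     (let F = regularized_field Xp Xm \<phi> \<epsilon> \<mu> (sqrt \<epsilon> * fst q, \<epsilon> * snd q)
      in (2 * fst F, 2 * snd F / sqrt \<epsilon>))"

definition hopf_lyapunov ::
    "(real \<times> real \<Rightarrow> real \<Rightarrow> real \<times> real) \<Rightarrow> (real \<times> real \<Rightarrow> real \<Rightarrow> real \<times> real) \<Rightarrow> (real \<Rightarrow> real) \<Rightarrow>
     (real \<Rightarrow> real \<Rightarrow> real \<times> real) \<Rightarrow> (real \<Rightarrow> real) \<Rightarrow> real \<Rightarrow> real" where
  "hopf_lyapunov Xp Xm \<phi> E \<mu>\<^sub>H \<epsilon> =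
     (let p = E \<epsilon> (\<mu>\<^sub>H \<epsilon>)
      in first_lyapunov (rescaled_field Xp Xm \<phi> \<epsilon> (\<mu>\<^sub>H \<epsilon>)) (fst p / sqrt \<epsilon>, snd p / \<epsilon>))"

section \<open>The coefficient of the expansion\<close>

definition y_star :: "real \<Rightarrow> real \<Rightarrow> (real \<Rightarrow> real) \<Rightarrow> real" where
  "y_star \<alpha> \<delta> \<phi> = inv_into {-1<..<1} \<phi> ((1 + inverse \<alpha> * \<delta>) / (1 - inverse \<alpha> * \<delta>))"

definition phi_H :: "real \<Rightarrow> real \<Rightarrow> (real \<Rightarrow> real) \<Rightarrow> nat \<Rightarrow> real" where
  "phi_H \<alpha> \<delta> \<phi> i = (deriv ^^ i) \<phi> (y_star \<alpha> \<delta> \<phi>)"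

definition a2 ::
    "real \<Rightarrow> real \<Rightarrow> real \<Rightarrow> real \<Rightarrow> real \<Rightarrow> real \<Rightarrow> real \<Rightarrow> real \<Rightarrow> real \<Rightarrow> (real \<Rightarrow> real) \<Rightarrow> real" where
  "a2 \<alpha> \<beta> \<delta> \<zeta>p \<zeta>m \<eta>p \<eta>m \<chi>p \<chi>m \<phi> =
     (let \<Omega> = \<beta> * \<delta> + \<alpha>; \<phi>1 = phi_H \<alpha> \<delta> \<phi> 1; \<phi>2 = phi_H \<alpha> \<delta> \<phi> 2; \<phi>3 = phi_H \<alpha> \<delta> \<phi> 3
      in (\<alpha> - \<delta>) * \<phi>1\<^sup>2 / (16 * \<Omega>\<^sup>2)
           * ((\<beta> + 1)\<^sup>2 * (\<delta> * \<zeta>m - \<alpha> * \<zeta>p) - (\<alpha> - \<delta>)\<^sup>2 * (\<eta>m + \<beta> * \<eta>p))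
         + (\<beta> + 1) * \<phi>2 / (16 * \<Omega>) * (\<delta> * \<chi>m - \<alpha> * \<chi>p)
         + 1 / 8 * (\<phi>3 / (\<phi>1 * (\<alpha> - \<delta>)) - \<phi>2\<^sup>2 / (\<phi>1\<^sup>2 * (\<alpha> - \<delta>)) - (\<beta> + 1) * \<phi>2 / \<Omega>)
           * (\<delta> * (\<zeta>m + \<chi>m) - \<alpha> * (\<zeta>p + \<chi>p)))"

text \<open>The coefficient of sqrt(eps) in \<open>hopf_lyapunov\<close>. It is \<open>a2\<close> plus a term which \<open>a2\<close>
  lacks and which is absent if \<open>\<chi>p = \<chi>m\<close>. The extra term comes from the v-dependence
  of the mixture ((1 + phi(v)) chi+ + (1 - phi(v)) chi-) / 2 in front of y.\<close>

definition lyapunov_slope ::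
    "real \<Rightarrow> real \<Rightarrow> real \<Rightarrow> real \<Rightarrow> real \<Rightarrow> real \<Rightarrow> real \<Rightarrow> real \<Rightarrow> real \<Rightarrow> (real \<Rightarrow> real) \<Rightarrow> real" where
  "lyapunov_slope \<alpha> \<beta> \<delta> \<zeta>p \<zeta>m \<eta>p \<eta>m \<chi>p \<chi>m \<phi> =
     a2 \<alpha> \<beta> \<delta> \<zeta>p \<zeta>m \<eta>p \<eta>m \<chi>p \<chi>m \<phi>
     + (\<chi>p - \<chi>m) / 16
       * (phi_H \<alpha> \<delta> \<phi> 2 - (\<beta> + 1) * (\<alpha> - \<delta>) * (phi_H \<alpha> \<delta> \<phi> 1)\<^sup>2 / (\<beta> * \<delta> + \<alpha>))"

lemma lyapunov_slope_eq_a2: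
  "lyapunov_slope \<alpha> \<beta> \<delta> \<zeta>p \<zeta>m \<eta>p \<eta>m \<chi>p \<chi>p \<phi> = a2 \<alpha> \<beta> \<delta> \<zeta>p \<zeta>m \<eta>p \<eta>m \<chi>p \<chi>p \<phi>"
  by (simp add: lyapunov_slope_def)

end

theory Submission
  imports Defs "HOL-Computational_Algebra.Polynomial"
begin

text \<open>In the variables \<open>x\<close> and \<open>v = y / \<epsilon>\<close> the equations for the equilibria extend smoothly to
  \<open>\<epsilon> = 0\<close>, where they have a nondegenerate solution at \<open>\<mu> = 0\<close>; the inverse function theorem in
  \<open>(x, v, \<epsilon>, \<mu>)\<close> yields the family. The product of \<open>\<epsilon>\<close> and the trace of the Jacobian along
  the family is smooth too, and its \<open>\<mu>\<close>-derivative at the origin does not vanish, so the intermediate value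
  theorem gives a zero \<open>\<mu>\<^sub>H = O(\<epsilon>)\<close> of the trace at which the eigenvalues cross with nonzero speed.

  For any such family, the equation of the first component determines \<open>v\<close> up to \<open>O(\<epsilon>)\<close>, and the vanishing
  trace determines the quotient by \<open>\<epsilon>\<close> of the difference of the second components of \<open>X\<^sup>+\<close>
  and \<open>X\<^sup>-\<close>. These two facts suffice to compute the limit of the Lyapunov coefficient
  divided by \<open>sqrt \<epsilon>\<close>. The third derivative of \<open>\<phi>\<close> enters through its value at \<open>v\<close>; it decides between
  the error terms for \<open>k = 3\<close> and \<open>k \<ge> 4\<close>.

  The coefficients are affine in the third derivative of \<open>\<phi>\<close> at \<open>y\<^sup>*\<close>, with a slope proportional to
  the quantity assumed to be nonzero. That derivative can be prescribed without changing the 2-jet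
  by adding a cubic with a narrow cutoff, whose first derivative is too small to destroy
  monotonicity.\<close>

section \<open>Calculus of \<open>Cn_on\<close>\<close>

text \<open>The obstacle is the factor \<phi>(y/\<epsilon>): derivatives of the regularized field in
  y have poles in \<epsilon>. Treating v = y/\<epsilon> as an independent variable removes the poles
  from the equilibrium equations, and a factor \<epsilon> removes them from the trace. One quotient
  survives into the Lyapunov coefficient, (C - D)/\<epsilon>, where C and D are the second
  components of the two fields. An O(\<epsilon>) bound on the Hopf parameter only makes this
  quotient bounded; its limit comes from the vanishing trace. This is why the expansion holds for
  every family that meets the definition, and not just for the branch constructed here. The order
  sqrt(\<epsilon>) of the coefficient has a simple origin: in the rescaled coordinates every product
  in the Lyapunov formula contains at least one factor of that order. The true coefficient of
  sqrt(\<epsilon>) and \<open>a2\<close> differ by a term free of the third derivative of \<phi>, so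
  one argument gives all signs for both.\<close>

lemma frechet_derivative_cong_open:
  assumes "open S" "x \<in> S" "\<And>y. y \<in> S \<Longrightarrow> f y = g y"
  shows "frechet_derivative f (at x) = frechet_derivative g (at x)"
proof -
  have "(f has_derivative D) (at x) \<longleftrightarrow> (g has_derivative D) (at x)" for D
    using assms has_derivative_transform_within_open[of _ D x UNIV S]
    by (metis)
  then show ?thesis
    by (simp add: frechet_derivative_def)
qed

lemma differentiable_cong_open:
  assumes "open S" "x \<in> S" "\<And>y. y \<in> S \<Longrightarrow> f y = g y"
  shows "f differentiable (at x) \<longleftrightarrow> g differentiable (at x)"
  unfolding differentiable_def
  using assms has_derivative_transform_within_open[of _ _ x UNIV S] by metis

lemma Cn_on_cong:
  assumes "open S" "\<And>x. x \<in> S \<Longrightarrow> f x = g x"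
  shows "Cn_on n S f \<longleftrightarrow> Cn_on n S g"
  using assms(2)
proof (induction n arbitrary: f g)
  case 0
  then show ?case by (simp cong: continuous_on_cong)
next
  case (Suc n)
  have "Cn_on n S (\<lambda>x. frechet_derivative f (at x) v) \<longleftrightarrow> Cn_on n S (\<lambda>x. frechet_derivative g (at x) v)" for v
    by (rule Suc.IH) (use frechet_derivative_cong_open[OF assms(1)] Suc.prems in metis)
  moreover have "(\<forall>x\<in>S. f differentiable (at x)) \<longleftrightarrow> (\<forall>x\<in>S. g differentiable (at x))"
    using differentiable_cong_open[OF assms(1)] Suc.prems by metis
  ultimately show ?case by simp
qed

text \<open>Derivatives are unique, so on an open set an explicit formula may replace
  \<open>frechet_derivative\<close>; the closure properties below rest on this.\<close>

lemma Cn_on_SucI: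
  assumes "open S" "\<And>x. x \<in> S \<Longrightarrow> (f has_derivative f' x) (at x)" "\<And>v. Cn_on n S (\<lambda>x. f' x v)"
  shows "Cn_on (Suc n) S f"
proof -
  have "Cn_on n S (\<lambda>x. frechet_derivative f (at x) v)" for v
    by (rule Cn_on_cong[OF assms(1), THEN iffD2, OF _ assms(3)[of v]])
      (simp only: frechet_derivative_at[OF assms(2), symmetric])
  then show ?thesis
    using assms(2) by (auto simp: differentiable_def)
qed

lemma Cn_on_Suc_has_derivative:
  assumes "Cn_on (Suc n) S f" "x \<in> S"
  shows "(f has_derivative frechet_derivative f (at x)) (at x)"
  using assms by (simp add: frechet_derivative_works[symmetric])

text \<open>The definition at order n + 1 speaks only of differentiability and of the derivatives,
  so losing one order needs an induction; at its base differentiability gives continuity.\<close>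

lemma Cn_on_Suc_imp: "Cn_on (Suc n) S f \<Longrightarrow> Cn_on n S f"
proof (induction n arbitrary: f)
  case 0
  then show ?case
    by (auto intro!: continuous_at_imp_continuous_on differentiable_imp_continuous_within)
next
  case (Suc n)
  have "Cn_on (Suc n) S (\<lambda>x. frechet_derivative f (at x) v)" for v
    using Suc.prems[unfolded Cn_on.simps(2)[of "Suc n"]] by blast
  then have "Cn_on n S (\<lambda>x. frechet_derivative f (at x) v)" for v
    by (rule Suc.IH)
  moreover have "\<forall>x\<in>S. f differentiable (at x)"
    using Suc.prems[unfolded Cn_on.simps(2)[of "Suc n"]] by blast
  ultimately show ?case
    by (simp only: Cn_on.simps(2)) blast
qed

lemma Cn_on_mono: "Cn_on n S f \<Longrightarrow> m \<le> n \<Longrightarrow> Cn_on m S f"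
  by (induction n) (simp, metis Cn_on_Suc_imp le_Suc_eq)

lemma Cn_on_const: "open S \<Longrightarrow> Cn_on n S (\<lambda>x. c)"
  by (induction n arbitrary: c) (auto intro!: Cn_on_SucI has_derivative_const simp del: Cn_on.simps(2))

lemma Cn_on_linear:
  assumes "open S" "bounded_linear f"
  shows "Cn_on n S f"
proof (cases n)
  case 0
  then show ?thesis using assms by (simp add: linear_continuous_on)
next
  case (Suc m)
  show ?thesis unfolding Suc
    by (rule Cn_on_SucI[OF assms(1), of _ "\<lambda>x. f"])
      (use assms in \<open>auto intro: bounded_linear_imp_has_derivative Cn_on_const\<close>)
qed

lemma Cn_on_add:
  assumes "open S"
  shows "Cn_on n S f \<Longrightarrow> Cn_on n S g \<Longrightarrow> Cn_on n S (\<lambda>x. f x + g x)"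
proof (induction n arbitrary: f g)
  case 0
  then show ?case by (auto intro: continuous_on_add)
next
  case (Suc n)
  show ?case
    by (rule Cn_on_SucI[OF assms has_derivative_add[OF Cn_on_Suc_has_derivative[OF Suc.prems(1)]
            Cn_on_Suc_has_derivative[OF Suc.prems(2)]]])
      (use Suc in auto)
qed

lemma Cn_on_mult:
  assumes "open S"
  shows "Cn_on n S f \<Longrightarrow> Cn_on n S g \<Longrightarrow> Cn_on n S (\<lambda>x. f x * g x)"
proof (induction n arbitrary: f g)
  case 0
  then show ?case by (auto intro: continuous_on_mult)
next
  case (Suc n)
  have "Cn_on n S f" "Cn_on n S g"
    using Suc.prems Cn_on_Suc_imp by blast+
  then show ?case
    by (intro Cn_on_SucI[OF assms has_derivative_mult[OF Cn_on_Suc_has_derivative[OF Suc.prems(1)]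
            Cn_on_Suc_has_derivative[OF Suc.prems(2)]]] Cn_on_add assms Suc.IH)
      (use Suc.prems in auto)
qed

text \<open>The derivative of 1/f contains 1/f again, so f stays fixed in the induction and the
  induction hypothesis supplies this factor.\<close>

lemma Cn_on_inverse:
  assumes "open S" "\<And>x. x \<in> S \<Longrightarrow> f x \<noteq> 0"
  shows "Cn_on n S f \<Longrightarrow> Cn_on n S (\<lambda>x. inverse (f x))"
proof (induction n)
  case 0
  then show ?case using assms by (auto intro: continuous_on_inverse)
next
  case (Suc n)
  have "Cn_on n S (\<lambda>x. inverse (f x))"
    using Suc Cn_on_Suc_imp by blast
  moreover have "Cn_on n S (\<lambda>x. frechet_derivative f (at x) v)" for v
    using Suc.prems by simp
  ultimately have "Cn_on n S (\<lambda>x. (- 1) * (inverse (f x) * frechet_derivative f (at x) v * inverse (f x)))" for v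
    by (intro Cn_on_mult Cn_on_const assms)
  then show ?case
    by (intro Cn_on_SucI[OF assms(1) Deriv.has_derivative_inverse[OF assms(2) Cn_on_Suc_has_derivative[OF Suc.prems]]])
      auto
qed

lemma Ck_on_infinity_imp: "Ck_on \<infinity> S f \<Longrightarrow> Ck_on k S f"
  by (simp add: Ck_on_def)

lemma smoothD: "Ck_on \<infinity> S f \<Longrightarrow> Cn_on n S f"
  by (simp add: Ck_on_def)

lemma smoothI: "(\<And>n. Cn_on n S f) \<Longrightarrow> Ck_on \<infinity> S f"
  by (simp add: Ck_on_def)

lemma smooth_add: "open S \<Longrightarrow> Ck_on \<infinity> S f \<Longrightarrow> Ck_on \<infinity> S g \<Longrightarrow> Ck_on \<infinity> S (\<lambda>x. f x + g x)"
  by (rule smoothI) (rule Cn_on_add[OF _ smoothD smoothD])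

lemma smooth_mult: "open S \<Longrightarrow> Ck_on \<infinity> S f \<Longrightarrow> Ck_on \<infinity> S g \<Longrightarrow> Ck_on \<infinity> S (\<lambda>x. f x * g x)"
  by (rule smoothI) (rule Cn_on_mult[OF _ smoothD smoothD])

lemma smooth_const: "open S \<Longrightarrow> Ck_on \<infinity> S (\<lambda>x. c)"
  by (rule smoothI) (rule Cn_on_const)

lemma smooth_linear: "open S \<Longrightarrow> bounded_linear f \<Longrightarrow> Ck_on \<infinity> S f"
  by (rule smoothI) (rule Cn_on_linear)

lemma smooth_inverse:
  "open S \<Longrightarrow> Ck_on \<infinity> S f \<Longrightarrow> (\<And>x. x \<in> S \<Longrightarrow> f x \<noteq> 0) \<Longrightarrow> Ck_on \<infinity> S (\<lambda>x. inverse (f x))"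
  by (rule smoothI) (rule Cn_on_inverse[OF _ _ smoothD])

lemma smooth_cong:
  "open S \<Longrightarrow> (\<And>x. x \<in> S \<Longrightarrow> f x = g x) \<Longrightarrow> Ck_on \<infinity> S f \<longleftrightarrow> Ck_on \<infinity> S g"
  unfolding Ck_on_def by (simp cong: Cn_on_cong del: Cn_on.simps)

lemma smooth_power: "open S \<Longrightarrow> Ck_on \<infinity> S f \<Longrightarrow> Ck_on \<infinity> S (\<lambda>x. f x ^ n)"
  by (induction n) (auto intro: smooth_const smooth_mult)

lemma smooth_minus: "open S \<Longrightarrow> Ck_on \<infinity> S f \<Longrightarrow> Ck_on \<infinity> S (\<lambda>x. - f x)"
  using smooth_mult[OF _ smooth_const[of S "-1"], of f] by simp

lemma smooth_diff: "open S \<Longrightarrow> Ck_on \<infinity> S f \<Longrightarrow> Ck_on \<infinity> S g \<Longrightarrow> Ck_on \<infinity> S (\<lambda>x. f x - g x)"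
  using smooth_add[OF _ _ smooth_minus, of S f g] by (simp only: diff_conv_add_uminus)

lemma smooth_imp_continuous_on: "Ck_on \<infinity> S f \<Longrightarrow> continuous_on S f"
  using smoothD[of S f 0] by simp

lemma smooth_has_derivative:
  "Ck_on \<infinity> S f \<Longrightarrow> x \<in> S \<Longrightarrow> (f has_derivative frechet_derivative f (at x)) (at x)"
  by (rule Cn_on_Suc_has_derivative[OF smoothD[of _ _ "Suc 0"]])

lemma smooth_frechet_derivative:
  assumes "Ck_on \<infinity> S f"
  shows "Ck_on \<infinity> S (\<lambda>x. frechet_derivative f (at x) v)"
  by (rule smoothI) (use smoothD[OF assms, of "Suc _"] in \<open>simp only: Cn_on.simps(2)\<close>)

subsection \<open>Functions of one variable\<close>

lemma Cn_on_Suc_real: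
  fixes f :: "real \<Rightarrow> real"
  assumes "Cn_on (Suc n) S f"
  shows "x \<in> S \<Longrightarrow> (f has_real_derivative deriv f x) (at x)"
    and "open S \<Longrightarrow> Cn_on n S (deriv f)"
proof -
  show d: "(f has_real_derivative deriv f x) (at x)" if "x \<in> S" for x
    using assms that DERIV_deriv_iff_real_differentiable by auto
  assume "open S"
  have "Cn_on n S (\<lambda>x. frechet_derivative f (at x) 1)"
    using assms by simp
  moreover have "frechet_derivative f (at x) 1 = deriv f x" if "x \<in> S" for x
    using d[OF that] unfolding has_field_derivative_def
    using frechet_derivative_at by (metis mult.right_neutral)
  ultimately show "Cn_on n S (deriv f)"
    by (rule Cn_on_cong[OF \<open>open S\<close>, THEN iffD1, rotated])
qed

lemma Cn_on_SucI_real: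
  fixes f :: "real \<Rightarrow> real"
  assumes "open S" "\<And>x. x \<in> S \<Longrightarrow> (f has_real_derivative f' x) (at x)" "Cn_on n S f'"
  shows "Cn_on (Suc n) S f"
  by (rule Cn_on_SucI[OF assms(1) assms(2)[unfolded has_field_derivative_def]])
    (auto intro!: Cn_on_mult assms Cn_on_const)

text \<open>Each differentiation costs one order: the i-th derivative is of class C^(n - i).\<close>

lemma Cn_on_higher_deriv:
  fixes f :: "real \<Rightarrow> real"
  assumes "Cn_on n UNIV f"
  shows "i < n \<Longrightarrow> ((deriv ^^ i) f has_real_derivative (deriv ^^ Suc i) f x) (at x)"
    and "i \<le> n \<Longrightarrow> continuous_on UNIV ((deriv ^^ i) f)"
proof -
  have *: "Cn_on (n - i) UNIV ((deriv ^^ i) f)" if "i \<le> n" for i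
    using that
  proof (induction i)
    case 0
    then show ?case using assms by simp
  next
    case (Suc i)
    then have "Cn_on (Suc (n - Suc i)) UNIV ((deriv ^^ i) f)"
      by (simp add: Suc_diff_Suc del: Cn_on.simps)
    from Cn_on_Suc_real(2)[OF this open_UNIV] show ?case by simp
  qed
  show "((deriv ^^ i) f has_real_derivative (deriv ^^ Suc i) f x) (at x)" if "i < n"
  proof -
    have "Cn_on (Suc (n - Suc i)) UNIV ((deriv ^^ i) f)"
      using *[of i] that by (simp add: Suc_diff_Suc del: Cn_on.simps)
    from Cn_on_Suc_real(1)[OF this] show ?thesis by simp
  qed
  show "continuous_on UNIV ((deriv ^^ i) f)" if "i \<le> n"
    using Cn_on_mono[OF *[OF that], of 0] by simp
qed

subsection \<open>Functions of three variables\<close>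

definition px :: "(real \<times> real \<times> real \<Rightarrow> real) \<Rightarrow> real \<times> real \<times> real \<Rightarrow> real" where
  "px h p = frechet_derivative h (at p) (1, 0, 0)"

definition py :: "(real \<times> real \<times> real \<Rightarrow> real) \<Rightarrow> real \<times> real \<times> real \<Rightarrow> real" where
  "py h p = frechet_derivative h (at p) (0, 1, 0)"

definition pm :: "(real \<times> real \<times> real \<Rightarrow> real) \<Rightarrow> real \<times> real \<times> real \<Rightarrow> real" where
  "pm h p = frechet_derivative h (at p) (0, 0, 1)"

lemma smooth_partial:
  assumes "Ck_on \<infinity> U h"
  shows "Ck_on \<infinity> U (px h)" "Ck_on \<infinity> U (py h)" "Ck_on \<infinity> U (pm h)"
  using smooth_frechet_derivative[OF assms] by (simp_all add: px_def[abs_def] py_def[abs_def] pm_def[abs_def])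

lemma smooth_has_derivative3:
  assumes "Ck_on \<infinity> U h" "p \<in> U"
  shows "(h has_derivative (\<lambda>(a, b, c). a * px h p + b * py h p + c * pm h p)) (at p)"
proof -
  have d: "(h has_derivative frechet_derivative h (at p)) (at p)"
    by (rule smooth_has_derivative[OF assms])
  interpret bounded_linear "frechet_derivative h (at p)"
    using d by (rule has_derivative_bounded_linear)
  have "frechet_derivative h (at p) (a, b, c) = a * px h p + b * py h p + c * pm h p" for a b c
  proof -
    have "(a, b, c) = a *\<^sub>R (1, 0, 0) + b *\<^sub>R (0, 1, 0) + c *\<^sub>R (0, 0, 1)" by simp
    then show ?thesis
      by (simp only: add scaleR px_def py_def pm_def real_scaleR_def)
  qed
  then have "frechet_derivative h (at p) = (\<lambda>(a, b, c). a * px h p + b * py h p + c * pm h p)"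
    by auto
  then show ?thesis using d by simp
qed

lemma has_derivative_smooth_compose:
  assumes "Ck_on \<infinity> U h" "(a z, b z, c z) \<in> U"
    and "(a has_derivative a') (at z within S)" "(b has_derivative b') (at z within S)"
    and "(c has_derivative c') (at z within S)"
  shows "((\<lambda>t. h (a t, b t, c t)) has_derivative
     (\<lambda>v. a' v * px h (a z, b z, c z) + b' v * py h (a z, b z, c z) + c' v * pm h (a z, b z, c z))) (at z within S)"
  using has_derivative_compose[OF has_derivative_Pair[OF assms(3) has_derivative_Pair[OF assms(4,5)]]
      smooth_has_derivative3[OF assms(1,2)]]
  by simp

lemma has_real_derivative_smooth_compose:
  assumes "Ck_on \<infinity> U h" "(a z, b z, c z) \<in> U"
    and "(a has_real_derivative a') (at z within S)" "(b has_real_derivative b') (at z within S)"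
    and "(c has_real_derivative c') (at z within S)"
  shows "((\<lambda>t. h (a t, b t, c t)) has_real_derivative
     (a' * px h (a z, b z, c z) + b' * py h (a z, b z, c z) + c' * pm h (a z, b z, c z))) (at z within S)"
  using has_derivative_smooth_compose[OF assms(1,2) assms(3-5)[unfolded has_field_derivative_def]]
  unfolding has_field_derivative_def
  by (rule has_derivative_eq_rhs) (auto simp: algebra_simps)

text \<open>Any derivative in gradient form determines the partial derivatives, which are defined
  through \<open>frechet_derivative\<close>.\<close>

lemma partial_unique:
  assumes "(h has_derivative (\<lambda>(a, b, c). a * k + b * l + c * m)) (at p)"
  shows "px h p = k" "py h p = l" "pm h p = m"
  unfolding px_def py_def pm_def frechet_derivative_at[OF assms, symmetric] by simp_all

lemma partial_cong:
  assumes "open U" "p \<in> U" "\<And>q. q \<in> U \<Longrightarrow> f q = g q"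
  shows "px f p = px g p" "py f p = py g p" "pm f p = pm g p"
  unfolding px_def py_def pm_def using frechet_derivative_cong_open[OF assms] by simp_all

lemma partial_add:
  assumes "Ck_on \<infinity> U f" "Ck_on \<infinity> U g" "p \<in> U"
  shows "px (\<lambda>q. f q + g q) p = px f p + px g p" "py (\<lambda>q. f q + g q) p = py f p + py g p"
  by (rule partial_unique[where k = "px f p + px g p" and l = "py f p + py g p" and m = "pm f p + pm g p"],
      rule has_derivative_eq_rhs[OF has_derivative_add[OF smooth_has_derivative3[OF assms(1,3)]
          smooth_has_derivative3[OF assms(2,3)]]], force simp: algebra_simps)+

lemma partial_cmult:
  assumes "Ck_on \<infinity> U f" "p \<in> U"
  shows "px (\<lambda>q. c * f q) p = c * px f p" "py (\<lambda>q. c * f q) p = c * py f p"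
  by (rule partial_unique[where k = "c * px f p" and l = "c * py f p" and m = "c * pm f p"],
      rule has_derivative_eq_rhs[OF has_derivative_mult_right[OF smooth_has_derivative3[OF assms]]],
      force simp: algebra_simps)+

section \<open>First and second order estimates near a point\<close>

lemma continuous_at_smooth_bounded:
  fixes h :: "'a::euclidean_space \<Rightarrow> real"
  assumes "open U" "p \<in> U" "Ck_on \<infinity> U h"
  obtains K r where "K > 0" "r > 0" "ball p r \<subseteq> U" "\<And>q. q \<in> ball p r \<Longrightarrow> \<bar>h q\<bar> \<le> K"
proof -
  have "isCont h p"
    using assms smooth_imp_continuous_on continuous_on_eq_continuous_at by blast
  then obtain d where d: "d > 0" "\<And>q. dist q p < d \<Longrightarrow> dist (h q) (h p) < 1"
    unfolding continuous_at_eps_delta by (metis zero_less_one)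
  obtain r where r: "r > 0" "ball p r \<subseteq> U"
    using assms openE by blast
  show ?thesis
  proof (rule that[of "\<bar>h p\<bar> + 1" "min d r"])
    show "\<bar>h q\<bar> \<le> \<bar>h p\<bar> + 1" if "q \<in> ball p (min d r)" for q
      using d(2)[of q] that by (simp add: dist_commute dist_real_def)
  qed (use d r in auto)
qed

lemma abs_le_norm3:
  fixes a b c :: real
  shows "\<bar>a\<bar> \<le> norm (a, b, c)" "\<bar>b\<bar> \<le> norm (a, b, c)" "\<bar>c\<bar> \<le> norm (a, b, c)"
    and "norm (a, b, c) \<le> \<bar>a\<bar> + \<bar>b\<bar> + \<bar>c\<bar>"
proof -
  have 1: "norm (b, c) \<le> norm (a, b, c)" by (rule norm_snd_le)
  show "\<bar>a\<bar> \<le> norm (a, b, c)" using norm_fst_le[of a "(b, c)"] by simp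
  show "\<bar>b\<bar> \<le> norm (a, b, c)" using norm_fst_le[of b c] 1 by simp
  show "\<bar>c\<bar> \<le> norm (a, b, c)" using norm_snd_le[of c b] 1 by simp
  show "norm (a, b, c) \<le> \<bar>a\<bar> + \<bar>b\<bar> + \<bar>c\<bar>"
    using norm_Pair_le[of a "(b, c)"] norm_Pair_le[of b c] by simp
qed

text \<open>The partial derivatives are bounded on a ball, which is convex, so the mean value
  inequality applies with the sum of the three bounds.\<close>

lemma smooth_lipschitz_at:
  fixes h :: "real \<times> real \<times> real \<Rightarrow> real"
  assumes "open U" "0 \<in> U" "Ck_on \<infinity> U h"
  obtains K r where "K > 0" "r > 0" "ball 0 r \<subseteq> U" "\<And>q. q \<in> ball 0 r \<Longrightarrow> \<bar>h q - h 0\<bar> \<le> K * norm q"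
proof -
  obtain K1 r1 where 1: "K1 > 0" "r1 > 0" "ball 0 r1 \<subseteq> U" "\<And>q. q \<in> ball 0 r1 \<Longrightarrow> \<bar>px h q\<bar> \<le> K1"
    using continuous_at_smooth_bounded[OF assms(1,2) smooth_partial(1)[OF assms(3)]] by metis
  obtain K2 r2 where 2: "K2 > 0" "r2 > 0" "ball 0 r2 \<subseteq> U" "\<And>q. q \<in> ball 0 r2 \<Longrightarrow> \<bar>py h q\<bar> \<le> K2"
    using continuous_at_smooth_bounded[OF assms(1,2) smooth_partial(2)[OF assms(3)]] by metis
  obtain K3 r3 where 3: "K3 > 0" "r3 > 0" "ball 0 r3 \<subseteq> U" "\<And>q. q \<in> ball 0 r3 \<Longrightarrow> \<bar>pm h q\<bar> \<le> K3"
    using continuous_at_smooth_bounded[OF assms(1,2) smooth_partial(3)[OF assms(3)]] by metis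
  let ?r = "min r1 (min r2 r3)"
  show ?thesis
  proof (rule that[of "K1 + K2 + K3" ?r])
    fix q :: "real \<times> real \<times> real" assume q: "q \<in> ball 0 ?r"
    have "norm (h q - h 0) \<le> (K1 + K2 + K3) * norm (q - 0)"
    proof (rule differentiable_bound[of "ball 0 ?r" h "\<lambda>p (a, b, c). a * px h p + b * py h p + c * pm h p"])
      fix p :: "real \<times> real \<times> real" assume p: "p \<in> ball 0 ?r"
      then have pU: "p \<in> U" using 1(3) by auto
      show "(h has_derivative (\<lambda>(a, b, c). a * px h p + b * py h p + c * pm h p)) (at p within ball 0 ?r)"
        by (rule has_derivative_at_withinI[OF smooth_has_derivative3[OF assms(3) pU]])
      show "onorm (\<lambda>(a, b, c). a * px h p + b * py h p + c * pm h p) \<le> K1 + K2 + K3"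
      proof (rule onorm_le)
        fix v :: "real \<times> real \<times> real"
        obtain a b c where v: "v = (a, b, c)" by (cases v)
        have n: "\<bar>a\<bar> \<le> norm v" "\<bar>b\<bar> \<le> norm v" "\<bar>c\<bar> \<le> norm v"
          unfolding v by (rule abs_le_norm3)+
        have "\<bar>a * px h p + b * py h p + c * pm h p\<bar> \<le> \<bar>a\<bar> * \<bar>px h p\<bar> + \<bar>b\<bar> * \<bar>py h p\<bar> + \<bar>c\<bar> * \<bar>pm h p\<bar>"
          by (simp add: abs_mult[symmetric])
        also have "\<dots> \<le> norm v * K1 + norm v * K2 + norm v * K3"
          using 1(4)[of p] 2(4)[of p] 3(4)[of p] p n by (intro add_mono mult_mono) auto
        finally show "norm (case v of (a, b, c) \<Rightarrow> a * px h p + b * py h p + c * pm h p) \<le> (K1 + K2 + K3) * norm v"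
          by (simp add: v algebra_simps)
      qed
    qed (use q 1 2 3 in auto)
    then show "\<bar>h q - h 0\<bar> \<le> (K1 + K2 + K3) * norm q" by simp
  qed (use 1 2 3 in auto)
qed

lemma smooth_taylor_at:
  fixes h :: "real \<times> real \<times> real \<Rightarrow> real"
  assumes "open U" "0 \<in> U" "Ck_on \<infinity> U h"
  obtains K r where "K > 0" "r > 0" "ball 0 r \<subseteq> U"
    "\<And>x y m. (x, y, m) \<in> ball 0 r \<Longrightarrow>
        \<bar>h (x, y, m) - h 0 - (x * px h 0 + y * py h 0 + m * pm h 0)\<bar> \<le> K * (norm (x, y, m))\<^sup>2"
proof -
  obtain K1 r1 where 1: "K1 > 0" "r1 > 0" "ball 0 r1 \<subseteq> U" "\<And>q. q \<in> ball 0 r1 \<Longrightarrow> \<bar>px h q - px h 0\<bar> \<le> K1 * norm q"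
    using smooth_lipschitz_at[OF assms(1,2) smooth_partial(1)[OF assms(3)]] by metis
  obtain K2 r2 where 2: "K2 > 0" "r2 > 0" "ball 0 r2 \<subseteq> U" "\<And>q. q \<in> ball 0 r2 \<Longrightarrow> \<bar>py h q - py h 0\<bar> \<le> K2 * norm q"
    using smooth_lipschitz_at[OF assms(1,2) smooth_partial(2)[OF assms(3)]] by metis
  obtain K3 r3 where 3: "K3 > 0" "r3 > 0" "ball 0 r3 \<subseteq> U" "\<And>q. q \<in> ball 0 r3 \<Longrightarrow> \<bar>pm h q - pm h 0\<bar> \<le> K3 * norm q"
    using smooth_lipschitz_at[OF assms(1,2) smooth_partial(3)[OF assms(3)]] by metis
  let ?r = "min r1 (min r2 r3)"
  let ?K = "K1 + K2 + K3"
  show ?thesis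
  proof (rule that[of ?K ?r])
    fix x y m :: real assume q: "(x, y, m) \<in> ball 0 ?r"
    \<comment> \<open>This is h along the segment from 0 with its linear part removed. Its
      derivative compares the gradient with the gradient at 0, and the Lipschitz bounds on the
      partial derivatives supply the second power of the norm.\<close>
    define g where "g t = h (t * x, t * y, t * m) - t * (x * px h 0 + y * py h 0 + m * pm h 0)" for t
    have inb: "(t * x, t * y, t * m) \<in> ball 0 ?r" and nle: "norm (t * x, t * y, t * m) \<le> norm (x, y, m)"
      if "0 \<le> t" "t \<le> 1" for t
    proof -
      have "norm (t *\<^sub>R (x, y, m)) \<le> 1 * norm (x, y, m)"
        unfolding norm_scaleR using that by (intro mult_right_mono) auto
      then show "norm (t * x, t * y, t * m) \<le> norm (x, y, m)" by simp
      then show "(t * x, t * y, t * m) \<in> ball 0 ?r" using q by simp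
    qed
    let ?d = "\<lambda>t. (x * px h (t * x, t * y, t * m) + y * py h (t * x, t * y, t * m) + m * pm h (t * x, t * y, t * m))
             - (x * px h 0 + y * py h 0 + m * pm h 0)"
    have der: "(g has_real_derivative ?d t) (at t)" if "0 \<le> t" "t \<le> 1" for t
      unfolding g_def
      by (rule derivative_eq_intros has_real_derivative_smooth_compose[OF assms(3)] refl
          | use inb[OF that] 1(3) in force)+
    obtain z where z: "0 < z" "z < 1" "g 1 - g 0 = (1 - 0) * ?d z"
      using MVT2[of 0 1 g ?d] der by auto
    let ?p = "(z * x, z * y, z * m)"
    let ?n = "norm (x, y, m)"
    have n: "\<bar>x\<bar> \<le> ?n" "\<bar>y\<bar> \<le> ?n" "\<bar>m\<bar> \<le> ?n"
      by (rule abs_le_norm3)+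
    have p: "?p \<in> ball 0 ?r" "norm ?p \<le> ?n" using inb nle z by auto
    have b: "\<bar>px h ?p - px h 0\<bar> \<le> K1 * ?n" "\<bar>py h ?p - py h 0\<bar> \<le> K2 * ?n" "\<bar>pm h ?p - pm h 0\<bar> \<le> K3 * ?n"
      using order_trans[OF 1(4)[of ?p] mult_left_mono[OF p(2), of K1]]
        order_trans[OF 2(4)[of ?p] mult_left_mono[OF p(2), of K2]]
        order_trans[OF 3(4)[of ?p] mult_left_mono[OF p(2), of K3]] p(1) 1(1) 2(1) 3(1)
      by auto
    have "\<bar>?d z\<bar> = \<bar>x * (px h ?p - px h 0) + y * (py h ?p - py h 0) + m * (pm h ?p - pm h 0)\<bar>"
      by (simp add: algebra_simps)
    also have "\<dots> \<le> \<bar>x\<bar> * \<bar>px h ?p - px h 0\<bar> + \<bar>y\<bar> * \<bar>py h ?p - py h 0\<bar> + \<bar>m\<bar> * \<bar>pm h ?p - pm h 0\<bar>"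
      unfolding abs_mult[symmetric] by linarith
    also have "\<dots> \<le> ?n * (K1 * ?n) + ?n * (K2 * ?n) + ?n * (K3 * ?n)"
      using b n by (intro add_mono mult_mono) auto
    also have "\<dots> = ?K * ?n\<^sup>2" by (simp add: power2_eq_square algebra_simps)
    finally have "\<bar>g 1 - g 0\<bar> \<le> ?K * ?n\<^sup>2" using z by simp
    then show "\<bar>h (x, y, m) - h 0 - (x * px h 0 + y * py h 0 + m * pm h 0)\<bar> \<le> ?K * ?n\<^sup>2"
      by (simp add: g_def zero_prod_def algebra_simps)
  qed (use 1 2 3 in auto)
qed

section \<open>Smooth transition functions\<close>

text \<open>The classical flat function exp(-1/x), with polynomials in 1/x as coefficients because
  these make the class closed under differentiation.\<close>

definition exp_flat :: "real poly \<Rightarrow> real \<Rightarrow> real" where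
  "exp_flat p x = (if x > 0 then poly p (1 / x) * exp (- (1 / x)) else 0)"

lemma poly_exp_decay: "((\<lambda>z::real. poly p z * exp (- z)) \<longlongrightarrow> 0) at_top"
proof (induction p)
  case 0
  then show ?case by simp
next
  case (pCons a p)
  have 1: "((\<lambda>z. a * exp (- z)) \<longlongrightarrow> 0) at_top"
    using tendsto_mult_right_zero[OF tendsto_power_div_exp_0[of 0], of a] by (simp add: exp_minus field_simps)
  have "((\<lambda>z::real. coeff p k * (z ^ Suc k / exp z)) \<longlongrightarrow> 0) at_top" for k
    using tendsto_mult_right_zero[OF tendsto_power_div_exp_0[of "Suc k"]] by blast
  then have "((\<lambda>z::real. \<Sum>k\<le>degree p. coeff p k * (z ^ Suc k / exp z)) \<longlongrightarrow> 0) at_top"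
    by (rule tendsto_null_sum)
  then have 2: "((\<lambda>z. z * poly p z * exp (- z)) \<longlongrightarrow> 0) at_top"
    by (simp add: poly_altdef exp_minus sum_distrib_left sum_distrib_right field_simps)
  show ?case
    using tendsto_add[OF 1 2] by (simp add: algebra_simps)
qed

text \<open>With z = 1/x one has dz/dx = - z^2, hence the new polynomial z^2 (p - p'). At 0 the
  difference quotient from the right is z p(z) exp(-z) with z tending to infinity.\<close>

lemma exp_flat_has_derivative:
  "(exp_flat p has_real_derivative exp_flat (monom 1 2 * (p - pderiv p)) x) (at x)"
proof -
  consider "x > 0" | "x < 0" | "x = 0" by linarith
  then show ?thesis
  proof cases
    case 1
    have "((\<lambda>x. poly p (1 / x) * exp (- (1 / x))) has_real_derivative
        exp_flat (monom 1 2 * (p - pderiv p)) x) (at x)"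
      using 1 unfolding exp_flat_def
      by (auto intro!: derivative_eq_intros DERIV_chain2[OF poly_DERIV]
          simp: poly_monom field_simps power2_eq_square)
    then show ?thesis
      by (rule has_field_derivative_transform_within_open[of _ _ _ "{0<..}"]) (use 1 in \<open>auto simp: exp_flat_def\<close>)
  next
    case 2
    have "((\<lambda>x. 0) has_real_derivative exp_flat (monom 1 2 * (p - pderiv p)) x) (at x)"
      using 2 by (simp add: exp_flat_def)
    then show ?thesis
      by (rule has_field_derivative_transform_within_open[of _ _ _ "{..<0}"]) (use 2 in \<open>auto simp: exp_flat_def\<close>)
  next
    case 3
    have l: "((\<lambda>h. exp_flat p h / h) \<longlongrightarrow> 0) (at_left 0)"
      by (rule tendsto_eventually) (auto simp: exp_flat_def eventually_at_filter)
    have "((\<lambda>h. poly (pCons 0 p) (inverse h) * exp (- inverse h)) \<longlongrightarrow> 0) (at_right 0)"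
      by (rule filterlim_compose[OF poly_exp_decay filterlim_inverse_at_top_right])
    then have r: "((\<lambda>h. exp_flat p h / h) \<longlongrightarrow> 0) (at_right 0)"
      by (rule Lim_transform_eventually)
        (auto simp: exp_flat_def eventually_at_filter field_simps)
    have "((\<lambda>h. exp_flat p h / h) \<longlongrightarrow> 0) (at 0)"
      using l r filterlim_at_split by blast
    then show ?thesis
      unfolding 3 DERIV_def by (simp add: exp_flat_def)
  qed
qed

lemma smooth_exp_flat: "Ck_on \<infinity> UNIV (exp_flat p)"
proof (rule smoothI)
  show "Cn_on n UNIV (exp_flat p)" for n
  proof (induction n arbitrary: p)
    case 0
    then show ?case
      using exp_flat_has_derivative DERIV_continuous_on
      by (metis Cn_on.simps(1) DERIV_isCont continuous_at_imp_continuous_on)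
  next
    case (Suc n)
    then show ?case
      by (intro Cn_on_SucI_real[OF open_UNIV exp_flat_has_derivative])
  qed
qed

text \<open>The chain rule with a free right-hand side F, so that it can be mixed with
  \<open>derivative_eq_intros\<close>.\<close>

lemma DERIV_chain_eq:
  assumes "(f has_real_derivative D) (at (g x))" "(g has_real_derivative E) (at x within S)" "D * E = F"
  shows "((\<lambda>x. f (g x)) has_real_derivative F) (at x within S)"
  using DERIV_chain2[OF assms(1,2)] assms(3) by simp

lemma Cn_on_affine:
  fixes f :: "real \<Rightarrow> real"
  shows "Cn_on n UNIV f \<Longrightarrow> Cn_on n UNIV (\<lambda>x. f (a + b * x))"
proof (induction n arbitrary: f)
  case 0
  then show ?case
    by (auto intro!: continuous_on_compose2[of UNIV f] continuous_intros)
next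
  case (Suc n)
  have "((\<lambda>x. f (a + b * x)) has_real_derivative b * deriv f (a + b * x)) (at x)" for x
    by (rule derivative_eq_intros DERIV_chain_eq[OF Cn_on_Suc_real(1)[OF Suc.prems]] refl | simp)+
  moreover have "Cn_on n UNIV (\<lambda>x. b * deriv f (a + b * x))"
    by (intro Cn_on_mult Cn_on_const open_UNIV Suc.IH Cn_on_Suc_real(2)[OF Suc.prems])
  ultimately show ?case by (rule Cn_on_SucI_real[OF open_UNIV])
qed

lemma smooth_affine: "Ck_on \<infinity> UNIV f \<Longrightarrow> Ck_on \<infinity> UNIV (\<lambda>x::real. f (a + b * x))"
  by (rule smoothI) (rule Cn_on_affine[OF smoothD])

section \<open>A smooth transition function\<close>

definition flat :: "real \<Rightarrow> real" where "flat = exp_flat 1"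

lemma flat_pos: "x > 0 \<Longrightarrow> flat x > 0" and flat_nonpos: "x \<le> 0 \<Longrightarrow> flat x = 0"
  by (simp_all add: flat_def exp_flat_def)

lemma flat_nonneg: "flat x \<ge> 0"
  using flat_pos flat_nonpos by (metis linorder_not_less order_less_imp_le order_refl)

lemma smooth_flat: "Ck_on \<infinity> UNIV flat"
  by (simp add: flat_def smooth_exp_flat)

lemma deriv_flat_pos: "x > 0 \<Longrightarrow> deriv flat x > 0"
  using DERIV_imp_deriv[OF exp_flat_has_derivative[of 1 x]]
  by (simp add: flat_def exp_flat_def poly_monom)

definition transition :: "real \<Rightarrow> real" where
  "transition s = (flat (1 + s) - flat (1 - s)) / (flat (1 + s) + flat (1 - s))"

text \<open>The two arguments add up to 2, so one of them is positive.\<close>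

lemma transition_denominator: "flat (1 + s) + flat (1 - s) > 0"
  using flat_pos[of "1 + s"] flat_pos[of "1 - s"] flat_nonneg[of "1 + s"] flat_nonneg[of "1 - s"]
  by (cases "1 + s > 0") (auto intro: add_pos_nonneg add_nonneg_pos)

lemma smooth_transition: "Ck_on \<infinity> UNIV transition"
proof -
  have 1: "Ck_on \<infinity> UNIV (\<lambda>s. flat (1 + 1 * s))" "Ck_on \<infinity> UNIV (\<lambda>s. flat (1 + (- 1) * s))"
    using smooth_affine[OF smooth_flat] by blast+
  have "flat (1 + s) + flat (1 - s) \<noteq> 0" for s
    using transition_denominator[of s] by simp
  then have "Ck_on \<infinity> UNIV (\<lambda>s. (flat (1 + 1 * s) - flat (1 + (- 1) * s)) * inverse (flat (1 + 1 * s) + flat (1 + (- 1) * s)))"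
    by (intro smooth_mult smooth_diff smooth_inverse smooth_add open_UNIV 1) auto
  then show ?thesis
    by (simp add: transition_def[abs_def] divide_inverse)
qed

lemma smooth_has_real_derivative:
  fixes f :: "real \<Rightarrow> real"
  shows "Ck_on \<infinity> UNIV f \<Longrightarrow> (f has_real_derivative deriv f x) (at x)"
  by (rule Cn_on_Suc_real(1)[OF smoothD[of _ _ "Suc 0"]]) auto

text \<open>In the numerator of the quotient rule the products p p' and q q' cancel, and what
  remains is 2 p' q + 2 q' p with positive factors.\<close>

lemma deriv_transition_pos:
  assumes "s \<in> {-1<..<1}"
  shows "deriv transition s > 0"
proof -
  let ?p = "flat (1 + s)" and ?q = "flat (1 - s)" and ?p' = "deriv flat (1 + s)" and ?q' = "deriv flat (1 - s)"
  have d: "(flat has_real_derivative deriv flat x) (at x)" for x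
    by (rule smooth_has_real_derivative[OF smooth_flat])
  have ne: "?p + ?q > 0" by (rule transition_denominator)
  have "(transition has_real_derivative
      ((?p' + ?q') * (?p + ?q) - (?p - ?q) * (?p' - ?q')) / ((?p + ?q) * (?p + ?q))) (at s)"
    unfolding transition_def[abs_def]
    by (rule derivative_eq_intros DERIV_chain_eq[OF d] refl | use ne in force)+
  then have "deriv transition s = (2 * ?p' * ?q + 2 * ?q' * ?p) / ((?p + ?q) * (?p + ?q))"
    by (simp add: DERIV_imp_deriv algebra_simps)
  moreover have "2 * ?p' * ?q + 2 * ?q' * ?p > 0"
    using assms flat_pos deriv_flat_pos by (intro add_pos_pos mult_pos_pos) auto
  ultimately show ?thesis using ne by simp
qed

lemma transition_values: "s \<ge> 1 \<Longrightarrow> transition s = 1" "s \<le> -1 \<Longrightarrow> transition s = -1"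
  using transition_denominator[of s] flat_nonpos[of "1 - s"] flat_nonpos[of "1 + s"]
  by (auto simp: transition_def)

section \<open>A localized perturbation of the third derivative\<close>

definition bump :: "real \<Rightarrow> real" where "bump z = flat (1 + z) * flat (1 - z)"

lemma smooth_bump: "Ck_on \<infinity> UNIV bump"
  using smooth_mult[OF open_UNIV smooth_affine[OF smooth_flat, of 1 1] smooth_affine[OF smooth_flat, of 1 "-1"]]
  by (simp add: bump_def[abs_def])

lemma bump_0: "bump 0 > 0" by (simp add: bump_def flat_pos)

lemma bump_outside: "\<bar>z\<bar> \<ge> 1 \<Longrightarrow> bump z = 0"
  using flat_nonpos[of "1 - z"] flat_nonpos[of "1 + z"] by (cases "z \<ge> 1") (auto simp: bump_def)

text \<open>The cube makes the perturbation invisible to the 2-jet at \<open>s\<^sub>0\<close>, while its first derivative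
  is of order \<open>l\<^sup>2\<close>.\<close>

definition cubic_bump :: "real \<Rightarrow> real \<Rightarrow> real \<Rightarrow> real" where
  "cubic_bump s\<^sub>0 l s = (s - s\<^sub>0) ^ 3 * bump ((s - s\<^sub>0) / l)"

lemma smooth_cubic_bump: "Ck_on \<infinity> UNIV (cubic_bump s\<^sub>0 l)"
proof -
  have "Ck_on \<infinity> UNIV (\<lambda>s::real. (s - s\<^sub>0) ^ 3 * bump (- (s\<^sub>0 / l) + (1 / l) * s))"
    by (rule smooth_mult[OF open_UNIV smooth_power[OF open_UNIV smooth_diff[OF open_UNIV
            smooth_linear[OF open_UNIV bounded_linear_ident] smooth_const[OF open_UNIV]]]
          smooth_affine[OF smooth_bump]])
  then show ?thesis by (simp add: cubic_bump_def[abs_def] diff_divide_distrib)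
qed

lemma bump_derivs:
  "(bump has_real_derivative deriv bump x) (at x)"
  "(deriv bump has_real_derivative deriv (deriv bump) x) (at x)"
  "(deriv (deriv bump) has_real_derivative deriv (deriv (deriv bump)) x) (at x)"
  using Cn_on_higher_deriv(1)[OF smoothD[OF smooth_bump, of 3], of _ x, of 0]
    Cn_on_higher_deriv(1)[OF smoothD[OF smooth_bump, of 3], of 1 x]
    Cn_on_higher_deriv(1)[OF smoothD[OF smooth_bump, of 3], of 2 x]
  by (simp_all add: numeral_2_eq_2)

text \<open>A term that still carries a power of the distance to \<open>s\<^sub>0\<close> vanishes
  there, so the third derivative at \<open>s\<^sub>0\<close> comes from differentiating the cube
  alone.\<close>

lemma cubic_bump_derivs:
  fixes s\<^sub>0 l :: real
  assumes "l \<noteq> 0"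
  defines "z \<equiv> \<lambda>s. (s - s\<^sub>0) / l"
  shows "deriv (cubic_bump s\<^sub>0 l) = (\<lambda>s. 3 * (s - s\<^sub>0)\<^sup>2 * bump (z s) + (s - s\<^sub>0) ^ 3 * (deriv bump (z s) / l))"
    and "(deriv ^^ 2) (cubic_bump s\<^sub>0 l) s\<^sub>0 = 0"
    and "(deriv ^^ 3) (cubic_bump s\<^sub>0 l) s\<^sub>0 = 6 * bump 0"
proof -
  have 1: "(cubic_bump s\<^sub>0 l has_real_derivative
      3 * (s - s\<^sub>0)\<^sup>2 * bump (z s) + (s - s\<^sub>0) ^ 3 * (deriv bump (z s) / l)) (at s)" for s
    unfolding cubic_bump_def[abs_def] z_def
    by (rule derivative_eq_intros DERIV_chain_eq[OF bump_derivs(1)] refl | use assms in \<open>simp add: algebra_simps\<close>)+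
  then show e1: "deriv (cubic_bump s\<^sub>0 l) = (\<lambda>s. 3 * (s - s\<^sub>0)\<^sup>2 * bump (z s) + (s - s\<^sub>0) ^ 3 * (deriv bump (z s) / l))"
    by (intro ext DERIV_imp_deriv)
  have 2: "(deriv (cubic_bump s\<^sub>0 l) has_real_derivative
      6 * (s - s\<^sub>0) * bump (z s) + 6 * (s - s\<^sub>0)\<^sup>2 * (deriv bump (z s) / l)
       + (s - s\<^sub>0) ^ 3 * (deriv (deriv bump) (z s) / l / l)) (at s)" for s
    unfolding e1 unfolding z_def
    by (rule derivative_eq_intros DERIV_chain_eq[OF bump_derivs(1)] DERIV_chain_eq[OF bump_derivs(2)] refl
        | use assms in \<open>simp add: algebra_simps\<close>)+
  then have e2: "deriv (deriv (cubic_bump s\<^sub>0 l)) = (\<lambda>s. 6 * (s - s\<^sub>0) * bump (z s) + 6 * (s - s\<^sub>0)\<^sup>2 * (deriv bump (z s) / l)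
       + (s - s\<^sub>0) ^ 3 * (deriv (deriv bump) (z s) / l / l))"
    by (intro ext DERIV_imp_deriv)
  then show "(deriv ^^ 2) (cubic_bump s\<^sub>0 l) s\<^sub>0 = 0"
    by (simp add: numeral_2_eq_2)
  have "(deriv (deriv (cubic_bump s\<^sub>0 l)) has_real_derivative 6 * bump 0) (at s\<^sub>0)"
    unfolding e2 unfolding z_def
    by (rule derivative_eq_intros DERIV_chain_eq[OF bump_derivs(1)] DERIV_chain_eq[OF bump_derivs(2)]
        DERIV_chain_eq[OF bump_derivs(3)] refl | use assms in \<open>simp\<close>)+
  then show "(deriv ^^ 3) (cubic_bump s\<^sub>0 l) s\<^sub>0 = 6 * bump 0"
    by (simp add: numeral_3_eq_3 DERIV_imp_deriv)
qed

lemma deriv_bump_outside: "\<bar>z\<bar> > 1 \<Longrightarrow> deriv bump z = 0"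
proof -
  assume z: "\<bar>z\<bar> > 1"
  have "((\<lambda>z. 0) has_real_derivative 0) (at z)" by simp
  then have "(bump has_real_derivative 0) (at z)"
    by (rule has_field_derivative_transform_within_open[of _ _ _ "- {-1..1}"])
      (use z in \<open>auto simp: bump_outside\<close>)
  then show ?thesis by (rule DERIV_imp_deriv)
qed

lemma transition_surj:
  assumes "\<theta> \<in> {-1<..<1}"
  obtains s where "s \<in> {-1<..<1}" "transition s = \<theta>"
proof -
  have c: "continuous_on {-1..1} transition"
    using continuous_on_subset[OF smooth_imp_continuous_on[OF smooth_transition]] by blast
  obtain s where "-1 \<le> s" "s \<le> 1" "transition s = \<theta>"
    using IVT'[of transition "-1" \<theta> 1] c assms transition_values by force
  moreover have "s \<noteq> -1" "s \<noteq> 1" using calculation assms transition_values by force+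
  ultimately show ?thesis using that[of s] by force
qed

text \<open>A positive derivative makes \<phi> strictly increasing on [-1, 1], and the values at the
  two ends then confine it to (-1, 1).\<close>

lemma regularization_function_of_deriv_pos:
  assumes "Ck_on \<infinity> UNIV \<phi>" "\<And>s. s \<ge> 1 \<Longrightarrow> \<phi> s = 1" "\<And>s. s \<le> -1 \<Longrightarrow> \<phi> s = -1"
    and "\<And>s. s \<in> {-1<..<1} \<Longrightarrow> deriv \<phi> s > 0"
  shows "regularization_function k \<phi>"
proof -
  have d: "(\<phi> has_real_derivative deriv \<phi> s) (at s)" for s
    by (rule smooth_has_real_derivative[OF assms(1)])
  have c: "continuous_on S \<phi>" for S
    using d by (meson DERIV_isCont continuous_at_imp_continuous_on)
  have mono: "\<phi> a < \<phi> b" if "-1 \<le> a" "a < b" "b \<le> 1" for a b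
    using DERIV_pos_imp_increasing_open[OF \<open>a < b\<close> _ c] d assms(4) that by force
  show ?thesis
    unfolding regularization_function_def
    using assms Ck_on_infinity_imp mono[of "-1"] mono[of _ 1] by (auto simp: assms(2,3))
qed

text \<open>The order of the quantifiers matters: the point and the 2-jet, that of
  \<open>transition\<close>, are fixed before k and t, so the third derivative varies alone.\<close>

lemma regularization_function_with_third_derivative:
  assumes "\<theta> \<in> {-1<..<1}"
  obtains s\<^sub>0 p\<^sub>1 p\<^sub>2 where "s\<^sub>0 \<in> {-1<..<1}" "p\<^sub>1 > 0"
    "\<And>k t. \<exists>\<phi>. regularization_function k \<phi> \<and> \<phi> s\<^sub>0 = \<theta> \<and> deriv \<phi> s\<^sub>0 = p\<^sub>1 \<and>
        (deriv ^^ 2) \<phi> s\<^sub>0 = p\<^sub>2 \<and> (deriv ^^ 3) \<phi> s\<^sub>0 = t"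
proof -
  obtain s\<^sub>0 where s0: "s\<^sub>0 \<in> {-1<..<1}" "transition s\<^sub>0 = \<theta>"
    using transition_surj[OF assms] .
  \<comment> \<open>Half the distance to the ends, so that the closed interval of radius r stays
    inside (-1, 1), where the slope of \<open>transition\<close> has a positive minimum m.\<close>
  define r where "r = (1 - \<bar>s\<^sub>0\<bar>) / 2"
  have r4: "0 < r" "r \<le> 1" "-1 < s\<^sub>0 - r" "s\<^sub>0 + r < 1"
    using s0(1) by (auto simp: r_def abs_if field_simps)
  then have r: "0 < r" "r \<le> 1" "{s\<^sub>0 - r..s\<^sub>0 + r} \<subseteq> {-1<..<1}" by auto
  have cT: "continuous_on S (deriv transition)" and cB: "continuous_on S bump" "continuous_on S (deriv bump)" for S
    using Cn_on_higher_deriv(2)[OF smoothD[OF smooth_transition, of 3], of 1]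
      Cn_on_higher_deriv(2)[OF smoothD[OF smooth_bump, of 3], of 0]
      Cn_on_higher_deriv(2)[OF smoothD[OF smooth_bump, of 3], of 1] continuous_on_subset
    by force+
  obtain m where m: "m > 0" "\<And>s. \<bar>s - s\<^sub>0\<bar> \<le> r \<Longrightarrow> deriv transition s \<ge> m"
  proof -
    obtain x where x: "x \<in> {s\<^sub>0 - r..s\<^sub>0 + r}" "\<And>s. s \<in> {s\<^sub>0 - r..s\<^sub>0 + r} \<Longrightarrow> deriv transition x \<le> deriv transition s"
      using continuous_attains_inf[of "{s\<^sub>0 - r..s\<^sub>0 + r}" "deriv transition"] cT r(1) by auto
    show ?thesis
      by (rule that[of "deriv transition x"])
        (use x r deriv_transition_pos in \<open>auto simp: abs_le_iff\<close>)
  qed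
  obtain B1 where B1: "\<And>z. z \<in> {-1..1} \<Longrightarrow> norm (bump z) \<le> B1"
    using compact_imp_bounded[OF compact_continuous_image[OF cB(1) compact_Icc[of "-1" 1]]]
    unfolding bounded_iff by (metis imageI)
  obtain B2 where B2: "\<And>z. z \<in> {-1..1} \<Longrightarrow> norm (deriv bump z) \<le> B2"
    using compact_imp_bounded[OF compact_continuous_image[OF cB(2) compact_Icc[of "-1" 1]]]
    unfolding bounded_iff by (metis imageI)
  \<comment> \<open>A bound for 3 b(z) + z b'(z) on [-1, 1], where b is \<open>bump\<close>; the
    summand 1 makes it positive.\<close>
  define B where "B = 3 * B1 + B2 + 1"
  have B: "B > 0" using B1[of 0] B2[of 0] by (simp add: B_def)
  show ?thesis
  proof (rule that[OF s0(1) deriv_transition_pos[OF s0(1)], of "(deriv ^^ 2) transition s\<^sub>0"])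
    fix k t
    \<comment> \<open>The third derivative of the cubic bump at \<open>s\<^sub>0\<close> is
      \<open>6 * bump 0\<close>, so c corrects the third derivative to t. The width l keeps the
      cutoff within radius r and makes the slope of the perturbation, at most |c| l B in size,
      smaller than m.\<close>
    define c where "c = (t - (deriv ^^ 3) transition s\<^sub>0) / (6 * bump 0)"
    define l where "l = min r (m / (2 * (\<bar>c\<bar> + 1) * B))"
    have l: "0 < l" "l \<le> r" "l \<le> 1" using r m B by (auto simp: l_def)
    have lc: "\<bar>c\<bar> * (l * B) < m"
    proof -
      have "\<bar>c\<bar> * (l * B) \<le> (\<bar>c\<bar> + 1) * ((m / (2 * (\<bar>c\<bar> + 1) * B)) * B)"
        using l B by (intro mult_mono mult_right_mono) (auto simp: l_def)
      also have "\<dots> = m / 2"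
      proof -
        have "a * ((m / (2 * a * B)) * B) = m / 2" if "a > 0" for a
          using that B by (simp add: field_simps)
        from this[of "\<bar>c\<bar> + 1"] show ?thesis by (rule meta_mp) (rule add_nonneg_pos, simp_all)
      qed
      finally show ?thesis using m by simp
    qed
    define \<phi> where "\<phi> s = transition s + c * cubic_bump s\<^sub>0 l s" for s
    have sm: "Ck_on \<infinity> UNIV \<phi>"
      unfolding \<phi>_def[abs_def]
      by (intro smooth_add smooth_mult smooth_const smooth_transition smooth_cubic_bump open_UNIV)
    have dphi: "deriv \<phi> = (\<lambda>s. deriv transition s + c * deriv (cubic_bump s\<^sub>0 l) s)"
      unfolding \<phi>_def[abs_def]
      by (intro ext DERIV_imp_deriv DERIV_add DERIV_cmult smooth_has_real_derivative smooth_transition smooth_cubic_bump)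
    have d2phi: "deriv (deriv \<phi>) = (\<lambda>s. deriv (deriv transition) s + c * deriv (deriv (cubic_bump s\<^sub>0 l)) s)"
      unfolding dphi
      using Cn_on_higher_deriv(1)[OF smoothD[OF smooth_transition, of 3], of 1]
        Cn_on_higher_deriv(1)[OF smoothD[OF smooth_cubic_bump[of s\<^sub>0 l], of 3], of 1]
      by (intro ext DERIV_imp_deriv DERIV_add DERIV_cmult) auto
    have d3phi: "deriv (deriv (deriv \<phi>)) = (\<lambda>s. deriv (deriv (deriv transition)) s + c * deriv (deriv (deriv (cubic_bump s\<^sub>0 l))) s)"
      unfolding d2phi
      using Cn_on_higher_deriv(1)[OF smoothD[OF smooth_transition, of 3], of 2]
        Cn_on_higher_deriv(1)[OF smoothD[OF smooth_cubic_bump[of s\<^sub>0 l], of 3], of 2]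
      by (intro ext DERIV_imp_deriv DERIV_add DERIV_cmult) (auto simp: numeral_2_eq_2)
    have small: "c * deriv (cubic_bump s\<^sub>0 l) s > - m" if "\<bar>s - s\<^sub>0\<bar> \<le> l" for s
    proof -
      let ?z = "(s - s\<^sub>0) / l"
      have z: "?z \<in> {-1..1}" using that l by (auto simp: field_simps abs_le_iff)
      \<comment> \<open>The square is at most l^2, hence at most l because l <= 1, and the second
        factor depends only on the scaled variable.\<close>
      have e: "deriv (cubic_bump s\<^sub>0 l) s = (s - s\<^sub>0)\<^sup>2 * (3 * bump ?z + ?z * deriv bump ?z)"
      proof -
        have "3 * d\<^sup>2 * b + d ^ 3 * (e / l) = d\<^sup>2 * (3 * b + d / l * e)" for b d e :: real
          by (simp add: power2_eq_square power3_eq_cube algebra_simps)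
        note ident = this
        have "l \<noteq> 0" using l by simp
        show ?thesis
          unfolding cubic_bump_derivs(1)[OF \<open>l \<noteq> 0\<close>] by (rule ident)
      qed
      have "\<bar>3 * bump ?z + ?z * deriv bump ?z\<bar> \<le> 3 * \<bar>bump ?z\<bar> + \<bar>?z\<bar> * \<bar>deriv bump ?z\<bar>"
        by (rule order_trans[OF abs_triangle_ineq]) (simp add: abs_mult)
      also have "\<dots> \<le> 3 * B1 + 1 * B2"
        using z B1[OF z] B2[OF z] by (intro add_mono mult_mono) auto
      finally have "\<bar>3 * bump ?z + ?z * deriv bump ?z\<bar> \<le> B" by (simp add: B_def)
      moreover have "(s - s\<^sub>0)\<^sup>2 \<le> l"
      proof -
        have "(s - s\<^sub>0)\<^sup>2 \<le> l\<^sup>2" using that l by (simp add: abs_le_square_iff[symmetric])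
        also have "\<dots> \<le> l" using l by (simp add: power2_eq_square)
        finally show ?thesis .
      qed
      ultimately have "\<bar>deriv (cubic_bump s\<^sub>0 l) s\<bar> \<le> l * B"
        unfolding e abs_mult using l by (intro mult_mono) auto
      then have "\<bar>c * deriv (cubic_bump s\<^sub>0 l) s\<bar> \<le> \<bar>c\<bar> * (l * B)"
        unfolding abs_mult by (intro mult_left_mono) auto
      then show ?thesis using lc by linarith
    qed
    have "regularization_function k \<phi>"
    proof (rule regularization_function_of_deriv_pos[OF sm])
      \<comment> \<open>Outside (-1, 1) the cutoff vanishes, so the constant values survive the
        perturbation.\<close>
      have far: "\<bar>(s - s\<^sub>0) / l\<bar> \<ge> 1" if "\<bar>s\<bar> \<ge> 1" for s
        using that l r4 by (auto simp: field_simps)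
      show "\<phi> s = 1" if "s \<ge> 1" for s
        using far[of s] that by (simp add: \<phi>_def transition_values cubic_bump_def bump_outside)
      show "\<phi> s = -1" if "s \<le> -1" for s
        using far[of s] that by (simp add: \<phi>_def transition_values cubic_bump_def bump_outside)
      show "deriv \<phi> s > 0" if s: "s \<in> {-1<..<1}" for s
      proof (cases "\<bar>s - s\<^sub>0\<bar> \<le> l")
        case True
        then show ?thesis using small[OF True] m(2)[of s] l by (simp add: dphi)
      next
        case False
        then have "\<bar>(s - s\<^sub>0) / l\<bar> > 1" using l by (simp add: field_simps)
        then have "deriv (cubic_bump s\<^sub>0 l) s = 0"
          using l by (simp add: cubic_bump_derivs(1) bump_outside deriv_bump_outside)
        then show ?thesis using deriv_transition_pos[OF s] by (simp add: dphi)
      qed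
    qed
    moreover have "\<phi> s\<^sub>0 = \<theta>" by (simp add: \<phi>_def s0 cubic_bump_def)
    moreover have "deriv \<phi> s\<^sub>0 = deriv transition s\<^sub>0"
      using l by (simp add: dphi cubic_bump_derivs(1))
    moreover have "(deriv ^^ 2) \<phi> s\<^sub>0 = (deriv ^^ 2) transition s\<^sub>0"
      using l cubic_bump_derivs(2)[of l s\<^sub>0] by (simp add: numeral_2_eq_2 d2phi)
    moreover have "(deriv ^^ 3) \<phi> s\<^sub>0 = t"
      using l cubic_bump_derivs(3)[of l s\<^sub>0] bump_0 by (simp add: numeral_3_eq_3 d3phi c_def)
    ultimately show "\<exists>\<phi>. regularization_function k \<phi> \<and> \<phi> s\<^sub>0 = \<theta> \<and> deriv \<phi> s\<^sub>0 = deriv transition s\<^sub>0 \<and>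
        (deriv ^^ 2) \<phi> s\<^sub>0 = (deriv ^^ 2) transition s\<^sub>0 \<and> (deriv ^^ 3) \<phi> s\<^sub>0 = t" by blast
  qed
qed

section \<open>All signs are attained\<close>

lemma regularization_function_increasing:
  assumes "regularization_function k \<phi>" "1 \<le> k" "-1 \<le> a" "a < b" "b \<le> 1"
  shows "\<phi> a < \<phi> b"
proof -
  have "Cn_on (Suc 0) UNIV \<phi>"
    using assms(1,2) unfolding regularization_function_def Ck_on_def by (metis One_nat_def one_enat_def)
  then have d: "(\<phi> has_real_derivative deriv \<phi> s) (at s)" for s
    by (rule Cn_on_Suc_real(1)) simp
  have c: "continuous_on {a..b} \<phi>"
    using d by (meson DERIV_isCont continuous_at_imp_continuous_on)
  show ?thesis
    using DERIV_pos_imp_increasing_open[OF \<open>a < b\<close> _ c] d assms(1,3-)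
    unfolding regularization_function_def by force
qed

text \<open>Strict monotonicity makes \<phi> injective on (-1, 1), which leaves
  \<open>inv_into\<close> no choice.\<close>

lemma y_star_eqI:
  assumes "regularization_function k \<phi>" "1 \<le> k" "s \<in> {-1<..<1}"
    and "\<phi> s = (1 + inverse \<alpha> * \<delta>) / (1 - inverse \<alpha> * \<delta>)"
  shows "y_star \<alpha> \<delta> \<phi> = s"
proof -
  have "inj_on \<phi> {-1<..<1}"
  proof (rule linorder_inj_onI)
    fix x y :: real assume "x < y" "x \<in> {-1<..<1}" "y \<in> {-1<..<1}"
    then show "\<phi> x \<noteq> \<phi> y"
      using regularization_function_increasing[OF assms(1,2), of x y] by simp
  qed auto
  then show ?thesis
    unfolding y_star_def assms(4)[symmetric] using assms(3) by (rule inv_into_f_f)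
qed

text \<open>L stands for either coefficient as a function of the three derivatives of \<phi>. The
  hypothesis on \<alpha> and \<delta> puts the prescribed value of \<phi> into (-1, 1).\<close>

lemma affine_in_third_derivative_all_signs:
  fixes L :: "real \<Rightarrow> real \<Rightarrow> real \<Rightarrow> real"
  assumes "\<alpha> * \<delta> < 0" "1 \<le> k" "c \<noteq> 0"
    and L: "\<And>p q t. p > 0 \<Longrightarrow> L p q t = L p q 0 + c * t / p"
  shows "\<exists>\<phi>. regularization_function k \<phi> \<and> L (phi_H \<alpha> \<delta> \<phi> 1) (phi_H \<alpha> \<delta> \<phi> 2) (phi_H \<alpha> \<delta> \<phi> 3) = w"
proof -
  let ?th = "(1 + inverse \<alpha> * \<delta>) / (1 - inverse \<alpha> * \<delta>)"
  have "inverse \<alpha> * \<delta> < 0"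
    using assms(1) by (auto simp: mult_less_0_iff)
  moreover have "(1 + q) / (1 - q) \<in> {-1<..<1}" if "q < 0" for q :: real
    using that by (auto simp: field_simps)
  ultimately have "?th \<in> {-1<..<1}" by blast
  from regularization_function_with_third_derivative[OF this] obtain s p q where
    s: "s \<in> {-1<..<1}" "p > 0" and ex: "\<And>k t. \<exists>\<phi>. regularization_function k \<phi> \<and> \<phi> s = ?th \<and> deriv \<phi> s = p \<and>
        (deriv ^^ 2) \<phi> s = q \<and> (deriv ^^ 3) \<phi> s = t" by metis
  \<comment> \<open>The prescribed third derivative is the solution t of L p q 0 + c t / p =
    w.\<close>
  obtain \<phi> where \<phi>: "regularization_function k \<phi>" "\<phi> s = ?th" "deriv \<phi> s = p"
        "(deriv ^^ 2) \<phi> s = q" "(deriv ^^ 3) \<phi> s = (w - L p q 0) * p / c"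
    using ex by blast
  have "y_star \<alpha> \<delta> \<phi> = s" by (rule y_star_eqI[OF \<phi>(1) assms(2) s(1) \<phi>(2)])
  then show ?thesis
    using \<phi> L[OF s(2), of q "(w - L p q 0) * p / c"] s(2) assms(3)
    by (intro exI[of _ \<phi>]) (simp add: phi_H_def)
qed

text \<open>The third derivative enters only through the term with factor 1/8 in \<open>a2\<close>.
  The summand by which \<open>lyapunov_slope\<close> differs is free of it, so both coefficients
  share the slope \<open>?N / (8 * (\<alpha> - \<delta>))\<close> up to the factor 1/p.\<close>

lemma a2_lyapunov_slope_all_values:
  fixes \<alpha> \<beta> \<delta> \<zeta>p \<zeta>m \<eta>p \<eta>m \<chi>p \<chi>m :: real
  assumes "\<alpha> * \<delta> < 0" "1 \<le> k" "\<delta> * (\<zeta>m + \<chi>m) - \<alpha> * (\<zeta>p + \<chi>p) \<noteq> 0"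
  shows "\<exists>\<phi>. regularization_function k \<phi> \<and> a2 \<alpha> \<beta> \<delta> \<zeta>p \<zeta>m \<eta>p \<eta>m \<chi>p \<chi>m \<phi> = w"
    and "\<exists>\<phi>. regularization_function k \<phi> \<and> lyapunov_slope \<alpha> \<beta> \<delta> \<zeta>p \<zeta>m \<eta>p \<eta>m \<chi>p \<chi>m \<phi> = w"
proof -
  let ?N = "\<delta> * (\<zeta>m + \<chi>m) - \<alpha> * (\<zeta>p + \<chi>p)"
  define L1 where "L1 \<phi>1 \<phi>2 \<phi>3 = (\<alpha> - \<delta>) * \<phi>1\<^sup>2 / (16 * (\<beta> * \<delta> + \<alpha>)\<^sup>2)
           * ((\<beta> + 1)\<^sup>2 * (\<delta> * \<zeta>m - \<alpha> * \<zeta>p) - (\<alpha> - \<delta>)\<^sup>2 * (\<eta>m + \<beta> * \<eta>p))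
         + (\<beta> + 1) * \<phi>2 / (16 * (\<beta> * \<delta> + \<alpha>)) * (\<delta> * \<chi>m - \<alpha> * \<chi>p)
         + 1 / 8 * (\<phi>3 / (\<phi>1 * (\<alpha> - \<delta>)) - \<phi>2\<^sup>2 / (\<phi>1\<^sup>2 * (\<alpha> - \<delta>)) - (\<beta> + 1) * \<phi>2 / (\<beta> * \<delta> + \<alpha>)) * ?N"
    for \<phi>1 \<phi>2 \<phi>3
  define L2 where "L2 \<phi>1 \<phi>2 \<phi>3 = L1 \<phi>1 \<phi>2 \<phi>3 + (\<chi>p - \<chi>m) / 16
       * (\<phi>2 - (\<beta> + 1) * (\<alpha> - \<delta>) * \<phi>1\<^sup>2 / (\<beta> * \<delta> + \<alpha>))" for \<phi>1 \<phi>2 \<phi>3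
  have ne: "\<alpha> - \<delta> \<noteq> 0" using assms(1) by (auto simp: mult_less_0_iff)
  have c: "?N / (8 * (\<alpha> - \<delta>)) \<noteq> 0" using ne assms(3) by simp
  have L1: "L1 p q t = L1 p q 0 + ?N / (8 * (\<alpha> - \<delta>)) * t / p" if "p > 0" for p q t
  proof -
    have "a + 1 / 8 * (t / (p * D) - b - d) * N = a + 1 / 8 * (0 / (p * D) - b - d) * N + N / (8 * D) * t / p"
      for a b d D N :: real
      by (simp add: algebra_simps add_divide_distrib diff_divide_distrib)
    then show ?thesis unfolding L1_def by blast
  qed
  have L2: "L2 p q t = L2 p q 0 + ?N / (8 * (\<alpha> - \<delta>)) * t / p" if "p > 0" for p q t
    unfolding L2_def L1[OF that, of q t] by simp
  show "\<exists>\<phi>. regularization_function k \<phi> \<and> a2 \<alpha> \<beta> \<delta> \<zeta>p \<zeta>m \<eta>p \<eta>m \<chi>p \<chi>m \<phi> = w"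
    using affine_in_third_derivative_all_signs[OF assms(1,2) c, of L1 w] L1
    unfolding a2_def Let_def L1_def by blast
  show "\<exists>\<phi>. regularization_function k \<phi> \<and> lyapunov_slope \<alpha> \<beta> \<delta> \<zeta>p \<zeta>m \<eta>p \<eta>m \<chi>p \<chi>m \<phi> = w"
    using affine_in_third_derivative_all_signs[OF assms(1,2) c, of L2 w] L2
    unfolding lyapunov_slope_def a2_def Let_def L2_def L1_def by blast
qed

section \<open>The equilibria of the regularized system\<close>

text \<open>A form of the inverse function theorem that keeps only differentiability of the inverse;
  the derivatives of the branch are recovered later by implicit differentiation.\<close>

lemma local_inverse:
  fixes f::"'a::euclidean_space \<Rightarrow> 'a" and f'::"'a \<Rightarrow> ('a \<Rightarrow>\<^sub>L 'a)"
  assumes "open W" and derf: "\<And>x. x \<in> W \<Longrightarrow> (f has_derivative (blinfun_apply (f' x))) (at x)"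
    and contf:  "continuous_on W f'" and "q \<in> W" and invf: "invf o\<^sub>L f' q = id_blinfun"
  shows "\<exists>U V g. open U \<and> U \<subseteq> W \<and> q \<in> U \<and> open V \<and> f q \<in> V \<and> homeomorphism U V f g \<and> (\<forall>y\<in>V. g differentiable (at y))"
    apply (rule inverse_function_theorem[where ?f = f and ?f' = f' and ?U = W and ?x0.0 = q and ?invf = invf,
        OF assms(1) _ contf assms(4,5)])
   apply (erule derf)
  subgoal premises p for U V g g'
    apply (rule exI[of _ U], rule exI[of _ V], rule exI[of _ g])
    apply (intro conjI p ballI differentiableI[OF p(7)])
    apply assumption
    done
  done

text \<open>A and B are the first components of the upper and the lower field, C and D the second
  ones, as functions of (x, y, \<mu>). The remainders of the normal form are replaced by smoothness
  and the Taylor coefficients at the origin.\<close>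

locale pws =
  fixes \<alpha> \<beta> \<delta> \<zeta>p \<zeta>m \<eta>p \<eta>m \<chi>p \<chi>m :: real
    and A B C D :: "real \<times> real \<times> real \<Rightarrow> real" and U
    and \<phi> :: "real \<Rightarrow> real" and k :: enat
  assumes delta: "\<delta> \<in> {1, -1}" and visible: "\<alpha> * \<delta> < 0" and Om: "\<beta> * \<delta> + \<alpha> > 0" and beta: "\<beta> \<noteq> 0"
    and openU: "open U" and zeroU: "0 \<in> U"
    and smooth: "Ck_on \<infinity> U A" "Ck_on \<infinity> U B" "Ck_on \<infinity> U C" "Ck_on \<infinity> U D"
    and A0: "A 0 = \<delta>" "px A 0 = \<zeta>p"
    and B0: "B 0 = \<alpha>" "px B 0 = \<zeta>m"
    and C0: "C 0 = 0" "px C 0 = 1" "py C 0 = \<chi>p" "pm C 0 = 0" "px (px C) 0 = 2 * \<eta>p"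
    and D0: "D 0 = 0" "px D 0 = - \<beta>" "py D 0 = \<chi>m" "pm D 0 = \<beta>" "px (px D) 0 = 2 * \<eta>m"
    and reg: "regularization_function k \<phi>" and k3: "3 \<le> k"
begin

abbreviation "Xp \<equiv> \<lambda>(x, y) \<mu>. (A (x, y, \<mu>), C (x, y, \<mu>))"
abbreviation "Xm \<equiv> \<lambda>(x, y) \<mu>. (B (x, y, \<mu>), D (x, y, \<mu>))"

abbreviation "\<Omega> \<equiv> \<beta> * \<delta> + \<alpha>"

text \<open>The value of \<phi> for which the mixture of \<delta> and \<alpha>, the first components
  at the origin, vanishes; \<phi> takes it at \<open>vs\<close>.\<close>

definition "\<kappa> = (1 + inverse \<alpha> * \<delta>) / (1 - inverse \<alpha> * \<delta>)"
definition "vs = y_star \<alpha> \<delta> \<phi>"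

abbreviation "d1 \<equiv> deriv \<phi>"
abbreviation "d2 \<equiv> deriv (deriv \<phi>)"
abbreviation "d3 \<equiv> deriv (deriv (deriv \<phi>))"

lemma alpha_delta: "\<alpha> \<noteq> 0" "\<alpha> - \<delta> \<noteq> 0" "\<delta> \<noteq> 0" "\<delta> * \<delta> = 1"
  using visible delta by (auto simp: mult_less_0_iff)

lemma kappa: "\<kappa> \<in> {-1<..<1}" "1 + \<kappa> = 2 * \<alpha> / (\<alpha> - \<delta>)" "1 - \<kappa> = - 2 * \<delta> / (\<alpha> - \<delta>)"
proof -
  have "inverse \<alpha> * \<delta> < 0"
    using visible by (auto simp: mult_less_0_iff)
  moreover have "(1 + q) / (1 - q) \<in> {-1<..<1}" if "q < 0" for q :: real
    using that by (auto simp: field_simps)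
  ultimately show "\<kappa> \<in> {-1<..<1}" unfolding \<kappa>_def by blast
  have k: "\<kappa> = (\<alpha> + \<delta>) / (\<alpha> - \<delta>)"
    using alpha_delta by (simp add: \<kappa>_def field_simps)
  show "1 + \<kappa> = 2 * \<alpha> / (\<alpha> - \<delta>)" "1 - \<kappa> = - 2 * \<delta> / (\<alpha> - \<delta>)"
    using alpha_delta by (simp_all add: k field_simps)
qed

lemma phi_C3: "Cn_on 3 UNIV \<phi>"
  using reg k3 unfolding regularization_function_def Ck_on_def by (metis numeral_eq_enat)

lemma phi_derivs:
  "(\<phi> has_real_derivative d1 v) (at v)" "(d1 has_real_derivative d2 v) (at v)"
  "(d2 has_real_derivative d3 v) (at v)"
  using Cn_on_higher_deriv(1)[OF phi_C3, of 0 v] Cn_on_higher_deriv(1)[OF phi_C3, of 1 v]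
    Cn_on_higher_deriv(1)[OF phi_C3, of 2 v]
  by (simp_all add: numeral_2_eq_2)

lemma phi_cont: "isCont \<phi> v" "isCont d1 v" "isCont d2 v" "isCont d3 v"
proof -
  show "isCont \<phi> v" "isCont d1 v" "isCont d2 v"
    using phi_derivs DERIV_isCont by blast+
  show "isCont d3 v"
    using Cn_on_higher_deriv(2)[OF phi_C3, of 3] by (simp add: numeral_3_eq_3 continuous_on_eq_continuous_at)
qed

lemma phi_values: "s \<ge> 1 \<Longrightarrow> \<phi> s = 1" "s \<le> -1 \<Longrightarrow> \<phi> s = -1" "s \<in> {-1<..<1} \<Longrightarrow> \<phi> s \<in> {-1<..<1}"
  "s \<in> {-1<..<1} \<Longrightarrow> d1 s > 0"
  using reg unfolding regularization_function_def by auto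

lemma phi_bound: "\<bar>\<phi> s\<bar> \<le> 1"
proof -
  consider "s \<ge> 1" | "s \<le> -1" | "s \<in> {-1<..<1}" by fastforce
  then show ?thesis using phi_values[of s] by cases auto
qed

lemma phi_increasing: "-1 \<le> a \<Longrightarrow> a < b \<Longrightarrow> b \<le> 1 \<Longrightarrow> \<phi> a < \<phi> b"
  by (rule regularization_function_increasing[OF reg])
    (use order_trans[OF _ k3, of 1] in \<open>auto simp: numeral_eq_enat one_enat_def\<close>)

lemma vs: "vs \<in> {-1<..<1}" "\<phi> vs = \<kappa>"
proof -
  have c: "continuous_on {-1..1} \<phi>"
    using phi_cont by (simp add: continuous_at_imp_continuous_on)
  obtain s where "-1 \<le> s" "s \<le> 1" "\<phi> s = \<kappa>"
    using IVT'[of \<phi> "-1" \<kappa> 1] c kappa(1) phi_values(1,2) by force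
  moreover have "s \<noteq> -1" "s \<noteq> 1" using calculation kappa(1) phi_values(1,2) by force+
  ultimately have "\<kappa> \<in> \<phi> ` {-1<..<1}" by (intro image_eqI[of _ _ s]) auto
  then show "vs \<in> {-1<..<1}" "\<phi> vs = \<kappa>"
    unfolding vs_def y_star_def \<kappa>_def[symmetric] by (rule inv_into_into, rule f_inv_into_f)
qed

lemma d1_vs: "d1 vs > 0"
  using phi_values(4) vs(1) by blast

lemma phi_H: "phi_H \<alpha> \<delta> \<phi> 1 = d1 vs" "phi_H \<alpha> \<delta> \<phi> 2 = d2 vs" "phi_H \<alpha> \<delta> \<phi> 3 = d3 vs"
  by (simp_all add: phi_H_def vs_def numeral_2_eq_2 numeral_3_eq_3)

text \<open>Near \<open>vs\<close> the derivative of \<phi> is at least some m > 0, and the mean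
  value theorem gives the constant 1/m. Monotonicity rules out every other real v whose value is
  close to \<kappa>.\<close>

lemma phi_inverse_lipschitz:
  obtains K e where "K > 0" "e > 0" "\<And>v. \<bar>\<phi> v - \<kappa>\<bar> < e \<Longrightarrow> \<bar>v - vs\<bar> \<le> K * \<bar>\<phi> v - \<kappa>\<bar>"
proof -
  define r where "r = (1 - \<bar>vs\<bar>) / 2"
  have r: "0 < r" "-1 < vs - r" "vs + r < 1"
    using vs(1) by (auto simp: r_def abs_if field_simps)
  obtain x where x: "x \<in> {vs - r..vs + r}" "\<And>s. s \<in> {vs - r..vs + r} \<Longrightarrow> d1 x \<le> d1 s"
    using continuous_attains_inf[of "{vs - r..vs + r}" d1] phi_cont(2) r(1)
    by (auto simp: continuous_at_imp_continuous_on)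
  define m where "m = d1 x"
  have m: "m > 0" using phi_values(4)[of x] x r by (auto simp: m_def)
  \<comment> \<open>Values closer to \<kappa> than e are not attained outside the interval of radius
    r.\<close>
  define e where "e = min (\<phi> (vs + r) - \<kappa>) (\<kappa> - \<phi> (vs - r))"
  show ?thesis
  proof (rule that[of "1 / m" e])
    show "e > 0"
      using phi_increasing[of "vs - r" vs] phi_increasing[of vs "vs + r"] r vs(2) by (simp add: e_def)
    fix v assume v: "\<bar>\<phi> v - \<kappa>\<bar> < e"
    have up: "\<phi> (vs + r) \<le> \<phi> v" if "v \<ge> vs + r"
      using phi_increasing[of "vs + r" v] phi_values(1)[of v] phi_bound[of "vs + r"] that r
      by (cases "v \<le> 1"; cases "v = vs + r") auto
    have lo: "\<phi> v \<le> \<phi> (vs - r)" if "v \<le> vs - r"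
      using phi_increasing[of v "vs - r"] phi_values(2)[of v] phi_bound[of "vs - r"] that r
      by (cases "v \<ge> -1"; cases "v = vs - r") auto
    have vin: "v \<in> {vs - r..vs + r}"
      using up lo v unfolding e_def by fastforce
    have "m * \<bar>v - vs\<bar> \<le> \<bar>\<phi> v - \<phi> vs\<bar>"
    proof (cases v vs rule: linorder_cases)
      case less
      then obtain z where z: "v < z" "z < vs" "\<phi> vs - \<phi> v = (vs - v) * d1 z"
        using MVT2[of v vs \<phi> d1] phi_derivs(1) by blast
      have "m \<le> d1 z" unfolding m_def by (rule x(2)) (use z vin r in auto)
      then have "m * (vs - v) \<le> (vs - v) * d1 z" using less by (simp add: mult.commute)
      moreover have "\<bar>v - vs\<bar> = vs - v" using less by simp
      ultimately show ?thesis using z(3) by simp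
    next
      case greater
      then obtain z where z: "vs < z" "z < v" "\<phi> v - \<phi> vs = (v - vs) * d1 z"
        using MVT2[of vs v \<phi> d1] phi_derivs(1) by blast
      have "m \<le> d1 z" unfolding m_def by (rule x(2)) (use z vin r in auto)
      then have "m * (v - vs) \<le> (v - vs) * d1 z" using greater by (simp add: mult.commute)
      moreover have "\<bar>v - vs\<bar> = v - vs" using greater by simp
      ultimately show ?thesis using z(3) by simp
    qed simp
    then show "\<bar>v - vs\<bar> \<le> 1 / m * \<bar>\<phi> v - \<kappa>\<bar>"
      using m vs(2) by (simp add: field_simps)
  qed (use m in auto)
qed

text \<open>Twice the convex combination of the regularization. The argument v of \<phi> is separate
  from the point p, so the expression makes sense for \<epsilon> = 0, where v is no longer
  y/\<epsilon>.\<close>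

definition mix :: "('a \<Rightarrow> real) \<Rightarrow> ('a \<Rightarrow> real) \<Rightarrow> real \<Rightarrow> 'a \<Rightarrow> real" where
  "mix f g v p = (1 + \<phi> v) * f p + (1 - \<phi> v) * g p"

lemma regularized_field_eq:
  "regularized_field Xp Xm \<phi> \<epsilon> \<mu> (x, y) =
     (mix A B (y / \<epsilon>) (x, y, \<mu>) / 2, mix C D (y / \<epsilon>) (x, y, \<mu>) / 2)"
  by (simp add: regularized_field_def mix_def add_divide_distrib)

lemma smooth_mix: "Ck_on \<infinity> U f \<Longrightarrow> Ck_on \<infinity> U g \<Longrightarrow> Ck_on \<infinity> U (mix f g v)"
  unfolding mix_def[abs_def] using openU
  by (auto intro!: smooth_add smooth_mult smooth_const)

lemma mix_bound: "\<bar>mix f g v p\<bar> \<le> 2 * \<bar>f p\<bar> + 2 * \<bar>g p\<bar>"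
proof -
  have "\<bar>mix f g v p\<bar> \<le> \<bar>1 + \<phi> v\<bar> * \<bar>f p\<bar> + \<bar>1 - \<phi> v\<bar> * \<bar>g p\<bar>"
    unfolding mix_def by (rule order_trans[OF abs_triangle_ineq]) (simp add: abs_mult)
  also have "\<dots> \<le> 2 * \<bar>f p\<bar> + 2 * \<bar>g p\<bar>"
    using phi_bound[of v] by (intro add_mono mult_right_mono) auto
  finally show ?thesis .
qed

lemma mix_vs_A: "mix A B vs 0 = 0"
  using alpha_delta by (simp add: mix_def A0 B0 vs kappa field_simps)

text \<open>The product of \<phi>(v) - \<kappa> with A - B is the difference of the mixtures at v
  and at \<open>vs\<close>. The first is zero, the second is of the order of the norm of p, and A -
  B stays away from 0. No closeness of v to \<open>vs\<close> is presupposed.\<close>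

lemma phi_estimate:
  obtains K r where "K > 0" "r > 0" "ball 0 r \<subseteq> U"
    "\<And>p v. p \<in> ball 0 r \<Longrightarrow> mix A B v p = 0 \<Longrightarrow> \<bar>\<phi> v - \<kappa>\<bar> \<le> K * norm p \<and> \<bar>v - vs\<bar> \<le> K * norm p"
proof -
  obtain K1 r1 where 1: "K1 > 0" "r1 > 0" "ball 0 r1 \<subseteq> U"
    "\<And>q. q \<in> ball 0 r1 \<Longrightarrow> \<bar>mix A B vs q - mix A B vs 0\<bar> \<le> K1 * norm q"
    using smooth_lipschitz_at[OF openU zeroU smooth_mix[OF smooth(1,2)]] by metis
  obtain K2 r2 where 2: "K2 > 0" "r2 > 0" "ball 0 r2 \<subseteq> U"
    "\<And>q. q \<in> ball 0 r2 \<Longrightarrow> \<bar>(A q - B q) - (A 0 - B 0)\<bar> \<le> K2 * norm q"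
    using smooth_lipschitz_at[OF openU zeroU smooth_diff[OF openU smooth(1,2)]] by metis
  obtain K3 e where 3: "K3 > 0" "e > 0" "\<And>v. \<bar>\<phi> v - \<kappa>\<bar> < e \<Longrightarrow> \<bar>v - vs\<bar> \<le> K3 * \<bar>\<phi> v - \<kappa>\<bar>"
    using phi_inverse_lipschitz by blast
  define d where "d = \<bar>\<alpha> - \<delta>\<bar> / 2"
  have d: "d > 0" using alpha_delta by (simp add: d_def)
  \<comment> \<open>The bound \<open>d / K2\<close> keeps A - B at least d, half its size at the
    origin; \<open>e * d / K1\<close> brings \<phi>(v) into the range of the Lipschitz estimate for
    the inverse.\<close>
  define r where "r = min (min r1 r2) (min (d / K2) (e * d / K1))"
  have r: "r > 0" using 1 2 3 d by (simp add: r_def)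
  define K where "K = K1 / d + K3 * (K1 / d)"
  show ?thesis
  proof (rule that[of K r])
    show "K > 0" using 1 3 d by (simp add: K_def add_pos_pos)
    fix p v assume p: "p \<in> ball 0 r" and m: "mix A B v p = 0"
    have pn: "norm p < r" using p by simp
    have p1: "p \<in> ball 0 r1" "p \<in> ball 0 r2" using pn by (auto simp: r_def)
    have "K2 * norm p \<le> d" using pn 2(1) by (simp add: r_def field_simps)
    then have "\<bar>(A p - B p) - (\<delta> - \<alpha>)\<bar> \<le> d" using 2(4)[OF p1(2)] by (simp add: A0 B0)
    then have ge: "\<bar>A p - B p\<bar> \<ge> d"
      using abs_triangle_ineq4[of "A p - B p" "A p - B p - (\<delta> - \<alpha>)"] unfolding d_def
      by (simp add: abs_minus_commute)
    have "(\<phi> v - \<kappa>) * (A p - B p) = mix A B v p - mix A B vs p"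
      by (simp add: mix_def vs algebra_simps)
    then have "\<bar>\<phi> v - \<kappa>\<bar> * \<bar>A p - B p\<bar> \<le> K1 * norm p"
      using 1(4)[OF p1(1)] unfolding abs_mult[symmetric] by (simp add: m mix_vs_A)
    moreover have "\<bar>\<phi> v - \<kappa>\<bar> * d \<le> \<bar>\<phi> v - \<kappa>\<bar> * \<bar>A p - B p\<bar>"
      using ge by (intro mult_left_mono) auto
    ultimately have le: "\<bar>\<phi> v - \<kappa>\<bar> \<le> K1 / d * norm p" using d by (simp add: field_simps)
    have "K1 * norm p < e * d" using pn 1(1) by (simp add: r_def field_simps)
    then have "K1 / d * norm p < e" using d by (simp add: field_simps)
    then have "\<bar>v - vs\<bar> \<le> K3 * \<bar>\<phi> v - \<kappa>\<bar>" using le 3(3)[of v] by simp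
    also have "\<dots> \<le> K3 * (K1 / d * norm p)" using mult_left_mono[OF le, of K3] 3(1) by simp
    finally have "\<bar>v - vs\<bar> \<le> K3 * (K1 / d) * norm p" by simp
    moreover have "K1 / d * norm p \<ge> 0" "K3 * (K1 / d) * norm p \<ge> 0" using 1 3 d by auto
    ultimately show "\<bar>\<phi> v - \<kappa>\<bar> \<le> K * norm p \<and> \<bar>v - vs\<bar> \<le> K * norm p"
      using le by (simp add: K_def distrib_right)
  qed (use r 1 in \<open>auto simp: r_def\<close>)
qed

text \<open>To first order along the equilibria, x grows like \<open>c\<^sub>x * \<mu>\<close> and C
  - D like \<open>lam * \<mu>\<close>.\<close>

definition "c\<^sub>x = \<beta> * \<delta> / \<Omega>"
definition "lam = \<beta> * (\<delta> - \<alpha>) / \<Omega>"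

lemma lam: "lam \<noteq> 0" "(1 + \<beta>) * c\<^sub>x - \<beta> = lam"
  using beta alpha_delta Om by (auto simp: lam_def c\<^sub>x_def field_simps)

text \<open>On the left stands the second equation with \<kappa> in place of \<phi>(v) and with the
  parts of C and D linear in x and \<mu>; the right-hand side collects the errors of both
  replacements.\<close>

lemma equilibrium_linear:
  assumes "mix C D v p = 0"
  shows "2 / (\<alpha> - \<delta>) * (\<Omega> * x - \<beta> * \<delta> * \<mu>)
    = - ((\<phi> v - \<kappa>) * (x + \<beta> * (x - \<mu>))) - mix (\<lambda>p. C p - x) (\<lambda>p. D p + \<beta> * (x - \<mu>)) v p"
proof -
  have "2 / d * (\<Omega> * x - \<beta> * \<delta> * \<mu>) = 2 * \<alpha> / d * x - - 2 * \<delta> / d * \<beta> * (x - \<mu>)" for d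
    by (simp add: algebra_simps add_divide_distrib diff_divide_distrib)
  then have "2 / (\<alpha> - \<delta>) * (\<Omega> * x - \<beta> * \<delta> * \<mu>) = (1 + \<kappa>) * x - (1 - \<kappa>) * \<beta> * (x - \<mu>)"
    unfolding kappa(2,3) .
  then show ?thesis using assms by (simp add: mix_def algebra_simps)
qed

text \<open>The nonlinear terms are of second order except in \<open>y\<close>, which is of order \<open>\<epsilon>\<close>.\<close>

lemma equilibrium_estimate:
  obtains K r where "K > 0" "r > 0" "ball 0 r \<subseteq> U"
    "\<And>x y \<mu> v. (x, y, \<mu>) \<in> ball 0 r \<Longrightarrow> mix A B v (x, y, \<mu>) = 0 \<Longrightarrow> mix C D v (x, y, \<mu>) = 0 \<Longrightarrow>
       \<bar>x - c\<^sub>x * \<mu>\<bar> \<le> K * (\<mu>\<^sup>2 + \<bar>y\<bar>) \<and>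
       \<bar>C (x, y, \<mu>) - D (x, y, \<mu>) - lam * \<mu>\<bar> \<le> K * (\<mu>\<^sup>2 + \<bar>y\<bar>)"
proof -
  obtain K1 r1 where 1: "K1 > 0" "r1 > 0" "ball 0 r1 \<subseteq> U"
    "\<And>x y m. (x, y, m) \<in> ball 0 r1 \<Longrightarrow>
        \<bar>C (x, y, m) - C 0 - (x * px C 0 + y * py C 0 + m * pm C 0)\<bar> \<le> K1 * (norm (x, y, m))\<^sup>2"
    using smooth_taylor_at[OF openU zeroU smooth(3)] by blast
  obtain K2 r2 where 2: "K2 > 0" "r2 > 0" "ball 0 r2 \<subseteq> U"
    "\<And>x y m. (x, y, m) \<in> ball 0 r2 \<Longrightarrow>
        \<bar>D (x, y, m) - D 0 - (x * px D 0 + y * py D 0 + m * pm D 0)\<bar> \<le> K2 * (norm (x, y, m))\<^sup>2"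
    using smooth_taylor_at[OF openU zeroU smooth(4)] by blast
  obtain K3 r3 where 3: "K3 > 0" "r3 > 0" "ball 0 r3 \<subseteq> U"
    "\<And>p v. p \<in> ball 0 r3 \<Longrightarrow> mix A B v p = 0 \<Longrightarrow> \<bar>\<phi> v - \<kappa>\<bar> \<le> K3 * norm p \<and> \<bar>v - vs\<bar> \<le> K3 * norm p"
    using phi_estimate by blast
  \<comment> \<open>Against n^2 + |y|, where n is the norm of the point, L bounds the errors of C
    and D, and M that of x. The constants N and c serve to replace n^2 by \<mu>^2 + |y|.\<close>
  define L where "L = K1 + K2 + \<bar>\<chi>p\<bar> + \<bar>\<chi>m\<bar>"
  define M where "M = (K3 * (1 + 2 * \<bar>\<beta>\<bar>) + 4 * L) * \<bar>\<alpha> - \<delta>\<bar> / (2 * \<Omega>)"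
  define N where "N = 3 * M + 1"
  define c where "c = 2 * c\<^sub>x\<^sup>2 + 1"
  define K where "K = 4 * N * c + \<bar>1 + \<beta>\<bar> * (4 * N * c) + 2 * L * (13 * c)"
  have L: "L > 0" using 1 2 by (simp add: L_def add_pos_nonneg)
  have M: "M > 0" using 3 L alpha_delta Om by (simp add: M_def add_pos_pos)
  have N: "N > 1" using M by (simp add: N_def)
  have c: "c \<ge> 1" by (simp add: c_def)
  \<comment> \<open>The last bound forces |x - \<open>c\<^sub>x\<close> \<mu>| <= 1/(4N), so that
    its square is at most 1/(4N) times itself.\<close>
  define r where "r = min (min r1 (min r2 r3)) (min 1 (1 / (4 * N * (1 + \<bar>c\<^sub>x\<bar>))))"
  show ?thesis
  proof (rule that[of K r])
    show "K > 0" using N c L unfolding K_def by (intro add_pos_nonneg) auto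
    show "r > 0" using 1 2 3 N by (simp add: r_def)
    show "ball 0 r \<subseteq> U" using 1 by (auto simp: r_def)
    fix x y \<mu> v assume p: "(x, y, \<mu>) \<in> ball 0 r" and m1: "mix A B v (x, y, \<mu>) = 0" and m2: "mix C D v (x, y, \<mu>) = 0"
    let ?p = "(x, y, \<mu>)"
    define n where "n = norm ?p"
    have n0: "n \<ge> 0" by (simp add: n_def)
    have pn: "n < r" using p by (simp add: n_def)
    have n: "\<bar>x\<bar> \<le> n" "\<bar>y\<bar> \<le> n" "\<bar>\<mu>\<bar> \<le> n" "n \<le> \<bar>x\<bar> + \<bar>y\<bar> + \<bar>\<mu>\<bar>" unfolding n_def by (rule abs_le_norm3)+
    have p1: "?p \<in> ball 0 r1" "?p \<in> ball 0 r2" "?p \<in> ball 0 r3" using p by (auto simp: r_def)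
    have "n < 1" using pn by (simp add: r_def)
    have C: "\<bar>C ?p - x\<bar> \<le> L * (n\<^sup>2 + \<bar>y\<bar>)"
    proof -
      have "\<bar>C ?p - x - y * \<chi>p\<bar> \<le> K1 * n\<^sup>2" using 1(4)[OF p1(1)] by (simp add: C0 n_def)
      then have "\<bar>C ?p - x\<bar> \<le> K1 * n\<^sup>2 + \<bar>\<chi>p\<bar> * \<bar>y\<bar>"
        using abs_triangle_ineq[of "C ?p - x - y * \<chi>p" "y * \<chi>p"] by (simp add: abs_mult mult.commute)
      also have "\<dots> \<le> L * n\<^sup>2 + L * \<bar>y\<bar>" using 1 2 by (intro add_mono mult_right_mono) (auto simp: L_def)
      finally show ?thesis by (simp add: distrib_left)
    qed
    have D: "\<bar>D ?p + \<beta> * (x - \<mu>)\<bar> \<le> L * (n\<^sup>2 + \<bar>y\<bar>)"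
    proof -
      have "\<bar>D ?p + \<beta> * (x - \<mu>) - y * \<chi>m\<bar> \<le> K2 * n\<^sup>2"
        using 2(4)[OF p1(2)] by (simp add: D0 n_def algebra_simps)
      then have "\<bar>D ?p + \<beta> * (x - \<mu>)\<bar> \<le> K2 * n\<^sup>2 + \<bar>\<chi>m\<bar> * \<bar>y\<bar>"
        using abs_triangle_ineq[of "D ?p + \<beta> * (x - \<mu>) - y * \<chi>m" "y * \<chi>m"] by (simp add: abs_mult mult.commute)
      also have "\<dots> \<le> L * n\<^sup>2 + L * \<bar>y\<bar>" using 1 2 by (intro add_mono mult_right_mono) (auto simp: L_def)
      finally show ?thesis by (simp add: distrib_left)
    qed
    have lin: "\<bar>x + \<beta> * (x - \<mu>)\<bar> \<le> (1 + 2 * \<bar>\<beta>\<bar>) * n"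
    proof -
      have "\<bar>\<beta> * (x - \<mu>)\<bar> \<le> \<bar>\<beta>\<bar> * (2 * n)" unfolding abs_mult using n by (intro mult_left_mono) auto
      then show ?thesis using n(1) by (simp add: algebra_simps)
    qed
    have "\<bar>2 / (\<alpha> - \<delta>) * (\<Omega> * x - \<beta> * \<delta> * \<mu>)\<bar> \<le> \<bar>(\<phi> v - \<kappa>) * (x + \<beta> * (x - \<mu>))\<bar>
        + \<bar>mix (\<lambda>p. C p - x) (\<lambda>p. D p + \<beta> * (x - \<mu>)) v ?p\<bar>"
      unfolding equilibrium_linear[OF m2] by linarith
    also have "\<dots> \<le> (K3 * n) * ((1 + 2 * \<bar>\<beta>\<bar>) * n) + (2 * (L * (n\<^sup>2 + \<bar>y\<bar>)) + 2 * (L * (n\<^sup>2 + \<bar>y\<bar>)))"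
      unfolding abs_mult
      using 3(4)[OF p1(3) m1] lin n0 3(1) C D
      by (intro add_mono mult_mono order_trans[OF mix_bound]) (auto simp: n_def)
    also have "\<dots> \<le> (K3 * (1 + 2 * \<bar>\<beta>\<bar>)) * (n\<^sup>2 + \<bar>y\<bar>) + 4 * L * (n\<^sup>2 + \<bar>y\<bar>)"
      using 3(1) by (simp add: power2_eq_square algebra_simps)
    also have "\<dots> = (K3 * (1 + 2 * \<bar>\<beta>\<bar>) + 4 * L) * (n\<^sup>2 + \<bar>y\<bar>)" by (simp add: algebra_simps)
    finally have b1: "\<bar>2 / (\<alpha> - \<delta>) * (\<Omega> * x - \<beta> * \<delta> * \<mu>)\<bar> \<le> (K3 * (1 + 2 * \<bar>\<beta>\<bar>) + 4 * L) * (n\<^sup>2 + \<bar>y\<bar>)" .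
    have eq: "2 / (\<alpha> - \<delta>) * (\<Omega> * x - \<beta> * \<delta> * \<mu>) = 2 * \<Omega> / (\<alpha> - \<delta>) * (x - c\<^sub>x * \<mu>)"
    proof -
      have "\<Omega> * x - \<beta> * \<delta> * \<mu> = \<Omega> * (x - c\<^sub>x * \<mu>)"
        using Om by (simp add: c\<^sub>x_def right_diff_distrib)
      then show ?thesis by simp
    qed
    have "2 * \<Omega> / \<bar>\<alpha> - \<delta>\<bar> * \<bar>x - c\<^sub>x * \<mu>\<bar> \<le> (K3 * (1 + 2 * \<bar>\<beta>\<bar>) + 4 * L) * (n\<^sup>2 + \<bar>y\<bar>)"
      using b1[unfolded eq abs_mult abs_divide] Om by simp
    then have x1: "\<bar>x - c\<^sub>x * \<mu>\<bar> \<le> M * (n\<^sup>2 + \<bar>y\<bar>)"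
      using Om alpha_delta by (simp add: M_def field_simps)
    have y2: "y\<^sup>2 \<le> \<bar>y\<bar>"
    proof -
      have "\<bar>y\<bar> * \<bar>y\<bar> \<le> \<bar>y\<bar> * 1" using n(2) \<open>n < 1\<close> by (intro mult_left_mono) auto
      then show ?thesis by (simp add: power2_eq_square)
    qed
    have n2: "n\<^sup>2 \<le> 3 * (x\<^sup>2 + \<mu>\<^sup>2 + \<bar>y\<bar>)"
    proof -
      have "n\<^sup>2 \<le> (\<bar>x\<bar> + \<bar>y\<bar> + \<bar>\<mu>\<bar>)\<^sup>2" using n n0 by (intro power_mono) auto
      also have "\<dots> \<le> 3 * (x\<^sup>2 + y\<^sup>2 + \<mu>\<^sup>2)"
        using sum_squares_ge_zero[of "\<bar>x\<bar> - \<bar>y\<bar>" "\<bar>x\<bar> - \<bar>\<mu>\<bar>"] zero_le_power2[of "\<bar>y\<bar> - \<bar>\<mu>\<bar>"]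
        by (simp add: power2_eq_square algebra_simps)
      finally show ?thesis using y2 by simp
    qed
    have x2: "x\<^sup>2 \<le> 2 * (x - c\<^sub>x * \<mu>)\<^sup>2 + 2 * c\<^sub>x\<^sup>2 * \<mu>\<^sup>2"
    proof -
      have "0 \<le> (x - 2 * (c\<^sub>x * \<mu>))\<^sup>2" by simp
      then show ?thesis by (simp add: power2_eq_square algebra_simps)
    qed
    have small: "\<bar>x - c\<^sub>x * \<mu>\<bar> \<le> 1 / (4 * N)"
    proof -
      have "\<bar>x - c\<^sub>x * \<mu>\<bar> \<le> \<bar>x\<bar> + \<bar>c\<^sub>x\<bar> * \<bar>\<mu>\<bar>" unfolding abs_mult[symmetric] by linarith
      also have "\<dots> \<le> (1 + \<bar>c\<^sub>x\<bar>) * n" using n mult_left_mono[OF n(3), of "\<bar>c\<^sub>x\<bar>"] by (simp add: distrib_right)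
      also have "\<dots> \<le> (1 + \<bar>c\<^sub>x\<bar>) * (1 / (4 * N * (1 + \<bar>c\<^sub>x\<bar>)))"
        using pn by (intro mult_left_mono) (auto simp: r_def)
      also have "\<dots> = 1 / (4 * N)"
      proof -
        have "1 + \<bar>c\<^sub>x\<bar> \<noteq> 0" by linarith
        then show ?thesis by simp
      qed
      finally show ?thesis .
    qed
    have sq: "(x - c\<^sub>x * \<mu>)\<^sup>2 \<le> 1 / (4 * N) * \<bar>x - c\<^sub>x * \<mu>\<bar>"
      using mult_right_mono[OF small, of "\<bar>x - c\<^sub>x * \<mu>\<bar>"] by (simp add: power2_eq_square)
    have MN: "M * (n\<^sup>2 + \<bar>y\<bar>) \<le> N * (x\<^sup>2 + \<mu>\<^sup>2 + 2 * \<bar>y\<bar>)"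
    proof -
      have "M * (n\<^sup>2 + \<bar>y\<bar>) \<le> M * (3 * (x\<^sup>2 + \<mu>\<^sup>2 + 2 * \<bar>y\<bar>))" using n2 M by (intro mult_left_mono) auto
      also have "\<dots> = (3 * M) * (x\<^sup>2 + \<mu>\<^sup>2 + 2 * \<bar>y\<bar>)" by simp
      also have "\<dots> \<le> N * (x\<^sup>2 + \<mu>\<^sup>2 + 2 * \<bar>y\<bar>)" unfolding N_def by (intro mult_right_mono) auto
      finally show ?thesis .
    qed
    define w where "w = \<mu>\<^sup>2 + \<bar>y\<bar>"
    have x2': "x\<^sup>2 \<le> 1 / (2 * N) * \<bar>x - c\<^sub>x * \<mu>\<bar> + 2 * c\<^sub>x\<^sup>2 * \<mu>\<^sup>2"
      using x2 sq by simp
    \<comment> \<open>The error of x reappears on the right with factor 1/2 only, and is absorbed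
      into the left-hand side.\<close>
    have "\<bar>x - c\<^sub>x * \<mu>\<bar> \<le> N * (1 / (2 * N) * \<bar>x - c\<^sub>x * \<mu>\<bar> + 2 * c\<^sub>x\<^sup>2 * \<mu>\<^sup>2 + \<mu>\<^sup>2 + 2 * \<bar>y\<bar>)"
    proof -
      have "N * (x\<^sup>2 + \<mu>\<^sup>2 + 2 * \<bar>y\<bar>) \<le> N * (1 / (2 * N) * \<bar>x - c\<^sub>x * \<mu>\<bar> + 2 * c\<^sub>x\<^sup>2 * \<mu>\<^sup>2 + \<mu>\<^sup>2 + 2 * \<bar>y\<bar>)"
        using x2' N by (intro mult_left_mono) auto
      then show ?thesis using x1 MN by linarith
    qed
    also have "\<dots> = \<bar>x - c\<^sub>x * \<mu>\<bar> / 2 + N * (c * \<mu>\<^sup>2 + 2 * \<bar>y\<bar>)"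
      using N by (simp add: c_def field_simps)
    finally have "\<bar>x - c\<^sub>x * \<mu>\<bar> \<le> 2 * N * (c * \<mu>\<^sup>2 + 2 * \<bar>y\<bar>)" by simp
    also have "\<dots> \<le> 2 * N * (2 * c * w)"
    proof -
      have "0 \<le> c * \<mu>\<^sup>2" "\<bar>y\<bar> \<le> c * \<bar>y\<bar>" using c mult_right_mono[OF c, of "\<bar>y\<bar>"] by auto
      then have "c * \<mu>\<^sup>2 + 2 * \<bar>y\<bar> \<le> 2 * c * w"
        unfolding w_def distrib_left by linarith
      then show ?thesis using N by (intro mult_left_mono) auto
    qed
    finally have X: "\<bar>x - c\<^sub>x * \<mu>\<bar> \<le> 4 * N * c * w" by simp
    show "\<bar>x - c\<^sub>x * \<mu>\<bar> \<le> K * (\<mu>\<^sup>2 + \<bar>y\<bar>) \<and> \<bar>C ?p - D ?p - lam * \<mu>\<bar> \<le> K * (\<mu>\<^sup>2 + \<bar>y\<bar>)"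
    proof
      have w0: "w \<ge> 0" by (simp add: w_def)
      have "4 * N * c * w \<le> K * w"
        using w0 N c L by (intro mult_right_mono) (auto simp: K_def)
      then show "\<bar>x - c\<^sub>x * \<mu>\<bar> \<le> K * (\<mu>\<^sup>2 + \<bar>y\<bar>)" using X by (simp add: w_def)
      have "1 / (2 * N) * \<bar>x - c\<^sub>x * \<mu>\<bar> \<le> 1 / (2 * N) * (4 * N * c * w)"
        using X N by (intro mult_left_mono) auto
      also have "\<dots> = 2 * c * w" using N by (simp add: field_simps)
      finally have "x\<^sup>2 \<le> 2 * c * w + 2 * c\<^sub>x\<^sup>2 * \<mu>\<^sup>2" using x2' by linarith
      moreover have "2 * c\<^sub>x\<^sup>2 * \<mu>\<^sup>2 \<le> c * w" unfolding w_def c_def by (intro mult_mono) auto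
      ultimately have "x\<^sup>2 \<le> 3 * c * w" by linarith
      moreover have "w \<le> c * w" using mult_right_mono[OF c w0] by simp
      moreover have "\<bar>y\<bar> \<le> w" "n\<^sup>2 \<le> 3 * x\<^sup>2 + 3 * w" using n2 by (auto simp: w_def)
      ultimately have n3: "n\<^sup>2 + \<bar>y\<bar> \<le> 13 * c * w" by linarith
      \<comment> \<open>The linear part of C - D is (1 + \<beta>) x - \<beta> \<mu>, which becomes
        \<open>lam * \<mu>\<close> at x = \<open>c\<^sub>x * \<mu>\<close>.\<close>
      have "C ?p - D ?p - lam * \<mu> = (C ?p - x) - (D ?p + \<beta> * (x - \<mu>)) + (1 + \<beta>) * (x - c\<^sub>x * \<mu>)"
        unfolding lam(2)[symmetric] by (simp add: algebra_simps)
      then have "\<bar>C ?p - D ?p - lam * \<mu>\<bar> \<le> \<bar>C ?p - x\<bar> + \<bar>D ?p + \<beta> * (x - \<mu>)\<bar> + \<bar>1 + \<beta>\<bar> * \<bar>x - c\<^sub>x * \<mu>\<bar>"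
        unfolding abs_mult[symmetric] by linarith
      also have "\<dots> \<le> L * (13 * c * w) + L * (13 * c * w) + \<bar>1 + \<beta>\<bar> * (4 * N * c * w)"
        using C D X L n3 by (intro add_mono mult_left_mono order_trans[OF C] order_trans[OF D]) auto
      also have "\<dots> = (\<bar>1 + \<beta>\<bar> * (4 * N * c) + 2 * L * (13 * c)) * w" by (simp add: algebra_simps)
      also have "\<dots> \<le> K * w" using w0 N c by (intro mult_right_mono) (auto simp: K_def)
      finally show "\<bar>C ?p - D ?p - lam * \<mu>\<bar> \<le> K * (\<mu>\<^sup>2 + \<bar>y\<bar>)" by (simp add: w_def)
    qed
  qed
qed

section \<open>The equilibrium equations as functions of (x, v, \<epsilon>, \<mu>)\<close>

lemma mix_has_derivative:
  assumes "Ck_on \<infinity> U f" "Ck_on \<infinity> U g" "(x z, y z, m z) \<in> U"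
    and "(x has_derivative x') (at z within S)" "(y has_derivative y') (at z within S)"
    and "(m has_derivative m') (at z within S)" "(v has_derivative v') (at z within S)"
  shows "((\<lambda>t. mix f g (v t) (x t, y t, m t)) has_derivative
     (\<lambda>a. x' a * mix (px f) (px g) (v z) (x z, y z, m z) + y' a * mix (py f) (py g) (v z) (x z, y z, m z)
        + m' a * mix (pm f) (pm g) (v z) (x z, y z, m z)
        + v' a * (d1 (v z) * (f (x z, y z, m z) - g (x z, y z, m z))))) (at z within S)"
proof -
  have p: "((\<lambda>t. \<phi> (v t)) has_derivative (\<lambda>a. d1 (v z) * v' a)) (at z within S)"
    by (rule has_derivative_compose[OF assms(7) phi_derivs(1)[unfolded has_field_derivative_def]])
  note fg = has_derivative_smooth_compose[OF assms(1,3-6)] has_derivative_smooth_compose[OF assms(2,3-6)]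
  show ?thesis
    unfolding mix_def
    by (rule has_derivative_eq_rhs[OF has_derivative_add[OF
            has_derivative_mult[OF has_derivative_add[OF has_derivative_const p] fg(1)]
            has_derivative_mult[OF has_derivative_diff[OF has_derivative_const p] fg(2)]]])
      (simp add: algebra_simps)
qed

lemma mix_has_real_derivative:
  assumes "Ck_on \<infinity> U f" "Ck_on \<infinity> U g" "(x z, y z, m z) \<in> U"
    and "(x has_real_derivative x') (at z within S)" "(y has_real_derivative y') (at z within S)"
    and "(m has_real_derivative m') (at z within S)" "(v has_real_derivative v') (at z within S)"
  shows "((\<lambda>t. mix f g (v t) (x t, y t, m t)) has_real_derivative
     (x' * mix (px f) (px g) (v z) (x z, y z, m z) + y' * mix (py f) (py g) (v z) (x z, y z, m z)
        + m' * mix (pm f) (pm g) (v z) (x z, y z, m z)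
        + v' * (d1 (v z) * (f (x z, y z, m z) - g (x z, y z, m z))))) (at z within S)"
  using mix_has_derivative[OF assms(1-3) assms(4-7)[unfolded has_field_derivative_def]]
  unfolding has_field_derivative_def
  by (rule has_derivative_eq_rhs) (auto simp: algebra_simps)

lemma continuous_on_smooth_compose:
  assumes "Ck_on \<infinity> U f" "continuous_on T x" "continuous_on T y" "continuous_on T m"
    and "\<And>t. t \<in> T \<Longrightarrow> (x t, y t, m t) \<in> U"
  shows "continuous_on T (\<lambda>t. f (x t, y t, m t))"
  by (rule continuous_on_compose2[OF smooth_imp_continuous_on[OF assms(1)]])
    (use assms in \<open>auto intro!: continuous_on_Pair\<close>)

lemma continuous_on_phi: "continuous_on T \<phi>" "continuous_on T d1"
  using phi_cont by (auto intro: continuous_at_imp_continuous_on)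

lemma continuous_on_mix:
  assumes "Ck_on \<infinity> U f" "Ck_on \<infinity> U g" "continuous_on T x" "continuous_on T y" "continuous_on T m"
    and "\<And>t. t \<in> T \<Longrightarrow> (x t, y t, m t) \<in> U" "continuous_on T v"
  shows "continuous_on T (\<lambda>t. mix f g (v t) (x t, y t, m t))"
  unfolding mix_def
  by (intro continuous_intros continuous_on_smooth_compose[OF assms(1,3-6)]
      continuous_on_smooth_compose[OF assms(2,3-6)] continuous_on_compose2[OF continuous_on_phi(1) assms(7)])
    auto

text \<open>The differential of a mixture at (x, e v, m) as a function of (x, v, e, m), applied to
  (a, b, c, d). Since y = e v is substituted, nothing is divided by e, and e = 0 is an ordinary
  point.\<close>

definition grad where
  "grad f g = (\<lambda>(x, v, e, m) (a, b, c, d).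
     a * mix (px f) (px g) v (x, e * v, m)
     + b * (e * mix (py f) (py g) v (x, e * v, m) + d1 v * (f (x, e * v, m) - g (x, e * v, m)))
     + c * (v * mix (py f) (py g) v (x, e * v, m))
     + d * mix (pm f) (pm g) v (x, e * v, m))"

lemma grad_has_derivative:
  assumes "Ck_on \<infinity> U f" "Ck_on \<infinity> U g" "(x, e * v, m) \<in> U"
  shows "((\<lambda>(x, v, e, m). mix f g v (x, e * v, m)) has_derivative grad f g (x, v, e, m)) (at (x, v, e, m))"
proof -
  have 1: "((\<lambda>q. fst q) has_derivative (\<lambda>q. fst q)) (at (x, v, e, m))"
    by (auto intro!: derivative_eq_intros)
  have 2: "((\<lambda>q. fst (snd (snd q)) * fst (snd q)) has_derivative (\<lambda>q. fst (snd (snd q)) * v + e * fst (snd q))) (at (x, v, e, m))"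
    by (auto intro!: derivative_eq_intros)
  have 3: "((\<lambda>q. snd (snd (snd q))) has_derivative (\<lambda>q. snd (snd (snd q)))) (at (x, v, e, m))"
    by (auto intro!: derivative_eq_intros)
  have 4: "((\<lambda>q. fst (snd q)) has_derivative (\<lambda>q. fst (snd q))) (at (x, v, e, m))"
    by (auto intro!: derivative_eq_intros)
  have e: "(\<lambda>(x, v, e, m). mix f g v (x, e * v, m))
    = (\<lambda>q. mix f g (fst (snd q)) (fst q, fst (snd (snd q)) * fst (snd q), snd (snd (snd q))))"
    by auto
  show ?thesis
    unfolding e
    by (rule has_derivative_eq_rhs[OF mix_has_derivative[OF assms(1,2) _ 1 2 3 4]])
      (use assms(3) in \<open>auto simp: grad_def algebra_simps\<close>)
qed

lemma grad_continuous:
  assumes "Ck_on \<infinity> U f" "Ck_on \<infinity> U g"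
  shows "continuous_on {(x, v, e, m). (x, e * v, m) \<in> U} (\<lambda>q. grad f g q w)"
proof -
  obtain a b c d where w: "w = (a, b, c, d)" by (cases w)
  have e: "(\<lambda>q. grad f g q w) = (\<lambda>q. a * mix (px f) (px g) (fst (snd q)) (fst q, fst (snd (snd q)) * fst (snd q), snd (snd (snd q)))
     + b * (fst (snd (snd q)) * mix (py f) (py g) (fst (snd q)) (fst q, fst (snd (snd q)) * fst (snd q), snd (snd (snd q)))
         + d1 (fst (snd q)) * (f (fst q, fst (snd (snd q)) * fst (snd q), snd (snd (snd q)))
              - g (fst q, fst (snd (snd q)) * fst (snd q), snd (snd (snd q)))))
     + c * (fst (snd q) * mix (py f) (py g) (fst (snd q)) (fst q, fst (snd (snd q)) * fst (snd q), snd (snd (snd q))))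
     + d * mix (pm f) (pm g) (fst (snd q)) (fst q, fst (snd (snd q)) * fst (snd q), snd (snd (snd q))))"
    by (auto simp: w grad_def)
  note sm = assms smooth_partial[OF assms(1)] smooth_partial[OF assms(2)]
  show ?thesis
    unfolding e
    by (intro continuous_on_add continuous_on_mult continuous_on_diff continuous_on_const
        continuous_on_mix sm continuous_on_smooth_compose[OF assms(1)] continuous_on_smooth_compose[OF assms(2)]
        continuous_on_compose2[OF continuous_on_phi(2)])
      (auto intro!: continuous_intros)
qed

definition "W = {(x, v, e, m). (x, e * v, m) \<in> U}"

text \<open>Carrying the parameters along turns the implicit problem into an inversion: the
  equilibrium is the preimage of (0, 0, \<epsilon>, \<mu>).\<close>

definition "G = (\<lambda>(x, v, e, m). (mix A B v (x, e * v, m), mix C D v (x, e * v, m), e :: real, m :: real))"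

definition "G' q = (\<lambda>w. (grad A B q w, grad C D q w, fst (snd (snd w)), snd (snd (snd w))))"

lemma openW: "open W"
proof -
  have "open ((\<lambda>q::real \<times> real \<times> real \<times> real. (fst q, fst (snd (snd q)) * fst (snd q), snd (snd (snd q)))) -` U)"
    by (rule open_vimage[OF openU]) (intro continuous_intros)
  moreover have "W = (\<lambda>q. (fst q, fst (snd (snd q)) * fst (snd q), snd (snd (snd q)))) -` U"
    by (auto simp: W_def)
  ultimately show ?thesis by simp
qed

lemma G_has_derivative:
  assumes "q \<in> W"
  shows "(G has_derivative G' q) (at q)"
proof -
  obtain x v e m where q: "q = (x, v, e, m)" by (cases q)
  have p: "(x, e * v, m) \<in> U" using assms by (simp add: W_def q)
  have e: "G = (\<lambda>q. ((\<lambda>(x, v, e, m). mix A B v (x, e * v, m)) q, (\<lambda>(x, v, e, m). mix C D v (x, e * v, m)) q,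
     fst (snd (snd q)), snd (snd (snd q))))"
    by (auto simp: G_def)
  show ?thesis
    unfolding e q G'_def[abs_def]
    by (intro has_derivative_Pair grad_has_derivative smooth p has_derivative_fst has_derivative_snd has_derivative_ident)
qed

end

text \<open>The parameter \<epsilon> takes both signs, so limits at the origin can be taken in a
  full neighbourhood in (\<epsilon>, \<mu>). Differentiability is assumed only in \<mu>, the
  bifurcation parameter.\<close>

locale branch = pws +
  fixes e\<^sub>0 and x v :: "real \<Rightarrow> real \<Rightarrow> real"
  assumes e0: "e\<^sub>0 > 0"
    and equi: "\<And>\<epsilon> \<mu>. \<bar>\<epsilon>\<bar> < e\<^sub>0 \<Longrightarrow> \<bar>\<mu>\<bar> < e\<^sub>0 \<Longrightarrow> (x \<epsilon> \<mu>, \<epsilon> * v \<epsilon> \<mu>, \<mu>) \<in> U \<and>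
        mix A B (v \<epsilon> \<mu>) (x \<epsilon> \<mu>, \<epsilon> * v \<epsilon> \<mu>, \<mu>) = 0 \<and> mix C D (v \<epsilon> \<mu>) (x \<epsilon> \<mu>, \<epsilon> * v \<epsilon> \<mu>, \<mu>) = 0"
    and derivs: "\<And>\<epsilon> \<mu>. \<bar>\<epsilon>\<bar> < e\<^sub>0 \<Longrightarrow> \<bar>\<mu>\<bar> < e\<^sub>0 \<Longrightarrow>
        (x \<epsilon> has_real_derivative deriv (x \<epsilon>) \<mu>) (at \<mu>) \<and> (v \<epsilon> has_real_derivative deriv (v \<epsilon>) \<mu>) (at \<mu>)"
    and branch_cont: "\<And>h. h > 0 \<Longrightarrow> \<exists>d>0. \<forall>\<epsilon> \<mu>. \<bar>\<epsilon>\<bar> < d \<longrightarrow> \<bar>\<mu>\<bar> < d \<longrightarrow> \<bar>x \<epsilon> \<mu>\<bar> < h \<and> \<bar>v \<epsilon> \<mu> - vs\<bar> < h"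
    and unique: "\<exists>h>0. \<forall>\<epsilon> \<mu> x\<^sub>1 v\<^sub>1. \<bar>\<epsilon>\<bar> < h \<longrightarrow> \<bar>\<mu>\<bar> < h \<longrightarrow> \<bar>x\<^sub>1\<bar> < h \<longrightarrow> \<bar>v\<^sub>1 - vs\<bar> < h \<longrightarrow>
        mix A B v\<^sub>1 (x\<^sub>1, \<epsilon> * v\<^sub>1, \<mu>) = 0 \<longrightarrow> mix C D v\<^sub>1 (x\<^sub>1, \<epsilon> * v\<^sub>1, \<mu>) = 0 \<longrightarrow> x\<^sub>1 = x \<epsilon> \<mu> \<and> v\<^sub>1 = v \<epsilon> \<mu>"

lemma (in pws) equilibrium_branch:
  obtains e\<^sub>0 x v where "branch \<alpha> \<beta> \<delta> \<zeta>p \<zeta>m \<eta>p \<eta>m \<chi>p \<chi>m A B C D U \<phi> k e\<^sub>0 x v"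
proof -
  let ?q0 = "(0, vs, 0, 0) :: real \<times> real \<times> real \<times> real"
  have z: "(0, 0, 0) = (0 :: real \<times> real \<times> real)" by (simp add: zero_prod_def)
  have q0: "?q0 \<in> W" using zeroU by (simp add: W_def z)
  define L where "L q = Blinfun (G' q)" for q
  have La: "blinfun_apply (L q) = G' q" if "q \<in> W" for q
    unfolding L_def by (rule bounded_linear_Blinfun_apply[OF has_derivative_bounded_linear[OF G_has_derivative[OF that]]])
  have contL: "continuous_on W L"
  proof (rule continuous_on_blinfun_componentwise)
    fix i :: "real \<times> real \<times> real \<times> real"
    have "continuous_on W (\<lambda>q. G' q i)"
      unfolding G'_def W_def by (intro continuous_on_Pair grad_continuous smooth continuous_on_const)
    then show "continuous_on W (\<lambda>q. blinfun_apply (L q) i)"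
      by (rule continuous_on_eq) (simp add: La)
  qed
  define a1 where "a1 = mix (px A) (px B) vs 0"
  define b1 where "b1 = d1 vs * (\<delta> - \<alpha>)"
  define c1 where "c1 = vs * mix (py A) (py B) vs 0"
  define m1 where "m1 = mix (pm A) (pm B) vs 0"
  define a2 where "a2 = mix (px C) (px D) vs 0"
  define c2 where "c2 = vs * mix (py C) (py D) vs 0"
  define m2 where "m2 = mix (pm C) (pm D) vs 0"
  have G'0: "G' ?q0 (a, b, c, d) = (a * a1 + b * b1 + c * c1 + d * m1, a * a2 + c * c2 + d * m2, c, d)" for a b c d
    by (simp add: G'_def grad_def z a1_def b1_def c1_def m1_def a2_def c2_def m2_def A0 B0 C0 D0)
  have b1: "b1 \<noteq> 0" using d1_vs alpha_delta by (simp add: b1_def)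
  have a2: "a2 \<noteq> 0"
  proof -
    have "a2 = 2 / (\<alpha> - \<delta>) * \<Omega>"
      by (simp add: a2_def mix_def C0 D0 vs kappa add_divide_distrib algebra_simps)
    then show ?thesis using Om alpha_delta by simp
  qed
  \<comment> \<open>The linearized system is triangular: C - D vanishes at the origin, so the second
    equation is free of b and gives a, and the first one then gives b.\<close>
  define I where "I = (\<lambda>(f, g, c, d). ((g - c * c2 - d * m2) / a2, (f - ((g - c * c2 - d * m2) / a2) * a1 - c * c1 - d * m1) / b1, c :: real, d :: real))"
  have Ie: "I = (\<lambda>w. ((fst (snd w) - fst (snd (snd w)) * c2 - snd (snd (snd w)) * m2) / a2,
     (fst w - ((fst (snd w) - fst (snd (snd w)) * c2 - snd (snd (snd w)) * m2) / a2) * a1 - fst (snd (snd w)) * c1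
        - snd (snd (snd w)) * m1) / b1, fst (snd (snd w)), snd (snd (snd w))))"
    by (auto simp: I_def)
  \<comment> \<open>A derivative is bounded linear, which is all that is wanted of I here.\<close>
  have "(I has_derivative I) (at 0)"
    unfolding Ie using a2 b1 by (auto intro!: derivative_eq_intros)
  then have blI: "bounded_linear I" by (rule has_derivative_bounded_linear)
  have inv: "Blinfun I o\<^sub>L L ?q0 = id_blinfun"
  proof (rule blinfun_eqI)
    fix w :: "real \<times> real \<times> real \<times> real"
    obtain a b c d where w: "w = (a, b, c, d)" by (cases w)
    show "blinfun_apply (Blinfun I o\<^sub>L L ?q0) w = blinfun_apply id_blinfun w"
      using a2 b1 by (simp add: bounded_linear_Blinfun_apply[OF blI] La[OF q0] w G'0) (simp add: I_def)
  qed
  have der: "(G has_derivative blinfun_apply (L q)) (at q)" if "q \<in> W" for q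
    using G_has_derivative[OF that] La[OF that] by simp
  have ift: "\<exists>U' V g. open U' \<and> U' \<subseteq> W \<and> ?q0 \<in> U' \<and> open V \<and> G ?q0 \<in> V \<and> homeomorphism U' V G g \<and>
      (\<forall>y\<in>V. g differentiable (at y))"
    by (rule local_inverse[OF openW _ contL q0 inv]) (rule der)
  then obtain U' V g where U': "open U'" "U' \<subseteq> W" "?q0 \<in> U'" and V: "open V" "G ?q0 \<in> V" and hom: "homeomorphism U' V G g"
    and gdiff: "\<forall>y\<in>V. g differentiable (at y)"
    by (elim exE conjE)
  define g' where "g' y = frechet_derivative g (at y)" for y
  have gd: "(g has_derivative (g' y)) (at y)" if "y \<in> V" for y
    unfolding g'_def frechet_derivative_works[symmetric] by (rule bspec[OF gdiff that])
  have G0: "G ?q0 = 0"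
  proof -
    have "G ?q0 = (mix A B vs 0, mix C D vs 0, 0, 0)" by (simp add: G_def z)
    moreover have "mix C D vs 0 = 0" by (simp add: mix_def C0 D0)
    ultimately show ?thesis by (simp only: mix_vs_A) (simp only: zero_prod_def)
  qed
  have gG: "g (G q) = q" if "q \<in> U'" for q using hom that by (simp add: homeomorphism_def)
  have Gg: "G (g y) = y" "g y \<in> U'" if "y \<in> V" for y using hom that by (auto simp: homeomorphism_def)
  obtain r where r: "r > 0" "ball 0 r \<subseteq> V" using V G0 openE by metis
  define e\<^sub>0 where "e\<^sub>0 = r / 2"
  have inV: "(0, 0, \<epsilon>, \<mu>) \<in> V" if "\<bar>\<epsilon>\<bar> < e\<^sub>0" "\<bar>\<mu>\<bar> < e\<^sub>0" for \<epsilon> \<mu>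
  proof -
    have "norm ((0::real), (0::real), \<epsilon>, \<mu>) \<le> \<bar>\<epsilon>\<bar> + \<bar>\<mu>\<bar>"
      using norm_Pair_le[of \<epsilon> \<mu>] by (simp add: norm_Pair)
    then show ?thesis using that r by (auto simp: e\<^sub>0_def)
  qed
  define x where "x \<epsilon> \<mu> = fst (g (0, 0, \<epsilon>, \<mu>))" for \<epsilon> \<mu>
  define v where "v \<epsilon> \<mu> = fst (snd (g (0, 0, \<epsilon>, \<mu>)))" for \<epsilon> \<mu>
  have gxv: "g (0, 0, \<epsilon>, \<mu>) = (x \<epsilon> \<mu>, v \<epsilon> \<mu>, \<epsilon>, \<mu>)" if "\<bar>\<epsilon>\<bar> < e\<^sub>0" "\<bar>\<mu>\<bar> < e\<^sub>0" for \<epsilon> \<mu>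
    using Gg(1)[OF inV[OF that]] by (cases "g (0, 0, \<epsilon>, \<mu>)") (auto simp: x_def v_def G_def)
  show ?thesis
  proof (rule that[of e\<^sub>0 x v], rule branch.intro[OF pws_axioms branch_axioms.intro])
    show "e\<^sub>0 > 0" using r by (simp add: e\<^sub>0_def)
    show "(x \<epsilon> \<mu>, \<epsilon> * v \<epsilon> \<mu>, \<mu>) \<in> U \<and>
        mix A B (v \<epsilon> \<mu>) (x \<epsilon> \<mu>, \<epsilon> * v \<epsilon> \<mu>, \<mu>) = 0 \<and> mix C D (v \<epsilon> \<mu>) (x \<epsilon> \<mu>, \<epsilon> * v \<epsilon> \<mu>, \<mu>) = 0"
      if "\<bar>\<epsilon>\<bar> < e\<^sub>0" "\<bar>\<mu>\<bar> < e\<^sub>0" for \<epsilon> \<mu>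
      using Gg[OF inV[OF that]] U'(2) unfolding gxv[OF that] by (auto simp: G_def W_def)
    show "(x \<epsilon> has_real_derivative deriv (x \<epsilon>) \<mu>) (at \<mu>) \<and> (v \<epsilon> has_real_derivative deriv (v \<epsilon>) \<mu>) (at \<mu>)"
      if "\<bar>\<epsilon>\<bar> < e\<^sub>0" "\<bar>\<mu>\<bar> < e\<^sub>0" for \<epsilon> \<mu>
    proof -
      have "((\<lambda>t. (0, 0, \<epsilon>, t)) has_derivative (\<lambda>t. (0, 0, 0, t))) (at \<mu>)"
        by (auto intro!: derivative_eq_intros)
      from has_derivative_compose[OF this gd[OF inV[OF that]]]
      have d: "((\<lambda>t. g (0, 0, \<epsilon>, t)) has_derivative (\<lambda>t. g' (0, 0, \<epsilon>, \<mu>) (0, 0, 0, t))) (at \<mu>)" .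
      have "x \<epsilon> differentiable (at \<mu>)" "v \<epsilon> differentiable (at \<mu>)"
        using has_derivative_fst[OF d] has_derivative_fst[OF has_derivative_snd[OF d]]
        unfolding x_def[abs_def] v_def[abs_def] differentiable_def by blast+
      then show ?thesis by (simp add: DERIV_deriv_iff_real_differentiable)
    qed
    show "\<exists>d>0. \<forall>\<epsilon> \<mu>. \<bar>\<epsilon>\<bar> < d \<longrightarrow> \<bar>\<mu>\<bar> < d \<longrightarrow> \<bar>x \<epsilon> \<mu>\<bar> < h \<and> \<bar>v \<epsilon> \<mu> - vs\<bar> < h" if hp: "h > 0" for h
    proof -
      have "0 \<in> V" using V G0 by simp
      then have "isCont g 0" using gd has_derivative_continuous by blast
      moreover have "g 0 = ?q0" using gG[OF U'(3)] G0 by simp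
      ultimately obtain d where d: "d > 0" "\<And>y. dist y 0 < d \<Longrightarrow> dist (g y) ?q0 < h"
        using hp unfolding continuous_at_eps_delta by metis
      have "\<bar>x \<epsilon> \<mu>\<bar> < h \<and> \<bar>v \<epsilon> \<mu> - vs\<bar> < h" if "\<bar>\<epsilon>\<bar> < d / 2" "\<bar>\<mu>\<bar> < d / 2" for \<epsilon> \<mu>
      proof -
        have "norm ((0::real), (0::real), \<epsilon>, \<mu>) \<le> \<bar>\<epsilon>\<bar> + \<bar>\<mu>\<bar>"
          using norm_Pair_le[of \<epsilon> \<mu>] by (simp add: norm_Pair)
        then have "dist (g (0, 0, \<epsilon>, \<mu>)) ?q0 < h" using d(2)[of "(0, 0, \<epsilon>, \<mu>)"] that by simp
        then show ?thesis
          using dist_fst_le[of "g (0, 0, \<epsilon>, \<mu>)" ?q0] dist_snd_le[of "g (0, 0, \<epsilon>, \<mu>)" ?q0]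
            dist_fst_le[of "snd (g (0, 0, \<epsilon>, \<mu>))" "snd ?q0"]
          by (simp add: x_def v_def dist_real_def)
      qed
      then show ?thesis using d(1) by (intro exI[of _ "d / 2"]) auto
    qed
    \<comment> \<open>On U' the map has a left inverse, so solutions with equal parameters coincide;
      each of the four coordinates may deviate by h/4.\<close>
    obtain h where h: "h > 0" "ball ?q0 h \<subseteq> U'" using U' openE by metis
    have "x\<^sub>1 = x \<epsilon> \<mu> \<and> v\<^sub>1 = v \<epsilon> \<mu>"
      if "\<bar>\<epsilon>\<bar> < h / 4" "\<bar>\<mu>\<bar> < h / 4" "\<bar>x\<^sub>1\<bar> < h / 4" "\<bar>v\<^sub>1 - vs\<bar> < h / 4"
        "mix A B v\<^sub>1 (x\<^sub>1, \<epsilon> * v\<^sub>1, \<mu>) = 0" "mix C D v\<^sub>1 (x\<^sub>1, \<epsilon> * v\<^sub>1, \<mu>) = 0" for \<epsilon> \<mu> x\<^sub>1 v\<^sub>1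
    proof -
      have "norm ((x\<^sub>1, v\<^sub>1, \<epsilon>, \<mu>) - ?q0) \<le> \<bar>x\<^sub>1\<bar> + (\<bar>v\<^sub>1 - vs\<bar> + (\<bar>\<epsilon>\<bar> + \<bar>\<mu>\<bar>))"
        using norm_Pair_le[of x\<^sub>1 "(v\<^sub>1 - vs, \<epsilon>, \<mu>)"] norm_Pair_le[of "v\<^sub>1 - vs" "(\<epsilon>, \<mu>)"] norm_Pair_le[of \<epsilon> \<mu>]
        by simp
      then have "dist ?q0 (x\<^sub>1, v\<^sub>1, \<epsilon>, \<mu>) < h" using that(1-4)
        unfolding dist_norm norm_minus_commute[of ?q0] by linarith
      then have "g (G (x\<^sub>1, v\<^sub>1, \<epsilon>, \<mu>)) = (x\<^sub>1, v\<^sub>1, \<epsilon>, \<mu>)" using h by (intro gG) auto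
      then show ?thesis using that(5,6) by (simp add: G_def x_def v_def)
    qed
    then show "\<exists>h>0. \<forall>\<epsilon> \<mu> x\<^sub>1 v\<^sub>1. \<bar>\<epsilon>\<bar> < h \<longrightarrow> \<bar>\<mu>\<bar> < h \<longrightarrow> \<bar>x\<^sub>1\<bar> < h \<longrightarrow> \<bar>v\<^sub>1 - vs\<bar> < h \<longrightarrow>
        mix A B v\<^sub>1 (x\<^sub>1, \<epsilon> * v\<^sub>1, \<mu>) = 0 \<longrightarrow> mix C D v\<^sub>1 (x\<^sub>1, \<epsilon> * v\<^sub>1, \<mu>) = 0 \<longrightarrow> x\<^sub>1 = x \<epsilon> \<mu> \<and> v\<^sub>1 = v \<epsilon> \<mu>"
      using h(1) by (intro exI[of _ "h / 4"]) auto
  qed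
qed

section \<open>Hopf bifurcation\<close>

text \<open>The vector (b, l - a) is an eigenvector, and it is nonzero because b is.\<close>

lemma jacobian_eigenvalueI:
  fixes l :: complex
  assumes "dx (\<lambda>q. fst (V q)) p = a" "dy (\<lambda>q. fst (V q)) p = b" "dx (\<lambda>q. snd (V q)) p = c" "dy (\<lambda>q. snd (V q)) p = d"
    and "b \<noteq> 0" "l\<^sup>2 - of_real (a + d) * l + of_real (a * d - b * c) = 0"
  shows "jacobian_eigenvalue V p l"
proof -
  have "of_real c * of_real b + of_real d * (l - of_real a) - l * (l - of_real a)
     = - (l\<^sup>2 - of_real (a + d) * l + of_real (a * d - b * c))"
    by (simp add: power2_eq_square algebra_simps)
  then have "of_real c * of_real b + of_real d * (l - of_real a) = l * (l - of_real a)"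
    unfolding assms(6) by simp
  then show ?thesis
    unfolding jacobian_eigenvalue_def assms(1-4)
    using assms(5) by (intro exI[of _ "of_real b"] exI[of _ "l - of_real a"]) (simp add: algebra_simps)
qed

text \<open>Eliminating the eigenvector leaves the characteristic equation, whose imaginary part at
  a purely imaginary l is the trace times - Im l.\<close>

lemma jacobian_eigenvalue_imaginary:
  assumes "jacobian_eigenvalue V p l" "Re l = 0" "Im l > 0"
  shows "dx (\<lambda>q. fst (V q)) p + dy (\<lambda>q. snd (V q)) p = 0"
proof -
  let ?a = "dx (\<lambda>q. fst (V q)) p" and ?b = "dy (\<lambda>q. fst (V q)) p"
    and ?c = "dx (\<lambda>q. snd (V q)) p" and ?d = "dy (\<lambda>q. snd (V q)) p"
  obtain z w :: complex where zw: "(z, w) \<noteq> (0, 0)" and 1: "of_real ?a * z + of_real ?b * w = l * z"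
    and 2: "of_real ?c * z + of_real ?d * w = l * w"
    using assms(1) unfolding jacobian_eigenvalue_def by blast
  have e: "(l - of_real ?a) * z = of_real ?b * w" "(l - of_real ?d) * w = of_real ?c * z"
    using 1 2 by (simp_all add: algebra_simps)
  have "((l - of_real ?a) * (l - of_real ?d) - of_real ?b * of_real ?c) * z = 0"
    "((l - of_real ?a) * (l - of_real ?d) - of_real ?b * of_real ?c) * w = 0"
  proof -
    have "((l - of_real ?a) * (l - of_real ?d) - of_real ?b * of_real ?c) * z
      = (l - of_real ?d) * ((l - of_real ?a) * z - of_real ?b * w) + of_real ?b * ((l - of_real ?d) * w - of_real ?c * z)"
      by (simp add: algebra_simps)
    then show "((l - of_real ?a) * (l - of_real ?d) - of_real ?b * of_real ?c) * z = 0"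
      by (simp add: e)
    have "((l - of_real ?a) * (l - of_real ?d) - of_real ?b * of_real ?c) * w
      = (l - of_real ?a) * ((l - of_real ?d) * w - of_real ?c * z) + of_real ?c * ((l - of_real ?a) * z - of_real ?b * w)"
      by (simp add: algebra_simps)
    then show "((l - of_real ?a) * (l - of_real ?d) - of_real ?b * of_real ?c) * w = 0"
      by (simp add: e)
  qed
  then have "(l - of_real ?a) * (l - of_real ?d) - of_real ?b * of_real ?c = 0" using zw by auto
  from arg_cong[OF this, of Im] have "- (?a + ?d) * Im l = 0"
    using assms(2) by (simp add: algebra_simps)
  then show ?thesis using assms(3) by simp
qed

lemma eventually_nhds_prod_0:
  "eventually P (nhds (0::real) \<times>\<^sub>F nhds (0::real)) \<longleftrightarrow> (\<exists>d>0. \<forall>a b. \<bar>a\<bar> < d \<longrightarrow> \<bar>b\<bar> < d \<longrightarrow> P (a, b))"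
proof
  assume "eventually P (nhds 0 \<times>\<^sub>F nhds 0)"
  then obtain Pf Pg where P: "eventually Pf (nhds (0::real))" "eventually Pg (nhds (0::real))"
    "\<And>x y. Pf x \<Longrightarrow> Pg y \<Longrightarrow> P (x, y)"
    unfolding eventually_prod_filter by blast
  obtain d1 d2 where d: "d1 > 0" "\<And>x. dist x 0 < d1 \<Longrightarrow> Pf x" "d2 > 0" "\<And>x. dist x 0 < d2 \<Longrightarrow> Pg x"
    using P(1,2) unfolding eventually_nhds_metric by blast
  show "\<exists>d>0. \<forall>a b. \<bar>a\<bar> < d \<longrightarrow> \<bar>b\<bar> < d \<longrightarrow> P (a, b)"
    using d P(3) by (intro exI[of _ "min d1 d2"]) simp
next
  assume "\<exists>d>0. \<forall>a b. \<bar>a\<bar> < d \<longrightarrow> \<bar>b\<bar> < d \<longrightarrow> P (a, b)"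
  then obtain d where d: "d > 0" "\<And>a b. \<bar>a\<bar> < d \<Longrightarrow> \<bar>b\<bar> < d \<Longrightarrow> P (a, b)" by blast
  have "eventually (\<lambda>a::real. \<bar>a\<bar> < d) (nhds 0)"
    unfolding eventually_nhds_metric using d(1) by auto
  then show "eventually P (nhds 0 \<times>\<^sub>F nhds 0)"
    unfolding eventually_prod_filter using d(2) by blast
qed

context pws
begin

text \<open>Together with the next three, the Jacobian of twice the regularized field. The quotients
  by \<epsilon> come from differentiating \<phi>(y/\<epsilon>) in y.\<close>

definition "J11 v p = mix (px A) (px B) v p"
definition "J12 \<epsilon> v p = mix (py A) (py B) v p + d1 v * (A p - B p) / \<epsilon>"
definition "J21 v p = mix (px C) (px D) v p"
definition "J22 \<epsilon> v p = mix (py C) (py D) v p + d1 v * (C p - D p) / \<epsilon>"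

lemma jacobian_entries:
  assumes "(x, y, \<mu>) \<in> U"
  shows "dx (\<lambda>q. fst (regularized_field Xp Xm \<phi> \<epsilon> \<mu> q)) (x, y) = J11 (y / \<epsilon>) (x, y, \<mu>) / 2"
    "dy (\<lambda>q. fst (regularized_field Xp Xm \<phi> \<epsilon> \<mu> q)) (x, y) = J12 \<epsilon> (y / \<epsilon>) (x, y, \<mu>) / 2"
    "dx (\<lambda>q. snd (regularized_field Xp Xm \<phi> \<epsilon> \<mu> q)) (x, y) = J21 (y / \<epsilon>) (x, y, \<mu>) / 2"
    "dy (\<lambda>q. snd (regularized_field Xp Xm \<phi> \<epsilon> \<mu> q)) (x, y) = J22 \<epsilon> (y / \<epsilon>) (x, y, \<mu>) / 2"
proof -
  have 1: "deriv (\<lambda>t. mix f g (y / \<epsilon>) (t, y, \<mu>) / 2) x = mix (px f) (px g) (y / \<epsilon>) (x, y, \<mu>) / 2"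
    if "Ck_on \<infinity> U f" "Ck_on \<infinity> U g" for f g
    by (rule DERIV_imp_deriv[OF DERIV_cdivide])
      (rule DERIV_cong[OF mix_has_real_derivative[OF that assms DERIV_ident DERIV_const DERIV_const DERIV_const]], simp)
  have 2: "deriv (\<lambda>t. mix f g (t / \<epsilon>) (x, t, \<mu>) / 2) y
      = (mix (py f) (py g) (y / \<epsilon>) (x, y, \<mu>) + d1 (y / \<epsilon>) * (f (x, y, \<mu>) - g (x, y, \<mu>)) / \<epsilon>) / 2"
    if "Ck_on \<infinity> U f" "Ck_on \<infinity> U g" for f g
    by (rule DERIV_imp_deriv[OF DERIV_cdivide])
      (rule DERIV_cong[OF mix_has_real_derivative[OF that assms DERIV_const DERIV_ident DERIV_const DERIV_cdivide[OF DERIV_ident]]], simp)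
  show "dx (\<lambda>q. fst (regularized_field Xp Xm \<phi> \<epsilon> \<mu> q)) (x, y) = J11 (y / \<epsilon>) (x, y, \<mu>) / 2"
    "dy (\<lambda>q. fst (regularized_field Xp Xm \<phi> \<epsilon> \<mu> q)) (x, y) = J12 \<epsilon> (y / \<epsilon>) (x, y, \<mu>) / 2"
    "dx (\<lambda>q. snd (regularized_field Xp Xm \<phi> \<epsilon> \<mu> q)) (x, y) = J21 (y / \<epsilon>) (x, y, \<mu>) / 2"
    "dy (\<lambda>q. snd (regularized_field Xp Xm \<phi> \<epsilon> \<mu> q)) (x, y) = J22 \<epsilon> (y / \<epsilon>) (x, y, \<mu>) / 2"
    by (simp_all add: dx_def dy_def regularized_field_eq 1 2 smooth J11_def J12_def J21_def J22_def)
qed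

lemma mix_C_x: "mix (px C) (px D) vs 0 = 2 * \<Omega> / (\<alpha> - \<delta>)"
  by (simp add: mix_def C0 D0 vs kappa add_divide_distrib algebra_simps)

lemma mix_C_m: "mix (pm C) (pm D) vs 0 = - 2 * \<delta> / (\<alpha> - \<delta>) * \<beta>"
  by (simp add: mix_def C0 D0 vs kappa)

lemma tendsto_smooth:
  assumes "Ck_on \<infinity> U f" "(p \<longlongrightarrow> 0) F"
  shows "((\<lambda>t. f (p t)) \<longlongrightarrow> f 0) F"
proof -
  have "isCont f 0"
    using smooth_imp_continuous_on[OF assms(1)] openU zeroU by (simp add: continuous_on_eq_continuous_at)
  then show ?thesis using assms(2) by (rule isCont_tendsto_compose)
qed

lemma tendsto_mix:
  assumes "Ck_on \<infinity> U f" "Ck_on \<infinity> U g" "(p \<longlongrightarrow> 0) F" "(v \<longlongrightarrow> vs) F"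
  shows "((\<lambda>t. mix f g (v t) (p t)) \<longlongrightarrow> mix f g vs 0) F"
  unfolding mix_def
  by (intro tendsto_intros tendsto_smooth[OF assms(1,3)] tendsto_smooth[OF assms(2,3)]
      isCont_tendsto_compose[OF phi_cont(1) assms(4)])

end

context branch
begin

definition "P = (\<lambda>(\<epsilon>, \<mu>). (x \<epsilon> \<mu>, \<epsilon> * v \<epsilon> \<mu>, \<mu>))"
definition "vv = (\<lambda>(\<epsilon>, \<mu>). v \<epsilon> \<mu>)"
definition "E \<epsilon> \<mu> = (x \<epsilon> \<mu>, \<epsilon> * v \<epsilon> \<mu>)"

abbreviation "Fz \<equiv> nhds (0::real) \<times>\<^sub>F nhds (0::real)"

lemma limits: "((\<lambda>(\<epsilon>, \<mu>). x \<epsilon> \<mu>) \<longlongrightarrow> 0) Fz" "(vv \<longlongrightarrow> vs) Fz" "(fst \<longlongrightarrow> 0) Fz" "(snd \<longlongrightarrow> 0) Fz"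
proof -
  show "((\<lambda>(\<epsilon>, \<mu>). x \<epsilon> \<mu>) \<longlongrightarrow> 0) Fz"
  proof (rule tendstoI, unfold eventually_nhds_prod_0)
    fix h :: real assume "h > 0"
    then obtain d where "d > 0" "\<forall>\<epsilon> \<mu>. \<bar>\<epsilon>\<bar> < d \<longrightarrow> \<bar>\<mu>\<bar> < d \<longrightarrow> \<bar>x \<epsilon> \<mu>\<bar> < h \<and> \<bar>v \<epsilon> \<mu> - vs\<bar> < h"
      using branch_cont by blast
    then show "\<exists>d>0. \<forall>a b. \<bar>a\<bar> < d \<longrightarrow> \<bar>b\<bar> < d \<longrightarrow> dist (case (a, b) of (\<epsilon>, \<mu>) \<Rightarrow> x \<epsilon> \<mu>) 0 < h"
      by (intro exI[of _ d]) simp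
  qed
  show "(vv \<longlongrightarrow> vs) Fz"
  proof (rule tendstoI, unfold eventually_nhds_prod_0)
    fix h :: real assume "h > 0"
    then obtain d where "d > 0" "\<forall>\<epsilon> \<mu>. \<bar>\<epsilon>\<bar> < d \<longrightarrow> \<bar>\<mu>\<bar> < d \<longrightarrow> \<bar>x \<epsilon> \<mu>\<bar> < h \<and> \<bar>v \<epsilon> \<mu> - vs\<bar> < h"
      using branch_cont by blast
    then show "\<exists>d>0. \<forall>a b. \<bar>a\<bar> < d \<longrightarrow> \<bar>b\<bar> < d \<longrightarrow> dist (vv (a, b)) vs < h"
      by (intro exI[of _ d]) (simp add: vv_def dist_real_def)
  qed
  show "(fst \<longlongrightarrow> (0::real)) Fz"
    by (rule tendstoI, unfold eventually_nhds_prod_0) (metis dist_0_norm dist_commute fst_conv real_norm_def)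
  show "(snd \<longlongrightarrow> (0::real)) Fz"
    by (rule tendstoI, unfold eventually_nhds_prod_0) (metis dist_0_norm dist_commute snd_conv real_norm_def)
qed

lemma limit_P: "(P \<longlongrightarrow> 0) Fz"
proof -
  have "((\<lambda>z. (fst (P z), fst z * vv z, snd z)) \<longlongrightarrow> (0, 0 * vs, 0)) Fz"
    using limits(2-) limits(1)[unfolded case_prod_beta']
    by (intro tendsto_Pair tendsto_mult) (simp_all add: P_def case_prod_beta')
  then show ?thesis
    by (simp add: P_def vv_def case_prod_beta' zero_prod_def)
qed

text \<open>A ball in (x, y) does not confine y/\<epsilon>, while the inverse function theorem gives
  uniqueness only for v near \<open>vs\<close>. The gap is closed by \<open>phi_estimate\<close>:
  every equilibrium in the ball already has v near \<open>vs\<close>.\<close>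

lemma equilibrium_family_branch: "equilibrium_family \<alpha> \<beta> \<delta> Xp Xm \<phi> E"
proof -
  obtain K1 r1 where 1: "K1 > 0" "r1 > 0" "ball 0 r1 \<subseteq> U"
    "\<And>p v. p \<in> ball 0 r1 \<Longrightarrow> mix A B v p = 0 \<Longrightarrow> \<bar>\<phi> v - \<kappa>\<bar> \<le> K1 * norm p \<and> \<bar>v - vs\<bar> \<le> K1 * norm p"
    using phi_estimate by blast
  obtain K2 r2 where 2: "K2 > 0" "r2 > 0" "ball 0 r2 \<subseteq> U"
    "\<And>x y \<mu> v. (x, y, \<mu>) \<in> ball 0 r2 \<Longrightarrow> mix A B v (x, y, \<mu>) = 0 \<Longrightarrow> mix C D v (x, y, \<mu>) = 0 \<Longrightarrow>
       \<bar>x - c\<^sub>x * \<mu>\<bar> \<le> K2 * (\<mu>\<^sup>2 + \<bar>y\<bar>) \<and>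
       \<bar>C (x, y, \<mu>) - D (x, y, \<mu>) - lam * \<mu>\<bar> \<le> K2 * (\<mu>\<^sup>2 + \<bar>y\<bar>)"
    using equilibrium_estimate by blast
  obtain h where h: "h > 0" "\<And>\<epsilon> \<mu> x\<^sub>1 v\<^sub>1. \<bar>\<epsilon>\<bar> < h \<Longrightarrow> \<bar>\<mu>\<bar> < h \<Longrightarrow> \<bar>x\<^sub>1\<bar> < h \<Longrightarrow> \<bar>v\<^sub>1 - vs\<bar> < h \<Longrightarrow>
        mix A B v\<^sub>1 (x\<^sub>1, \<epsilon> * v\<^sub>1, \<mu>) = 0 \<Longrightarrow> mix C D v\<^sub>1 (x\<^sub>1, \<epsilon> * v\<^sub>1, \<mu>) = 0 \<Longrightarrow> x\<^sub>1 = x \<epsilon> \<mu> \<and> v\<^sub>1 = v \<epsilon> \<mu>"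
    using unique by blast
  \<comment> \<open>Halving leaves room for \<mu>, since a point (x, y, \<mu>) may have norm up to
    2r; the entry \<open>h / K1\<close> puts v within h of \<open>vs\<close>.\<close>
  define r where "r = min (min r1 r2) (min h (h / K1)) / 2"
  have r: "r > 0" "2 * r \<le> r1" "2 * r \<le> r2" "2 * r \<le> h" "2 * r \<le> h / K1"
    using 1 2 h by (auto simp: r_def)
  obtain d where d: "d > 0" "\<And>\<epsilon> \<mu>. \<bar>\<epsilon>\<bar> < d \<Longrightarrow> \<bar>\<mu>\<bar> < d \<Longrightarrow> \<bar>x \<epsilon> \<mu>\<bar> < min (r / 4) 1 \<and> \<bar>v \<epsilon> \<mu> - vs\<bar> < min (r / 4) 1"
    using branch_cont[of "min (r / 4) 1"] r(1) by auto
  define m where "m = min (min d e\<^sub>0) (r / 4)"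
  have m: "m > 0" using d e0 r by (simp add: m_def)
  have main: "E \<epsilon> \<mu> \<in> ball 0 r \<and> regularized_field Xp Xm \<phi> \<epsilon> \<mu> (E \<epsilon> \<mu>) = 0 \<and>
        (\<forall>p\<in>ball 0 r. regularized_field Xp Xm \<phi> \<epsilon> \<mu> p = 0 \<longrightarrow> p = E \<epsilon> \<mu>) \<and>
        \<bar>fst (E \<epsilon> \<mu>) - \<beta> * \<delta> / (\<beta> * \<delta> + \<alpha>) * \<mu>\<bar> \<le> (2 * K2 + 2) * (\<mu>\<^sup>2 + \<epsilon>) \<and>
        \<bar>snd (E \<epsilon> \<mu>)\<bar> \<le> (2 * K2 + 2) * \<epsilon>"
    if e: "\<epsilon> \<in> {0<..<m}" and mu: "\<mu> \<in> {-m<..<m}" for \<epsilon> \<mu>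
  proof -
    have em: "\<bar>\<epsilon>\<bar> < d" "\<bar>\<mu>\<bar> < d" "\<bar>\<epsilon>\<bar> < e\<^sub>0" "\<bar>\<mu>\<bar> < e\<^sub>0" "\<epsilon> < r / 4" "\<bar>\<mu>\<bar> < r / 4" "\<epsilon> > 0"
      using e mu by (auto simp: m_def)
    have v2: "\<bar>v \<epsilon> \<mu>\<bar> \<le> 2" using d(2)[OF em(1,2)] vs(1) by auto
    have y2: "\<bar>\<epsilon> * v \<epsilon> \<mu>\<bar> \<le> 2 * \<epsilon>"
      using v2 em(7) by (simp add: abs_mult)
    have nE: "norm (E \<epsilon> \<mu>) < r"
      using norm_Pair_le[of "x \<epsilon> \<mu>" "\<epsilon> * v \<epsilon> \<mu>"] d(2)[OF em(1,2)] y2 em(5) r(1) by (simp add: E_def)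
    have eq: "(x \<epsilon> \<mu>, \<epsilon> * v \<epsilon> \<mu>, \<mu>) \<in> U" "mix A B (v \<epsilon> \<mu>) (x \<epsilon> \<mu>, \<epsilon> * v \<epsilon> \<mu>, \<mu>) = 0"
      "mix C D (v \<epsilon> \<mu>) (x \<epsilon> \<mu>, \<epsilon> * v \<epsilon> \<mu>, \<mu>) = 0"
      using equi[OF em(3,4)] by auto
    have n3: "norm (x\<^sub>1, y\<^sub>1, \<mu>) < 2 * r" if "norm (x\<^sub>1, y\<^sub>1) < r" for x\<^sub>1 y\<^sub>1
    proof -
      have "norm (x\<^sub>1, y\<^sub>1, \<mu>) \<le> norm (x\<^sub>1, y\<^sub>1) + \<bar>\<mu>\<bar>"
        using norm_triangle_ineq[of "(x\<^sub>1, y\<^sub>1, 0)" "(0, 0, \<mu>)"] by (simp add: norm_Pair)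
      then show ?thesis using that em(6) r(1) by simp
    qed
    have in2: "(x \<epsilon> \<mu>, \<epsilon> * v \<epsilon> \<mu>, \<mu>) \<in> ball 0 r2"
      using n3[OF nE[unfolded E_def]] r by simp
    have est: "\<bar>x \<epsilon> \<mu> - c\<^sub>x * \<mu>\<bar> \<le> K2 * (\<mu>\<^sup>2 + \<bar>\<epsilon> * v \<epsilon> \<mu>\<bar>)"
      using 2(4)[OF in2 eq(2,3)] by blast
    also have "\<dots> \<le> K2 * (2 * (\<mu>\<^sup>2 + \<epsilon>))"
    proof (rule mult_left_mono)
      show "\<mu>\<^sup>2 + \<bar>\<epsilon> * v \<epsilon> \<mu>\<bar> \<le> 2 * (\<mu>\<^sup>2 + \<epsilon>)"
      proof -
        have "a + b \<le> 2 * (a + e)" if "b \<le> 2 * e" "0 \<le> a" for a b e :: real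
          using that by simp
        from this[OF y2 zero_le_power2] show ?thesis .
      qed
    qed (use 2(1) in simp)
    also have "\<dots> = (2 * K2) * (\<mu>\<^sup>2 + \<epsilon>)" by simp
    also have "\<dots> \<le> (2 * K2 + 2) * (\<mu>\<^sup>2 + \<epsilon>)"
      using em(7) by (intro mult_right_mono) auto
    finally have e1: "\<bar>x \<epsilon> \<mu> - c\<^sub>x * \<mu>\<bar> \<le> (2 * K2 + 2) * (\<mu>\<^sup>2 + \<epsilon>)" .
    have e2: "\<bar>\<epsilon> * v \<epsilon> \<mu>\<bar> \<le> (2 * K2 + 2) * \<epsilon>"
    proof -
      have "2 * \<epsilon> \<le> (2 * K2 + 2) * \<epsilon>" using 2(1) em(7) by (intro mult_right_mono) auto
      then show ?thesis using y2 by linarith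
    qed
    have un: "p = E \<epsilon> \<mu>" if p: "p \<in> ball 0 r" "regularized_field Xp Xm \<phi> \<epsilon> \<mu> p = 0" for p
    proof -
      obtain x\<^sub>1 y\<^sub>1 where pe: "p = (x\<^sub>1, y\<^sub>1)" by (cases p)
      define v\<^sub>1 where "v\<^sub>1 = y\<^sub>1 / \<epsilon>"
      have y1: "y\<^sub>1 = \<epsilon> * v\<^sub>1" using em(7) by (simp add: v\<^sub>1_def)
      have pn: "norm (x\<^sub>1, y\<^sub>1) < r" using p(1) by (simp add: pe)
      have m0: "mix A B v\<^sub>1 (x\<^sub>1, y\<^sub>1, \<mu>) = 0" "mix C D v\<^sub>1 (x\<^sub>1, y\<^sub>1, \<mu>) = 0"
        using p(2) unfolding pe regularized_field_eq v\<^sub>1_def[symmetric] by (simp_all add: zero_prod_def)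
      have "\<bar>v\<^sub>1 - vs\<bar> \<le> K1 * norm (x\<^sub>1, y\<^sub>1, \<mu>)"
        using 1(4)[OF _ m0(1)] n3[OF pn] r(2) by simp
      also have "\<dots> < K1 * (h / K1)" using n3[OF pn] r(5) 1(1) by (intro mult_strict_left_mono) auto
      finally have "\<bar>v\<^sub>1 - vs\<bar> < h" using 1(1) by simp
      moreover have "\<bar>x\<^sub>1\<bar> < h" using norm_fst_le[of x\<^sub>1 y\<^sub>1] pn r by simp
      ultimately have "x\<^sub>1 = x \<epsilon> \<mu> \<and> v\<^sub>1 = v \<epsilon> \<mu>"
        using em r m0 unfolding y1 by (intro h(2)) auto
      then show ?thesis by (simp add: pe E_def y1)
    qed
    have "E \<epsilon> \<mu> \<in> ball 0 r" using nE by simp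
    moreover have "regularized_field Xp Xm \<phi> \<epsilon> \<mu> (E \<epsilon> \<mu>) = 0"
      using eq em(7) by (simp add: E_def regularized_field_eq zero_prod_def)
    moreover have "\<forall>p\<in>ball 0 r. regularized_field Xp Xm \<phi> \<epsilon> \<mu> p = 0 \<longrightarrow> p = E \<epsilon> \<mu>"
      by (intro ballI impI un)
    moreover have "\<bar>fst (E \<epsilon> \<mu>) - \<beta> * \<delta> / (\<beta> * \<delta> + \<alpha>) * \<mu>\<bar> \<le> (2 * K2 + 2) * (\<mu>\<^sup>2 + \<epsilon>)"
      using e1 unfolding c\<^sub>x_def E_def fst_conv .
    moreover have "\<bar>snd (E \<epsilon> \<mu>)\<bar> \<le> (2 * K2 + 2) * \<epsilon>"
      using e2 unfolding E_def snd_conv .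
    ultimately show ?thesis by (intro conjI)
  qed
  show ?thesis
    unfolding equilibrium_family_def
    by (intro exI[of _ m] exI[of _ r] exI[of _ "2 * K2 + 2"] conjI m r(1) ballI main)
qed

text \<open>Both equations hold identically in \<mu> along the branch. Differentiating them gives a
  linear system for the derivatives of x and v, solved by Cramer's rule; its determinant has a
  nonzero limit. For v only the existence of a limit is recorded, because it will be multiplied by
  quantities that tend to 0.\<close>

lemma derivative_limits:
  "((\<lambda>(\<epsilon>, \<mu>). deriv (x \<epsilon>) \<mu>) \<longlongrightarrow> c\<^sub>x) Fz"
  "\<exists>L. ((\<lambda>(\<epsilon>, \<mu>). deriv (v \<epsilon>) \<mu>) \<longlongrightarrow> L) Fz"
proof -
  let ?x' = "\<lambda>(\<epsilon>, \<mu>). deriv (x \<epsilon>) \<mu>" and ?v' = "\<lambda>(\<epsilon>, \<mu>). deriv (v \<epsilon>) \<mu>"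
  define a11 where "a11 z = mix (px A) (px B) (vv z) (P z)" for z
  define a12 where "a12 z = fst z * mix (py A) (py B) (vv z) (P z) + d1 (vv z) * (A (P z) - B (P z))" for z
  define a21 where "a21 z = mix (px C) (px D) (vv z) (P z)" for z
  define a22 where "a22 z = fst z * mix (py C) (py D) (vv z) (P z) + d1 (vv z) * (C (P z) - D (P z))" for z
  define b1 where "b1 z = mix (pm A) (pm B) (vv z) (P z)" for z
  define b2 where "b2 z = mix (pm C) (pm D) (vv z) (P z)" for z
  note sp = smooth smooth_partial[OF smooth(1)] smooth_partial[OF smooth(2)] smooth_partial[OF smooth(3)] smooth_partial[OF smooth(4)]
  note tm = tendsto_mix[OF _ _ limit_P limits(2)]
  have d1l: "((\<lambda>z. d1 (vv z)) \<longlongrightarrow> d1 vs) Fz"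
    by (rule isCont_tendsto_compose[OF phi_cont(2) limits(2)])
  note ts = tendsto_smooth[OF _ limit_P]
  have l: "(a11 \<longlongrightarrow> mix (px A) (px B) vs 0) Fz" "(a12 \<longlongrightarrow> 0 * mix (py A) (py B) vs 0 + d1 vs * (A 0 - B 0)) Fz"
    "(a21 \<longlongrightarrow> mix (px C) (px D) vs 0) Fz" "(a22 \<longlongrightarrow> 0 * mix (py C) (py D) vs 0 + d1 vs * (C 0 - D 0)) Fz"
    "(b1 \<longlongrightarrow> mix (pm A) (pm B) vs 0) Fz" "(b2 \<longlongrightarrow> mix (pm C) (pm D) vs 0) Fz"
    unfolding a11_def[abs_def] a12_def[abs_def] a21_def[abs_def] a22_def[abs_def] b1_def[abs_def] b2_def[abs_def]
    by (intro tm sp tendsto_add tendsto_mult tendsto_diff ts d1l limits)+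
  let ?l11 = "mix (px A) (px B) vs 0" and ?l12 = "d1 vs * (\<delta> - \<alpha>)" and ?l21 = "2 * \<Omega> / (\<alpha> - \<delta>)"
    and ?m1 = "mix (pm A) (pm B) vs 0" and ?m2 = "- 2 * \<delta> / (\<alpha> - \<delta>) * \<beta>"
  have l12: "(a12 \<longlongrightarrow> ?l12) Fz" and l21: "(a21 \<longlongrightarrow> ?l21) Fz" and l22: "(a22 \<longlongrightarrow> 0) Fz" and lb2: "(b2 \<longlongrightarrow> ?m2) Fz"
    using l(2,3,4,6) by (simp_all only: mix_C_x mix_C_m A0 B0 C0 D0) simp_all
  have "((\<lambda>z. a11 z * a22 z - a12 z * a21 z) \<longlongrightarrow> ?l11 * 0 - ?l12 * ?l21) Fz"
    by (intro tendsto_diff tendsto_mult l(1) l12 l21 l22)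
  then have ld: "((\<lambda>z. a11 z * a22 z - a12 z * a21 z) \<longlongrightarrow> - (?l12 * ?l21)) Fz" by simp
  have ne: "?l12 \<noteq> 0" "?l21 \<noteq> 0" using d1_vs alpha_delta Om by auto
  then have ne': "- (?l12 * ?l21) \<noteq> 0" by simp
  have evd: "eventually (\<lambda>z. a11 z * a22 z - a12 z * a21 z \<noteq> 0) Fz"
    by (rule tendsto_imp_eventually_ne[OF ld ne'])
  have evb: "eventually (\<lambda>z. \<bar>fst z\<bar> < e\<^sub>0 \<and> \<bar>snd z\<bar> < e\<^sub>0) Fz"
    unfolding eventually_nhds_prod_0 using e0 by auto
  have sys: "?x' z * a11 z + ?v' z * a12 z = - b1 z" "?x' z * a21 z + ?v' z * a22 z = - b2 z"
    if "\<bar>fst z\<bar> < e\<^sub>0 \<and> \<bar>snd z\<bar> < e\<^sub>0" for z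
  proof -
    obtain \<epsilon> \<mu> where z: "z = (\<epsilon>, \<mu>)" by (cases z)
    have em: "\<bar>\<epsilon>\<bar> < e\<^sub>0" "\<bar>\<mu>\<bar> < e\<^sub>0" using that by (auto simp: z)
    have gen: "deriv (x \<epsilon>) \<mu> * mix (px f) (px g) (v \<epsilon> \<mu>) (P z) + deriv (v \<epsilon>) \<mu> *
        (\<epsilon> * mix (py f) (py g) (v \<epsilon> \<mu>) (P z) + d1 (v \<epsilon> \<mu>) * (f (P z) - g (P z))) = - mix (pm f) (pm g) (v \<epsilon> \<mu>) (P z)"
      if sm: "Ck_on \<infinity> U f" "Ck_on \<infinity> U g" and 0: "\<And>\<mu>. \<bar>\<mu>\<bar> < e\<^sub>0 \<Longrightarrow> mix f g (v \<epsilon> \<mu>) (x \<epsilon> \<mu>, \<epsilon> * v \<epsilon> \<mu>, \<mu>) = 0" for f g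
    proof -
      have "((\<lambda>t. mix f g (v \<epsilon> t) (x \<epsilon> t, \<epsilon> * v \<epsilon> t, t)) has_real_derivative
         (deriv (x \<epsilon>) \<mu> * mix (px f) (px g) (v \<epsilon> \<mu>) (P z) + \<epsilon> * deriv (v \<epsilon>) \<mu> * mix (py f) (py g) (v \<epsilon> \<mu>) (P z)
            + 1 * mix (pm f) (pm g) (v \<epsilon> \<mu>) (P z) + deriv (v \<epsilon>) \<mu> * (d1 (v \<epsilon> \<mu>) * (f (P z) - g (P z))))) (at \<mu>)"
        unfolding P_def z prod.case using equi[OF em] derivs[OF em]
        by (intro mix_has_real_derivative sm DERIV_cmult DERIV_ident) auto
      moreover have "((\<lambda>t. mix f g (v \<epsilon> t) (x \<epsilon> t, \<epsilon> * v \<epsilon> t, t)) has_real_derivative 0) (at \<mu>)"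
      proof (rule has_field_derivative_transform_within_open[of "\<lambda>_. 0" _ _ "{-e\<^sub>0<..<e\<^sub>0}"])
        show "\<mu> \<in> {-e\<^sub>0<..<e\<^sub>0}" using em(2) by auto
        show "0 = mix f g (v \<epsilon> t) (x \<epsilon> t, \<epsilon> * v \<epsilon> t, t)" if "t \<in> {-e\<^sub>0<..<e\<^sub>0}" for t
          using 0[of t] that by (simp add: abs_less_iff)
      qed auto
      ultimately have "deriv (x \<epsilon>) \<mu> * mix (px f) (px g) (v \<epsilon> \<mu>) (P z) + \<epsilon> * deriv (v \<epsilon>) \<mu> * mix (py f) (py g) (v \<epsilon> \<mu>) (P z)
            + 1 * mix (pm f) (pm g) (v \<epsilon> \<mu>) (P z) + deriv (v \<epsilon>) \<mu> * (d1 (v \<epsilon> \<mu>) * (f (P z) - g (P z))) = 0"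
        by (rule DERIV_unique)
      then show ?thesis by (simp add: algebra_simps)
    qed
    show "?x' z * a11 z + ?v' z * a12 z = - b1 z"
      using gen[OF smooth(1,2)] equi[OF em(1)] by (simp add: a11_def a12_def b1_def z vv_def)
    show "?x' z * a21 z + ?v' z * a22 z = - b2 z"
      using gen[OF smooth(3,4)] equi[OF em(1)] by (simp add: a21_def a22_def b2_def z vv_def)
  qed
  have "((\<lambda>z. (a12 z * b2 z - a22 z * b1 z) / (a11 z * a22 z - a12 z * a21 z)) \<longlongrightarrow>
      (?l12 * ?m2 - 0 * ?m1) / (- (?l12 * ?l21))) Fz"
    by (intro tendsto_divide tendsto_diff tendsto_mult l(1,5) l12 l21 l22 lb2 ne' ld)
  moreover have "(?l12 * ?m2 - 0 * ?m1) / (- (?l12 * ?l21)) = c\<^sub>x"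
  proof -
    have "(p * m - 0 * n) / (- (p * q)) = - (m / q)" if "p \<noteq> 0" for p m n q :: real
      using that by simp
    from this[OF ne(1)] have "(?l12 * ?m2 - 0 * ?m1) / (- (?l12 * ?l21)) = - (?m2 / ?l21)" .
    also have "\<dots> = c\<^sub>x"
    proof -
      have "- ((- 2 * \<delta> / d * \<beta>) / (2 * w / d)) = \<beta> * \<delta> / w" if "d \<noteq> 0" "w > 0" for d w
        using that by (simp add: field_simps)
      from this[OF alpha_delta(2) Om] show ?thesis unfolding c\<^sub>x_def .
    qed
    finally show ?thesis .
  qed
  ultimately have "((\<lambda>z. (a12 z * b2 z - a22 z * b1 z) / (a11 z * a22 z - a12 z * a21 z)) \<longlongrightarrow> c\<^sub>x) Fz" by simp
  then show "(?x' \<longlongrightarrow> c\<^sub>x) Fz"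
  proof (rule Lim_transform_eventually)
    show "eventually (\<lambda>z. (a12 z * b2 z - a22 z * b1 z) / (a11 z * a22 z - a12 z * a21 z) = ?x' z) Fz"
      using evd evb
    proof eventually_elim
      case (elim z)
      have "?x' z * (a11 z * a22 z - a12 z * a21 z)
         = (?x' z * a11 z + ?v' z * a12 z) * a22 z - (?x' z * a21 z + ?v' z * a22 z) * a12 z"
        by (simp add: algebra_simps)
      also have "\<dots> = a12 z * b2 z - a22 z * b1 z"
        unfolding sys[OF elim(2)] by (simp add: algebra_simps)
      finally show ?case using elim(1) by (simp add: field_simps)
    qed
  qed
  have "((\<lambda>z. (a21 z * b1 z - a11 z * b2 z) / (a11 z * a22 z - a12 z * a21 z)) \<longlongrightarrow>
      (?l21 * ?m1 - ?l11 * ?m2) / (- (?l12 * ?l21))) Fz"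
    by (intro tendsto_divide tendsto_diff tendsto_mult l(1,5) l12 l21 l22 lb2 ne' ld)
  then have "(?v' \<longlongrightarrow> (?l21 * ?m1 - ?l11 * ?m2) / (- (?l12 * ?l21))) Fz"
  proof (rule Lim_transform_eventually)
    show "eventually (\<lambda>z. (a21 z * b1 z - a11 z * b2 z) / (a11 z * a22 z - a12 z * a21 z) = ?v' z) Fz"
      using evd evb
    proof eventually_elim
      case (elim z)
      have "?v' z * (a11 z * a22 z - a12 z * a21 z)
         = (?x' z * a21 z + ?v' z * a22 z) * a11 z - (?x' z * a11 z + ?v' z * a12 z) * a21 z"
        by (simp add: algebra_simps)
      also have "\<dots> = a21 z * b1 z - a11 z * b2 z"
        unfolding sys[OF elim(2)] by (simp add: algebra_simps)
      finally show ?case using elim(1) by (simp add: field_simps)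
    qed
  qed
  then show "\<exists>L. (?v' \<longlongrightarrow> L) Fz" by blast
qed

section \<open>The scaled trace along the branch and its zero\<close>

definition "T = (\<lambda>(\<epsilon>, \<mu>). \<epsilon> * (mix (px A) (px B) (v \<epsilon> \<mu>) (P (\<epsilon>, \<mu>)) + mix (py C) (py D) (v \<epsilon> \<mu>) (P (\<epsilon>, \<mu>)))
   + d1 (v \<epsilon> \<mu>) * (C (P (\<epsilon>, \<mu>)) - D (P (\<epsilon>, \<mu>))))"

text \<open>Unlike the trace of the Jacobian itself, \<open>T\<close> extends smoothly to \<open>\<epsilon> = 0\<close>.\<close>

lemma T_trace:
  assumes "\<epsilon> > 0"
  shows "T (\<epsilon>, \<mu>) = \<epsilon> * (J11 (v \<epsilon> \<mu>) (P (\<epsilon>, \<mu>)) + J22 \<epsilon> (v \<epsilon> \<mu>) (P (\<epsilon>, \<mu>)))"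
  using assms by (simp add: T_def J11_def J22_def distrib_left)

lemma compose_derivs:
  assumes "\<bar>\<epsilon>\<bar> < e\<^sub>0" "\<bar>\<mu>\<bar> < e\<^sub>0"
  shows "Ck_on \<infinity> U f \<Longrightarrow> ((\<lambda>t. f (P (\<epsilon>, t))) has_real_derivative
        (deriv (x \<epsilon>) \<mu> * px f (P (\<epsilon>, \<mu>)) + \<epsilon> * deriv (v \<epsilon>) \<mu> * py f (P (\<epsilon>, \<mu>)) + 1 * pm f (P (\<epsilon>, \<mu>)))) (at \<mu>)"
    and "Ck_on \<infinity> U f \<Longrightarrow> Ck_on \<infinity> U g \<Longrightarrow> ((\<lambda>t. mix f g (v \<epsilon> t) (P (\<epsilon>, t))) has_real_derivative
        (deriv (x \<epsilon>) \<mu> * mix (px f) (px g) (v \<epsilon> \<mu>) (P (\<epsilon>, \<mu>)) + \<epsilon> * deriv (v \<epsilon>) \<mu> * mix (py f) (py g) (v \<epsilon> \<mu>) (P (\<epsilon>, \<mu>))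
            + 1 * mix (pm f) (pm g) (v \<epsilon> \<mu>) (P (\<epsilon>, \<mu>))
            + deriv (v \<epsilon>) \<mu> * (d1 (v \<epsilon> \<mu>) * (f (P (\<epsilon>, \<mu>)) - g (P (\<epsilon>, \<mu>)))))) (at \<mu>)"
    and "((\<lambda>t. d1 (v \<epsilon> t)) has_real_derivative d2 (v \<epsilon> \<mu>) * deriv (v \<epsilon>) \<mu>) (at \<mu>)"
proof -
  have d: "(x \<epsilon> has_real_derivative deriv (x \<epsilon>) \<mu>) (at \<mu>)" "(v \<epsilon> has_real_derivative deriv (v \<epsilon>) \<mu>) (at \<mu>)"
    and u: "(x \<epsilon> \<mu>, \<epsilon> * v \<epsilon> \<mu>, \<mu>) \<in> U"
    using equi[OF assms] derivs[OF assms] by auto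
  show "((\<lambda>t. d1 (v \<epsilon> t)) has_real_derivative d2 (v \<epsilon> \<mu>) * deriv (v \<epsilon>) \<mu>) (at \<mu>)"
    by (rule DERIV_chain2[OF phi_derivs(2) d(2)])
  assume f: "Ck_on \<infinity> U f"
  show "((\<lambda>t. f (P (\<epsilon>, t))) has_real_derivative
        (deriv (x \<epsilon>) \<mu> * px f (P (\<epsilon>, \<mu>)) + \<epsilon> * deriv (v \<epsilon>) \<mu> * py f (P (\<epsilon>, \<mu>)) + 1 * pm f (P (\<epsilon>, \<mu>)))) (at \<mu>)"
    unfolding P_def prod.case
    by (rule has_real_derivative_smooth_compose[OF f u d(1) DERIV_cmult[OF d(2)] DERIV_ident])
  assume g: "Ck_on \<infinity> U g"
  show "((\<lambda>t. mix f g (v \<epsilon> t) (P (\<epsilon>, t))) has_real_derivative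
        (deriv (x \<epsilon>) \<mu> * mix (px f) (px g) (v \<epsilon> \<mu>) (P (\<epsilon>, \<mu>)) + \<epsilon> * deriv (v \<epsilon>) \<mu> * mix (py f) (py g) (v \<epsilon> \<mu>) (P (\<epsilon>, \<mu>))
            + 1 * mix (pm f) (pm g) (v \<epsilon> \<mu>) (P (\<epsilon>, \<mu>))
            + deriv (v \<epsilon>) \<mu> * (d1 (v \<epsilon> \<mu>) * (f (P (\<epsilon>, \<mu>)) - g (P (\<epsilon>, \<mu>)))))) (at \<mu>)"
    unfolding P_def prod.case
    by (rule mix_has_real_derivative[OF f g u d(1) DERIV_cmult[OF d(2)] DERIV_ident d(2)])
qed

definition "T' = (\<lambda>(\<epsilon>, \<mu>). deriv (\<lambda>t. T (\<epsilon>, t)) \<mu>)"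

text \<open>Every term of the derivative has a vanishing factor \<epsilon> or C - D, except
  \<phi>'(v) times the \<mu>-derivative of C - D. The limit is nonzero, which becomes the crossing
  speed.\<close>

lemma T_derivative:
  "\<bar>\<epsilon>\<bar> < e\<^sub>0 \<Longrightarrow> \<bar>\<mu>\<bar> < e\<^sub>0 \<Longrightarrow> ((\<lambda>t. T (\<epsilon>, t)) has_real_derivative T' (\<epsilon>, \<mu>)) (at \<mu>)"
  "(T' \<longlongrightarrow> d1 vs * lam) Fz"
proof -
  note sp = smooth smooth_partial[OF smooth(1)] smooth_partial[OF smooth(2)] smooth_partial[OF smooth(3)] smooth_partial[OF smooth(4)]
  note sp2 = sp smooth_partial[OF sp(5)] smooth_partial[OF sp(8)] smooth_partial[OF sp(12)] smooth_partial[OF sp(15)]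
  define M where "M f g z = (case z of (\<epsilon>, \<mu>) \<Rightarrow> deriv (x \<epsilon>) \<mu> * mix (px f) (px g) (v \<epsilon> \<mu>) (P (\<epsilon>, \<mu>))
     + \<epsilon> * deriv (v \<epsilon>) \<mu> * mix (py f) (py g) (v \<epsilon> \<mu>) (P (\<epsilon>, \<mu>))
            + 1 * mix (pm f) (pm g) (v \<epsilon> \<mu>) (P (\<epsilon>, \<mu>))
            + deriv (v \<epsilon>) \<mu> * (d1 (v \<epsilon> \<mu>) * (f (P (\<epsilon>, \<mu>)) - g (P (\<epsilon>, \<mu>)))))" for f g z
  define N where "N f z = (case z of (\<epsilon>, \<mu>) \<Rightarrow> deriv (x \<epsilon>) \<mu> * px f (P (\<epsilon>, \<mu>))
     + \<epsilon> * deriv (v \<epsilon>) \<mu> * py f (P (\<epsilon>, \<mu>)) + 1 * pm f (P (\<epsilon>, \<mu>)))" for f z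
  define R where "R = (\<lambda>(\<epsilon>, \<mu>). \<epsilon> * (M (px A) (px B) (\<epsilon>, \<mu>) + M (py C) (py D) (\<epsilon>, \<mu>))
     + (d2 (v \<epsilon> \<mu>) * deriv (v \<epsilon>) \<mu> * (C (P (\<epsilon>, \<mu>)) - D (P (\<epsilon>, \<mu>)))
        + (N C (\<epsilon>, \<mu>) - N D (\<epsilon>, \<mu>)) * d1 (v \<epsilon> \<mu>)))"
  have d: "((\<lambda>t. T (\<epsilon>, t)) has_real_derivative R (\<epsilon>, \<mu>)) (at \<mu>)" if "\<bar>\<epsilon>\<bar> < e\<^sub>0" "\<bar>\<mu>\<bar> < e\<^sub>0" for \<epsilon> \<mu>
    unfolding T_def R_def M_def N_def prod.case
    by (intro DERIV_add DERIV_cmult DERIV_mult DERIV_diff compose_derivs[OF that] sp)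
  have T'R: "T' (\<epsilon>, \<mu>) = R (\<epsilon>, \<mu>)" if "\<bar>\<epsilon>\<bar> < e\<^sub>0" "\<bar>\<mu>\<bar> < e\<^sub>0" for \<epsilon> \<mu>
    unfolding T'_def prod.case by (rule DERIV_imp_deriv[OF d[OF that]])
  show "((\<lambda>t. T (\<epsilon>, t)) has_real_derivative T' (\<epsilon>, \<mu>)) (at \<mu>)" if "\<bar>\<epsilon>\<bar> < e\<^sub>0" "\<bar>\<mu>\<bar> < e\<^sub>0" for \<epsilon> \<mu>
    unfolding T'R[OF that] by (rule d[OF that])
  obtain L where L: "((\<lambda>(\<epsilon>, \<mu>). deriv (v \<epsilon>) \<mu>) \<longlongrightarrow> L) Fz" using derivative_limits(2) by blast
  note l = derivative_limits(1)[unfolded case_prod_beta'] L[unfolded case_prod_beta'] limits(3)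
    limits(2)[unfolded vv_def case_prod_beta']
  have tm: "((\<lambda>z. mix f g (v (fst z) (snd z)) (P z)) \<longlongrightarrow> mix f g vs 0) Fz"
    if "Ck_on \<infinity> U f" "Ck_on \<infinity> U g" for f g
    by (rule tendsto_mix[OF that limit_P l(4)])
  note ts = tendsto_smooth[OF _ limit_P]
  have dl: "((\<lambda>z. d1 (v (fst z) (snd z))) \<longlongrightarrow> d1 vs) Fz" "((\<lambda>z. d2 (v (fst z) (snd z))) \<longlongrightarrow> d2 vs) Fz"
    by (rule isCont_tendsto_compose[OF phi_cont(2) l(4)], rule isCont_tendsto_compose[OF phi_cont(3) l(4)])
  have N: "(N f \<longlongrightarrow> c\<^sub>x * px f 0 + 0 * L * py f 0 + 1 * pm f 0) Fz" if "Ck_on \<infinity> U f" for f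
    unfolding N_def case_prod_beta' prod.collapse
    by (intro tendsto_add tendsto_mult tendsto_const l ts smooth_partial that)
  have M: "(M f g \<longlongrightarrow> c\<^sub>x * mix (px f) (px g) vs 0 + 0 * L * mix (py f) (py g) vs 0 + 1 * mix (pm f) (pm g) vs 0
      + L * (d1 vs * (f 0 - g 0))) Fz" if "Ck_on \<infinity> U f" "Ck_on \<infinity> U g" for f g
    unfolding M_def case_prod_beta' prod.collapse
    by (intro tendsto_add tendsto_mult tendsto_const tendsto_diff l tm ts smooth_partial that dl)
  have "(R \<longlongrightarrow> 0 * ((c\<^sub>x * mix (px (px A)) (px (px B)) vs 0 + 0 * L * mix (py (px A)) (py (px B)) vs 0 + 1 * mix (pm (px A)) (pm (px B)) vs 0
      + L * (d1 vs * (px A 0 - px B 0))) + (c\<^sub>x * mix (px (py C)) (px (py D)) vs 0 + 0 * L * mix (py (py C)) (py (py D)) vs 0 + 1 * mix (pm (py C)) (pm (py D)) vs 0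
      + L * (d1 vs * (py C 0 - py D 0)))) + (d2 vs * L * (C 0 - D 0) +
      ((c\<^sub>x * px C 0 + 0 * L * py C 0 + 1 * pm C 0) - (c\<^sub>x * px D 0 + 0 * L * py D 0 + 1 * pm D 0)) * d1 vs)) Fz"
    unfolding R_def case_prod_beta' prod.collapse
    by (intro tendsto_add tendsto_mult tendsto_diff l M N ts smooth_partial smooth dl)
  then have RL: "(R \<longlongrightarrow> d1 vs * lam) Fz"
    by (simp add: C0 D0 lam(2)[symmetric] algebra_simps)
  have "eventually (\<lambda>z. R z = T' z) Fz"
    unfolding eventually_nhds_prod_0 using e0 T'R by (intro exI[of _ e\<^sub>0]) simp
  then show "(T' \<longlongrightarrow> d1 vs * lam) Fz" by (rule Lim_transform_eventually[OF RL])
qed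

text \<open>Divided by \<phi>'(v), T equals \<open>lam * \<mu>\<close> up to O(\<mu>^2 +
  \<epsilon>). On |\<mu>| = N \<epsilon> with N large the linear term dominates, so T changes
  sign.\<close>

lemma hopf_parameter:
  obtains N \<mu>\<^sub>H where "N > 0" "eventually (\<lambda>\<epsilon>. \<bar>\<mu>\<^sub>H \<epsilon>\<bar> \<le> N * \<epsilon> \<and> T (\<epsilon>, \<mu>\<^sub>H \<epsilon>) = 0) (at_right 0)"
proof -
  obtain K r where K: "K > 0" "r > 0" "ball 0 r \<subseteq> U"
    "\<And>x y \<mu> v. (x, y, \<mu>) \<in> ball 0 r \<Longrightarrow> mix A B v (x, y, \<mu>) = 0 \<Longrightarrow> mix C D v (x, y, \<mu>) = 0 \<Longrightarrow>
       \<bar>x - c\<^sub>x * \<mu>\<bar> \<le> K * (\<mu>\<^sup>2 + \<bar>y\<bar>) \<and>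
       \<bar>C (x, y, \<mu>) - D (x, y, \<mu>) - lam * \<mu>\<bar> \<le> K * (\<mu>\<^sup>2 + \<bar>y\<bar>)"
    using equilibrium_estimate by blast
  note sp = smooth_partial[OF smooth(1)] smooth_partial[OF smooth(2)] smooth_partial[OF smooth(3)] smooth_partial[OF smooth(4)]
  define Q where "Q z = (mix (px A) (px B) (vv z) (P z) + mix (py C) (py D) (vv z) (P z)) / d1 (vv z)" for z
  define q where "q = (mix (px A) (px B) vs 0 + mix (py C) (py D) vs 0) / d1 vs"
  have dl: "((\<lambda>z. d1 (vv z)) \<longlongrightarrow> d1 vs) Fz"
    by (rule isCont_tendsto_compose[OF phi_cont(2) limits(2)])
  have "(Q \<longlongrightarrow> q) Fz"
    unfolding Q_def[abs_def] q_def using d1_vs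
    by (intro tendsto_divide tendsto_add tendsto_mix limit_P limits(2) dl sp) auto
  then have evQ: "eventually (\<lambda>z. dist (Q z) q < 1) Fz" by (rule tendstoD) simp
  have evd: "eventually (\<lambda>z. d1 (vv z) > 0) Fz" by (rule order_tendstoD(1)[OF dl d1_vs])
  have evv: "eventually (\<lambda>z. dist (vv z) vs < 1) Fz" by (rule tendstoD[OF limits(2)]) simp
  have evP: "eventually (\<lambda>z. dist (P z) 0 < r) Fz" by (rule tendstoD[OF limit_P K(2)])
  have "eventually (\<lambda>z. dist (Q z) q < 1 \<and> d1 (vv z) > 0 \<and> dist (vv z) vs < 1 \<and> dist (P z) 0 < r) Fz"
    using evQ evd evv evP by eventually_elim blast
  then obtain d where d: "d > 0" "\<And>\<epsilon> \<mu>. \<bar>\<epsilon>\<bar> < d \<Longrightarrow> \<bar>\<mu>\<bar> < d \<Longrightarrow> dist (Q (\<epsilon>, \<mu>)) q < 1 \<and> d1 (vv (\<epsilon>, \<mu>)) > 0 \<and> dist (vv (\<epsilon>, \<mu>)) vs < 1 \<and>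
      dist (P (\<epsilon>, \<mu>)) 0 < r"
    unfolding eventually_nhds_prod_0 by blast
  define K3 where "K3 = 2 * K + \<bar>q\<bar> + 1"
  have K3: "K3 > 0" using K by (simp add: K3_def add_pos_nonneg)
  \<comment> \<open>This makes the linear term 2 K3 \<epsilon> at the ends, while for (N
    \<epsilon>)^2 < \<epsilon> the error K3 ((N \<epsilon>)^2 + \<epsilon>) is smaller.\<close>
  define N where "N = 2 * K3 / \<bar>lam\<bar>"
  have N: "N > 0" using K3 lam by (simp add: N_def)
  have ex: "\<exists>\<mu>. \<bar>\<mu>\<bar> \<le> N * \<epsilon> \<and> T (\<epsilon>, \<mu>) = 0" if e: "0 < \<epsilon>" "\<epsilon> < min (min d e\<^sub>0) (min (min d e\<^sub>0 / N) (1 / (2 * N\<^sup>2)))" for \<epsilon>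
  proof -
    have Ne: "N * \<epsilon> < d" "N * \<epsilon> < e\<^sub>0" "N\<^sup>2 * \<epsilon> < 1" "0 < N * \<epsilon>" "\<epsilon> < d" "\<epsilon> < e\<^sub>0"
      using e N d(1) e0 by (auto simp: field_simps power2_eq_square)
    have est: "\<bar>T (\<epsilon>, \<mu>) / d1 (v \<epsilon> \<mu>) - lam * \<mu>\<bar> \<le> K3 * (\<mu>\<^sup>2 + \<epsilon>)" "d1 (v \<epsilon> \<mu>) > 0"
      if mu: "\<bar>\<mu>\<bar> \<le> N * \<epsilon>" for \<mu>
    proof -
      have em: "\<bar>\<epsilon>\<bar> < d" "\<bar>\<mu>\<bar> < d" "\<bar>\<epsilon>\<bar> < e\<^sub>0" "\<bar>\<mu>\<bar> < e\<^sub>0" using e mu Ne by auto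
      have dd: "dist (Q (\<epsilon>, \<mu>)) q < 1" "d1 (v \<epsilon> \<mu>) > 0" "dist (v \<epsilon> \<mu>) vs < 1" "P (\<epsilon>, \<mu>) \<in> ball 0 r"
        using d(2)[OF em(1,2)] by (auto simp: vv_def dist_commute)
      show "d1 (v \<epsilon> \<mu>) > 0" by (rule dd)
      have "\<bar>v \<epsilon> \<mu>\<bar> \<le> 2" using dd(3) vs(1) by (auto simp: dist_real_def)
      then have y2: "\<bar>\<epsilon> * v \<epsilon> \<mu>\<bar> \<le> 2 * \<epsilon>" using e by (simp add: abs_mult)
      have CD: "\<bar>C (P (\<epsilon>, \<mu>)) - D (P (\<epsilon>, \<mu>)) - lam * \<mu>\<bar> \<le> K * (\<mu>\<^sup>2 + \<bar>\<epsilon> * v \<epsilon> \<mu>\<bar>)"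
        using K(4)[of "x \<epsilon> \<mu>" "\<epsilon> * v \<epsilon> \<mu>" \<mu> "v \<epsilon> \<mu>"] dd(4) equi[OF em(3,4)] by (simp add: P_def)
      have "T (\<epsilon>, \<mu>) / d1 (v \<epsilon> \<mu>) - lam * \<mu> = \<epsilon> * Q (\<epsilon>, \<mu>) + (C (P (\<epsilon>, \<mu>)) - D (P (\<epsilon>, \<mu>)) - lam * \<mu>)"
        using dd(2) by (simp add: T_def Q_def vv_def add_divide_distrib distrib_left)
      then have "\<bar>T (\<epsilon>, \<mu>) / d1 (v \<epsilon> \<mu>) - lam * \<mu>\<bar> \<le> \<bar>\<epsilon> * Q (\<epsilon>, \<mu>)\<bar> + K * (\<mu>\<^sup>2 + \<bar>\<epsilon> * v \<epsilon> \<mu>\<bar>)"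
        using CD by linarith
      also have "\<dots> \<le> \<epsilon> * (\<bar>q\<bar> + 1) + K * (\<mu>\<^sup>2 + 2 * \<epsilon>)"
      proof (intro add_mono mult_left_mono order_refl y2)
        have "\<bar>Q (\<epsilon>, \<mu>)\<bar> \<le> \<bar>q\<bar> + 1" using dd(1) by (auto simp: dist_real_def)
        then show "\<bar>\<epsilon> * Q (\<epsilon>, \<mu>)\<bar> \<le> \<epsilon> * (\<bar>q\<bar> + 1)" using e by (simp add: abs_mult)
      qed (use K in auto)
      also have "\<dots> \<le> K3 * (\<mu>\<^sup>2 + \<epsilon>)"
      proof -
        have "K3 * (\<mu>\<^sup>2 + \<epsilon>) - (\<epsilon> * (\<bar>q\<bar> + 1) + K * (\<mu>\<^sup>2 + 2 * \<epsilon>)) = (K + \<bar>q\<bar> + 1) * \<mu>\<^sup>2"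
          by (simp add: K3_def algebra_simps)
        moreover have "(K + \<bar>q\<bar> + 1) * \<mu>\<^sup>2 \<ge> 0" using K by simp
        ultimately show ?thesis by linarith
      qed
      finally show "\<bar>T (\<epsilon>, \<mu>) / d1 (v \<epsilon> \<mu>) - lam * \<mu>\<bar> \<le> K3 * (\<mu>\<^sup>2 + \<epsilon>)" .
    qed
    have small: "K3 * ((N * \<epsilon>)\<^sup>2 + \<epsilon>) < \<bar>lam\<bar> * (N * \<epsilon>)"
    proof -
      have lN: "\<bar>lam\<bar> * N = 2 * K3" using lam by (simp add: N_def)
      have "\<bar>lam\<bar> * (N * \<epsilon>) = \<bar>lam\<bar> * N * \<epsilon>" by (rule mult.assoc[symmetric])
      also have "\<dots> = K3 * (2 * \<epsilon>)" unfolding lN by simp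
      finally have e1: "\<bar>lam\<bar> * (N * \<epsilon>) = K3 * (2 * \<epsilon>)" .
      have "(N * \<epsilon>)\<^sup>2 + \<epsilon> < 2 * \<epsilon>"
        using mult_strict_right_mono[OF Ne(3) e(1)] by (simp add: power2_eq_square algebra_simps)
      then show ?thesis unfolding e1 by (rule mult_strict_left_mono[OF _ K3])
    qed
    \<comment> \<open>The factor \<open>lam\<close> makes the leading coefficient a square and
      spares a case distinction on its sign.\<close>
    let ?S = "\<lambda>\<mu>. lam * (T (\<epsilon>, \<mu>) / d1 (v \<epsilon> \<mu>))"
    have err: "\<bar>?S \<mu> - lam\<^sup>2 * \<mu>\<bar> < lam\<^sup>2 * (N * \<epsilon>)" if "\<bar>\<mu>\<bar> = N * \<epsilon>" for \<mu>
    proof -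
      have "?S \<mu> - lam\<^sup>2 * \<mu> = lam * (T (\<epsilon>, \<mu>) / d1 (v \<epsilon> \<mu>) - lam * \<mu>)"
        by (simp add: power2_eq_square algebra_simps)
      then have "\<bar>?S \<mu> - lam\<^sup>2 * \<mu>\<bar> \<le> \<bar>lam\<bar> * (K3 * (\<mu>\<^sup>2 + \<epsilon>))"
        using est(1)[of \<mu>] that by (simp add: abs_mult mult_left_mono)
      also have "\<mu>\<^sup>2 = (N * \<epsilon>)\<^sup>2" using that power2_abs[of \<mu>] by simp
      also have "\<bar>lam\<bar> * (K3 * ((N * \<epsilon>)\<^sup>2 + \<epsilon>)) < \<bar>lam\<bar> * (\<bar>lam\<bar> * (N * \<epsilon>))"
        using small lam by (intro mult_strict_left_mono) auto
      also have "\<dots> = lam\<^sup>2 * (N * \<epsilon>)" by (simp add: power2_eq_square mult.assoc[symmetric])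
      finally show ?thesis .
    qed
    have "continuous_on {- (N * \<epsilon>)..N * \<epsilon>} ?S"
    proof (intro continuous_at_imp_continuous_on ballI)
      fix \<mu> assume "\<mu> \<in> {- (N * \<epsilon>)..N * \<epsilon>}"
      then have mu: "\<bar>\<mu>\<bar> \<le> N * \<epsilon>" by auto
      then have em: "\<bar>\<epsilon>\<bar> < e\<^sub>0" "\<bar>\<mu>\<bar> < e\<^sub>0" using e Ne by auto
      show "isCont ?S \<mu>"
        using est(2)[OF mu] DERIV_isCont[OF T_derivative(1)[OF em]] DERIV_isCont[OF compose_derivs(3)[OF em]]
        by (intro continuous_intros) auto
    qed
    moreover have "?S (- (N * \<epsilon>)) \<le> 0" using err[of "- (N * \<epsilon>)"] Ne(4) by (simp add: abs_less_iff)
    moreover have "0 \<le> ?S (N * \<epsilon>)" using err[of "N * \<epsilon>"] Ne(4) by (simp add: abs_less_iff)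
    ultimately obtain \<mu> where mu: "- (N * \<epsilon>) \<le> \<mu>" "\<mu> \<le> N * \<epsilon>" "?S \<mu> = 0"
      using IVT'[of ?S "- (N * \<epsilon>)" 0 "N * \<epsilon>"] Ne(4) by auto
    then have "\<bar>\<mu>\<bar> \<le> N * \<epsilon>" by auto
    moreover from est(2)[OF this] have "T (\<epsilon>, \<mu>) = 0" using mu(3) lam by simp
    ultimately show ?thesis by blast
  qed
  define \<mu>\<^sub>H where "\<mu>\<^sub>H \<epsilon> = (SOME \<mu>. \<bar>\<mu>\<bar> \<le> N * \<epsilon> \<and> T (\<epsilon>, \<mu>) = 0)" for \<epsilon>
  define e1 where "e1 = min (min d e\<^sub>0) (min (min d e\<^sub>0 / N) (1 / (2 * N\<^sup>2)))"
  have "e1 > 0" using d e0 N by (simp add: e1_def)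
  then have "eventually (\<lambda>\<epsilon>. \<epsilon> \<in> {0<..<e1}) (at_right 0)" by (rule eventually_at_right_real)
  then have "eventually (\<lambda>\<epsilon>. \<bar>\<mu>\<^sub>H \<epsilon>\<bar> \<le> N * \<epsilon> \<and> T (\<epsilon>, \<mu>\<^sub>H \<epsilon>) = 0) (at_right 0)"
  proof eventually_elim
    case (elim \<epsilon>)
    have "\<exists>\<mu>. \<bar>\<mu>\<bar> \<le> N * \<epsilon> \<and> T (\<epsilon>, \<mu>) = 0"
      by (rule ex) (use elim in \<open>simp_all add: e1_def\<close>)
    from someI_ex[OF this] show ?case unfolding \<mu>\<^sub>H_def .
  qed
  then show ?thesis using that[OF N] by blast
qed

text \<open>The determinant is positive, of order 1/\<epsilon>, so at a zero of the trace the
  eigenvalues are nonzero and imaginary. Their real part is T/(4 \<epsilon>), and its derivative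
  does not vanish.\<close>

lemma hopf_of_family_branch: "\<exists>\<mu>\<^sub>H. hopf_of_family \<alpha> \<beta> \<delta> Xp Xm \<phi> E \<mu>\<^sub>H"
proof -
  obtain N \<mu>\<^sub>H where N: "N > 0" and mu: "eventually (\<lambda>\<epsilon>. \<bar>\<mu>\<^sub>H \<epsilon>\<bar> \<le> N * \<epsilon> \<and> T (\<epsilon>, \<mu>\<^sub>H \<epsilon>) = 0) (at_right 0)"
    using hopf_parameter by blast
  have O: "\<mu>\<^sub>H \<in> O[at_right 0](\<lambda>\<epsilon>. \<epsilon>)"
  proof (rule bigoI[of _ N])
    have "eventually (\<lambda>\<epsilon>::real. \<epsilon> > 0) (at_right 0)" by (simp add: eventually_at_right_less)
    then show "eventually (\<lambda>\<epsilon>. norm (\<mu>\<^sub>H \<epsilon>) \<le> N * norm \<epsilon>) (at_right 0)"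
      using mu by eventually_elim simp
  qed
  note sp = smooth_partial[OF smooth(1)] smooth_partial[OF smooth(2)] smooth_partial[OF smooth(3)] smooth_partial[OF smooth(4)]
  have dl: "((\<lambda>z. d1 (vv z)) \<longlongrightarrow> d1 vs) Fz"
    by (rule isCont_tendsto_compose[OF phi_cont(2) limits(2)])
  note ts = tendsto_smooth[OF _ limit_P] and tm = tendsto_mix[OF _ _ limit_P limits(2)]
  \<comment> \<open>These are the Jacobian entries with the second column multiplied by \<epsilon>,
    so that the determinant, scaled by \<epsilon>, has the positive limit 2 \<Omega>
    \<phi>'(\<open>vs\<close>).\<close>
  define j11 where "j11 z = mix (px A) (px B) (vv z) (P z)" for z
  define j12 where "j12 z = fst z * mix (py A) (py B) (vv z) (P z) + d1 (vv z) * (A (P z) - B (P z))" for z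
  define j21 where "j21 z = mix (px C) (px D) (vv z) (P z)" for z
  define j22 where "j22 z = fst z * mix (py C) (py D) (vv z) (P z) + d1 (vv z) * (C (P z) - D (P z))" for z
  have "((\<lambda>z. j11 z * j22 z - j12 z * j21 z) \<longlongrightarrow>
     mix (px A) (px B) vs 0 * (0 * mix (py C) (py D) vs 0 + d1 vs * (C 0 - D 0))
      - (0 * mix (py A) (py B) vs 0 + d1 vs * (A 0 - B 0)) * mix (px C) (px D) vs 0) Fz"
    unfolding j11_def j12_def j21_def j22_def
    by (intro tendsto_add tendsto_mult tendsto_diff limits(3) tm sp ts smooth dl)
  then have dt: "((\<lambda>z. j11 z * j22 z - j12 z * j21 z) \<longlongrightarrow> d1 vs * (\<alpha> - \<delta>) * (2 * \<Omega> / (\<alpha> - \<delta>))) Fz"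
    by (simp add: C0 D0 A0 B0 mix_C_x algebra_simps add_divide_distrib diff_divide_distrib)
  have "d1 vs * (\<alpha> - \<delta>) * (2 * \<Omega> / (\<alpha> - \<delta>)) > 0"
    using d1_vs alpha_delta Om by simp
  from order_tendstoD(1)[OF dt this] have ev1: "eventually (\<lambda>z. j11 z * j22 z - j12 z * j21 z > 0) Fz" .
  have ev2: "eventually (\<lambda>z. T' z \<noteq> 0) Fz"
    by (rule tendsto_imp_eventually_ne[OF T_derivative(2)]) (use d1_vs lam in simp)
  have "eventually (\<lambda>z. j11 z * j22 z - j12 z * j21 z > 0 \<and> T' z \<noteq> 0) Fz"
    using ev1 ev2 by eventually_elim blast
  then obtain d where d: "d > 0" "\<And>\<epsilon> \<mu>. \<bar>\<epsilon>\<bar> < d \<Longrightarrow> \<bar>\<mu>\<bar> < d \<Longrightarrow>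
      j11 (\<epsilon>, \<mu>) * j22 (\<epsilon>, \<mu>) - j12 (\<epsilon>, \<mu>) * j21 (\<epsilon>, \<mu>) > 0 \<and> T' (\<epsilon>, \<mu>) \<noteq> 0"
    unfolding eventually_nhds_prod_0 by blast
  define m where "m = min (min d e\<^sub>0) (min d e\<^sub>0 / N)"
  have m: "m > 0" using d e0 N by (simp add: m_def)
  have "eventually (\<lambda>\<epsilon>. \<epsilon> \<in> {0<..<m}) (at_right 0)" using m by (rule eventually_at_right_real)
  then have "eventually (\<lambda>\<epsilon>. hopf_bifurcation (regularized_field Xp Xm \<phi> \<epsilon>) (E \<epsilon>) (\<mu>\<^sub>H \<epsilon>)) (at_right 0)"
    using mu
  proof eventually_elim
    case (elim \<epsilon>)
    define \<mu>\<^sub>0 where "\<mu>\<^sub>0 = \<mu>\<^sub>H \<epsilon>"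
    have e: "0 < \<epsilon>" "\<bar>\<epsilon>\<bar> < d" "\<bar>\<epsilon>\<bar> < e\<^sub>0" "N * \<epsilon> < min d e\<^sub>0"
      using elim(1) N by (auto simp: m_def field_simps)
    have m0: "\<bar>\<mu>\<^sub>0\<bar> < d" "\<bar>\<mu>\<^sub>0\<bar> < e\<^sub>0" "T (\<epsilon>, \<mu>\<^sub>0) = 0" using elim(2) e by (auto simp: \<mu>\<^sub>0_def)
    define a where "a \<mu> = J11 (v \<epsilon> \<mu>) (P (\<epsilon>, \<mu>)) / 2" for \<mu>
    define b where "b \<mu> = J12 \<epsilon> (v \<epsilon> \<mu>) (P (\<epsilon>, \<mu>)) / 2" for \<mu>
    define c where "c \<mu> = J21 (v \<epsilon> \<mu>) (P (\<epsilon>, \<mu>)) / 2" for \<mu>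
    define e' where "e' \<mu> = J22 \<epsilon> (v \<epsilon> \<mu>) (P (\<epsilon>, \<mu>)) / 2" for \<mu>
    have tr: "a \<mu> + e' \<mu> = T (\<epsilon>, \<mu>) / (2 * \<epsilon>)" for \<mu>
      using T_trace[OF e(1), of \<mu>] e(1) by (simp add: a_def e'_def)
    have det: "a \<mu> * e' \<mu> - b \<mu> * c \<mu> = (j11 (\<epsilon>, \<mu>) * j22 (\<epsilon>, \<mu>) - j12 (\<epsilon>, \<mu>) * j21 (\<epsilon>, \<mu>)) / (4 * \<epsilon>)" for \<mu>
    proof -
      have "j22 (\<epsilon>, \<mu>) = \<epsilon> * (2 * e' \<mu>)" "j12 (\<epsilon>, \<mu>) = \<epsilon> * (2 * b \<mu>)" "j11 (\<epsilon>, \<mu>) = 2 * a \<mu>" "j21 (\<epsilon>, \<mu>) = 2 * c \<mu>"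
        using e(1) by (simp_all add: j22_def j12_def j11_def j21_def a_def b_def c_def e'_def J11_def J12_def J21_def J22_def vv_def distrib_left)
      then show ?thesis using e(1) by (simp add: field_simps)
    qed
    have ediff: "\<exists>D. (h has_real_derivative D) (at \<mu>\<^sub>0)" if "h \<in> {a, b, c, e'}" for h
    proof -
      note cd = compose_derivs[OF e(3) m0(2)]
      have "\<exists>D. (a has_real_derivative D) (at \<mu>\<^sub>0)" "\<exists>D. (c has_real_derivative D) (at \<mu>\<^sub>0)"
        unfolding a_def[abs_def] c_def[abs_def] J11_def J21_def
        by (rule exI, rule DERIV_cdivide, rule cd(2), (rule sp)+)+
      moreover have "\<exists>D. (b has_real_derivative D) (at \<mu>\<^sub>0)"
        unfolding b_def[abs_def] J12_def
        by (rule exI, rule DERIV_cdivide, rule DERIV_add, rule cd(2), (rule sp)+, rule DERIV_cdivide,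
            rule DERIV_mult, rule cd(3), rule DERIV_diff, rule cd(1), rule smooth, rule cd(1), rule smooth)
      moreover have "\<exists>D. (e' has_real_derivative D) (at \<mu>\<^sub>0)"
        unfolding e'_def[abs_def] J22_def
        by (rule exI, rule DERIV_cdivide, rule DERIV_add, rule cd(2), (rule sp)+, rule DERIV_cdivide,
            rule DERIV_mult, rule cd(3), rule DERIV_diff, rule cd(1), rule smooth, rule cd(1), rule smooth)
      ultimately show ?thesis using that by auto
    qed
    obtain Da Db Dc De where D: "(a has_real_derivative Da) (at \<mu>\<^sub>0)" "(b has_real_derivative Db) (at \<mu>\<^sub>0)"
      "(c has_real_derivative Dc) (at \<mu>\<^sub>0)" "(e' has_real_derivative De) (at \<mu>\<^sub>0)"
      using ediff[of a] ediff[of b] ediff[of c] ediff[of e'] by auto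
    \<comment> \<open>The eigenvalue is t + i sqrt(s), with t half the trace and s the determinant
      minus t^2.\<close>
    define t where "t \<mu> = (a \<mu> + e' \<mu>) / 2" for \<mu>
    define s where "s \<mu> = a \<mu> * e' \<mu> - b \<mu> * c \<mu> - (t \<mu>)\<^sup>2" for \<mu>
    have t0: "t \<mu>\<^sub>0 = 0" using m0(3) by (simp add: t_def tr)
    have dt: "(t has_real_derivative T' (\<epsilon>, \<mu>\<^sub>0) / (2 * \<epsilon>) / 2) (at \<mu>\<^sub>0)"
      unfolding t_def[abs_def] tr by (intro DERIV_cdivide T_derivative(1) e(3) m0(2))
    have "\<exists>S. (s has_real_derivative S) (at \<mu>\<^sub>0)"
      unfolding s_def[abs_def]
      by (rule exI, rule DERIV_diff, rule DERIV_diff, rule DERIV_mult, rule D(1), rule D(4), rule DERIV_mult,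
          rule D(2), rule D(3), rule DERIV_power, rule dt)
    then obtain S where S: "(s has_real_derivative S) (at \<mu>\<^sub>0)" by blast
    have s0: "s \<mu>\<^sub>0 > 0" using d(2)[OF e(2) m0(1)] e(1) by (simp add: s_def t0 det)
    define l where "l \<mu> = complex_of_real (t \<mu>) + \<i> * complex_of_real (sqrt (s \<mu>))" for \<mu>
    have dl: "(l has_vector_derivative (complex_of_real (T' (\<epsilon>, \<mu>\<^sub>0) / (2 * \<epsilon>) / 2)
        + \<i> * complex_of_real (S * (inverse (sqrt (s \<mu>\<^sub>0)) / 2)))) (at \<mu>\<^sub>0)"
      unfolding l_def[abs_def]
      by (intro has_vector_derivative_add has_vector_derivative_mult_right has_vector_derivative_of_real)
        (use dt DERIV_chain2[OF DERIV_real_sqrt[OF s0] S] in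
          \<open>simp_all add: has_real_derivative_iff_has_vector_derivative mult.commute\<close>)
    have "isCont s \<mu>\<^sub>0" by (rule DERIV_isCont[OF S])
    then have "eventually (\<lambda>\<mu>. s \<mu> > 0) (nhds \<mu>\<^sub>0)"
      using s0 order_tendstoD(1)[of s "s \<mu>\<^sub>0" "nhds \<mu>\<^sub>0" 0] continuous_within tendsto_at_iff_tendsto_nhds[of s \<mu>\<^sub>0]
      by auto
    moreover have "eventually (\<lambda>\<mu>. \<bar>\<mu>\<bar> < e\<^sub>0) (nhds \<mu>\<^sub>0)"
    proof -
      have "eventually (\<lambda>\<mu>. \<mu> \<in> {-e\<^sub>0<..<e\<^sub>0}) (nhds \<mu>\<^sub>0)"
        using m0(2) by (intro eventually_nhds_in_open) auto
      then show ?thesis by eventually_elim auto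
    qed
    ultimately have ev: "eventually (\<lambda>\<mu>. regularized_field Xp Xm \<phi> \<epsilon> \<mu> (E \<epsilon> \<mu>) = 0 \<and>
        jacobian_eigenvalue (regularized_field Xp Xm \<phi> \<epsilon> \<mu>) (E \<epsilon> \<mu>) (l \<mu>)) (nhds \<mu>\<^sub>0)"
    proof eventually_elim
      case (elim \<mu>)
      have eq: "(x \<epsilon> \<mu>, \<epsilon> * v \<epsilon> \<mu>, \<mu>) \<in> U" "mix A B (v \<epsilon> \<mu>) (x \<epsilon> \<mu>, \<epsilon> * v \<epsilon> \<mu>, \<mu>) = 0"
        "mix C D (v \<epsilon> \<mu>) (x \<epsilon> \<mu>, \<epsilon> * v \<epsilon> \<mu>, \<mu>) = 0"
        using equi[OF e(3) elim(2)] by auto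
      have "regularized_field Xp Xm \<phi> \<epsilon> \<mu> (E \<epsilon> \<mu>) = 0"
        using eq e(1) by (simp add: E_def regularized_field_eq zero_prod_def)
      moreover have "jacobian_eigenvalue (regularized_field Xp Xm \<phi> \<epsilon> \<mu>) (E \<epsilon> \<mu>) (l \<mu>)"
      proof (rule jacobian_eigenvalueI)
        have y: "\<epsilon> * v \<epsilon> \<mu> / \<epsilon> = v \<epsilon> \<mu>" using e(1) by simp
        show "dx (\<lambda>q. fst (regularized_field Xp Xm \<phi> \<epsilon> \<mu> q)) (E \<epsilon> \<mu>) = a \<mu>"
          "dy (\<lambda>q. fst (regularized_field Xp Xm \<phi> \<epsilon> \<mu> q)) (E \<epsilon> \<mu>) = b \<mu>"
          "dx (\<lambda>q. snd (regularized_field Xp Xm \<phi> \<epsilon> \<mu> q)) (E \<epsilon> \<mu>) = c \<mu>"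
          "dy (\<lambda>q. snd (regularized_field Xp Xm \<phi> \<epsilon> \<mu> q)) (E \<epsilon> \<mu>) = e' \<mu>"
          unfolding E_def jacobian_entries[OF eq(1)] y a_def b_def c_def e'_def P_def prod.case by (rule refl)+
        \<comment> \<open>A triangular Jacobian would have real eigenvalues, whereas s > 0.\<close>
        show "b \<mu> \<noteq> 0"
        proof
          assume "b \<mu> = 0"
          then have "s \<mu> = - ((a \<mu> - e' \<mu>) / 2)\<^sup>2"
            by (simp add: s_def t_def power2_eq_square field_simps)
          then show False using elim(1) zero_le_power2[of "(a \<mu> - e' \<mu>) / 2"] by linarith
        qed
        have "(complex_of_real (sqrt (s \<mu>)))\<^sup>2 = complex_of_real (s \<mu>)"
          using elim(1) by (simp add: of_real_power[symmetric] del: of_real_power)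
        then have "(l \<mu>)\<^sup>2 = (complex_of_real (t \<mu>))\<^sup>2 + 2 * \<i> * complex_of_real (t \<mu>) * complex_of_real (sqrt (s \<mu>)) - complex_of_real (s \<mu>)"
          by (simp add: l_def power2_sum power_mult_distrib)
        moreover have "a \<mu> + e' \<mu> = 2 * t \<mu>" "a \<mu> * e' \<mu> - b \<mu> * c \<mu> = s \<mu> + (t \<mu>)\<^sup>2" by (simp_all add: t_def s_def)
        ultimately show "(l \<mu>)\<^sup>2 - complex_of_real (a \<mu> + e' \<mu>) * l \<mu> + complex_of_real (a \<mu> * e' \<mu> - b \<mu> * c \<mu>) = 0"
          by (simp add: l_def power2_eq_square algebra_simps)
      qed
      ultimately show ?case by blast
    qed
    have "Re (l \<mu>\<^sub>0) = 0" "Im (l \<mu>\<^sub>0) > 0" using t0 s0 by (simp_all add: l_def)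
    moreover have "Re (complex_of_real (T' (\<epsilon>, \<mu>\<^sub>0) / (2 * \<epsilon>) / 2)
        + \<i> * complex_of_real (S * (inverse (sqrt (s \<mu>\<^sub>0)) / 2))) \<noteq> 0"
      using d(2)[OF e(2) m0(1)] e(1) by simp
    ultimately show ?case
      unfolding hopf_bifurcation_def \<mu>\<^sub>0_def[symmetric] using ev dl by blast
  qed
  then show ?thesis
    unfolding hopf_of_family_def using equilibrium_family_branch O by blast
qed

end

lemma (in pws) hopf_of_family_exists: "\<exists>E \<mu>\<^sub>H. hopf_of_family \<alpha> \<beta> \<delta> Xp Xm \<phi> E \<mu>\<^sub>H"
proof (rule equilibrium_branch)
  fix e\<^sub>0 x v
  assume "branch \<alpha> \<beta> \<delta> \<zeta>p \<zeta>m \<eta>p \<eta>m \<chi>p \<chi>m A B C D U \<phi> k e\<^sub>0 x v"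
  then interpret b: branch \<alpha> \<beta> \<delta> \<zeta>p \<zeta>m \<eta>p \<eta>m \<chi>p \<chi>m A B C D U \<phi> k e\<^sub>0 x v .
  show ?thesis using b.hopf_of_family_branch by blast
qed

section \<open>The first Lyapunov coefficient in terms of partial derivatives\<close>

text \<open>\<open>F i j\<close> is the derivative obtained by differentiating \<open>j\<close> times in the second variable and then
  \<open>i\<close> times in the first one; no other order of differentiation occurs in \<open>normal_form_lyapunov\<close>.\<close>

definition jet :: "(real \<times> real) set \<Rightarrow> (nat \<Rightarrow> nat \<Rightarrow> real \<times> real \<Rightarrow> real) \<Rightarrow> bool" where
  "jet N F \<longleftrightarrow> (\<forall>i j a b. i + j < 3 \<longrightarrow> (a, b) \<in> N \<longrightarrow>
     ((\<lambda>t. F i j (t, b)) has_real_derivative F (Suc i) j (a, b)) (at a) \<and>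
     (i = 0 \<longrightarrow> ((\<lambda>t. F i j (a, t)) has_real_derivative F i (Suc j) (a, b)) (at b)))"

lemma open_slice:
  assumes "open (N :: (real \<times> real) set)"
  shows "open {t. (t, b) \<in> N}" "open {t. (a, t) \<in> N}"
proof -
  have "open ((\<lambda>t. (t, b)) -` N)" "open ((\<lambda>t. (a, t)) -` N)"
    by (intro open_vimage assms continuous_intros)+
  then show "open {t. (t, b) \<in> N}" "open {t. (a, t) \<in> N}" by (simp_all add: vimage_def)
qed

text \<open>Agreement of h with a member of the jet on all of N is inherited by \<open>dx h\<close>,
  so the lemma can be iterated.\<close>

lemma jet_dx:
  assumes "open N" "jet N F" "i + j < 3" "\<And>z. z \<in> N \<Longrightarrow> h z = F i j z" "z \<in> N"
  shows "dx h z = F (Suc i) j z"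
proof -
  obtain a b where z: "z = (a, b)" by (cases z)
  have "((\<lambda>t. F i j (t, b)) has_real_derivative F (Suc i) j (a, b)) (at a)"
    using assms(2,3,5) unfolding jet_def z by blast
  then have "((\<lambda>t. h (t, b)) has_real_derivative F (Suc i) j (a, b)) (at a)"
    by (rule has_field_derivative_transform_within_open[OF _ open_slice(1)[OF assms(1), of b]])
      (use assms(4,5) in \<open>auto simp: z\<close>)
  then show ?thesis by (simp add: dx_def z DERIV_imp_deriv)
qed

lemma jet_dy:
  assumes "open N" "jet N F" "j < 3" "\<And>z. z \<in> N \<Longrightarrow> h z = F 0 j z" "z \<in> N"
  shows "dy h z = F 0 (Suc j) z"
proof -
  obtain a b where z: "z = (a, b)" by (cases z)
  have "((\<lambda>t. F 0 j (a, t)) has_real_derivative F 0 (Suc j) (a, b)) (at b)"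
    using assms(2,3,5) unfolding jet_def z by (metis add_0)
  then have "((\<lambda>t. h (a, t)) has_real_derivative F 0 (Suc j) (a, b)) (at b)"
    by (rule has_field_derivative_transform_within_open[OF _ open_slice(2)[OF assms(1), of a]])
      (use assms(4,5) in \<open>auto simp: z\<close>)
  then show ?thesis by (simp add: dy_def z DERIV_imp_deriv)
qed

lemma jet_partials:
  assumes "open N" "jet N F" "\<And>z. z \<in> N \<Longrightarrow> h z = F 0 0 z" "z \<in> N"
  shows "dx (dx h) z = F 2 0 z" "dx (dy h) z = F 1 1 z" "dy (dy h) z = F 0 2 z"
    "dx (dx (dx h)) z = F 3 0 z" "dx (dy (dy h)) z = F 1 2 z" "dx (dx (dy h)) z = F 2 1 z"
    "dy (dy (dy h)) z = F 0 3 z"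
proof -
  note X = jet_dx[OF assms(1,2)] and Y = jet_dy[OF assms(1,2)]
  have x: "dx h z = F (Suc 0) 0 z" if "z \<in> N" for z by (rule X) (use assms(3) that in auto)
  have xx: "dx (dx h) z = F (Suc (Suc 0)) 0 z" if "z \<in> N" for z by (rule X) (use x that in auto)
  have xxx: "dx (dx (dx h)) z = F (Suc (Suc (Suc 0))) 0 z" if "z \<in> N" for z by (rule X) (use xx that in auto)
  have y: "dy h z = F 0 (Suc 0) z" if "z \<in> N" for z by (rule Y) (use assms(3) that in auto)
  have yy: "dy (dy h) z = F 0 (Suc (Suc 0)) z" if "z \<in> N" for z by (rule Y) (use y that in auto)
  have yyy: "dy (dy (dy h)) z = F 0 (Suc (Suc (Suc 0))) z" if "z \<in> N" for z by (rule Y) (use yy that in auto)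
  have xy: "dx (dy h) z = F (Suc 0) (Suc 0) z" if "z \<in> N" for z by (rule X) (use y that in auto)
  have xxy: "dx (dx (dy h)) z = F (Suc (Suc 0)) (Suc 0) z" if "z \<in> N" for z by (rule X) (use xy that in auto)
  have xyy: "dx (dy (dy h)) z = F (Suc 0) (Suc (Suc 0)) z" if "z \<in> N" for z by (rule X) (use yy that in auto)
  show "dx (dx h) z = F 2 0 z" "dx (dy h) z = F 1 1 z" "dy (dy h) z = F 0 2 z"
    "dx (dx (dx h)) z = F 3 0 z" "dx (dy (dy h)) z = F 1 2 z" "dx (dx (dy h)) z = F 2 1 z"
    "dy (dy (dy h)) z = F 0 3 z"
    using xx xxx yy yyy xy xxy xyy assms(4) by (simp_all add: numeral_2_eq_2 numeral_3_eq_3)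
qed

text \<open>Serves the linear change of coordinates in \<open>first_lyapunov\<close>, which combines
  the two components of the field.\<close>

lemma jet_linear_combination:
  assumes "jet N F" "jet N G"
  shows "jet N (\<lambda>i j z. (c * F i j z + d * G i j z) / \<omega>)"
  unfolding jet_def
proof (intro allI impI conjI)
  fix i j :: nat and a b :: real
  assume ij: "i + j < 3" and ab: "(a, b) \<in> N"
  have "((\<lambda>t. F i j (t, b)) has_real_derivative F (Suc i) j (a, b)) (at a)"
    "((\<lambda>t. G i j (t, b)) has_real_derivative G (Suc i) j (a, b)) (at a)"
    using assms ij ab unfolding jet_def by blast+
  then show "((\<lambda>t. (c * F i j (t, b) + d * G i j (t, b)) / \<omega>) has_real_derivative
      (c * F (Suc i) j (a, b) + d * G (Suc i) j (a, b)) / \<omega>) (at a)"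
    by (intro DERIV_cdivide DERIV_add DERIV_cmult)
  assume "i = 0"
  then have "((\<lambda>t. F i j (a, t)) has_real_derivative F i (Suc j) (a, b)) (at b)"
    "((\<lambda>t. G i j (a, t)) has_real_derivative G i (Suc j) (a, b)) (at b)"
    using assms ij ab unfolding jet_def by blast+
  then show "((\<lambda>t. (c * F i j (a, t) + d * G i j (a, t)) / \<omega>) has_real_derivative
      (c * F i (Suc j) (a, b) + d * G i (Suc j) (a, b)) / \<omega>) (at b)"
    by (intro DERIV_cdivide DERIV_add DERIV_cmult)
qed

definition lyapunov_form :: "real \<Rightarrow> (nat \<Rightarrow> nat \<Rightarrow> real) \<Rightarrow> (nat \<Rightarrow> nat \<Rightarrow> real) \<Rightarrow> real" where
  "lyapunov_form \<omega> F G = (F 3 0 + F 1 2 + G 2 1 + G 0 3) / 16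
     + (F 1 1 * (F 2 0 + F 0 2) - G 1 1 * (G 2 0 + G 0 2) - F 2 0 * G 2 0 + F 0 2 * G 0 2) / (16 * \<omega>)"

lemma normal_form_lyapunov_jets:
  assumes "open N" "(0, 0) \<in> N" "jet N F" "jet N G"
    "\<And>z. z \<in> N \<Longrightarrow> fst (V z) = F 0 0 z" "\<And>z. z \<in> N \<Longrightarrow> snd (V z) = G 0 0 z"
  shows "normal_form_lyapunov \<omega> V = lyapunov_form \<omega> (\<lambda>i j. F i j (0, 0)) (\<lambda>i j. G i j (0, 0))"
  using jet_partials[OF assms(1,3,5,2)] jet_partials[OF assms(1,4,6,2)]
  by (simp add: normal_form_lyapunov_def lyapunov_form_def Let_def)

text \<open>\<open>D1\<close> and \<open>D2\<close> are the derivatives along the coordinates w and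
  v of the affine map \<open>aff\<close>, with the powers s and s^2 of s = sqrt(\<epsilon>) split
  off.\<close>

definition D1 :: "real \<Rightarrow> (real \<times> real \<times> real \<Rightarrow> real) \<Rightarrow> real \<times> real \<times> real \<Rightarrow> real" where
  "D1 a h p = a * px h p"

definition D2 :: "real \<Rightarrow> (real \<times> real \<times> real \<Rightarrow> real) \<Rightarrow> real \<times> real \<times> real \<Rightarrow> real" where
  "D2 b h p = b * px h p + py h p"

definition DD :: "real \<Rightarrow> real \<Rightarrow> nat \<Rightarrow> nat \<Rightarrow> (real \<times> real \<times> real \<Rightarrow> real) \<Rightarrow> real \<times> real \<times> real \<Rightarrow> real" where
  "DD a b i j h = (D1 a ^^ i) ((D2 b ^^ j) h)"

lemma DD_Suc: "DD a b (Suc i) j h = D1 a (DD a b i j h)" "DD a b 0 (Suc j) h = D2 b (DD a b 0 j h)"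
  "DD a b 0 0 h = h"
  by (simp_all add: DD_def)

lemma smooth_DD:
  assumes "open U" "Ck_on \<infinity> U h"
  shows "Ck_on \<infinity> U (DD a b i j h)"
proof (induction i)
  case 0
  show ?case
  proof (induction j)
    case (Suc j)
    show ?case
      unfolding DD_Suc(2) D2_def[abs_def]
      by (intro smooth_add smooth_mult smooth_const smooth_partial Suc.IH assms(1))
  qed (simp add: DD_Suc assms)
next
  case (Suc i)
  show ?case
    unfolding DD_Suc(1) D1_def[abs_def]
    by (intro smooth_mult smooth_const smooth_partial Suc.IH assms(1))
qed

context pws
begin

text \<open>The coordinates (w, v) of \<open>first_lyapunov\<close> composed with the rescaling x =
  s u, y = s^2 v, where s = sqrt(\<epsilon>).\<close>

definition aff where
  "aff x\<^sub>0 y\<^sub>0 \<mu> s a b z = (x\<^sub>0 + s * a * fst z + s\<^sup>2 * b * snd z, y\<^sub>0 + s\<^sup>2 * snd z, \<mu>)"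

lemma aff_derivatives:
  assumes "Ck_on \<infinity> U h" "aff x\<^sub>0 y\<^sub>0 \<mu> s a b (w, v) \<in> U"
  shows "((\<lambda>t. h (aff x\<^sub>0 y\<^sub>0 \<mu> s a b (t, v))) has_real_derivative s * D1 a h (aff x\<^sub>0 y\<^sub>0 \<mu> s a b (w, v))) (at w)"
    "((\<lambda>t. h (aff x\<^sub>0 y\<^sub>0 \<mu> s a b (w, t))) has_real_derivative s\<^sup>2 * D2 b h (aff x\<^sub>0 y\<^sub>0 \<mu> s a b (w, v))) (at v)"
proof -
  have u: "(x\<^sub>0 + s * a * w + s\<^sup>2 * b * v, y\<^sub>0 + s\<^sup>2 * v, \<mu>) \<in> U" using assms(2) by (simp add: aff_def)
  have 1: "((\<lambda>t. x\<^sub>0 + s * a * t + s\<^sup>2 * b * v) has_real_derivative s * a) (at w)"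
    "((\<lambda>t. x\<^sub>0 + s * a * w + s\<^sup>2 * b * t) has_real_derivative s\<^sup>2 * b) (at v)"
    "((\<lambda>t. y\<^sub>0 + s\<^sup>2 * t) has_real_derivative s\<^sup>2) (at v)"
    by (auto intro!: derivative_eq_intros)
  show "((\<lambda>t. h (aff x\<^sub>0 y\<^sub>0 \<mu> s a b (t, v))) has_real_derivative s * D1 a h (aff x\<^sub>0 y\<^sub>0 \<mu> s a b (w, v))) (at w)"
    unfolding aff_def fst_conv snd_conv
    by (rule DERIV_cong[OF has_real_derivative_smooth_compose[OF assms(1) u 1(1) DERIV_const DERIV_const]])
      (simp add: D1_def algebra_simps)
  show "((\<lambda>t. h (aff x\<^sub>0 y\<^sub>0 \<mu> s a b (w, t))) has_real_derivative s\<^sup>2 * D2 b h (aff x\<^sub>0 y\<^sub>0 \<mu> s a b (w, v))) (at v)"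
    unfolding aff_def fst_conv snd_conv
    by (rule DERIV_cong[OF has_real_derivative_smooth_compose[OF assms(1) u 1(2,3) DERIV_const]])
      (simp add: D2_def algebra_simps)
qed

text \<open>Leibniz's rule for (f + g) + \<phi> (f - g): j derivatives in v are distributed over
  \<phi> and f - g, while the i derivatives in w do not touch \<phi>.\<close>

definition mixjet where
  "mixjet p f g v\<^sub>0 s a b i j z = s ^ i * (s ^ (2 * j) * (DD a b i j f (p z) + DD a b i j g (p z))
     + (\<Sum>l\<le>j. real (j choose l) * (deriv ^^ (j - l)) \<phi> (v\<^sub>0 + snd z) * s ^ (2 * l) * (DD a b i l f (p z) - DD a b i l g (p z))))"

lemma jet_mixjet:
  fixes f g :: "real \<times> real \<times> real \<Rightarrow> real"
  assumes "Ck_on \<infinity> U f" "Ck_on \<infinity> U g"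
  shows "jet {z. aff x\<^sub>0 y\<^sub>0 \<mu> s a b z \<in> U} (mixjet (aff x\<^sub>0 y\<^sub>0 \<mu> s a b) f g v\<^sub>0 s a b)"
  unfolding jet_def
proof (intro allI impI conjI)
  fix i j :: nat and w v :: real
  let ?p = "aff x\<^sub>0 y\<^sub>0 \<mu> s a b"
  assume ij: "i + j < 3" and "(w, v) \<in> {z. ?p z \<in> U}"
  then have u: "?p (w, v) \<in> U" by simp
  have f1: "((\<lambda>t. DD a b i l h (?p (t, v))) has_real_derivative s * DD a b (Suc i) l h (?p (w, v))) (at w)"
    if "Ck_on \<infinity> U h" for h l
    unfolding DD_Suc(1) by (rule aff_derivatives(1)[OF smooth_DD[OF openU that] u])
  have "((\<lambda>t. mixjet ?p f g v\<^sub>0 s a b i j (t, v)) has_real_derivative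
     s ^ i * (s ^ (2 * j) * (s * DD a b (Suc i) j f (?p (w, v)) + s * DD a b (Suc i) j g (?p (w, v)))
     + (\<Sum>l\<le>j. real (j choose l) * (deriv ^^ (j - l)) \<phi> (v\<^sub>0 + v) * s ^ (2 * l) *
          (s * DD a b (Suc i) l f (?p (w, v)) - s * DD a b (Suc i) l g (?p (w, v)))))) (at w)"
    unfolding mixjet_def snd_conv
    by (intro DERIV_cmult DERIV_add DERIV_sum DERIV_diff f1 assms)
  then show "((\<lambda>t. mixjet ?p f g v\<^sub>0 s a b i j (t, v)) has_real_derivative mixjet ?p f g v\<^sub>0 s a b (Suc i) j (w, v)) (at w)"
    by (rule DERIV_cong) (simp add: mixjet_def algebra_simps sum_distrib_left)
  assume i: "i = 0"
  have f2: "((\<lambda>t. DD a b 0 l h (?p (w, t))) has_real_derivative s\<^sup>2 * DD a b 0 (Suc l) h (?p (w, v))) (at v)"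
    if "Ck_on \<infinity> U h" for h l
    unfolding DD_Suc(2) by (rule aff_derivatives(2)[OF smooth_DD[OF openU that] u])
  have ph: "((\<lambda>t. (deriv ^^ n) \<phi> (v\<^sub>0 + t)) has_real_derivative (deriv ^^ Suc n) \<phi> (v\<^sub>0 + v)) (at v)" if "n < 3" for n
    by (rule DERIV_cong[OF DERIV_chain2[OF Cn_on_higher_deriv(1)[OF phi_C3 that] DERIV_add[OF DERIV_const DERIV_ident]]]) simp
  have "((\<lambda>t. mixjet ?p f g v\<^sub>0 s a b 0 j (w, t)) has_real_derivative
     s ^ 0 * (s ^ (2 * j) * (s\<^sup>2 * DD a b 0 (Suc j) f (?p (w, v)) + s\<^sup>2 * DD a b 0 (Suc j) g (?p (w, v)))
     + (\<Sum>l\<le>j. (real (j choose l) * (deriv ^^ Suc (j - l)) \<phi> (v\<^sub>0 + v) * s ^ (2 * l)) *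
          (DD a b 0 l f (?p (w, v)) - DD a b 0 l g (?p (w, v)))
        + (s\<^sup>2 * DD a b 0 (Suc l) f (?p (w, v)) - s\<^sup>2 * DD a b 0 (Suc l) g (?p (w, v)))
          * (real (j choose l) * (deriv ^^ (j - l)) \<phi> (v\<^sub>0 + v) * s ^ (2 * l))))) (at v)"
    unfolding mixjet_def snd_conv
    using ij by (intro DERIV_cmult DERIV_add DERIV_sum DERIV_mult DERIV_diff DERIV_cmult_right f2 assms ph) auto
  \<comment> \<open>In these few cases the recursion of the binomial coefficients is checked by
    expansion.\<close>
  moreover consider "j = 0" | "j = 1" | "j = 2" using ij by linarith
  then have "s ^ 0 * (s ^ (2 * j) * (s\<^sup>2 * DD a b 0 (Suc j) f (?p (w, v)) + s\<^sup>2 * DD a b 0 (Suc j) g (?p (w, v)))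
     + (\<Sum>l\<le>j. (real (j choose l) * (deriv ^^ Suc (j - l)) \<phi> (v\<^sub>0 + v) * s ^ (2 * l)) *
          (DD a b 0 l f (?p (w, v)) - DD a b 0 l g (?p (w, v)))
        + (s\<^sup>2 * DD a b 0 (Suc l) f (?p (w, v)) - s\<^sup>2 * DD a b 0 (Suc l) g (?p (w, v)))
          * (real (j choose l) * (deriv ^^ (j - l)) \<phi> (v\<^sub>0 + v) * s ^ (2 * l))))
     = mixjet ?p f g v\<^sub>0 s a b 0 (Suc j) (w, v)"
    by cases (simp_all add: mixjet_def numeral_2_eq_2 power2_eq_square algebra_simps)
  ultimately show "((\<lambda>t. mixjet ?p f g v\<^sub>0 s a b i j (w, t)) has_real_derivative mixjet ?p f g v\<^sub>0 s a b i (Suc j) (w, v)) (at v)"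
    unfolding i by (rule DERIV_cong)
qed

text \<open>The jet \<open>mixjet\<close> at the origin of the coordinates (w, v), with p the base
  point.\<close>

definition mj where
  "mj f g v\<^sub>0 p s a b i j = s ^ i * (s ^ (2 * j) * (DD a b i j f p + DD a b i j g p)
     + (\<Sum>l\<le>j. real (j choose l) * (deriv ^^ (j - l)) \<phi> v\<^sub>0 * s ^ (2 * l) * (DD a b i l f p - DD a b i l g p)))"

lemma mj_simps:
  "mj f g v p s a b 2 0 = s\<^sup>2 * mix (DD a b 2 0 f) (DD a b 2 0 g) v p"
  "mj f g v p s a b 3 0 = s ^ 3 * mix (DD a b 3 0 f) (DD a b 3 0 g) v p"
  "mj f g v p s a b 1 1 = s * (s\<^sup>2 * mix (DD a b 1 1 f) (DD a b 1 1 g) v p + d1 v * (DD a b 1 0 f p - DD a b 1 0 g p))"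
  "mj f g v p s a b 0 2 = s ^ 4 * mix (DD a b 0 2 f) (DD a b 0 2 g) v p + 2 * d1 v * s\<^sup>2 * (DD a b 0 1 f p - DD a b 0 1 g p)
     + d2 v * (f p - g p)"
  "mj f g v p s a b 2 1 = s\<^sup>2 * (s\<^sup>2 * mix (DD a b 2 1 f) (DD a b 2 1 g) v p + d1 v * (DD a b 2 0 f p - DD a b 2 0 g p))"
  "mj f g v p s a b 1 2 = s * (s ^ 4 * mix (DD a b 1 2 f) (DD a b 1 2 g) v p + 2 * d1 v * s\<^sup>2 * (DD a b 1 1 f p - DD a b 1 1 g p)
     + d2 v * (DD a b 1 0 f p - DD a b 1 0 g p))"
  "mj f g v p s a b 0 3 = s ^ 6 * mix (DD a b 0 3 f) (DD a b 0 3 g) v p + 3 * d1 v * s ^ 4 * (DD a b 0 2 f p - DD a b 0 2 g p)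
     + 3 * d2 v * s\<^sup>2 * (DD a b 0 1 f p - DD a b 0 1 g p) + d3 v * (f p - g p)"
proof -
  have "s ^ 4 = s * (s * (s * s))" "s ^ 6 = s * (s * (s * (s * (s * s))))"
    by (simp_all add: eval_nat_numeral)
  then show "mj f g v p s a b 2 0 = s\<^sup>2 * mix (DD a b 2 0 f) (DD a b 2 0 g) v p"
    "mj f g v p s a b 3 0 = s ^ 3 * mix (DD a b 3 0 f) (DD a b 3 0 g) v p"
    "mj f g v p s a b 1 1 = s * (s\<^sup>2 * mix (DD a b 1 1 f) (DD a b 1 1 g) v p + d1 v * (DD a b 1 0 f p - DD a b 1 0 g p))"
    "mj f g v p s a b 0 2 = s ^ 4 * mix (DD a b 0 2 f) (DD a b 0 2 g) v p + 2 * d1 v * s\<^sup>2 * (DD a b 0 1 f p - DD a b 0 1 g p)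
       + d2 v * (f p - g p)"
    "mj f g v p s a b 2 1 = s\<^sup>2 * (s\<^sup>2 * mix (DD a b 2 1 f) (DD a b 2 1 g) v p + d1 v * (DD a b 2 0 f p - DD a b 2 0 g p))"
    "mj f g v p s a b 1 2 = s * (s ^ 4 * mix (DD a b 1 2 f) (DD a b 1 2 g) v p + 2 * d1 v * s\<^sup>2 * (DD a b 1 1 f p - DD a b 1 1 g p)
       + d2 v * (DD a b 1 0 f p - DD a b 1 0 g p))"
    "mj f g v p s a b 0 3 = s ^ 6 * mix (DD a b 0 3 f) (DD a b 0 3 g) v p + 3 * d1 v * s ^ 4 * (DD a b 0 2 f p - DD a b 0 2 g p)
       + 3 * d2 v * s\<^sup>2 * (DD a b 0 1 f p - DD a b 0 1 g p) + d3 v * (f p - g p)"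
    by (simp_all add: mj_def mix_def DD_Suc(3) numeral_2_eq_2 numeral_3_eq_3 algebra_simps)
qed

text \<open>With s = sqrt(\<epsilon>), rescaling turns the Jacobian into (s \<open>J11\<close>,
  \<epsilon> \<open>J12\<close>; c, s d). The normalizing coordinates become the affine map
  \<open>aff\<close> with coefficients \<open>\<omega> / c\<close> and \<open>- d / c\<close>, and
  the derivatives are read off the jets.\<close>

lemma first_lyapunov_rescaled:
  assumes e: "\<epsilon> > 0" and u: "(x\<^sub>0, y\<^sub>0, \<mu>) \<in> U"
  defines "s \<equiv> sqrt \<epsilon>" and "v \<equiv> y\<^sub>0 / \<epsilon>" and "p \<equiv> (x\<^sub>0, y\<^sub>0, \<mu>)"
  defines "c \<equiv> J21 v p" and "d \<equiv> J22 \<epsilon> v p"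
  defines "\<omega> \<equiv> sqrt (\<epsilon> * J11 v p * d - \<epsilon> * J12 \<epsilon> v p * c)"
  assumes c: "c \<noteq> 0"
  shows "first_lyapunov (rescaled_field Xp Xm \<phi> \<epsilon> \<mu>) (x\<^sub>0 / sqrt \<epsilon>, y\<^sub>0 / \<epsilon>) =
    lyapunov_form \<omega>
      (\<lambda>i j. (c * mj A B v p s (\<omega> / c) (- d / c) i j + s * d * (mj C D v p s (\<omega> / c) (- d / c) i j / s)) / \<omega>)
      (\<lambda>i j. mj C D v p s (\<omega> / c) (- d / c) i j / s)"
proof -
  have s: "s > 0" "s\<^sup>2 = \<epsilon>" "s * s = \<epsilon>" using e by (simp_all add: s_def)
  let ?V = "rescaled_field Xp Xm \<phi> \<epsilon> \<mu>"
  have V: "?V (q1, q2) = (mix A B q2 (s * q1, \<epsilon> * q2, \<mu>), mix C D q2 (s * q1, \<epsilon> * q2, \<mu>) / s)" for q1 q2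
    using e by (simp add: rescaled_field_def regularized_field_eq Let_def s_def)
  have u': "(s * (x\<^sub>0 / s), \<epsilon> * (y\<^sub>0 / \<epsilon>), \<mu>) \<in> U" using u s e by simp
  have sx: "s * (x\<^sub>0 / s) = x\<^sub>0" "\<epsilon> * (y\<^sub>0 / \<epsilon>) = y\<^sub>0" using s e by auto
  have D: "((\<lambda>t. mix f g (y\<^sub>0 / \<epsilon>) (s * t, \<epsilon> * (y\<^sub>0 / \<epsilon>), \<mu>)) has_real_derivative s * mix (px f) (px g) v p) (at (x\<^sub>0 / s))"
    "((\<lambda>t. mix f g t (s * (x\<^sub>0 / s), \<epsilon> * t, \<mu>)) has_real_derivative
       \<epsilon> * mix (py f) (py g) v p + d1 v * (f p - g p)) (at (y\<^sub>0 / \<epsilon>))" if "Ck_on \<infinity> U f" "Ck_on \<infinity> U g" for f g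
    subgoal
      by (rule DERIV_cong[OF mix_has_real_derivative[OF that _ DERIV_cmult[OF DERIV_ident] DERIV_const DERIV_const DERIV_const]])
        (use u' s e in \<open>simp_all add: v_def p_def\<close>)
    subgoal
      by (rule DERIV_cong[OF mix_has_real_derivative[OF that _ DERIV_const DERIV_cmult[OF DERIV_ident] DERIV_const DERIV_ident]])
        (use u' s e in \<open>simp_all add: v_def p_def\<close>)
    done
  let ?q = "(x\<^sub>0 / s, y\<^sub>0 / \<epsilon>)"
  have fx: "dx (\<lambda>q. fst (?V q)) ?q = s * J11 v p"
    unfolding dx_def prod.case V fst_conv J11_def by (rule DERIV_imp_deriv[OF D(1)[OF smooth(1,2)]])
  have fy: "dy (\<lambda>q. fst (?V q)) ?q = \<epsilon> * J12 \<epsilon> v p"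
    unfolding dy_def prod.case V fst_conv J12_def
    by (rule DERIV_imp_deriv[OF DERIV_cong[OF D(2)[OF smooth(1,2)]]]) (use e in \<open>simp add: distrib_left\<close>)
  have gx: "dx (\<lambda>q. snd (?V q)) ?q = c"
    unfolding dx_def prod.case V snd_conv c_def J21_def
    by (rule DERIV_imp_deriv[OF DERIV_cong[OF DERIV_cdivide[OF D(1)[OF smooth(3,4)]]]]) (use s in simp)
  have gy: "dy (\<lambda>q. snd (?V q)) ?q = s * d"
    unfolding dy_def prod.case V snd_conv d_def J22_def
  proof (rule DERIV_imp_deriv[OF DERIV_cong[OF DERIV_cdivide[OF D(2)[OF smooth(3,4)]]]])
    have "(s * s * m + k) / s = s * (m + k / (s * s))" for m k
      using s(1) by (simp add: field_simps)
    then show "(\<epsilon> * mix (py C) (py D) v p + d1 v * (C p - D p)) / s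
        = s * (mix (py C) (py D) v p + d1 v * (C p - D p) / \<epsilon>)"
      unfolding s(3) .
  qed
  have om: "sqrt (s * J11 v p * (s * d) - \<epsilon> * J12 \<epsilon> v p * c) = \<omega>"
  proof -
    have "s * J11 v p * (s * d) = \<epsilon> * J11 v p * d" unfolding s(3)[symmetric] by (simp add: mult_ac)
    then show ?thesis by (simp add: \<omega>_def)
  qed
  let ?a = "\<omega> / c" and ?b = "- d / c"
  let ?aff = "aff x\<^sub>0 y\<^sub>0 \<mu> s ?a ?b"
  let ?N = "{z. ?aff z \<in> U}"
  have oN: "open ?N"
  proof -
    have "open (?aff -` U)"
      unfolding aff_def by (intro open_vimage openU continuous_intros)
    then show ?thesis by (simp add: vimage_def)
  qed
  have zN: "(0, 0) \<in> ?N" using u by (simp add: aff_def)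
  let ?MA = "mixjet ?aff A B v s ?a ?b" and ?MC = "mixjet ?aff C D v s ?a ?b"
  have jA: "jet ?N ?MA" and jC: "jet ?N ?MC" by (rule jet_mixjet smooth)+
  have jC': "jet ?N (\<lambda>i j z. ?MC i j z / s)"
    using jet_linear_combination[OF jC jC, of 1 0 s] by simp
  have jF: "jet ?N (\<lambda>i j z. (c * ?MA i j z + s * d * (?MC i j z / s)) / \<omega>)"
    by (rule jet_linear_combination[OF jA jC'])
  have m00: "mixjet q f g w s a b 0 0 z = mix f g (w + snd z) (q z)"
    for q :: "real \<times> real \<Rightarrow> real \<times> real \<times> real" and f g w a b z
    by (simp add: mixjet_def mix_def DD_Suc(3) algebra_simps)
  have q: "(s * (x\<^sub>0 / s + (\<omega> * w - s * d * t) / c), \<epsilon> * (y\<^sub>0 / \<epsilon> + t), \<mu>) = ?aff (w, t)" for w t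
  proof -
    have "s * (x\<^sub>0 / s + (\<omega> * w - s * d * t) / c) = x\<^sub>0 + s * ?a * w + s\<^sup>2 * ?b * t"
      using s(1) by (simp add: distrib_left power2_eq_square diff_divide_distrib right_diff_distrib)
    moreover have "\<epsilon> * (y\<^sub>0 / \<epsilon> + t) = y\<^sub>0 + s\<^sup>2 * t" using s e by (simp add: distrib_left)
    ultimately show ?thesis by (simp add: aff_def)
  qed
  have "first_lyapunov ?V ?q = normal_form_lyapunov \<omega> (\<lambda>(w, t). let q = (x\<^sub>0 / s + (\<omega> * w - s * d * t) / c, y\<^sub>0 / \<epsilon> + t)
         in ((c * fst (?V q) + s * d * snd (?V q)) / \<omega>, snd (?V q)))"
    unfolding first_lyapunov_def Let_def fx fy gx gy om fst_conv snd_conv by (rule refl)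
  also have "\<dots> = lyapunov_form \<omega> (\<lambda>i j. (c * ?MA i j (0, 0) + s * d * (?MC i j (0, 0) / s)) / \<omega>) (\<lambda>i j. ?MC i j (0, 0) / s)"
    by (rule normal_form_lyapunov_jets[OF oN zN jF jC'])
      (auto simp: Let_def V q m00 v_def)
  also have "\<dots> = lyapunov_form \<omega>
      (\<lambda>i j. (c * mj A B v p s ?a ?b i j + s * d * (mj C D v p s ?a ?b i j / s)) / \<omega>)
      (\<lambda>i j. mj C D v p s ?a ?b i j / s)"
    by (simp add: mixjet_def mj_def aff_def p_def)
  finally show ?thesis by (simp only: s_def)
qed

end

section \<open>Asymptotics of the first Lyapunov coefficient\<close>

text \<open>Convergence with rate r. Limits alone would give only the little-o form of the
  expansion; carrying one rate through the computation gives both forms.\<close>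

definition ap :: "(real \<Rightarrow> real) \<Rightarrow> (real \<Rightarrow> real) \<Rightarrow> real \<Rightarrow> bool" where
  "ap r X L \<longleftrightarrow> (\<lambda>\<epsilon>. X \<epsilon> - L) \<in> O[at_right 0](r)"

lemma ap_const: "ap r (\<lambda>_. c) c"
  by (simp add: ap_def)

lemma ap_add: "ap r X L \<Longrightarrow> ap r Y M \<Longrightarrow> ap r (\<lambda>\<epsilon>. X \<epsilon> + Y \<epsilon>) (L + M)"
  using sum_in_bigo(1)[of "\<lambda>\<epsilon>. X \<epsilon> - L" "at_right 0" r "\<lambda>\<epsilon>. Y \<epsilon> - M"]
  by (simp add: ap_def algebra_simps)

lemma ap_diff: "ap r X L \<Longrightarrow> ap r Y M \<Longrightarrow> ap r (\<lambda>\<epsilon>. X \<epsilon> - Y \<epsilon>) (L - M)"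
  using sum_in_bigo(2)[of "\<lambda>\<epsilon>. X \<epsilon> - L" "at_right 0" r "\<lambda>\<epsilon>. Y \<epsilon> - M"]
  by (simp add: ap_def algebra_simps)

lemma ap_cong:
  assumes "ap r X L" "eventually (\<lambda>\<epsilon>. Y \<epsilon> = X \<epsilon>) (at_right 0)"
  shows "ap r Y L"
proof -
  have "eventually (\<lambda>\<epsilon>. Y \<epsilon> - L = X \<epsilon> - L) (at_right 0)" using assms(2) by eventually_elim simp
  from landau_o.big.in_cong[OF this] show ?thesis using assms(1) unfolding ap_def by blast
qed

text \<open>For higher-order terms, where Y is bounded but its limit is never computed.\<close>

lemma ap_zero_mult: "ap r X 0 \<Longrightarrow> Y \<in> O[at_right 0](\<lambda>_. 1) \<Longrightarrow> ap r (\<lambda>\<epsilon>. X \<epsilon> * Y \<epsilon>) 0"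
  using landau_o.big.mult[of X "at_right 0" r Y "\<lambda>_. 1"] by (simp add: ap_def)

lemma ap_tendsto:
  assumes "(r \<longlongrightarrow> 0) (at_right 0)" "ap r X L"
  shows "(X \<longlongrightarrow> L) (at_right 0)"
proof -
  have "r \<in> o[at_right 0](\<lambda>_. 1)" using assms(1) by (intro smalloI_tendsto) auto
  with assms(2) have "(\<lambda>\<epsilon>. X \<epsilon> - L) \<in> o[at_right 0](\<lambda>_. 1)"
    unfolding ap_def by (rule landau_o.big_small_trans)
  from smalloD_tendsto[OF this] show ?thesis by (simp add: LIM_zero_iff)
qed

lemma tendsto_bounded: "(X \<longlongrightarrow> (L::real)) (at_right (0::real)) \<Longrightarrow> X \<in> O[at_right 0](\<lambda>_. 1)"
  by (rule bigoI_tendsto[of _ _ L]) auto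

lemma ap_mult:
  assumes "(r \<longlongrightarrow> 0) (at_right 0)" "ap r X L" "ap r Y M"
  shows "ap r (\<lambda>\<epsilon>. X \<epsilon> * Y \<epsilon>) (L * M)"
proof -
  have "(\<lambda>\<epsilon>. (X \<epsilon> - L) * Y \<epsilon>) \<in> O[at_right 0](\<lambda>\<epsilon>. r \<epsilon> * 1)"
    using assms(2) unfolding ap_def
    by (rule landau_o.big.mult) (rule tendsto_bounded[OF ap_tendsto[OF assms(1,3)]])
  moreover have "(\<lambda>\<epsilon>. L * (Y \<epsilon> - M)) \<in> O[at_right 0](\<lambda>\<epsilon>. r \<epsilon> * 1)"
    using assms(3) by (simp add: ap_def)
  ultimately have "(\<lambda>\<epsilon>. (X \<epsilon> - L) * Y \<epsilon> + L * (Y \<epsilon> - M)) \<in> O[at_right 0](\<lambda>\<epsilon>. r \<epsilon> * 1)"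
    by (rule sum_in_bigo)
  then show ?thesis by (simp add: ap_def algebra_simps)
qed

lemma ap_inverse:
  assumes "(r \<longlongrightarrow> 0) (at_right 0)" "ap r X L" "L \<noteq> 0"
  shows "ap r (\<lambda>\<epsilon>. inverse (X \<epsilon>)) (inverse L)"
proof -
  have t: "(X \<longlongrightarrow> L) (at_right 0)" by (rule ap_tendsto[OF assms(1,2)])
  have "(\<lambda>\<epsilon>. (X \<epsilon> - L) * (- inverse (X \<epsilon>) * inverse L)) \<in> O[at_right 0](\<lambda>\<epsilon>. r \<epsilon> * 1)"
    using assms(2) unfolding ap_def
    by (rule landau_o.big.mult) (rule tendsto_bounded[OF tendsto_mult[OF tendsto_minus[OF
            tendsto_inverse[OF t assms(3)]] tendsto_const]])
  moreover have "eventually (\<lambda>\<epsilon>. X \<epsilon> \<noteq> 0) (at_right 0)"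
    by (rule tendsto_imp_eventually_ne[OF t assms(3)])
  then have "eventually (\<lambda>\<epsilon>. inverse (X \<epsilon>) - inverse L = (X \<epsilon> - L) * (- inverse (X \<epsilon>) * inverse L)) (at_right 0)"
    by eventually_elim (use assms(3) in \<open>simp add: field_simps\<close>)
  from landau_o.big.in_cong[OF this]
  have "(\<lambda>\<epsilon>. inverse (X \<epsilon>) - inverse L) \<in> O[at_right 0](\<lambda>\<epsilon>. r \<epsilon> * 1) \<longleftrightarrow>
     (\<lambda>\<epsilon>. (X \<epsilon> - L) * (- inverse (X \<epsilon>) * inverse L)) \<in> O[at_right 0](\<lambda>\<epsilon>. r \<epsilon> * 1)" .
  ultimately show ?thesis unfolding ap_def by simp
qed

lemma ap_divide:
  assumes "(r \<longlongrightarrow> 0) (at_right 0)" "ap r X L" "ap r Y M" "M \<noteq> 0"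
  shows "ap r (\<lambda>\<epsilon>. X \<epsilon> / Y \<epsilon>) (L / M)"
  unfolding divide_inverse by (rule ap_mult[OF assms(1,2) ap_inverse[OF assms(1,3,4)]])

text \<open>The difference of the roots is X - L divided by a sum that is at least sqrt(L).\<close>

lemma ap_sqrt:
  assumes "(r \<longlongrightarrow> 0) (at_right 0)" "ap r X L" "L > 0"
  shows "ap r (\<lambda>\<epsilon>. sqrt (X \<epsilon>)) (sqrt L)"
proof -
  have "eventually (\<lambda>\<epsilon>. X \<epsilon> > 0) (at_right 0)"
    by (rule order_tendstoD(1)[OF ap_tendsto[OF assms(1,2)] assms(3)])
  then have "eventually (\<lambda>\<epsilon>. norm (sqrt (X \<epsilon>) - sqrt L) \<le> 1 / sqrt L * norm (X \<epsilon> - L)) (at_right 0)"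
  proof eventually_elim
    case (elim \<epsilon>)
    have "X \<epsilon> - L = (sqrt (X \<epsilon>) - sqrt L) * (sqrt (X \<epsilon>) + sqrt L)"
      using elim assms(3) by (simp add: algebra_simps)
    then have "\<bar>X \<epsilon> - L\<bar> = \<bar>sqrt (X \<epsilon>) - sqrt L\<bar> * \<bar>sqrt (X \<epsilon>) + sqrt L\<bar>" by (simp add: abs_mult)
    also have "\<dots> \<ge> \<bar>sqrt (X \<epsilon>) - sqrt L\<bar> * sqrt L"
      using elim assms(3) by (intro mult_left_mono) auto
    finally show ?case using assms(3) by (simp add: field_simps)
  qed
  then have "(\<lambda>\<epsilon>. sqrt (X \<epsilon>) - sqrt L) \<in> O[at_right 0](\<lambda>\<epsilon>. X \<epsilon> - L)" by (rule bigoI)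
  then show ?thesis using assms(2) unfolding ap_def by (rule landau_o.big_trans)
qed

text \<open>Difference quotients near a are bounded, so differentiability at a alone transfers the
  rate of v to f(v).\<close>

lemma has_real_derivative_bigo:
  assumes "(f has_real_derivative D) (at a)" "(v \<longlongrightarrow> a) F" "(\<lambda>\<epsilon>. v \<epsilon> - a) \<in> O[F](g)"
  shows "(\<lambda>\<epsilon>. f (v \<epsilon>) - f a) \<in> O[F](g)"
proof -
  have "((\<lambda>y. (f y - f a) / (y - a)) \<longlongrightarrow> D) (at a)"
    using assms(1) by (simp add: has_field_derivative_iff)
  then have "eventually (\<lambda>y. dist ((f y - f a) / (y - a)) D < 1) (at a)" by (rule tendstoD) simp
  then have "eventually (\<lambda>y. \<bar>f y - f a\<bar> \<le> (\<bar>D\<bar> + 1) * \<bar>y - a\<bar>) (at a)"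
    using eventually_neq_at_within[of a a UNIV]
  proof eventually_elim
    case (elim y)
    have "\<bar>(f y - f a) / (y - a)\<bar> \<le> \<bar>D\<bar> + 1" using elim(1) unfolding dist_real_def by linarith
    then show ?case using elim(2) by (simp add: field_simps)
  qed
  then have "eventually (\<lambda>y. \<bar>f y - f a\<bar> \<le> (\<bar>D\<bar> + 1) * \<bar>y - a\<bar>) (nhds a)"
    unfolding eventually_nhds_conv_at by simp
  then have "eventually (\<lambda>\<epsilon>. \<bar>f (v \<epsilon>) - f a\<bar> \<le> (\<bar>D\<bar> + 1) * \<bar>v \<epsilon> - a\<bar>) F"
    using assms(2) by (rule eventually_compose_filterlim)
  then have "(\<lambda>\<epsilon>. f (v \<epsilon>) - f a) \<in> O[F](\<lambda>\<epsilon>. v \<epsilon> - a)" by (intro bigoI[of _ "\<bar>D\<bar> + 1"]) simp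
  then show ?thesis using assms(3) by (rule landau_o.big_trans)
qed

text \<open>Families of smooth functions whose derivatives of every order stay bounded along \<open>\<epsilon> \<rightarrow> 0\<close>.\<close>

inductive family :: "(real \<times> real \<times> real) set \<Rightarrow> (real \<Rightarrow> real \<times> real \<times> real \<Rightarrow> real) \<Rightarrow> bool" for U where
  base: "Ck_on \<infinity> U h \<Longrightarrow> c \<in> O[at_right 0](\<lambda>_. 1) \<Longrightarrow> family U (\<lambda>\<epsilon> p. c \<epsilon> * h p)"
| add: "family U F \<Longrightarrow> family U G \<Longrightarrow> family U (\<lambda>\<epsilon> p. F \<epsilon> p + G \<epsilon> p)"

lemma family_scale:
  assumes "family U F" and c: "c \<in> O[at_right 0](\<lambda>_. 1)"
  shows "family U (\<lambda>\<epsilon> p. c \<epsilon> * F \<epsilon> p)"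
  using assms(1)
proof induction
  case (base h d)
  have "(\<lambda>\<epsilon>. c \<epsilon> * d \<epsilon>) \<in> O[at_right 0](\<lambda>_. 1)" using landau_o.big.mult[OF c base(2)] by simp
  from family.base[OF base(1) this] show ?case by (simp add: mult.assoc)
next
  case (add F G)
  from family.add[OF add.IH] show ?case by (simp add: distrib_left)
qed

lemma family_smooth:
  assumes "open U" "family U F"
  shows "Ck_on \<infinity> U (F \<epsilon>)"
  using assms(2) by induction (auto intro!: smooth_mult smooth_add smooth_const assms(1))

lemma family_partial:
  assumes "open U" "family U F"
  shows "(\<exists>G. family U G \<and> (\<forall>\<epsilon>. \<forall>p\<in>U. px (F \<epsilon>) p = G \<epsilon> p)) \<and> (\<exists>G. family U G \<and> (\<forall>\<epsilon>. \<forall>p\<in>U. py (F \<epsilon>) p = G \<epsilon> p))"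
  using assms(2)
proof induction
  case (base h c)
  show ?case
    using family.base[OF smooth_partial(1)[OF base(1)] base(2)] family.base[OF smooth_partial(2)[OF base(1)] base(2)]
      partial_cmult[OF base(1)]
    by (intro conjI exI[of _ "\<lambda>\<epsilon> p. c \<epsilon> * px h p"] exI[of _ "\<lambda>\<epsilon> p. c \<epsilon> * py h p"]) auto
next
  case (add F G)
  obtain F1 F2 G1 G2 where *: "family U F1" "\<forall>\<epsilon>. \<forall>p\<in>U. px (F \<epsilon>) p = F1 \<epsilon> p" "family U F2" "\<forall>\<epsilon>. \<forall>p\<in>U. py (F \<epsilon>) p = F2 \<epsilon> p"
    "family U G1" "\<forall>\<epsilon>. \<forall>p\<in>U. px (G \<epsilon>) p = G1 \<epsilon> p" "family U G2" "\<forall>\<epsilon>. \<forall>p\<in>U. py (G \<epsilon>) p = G2 \<epsilon> p"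
    using add.IH by blast
  have "px (\<lambda>p. F \<epsilon> p + G \<epsilon> p) p = F1 \<epsilon> p + G1 \<epsilon> p" "py (\<lambda>p. F \<epsilon> p + G \<epsilon> p) p = F2 \<epsilon> p + G2 \<epsilon> p"
    if "p \<in> U" for \<epsilon> p
    using partial_add[OF family_smooth[OF assms(1) add.hyps(1)] family_smooth[OF assms(1) add.hyps(2)] that] * that
    by simp_all
  then show ?case
    using family.add[OF *(1,5)] family.add[OF *(3,7)] by blast
qed

text \<open>The coefficients a and b vary with \<epsilon>, so no single smooth function is being
  differentiated. Families with bounded coefficients are closed under the operators
  \<open>D1\<close> and \<open>D2\<close>.\<close>

lemma family_DD:
  assumes "open U" "Ck_on \<infinity> U h" "a \<in> O[at_right 0](\<lambda>_. 1)" "b \<in> O[at_right 0](\<lambda>_. 1)"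
  shows "\<exists>G. family U G \<and> (\<forall>\<epsilon>. \<forall>p\<in>U. DD (a \<epsilon>) (b \<epsilon>) i j h p = G \<epsilon> p)"
proof (induction i)
  case 0
  show ?case
  proof (induction j)
    case 0
    show ?case
      using family.base[OF assms(2), of "\<lambda>_. 1"] by (intro exI[of _ "\<lambda>_ p. 1 * h p"]) (simp add: DD_Suc)
  next
    case (Suc j)
    then obtain G where G: "family U G" "\<And>\<epsilon> p. p \<in> U \<Longrightarrow> DD (a \<epsilon>) (b \<epsilon>) 0 j h p = G \<epsilon> p" by blast
    obtain G1 G2 where G12: "family U G1" "\<And>\<epsilon> p. p \<in> U \<Longrightarrow> px (G \<epsilon>) p = G1 \<epsilon> p"
      "family U G2" "\<And>\<epsilon> p. p \<in> U \<Longrightarrow> py (G \<epsilon>) p = G2 \<epsilon> p"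
      using family_partial[OF assms(1) G(1)] by blast
    have "DD (a \<epsilon>) (b \<epsilon>) 0 (Suc j) h p = b \<epsilon> * G1 \<epsilon> p + G2 \<epsilon> p" if "p \<in> U" for \<epsilon> p
      using partial_cong(1,2)[OF assms(1) that, of "DD (a \<epsilon>) (b \<epsilon>) 0 j h" "G \<epsilon>"] G(2) G12 that
      by (simp add: DD_Suc(2) D2_def)
    then show ?case using family.add[OF family_scale[OF G12(1) assms(4)] G12(3)] by blast
  qed
next
  case (Suc i)
  then obtain G where G: "family U G" "\<And>\<epsilon> p. p \<in> U \<Longrightarrow> DD (a \<epsilon>) (b \<epsilon>) i j h p = G \<epsilon> p" by blast
  obtain G1 where G1: "family U G1" "\<And>\<epsilon> p. p \<in> U \<Longrightarrow> px (G \<epsilon>) p = G1 \<epsilon> p"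
    using family_partial[OF assms(1) G(1)] by blast
  have "DD (a \<epsilon>) (b \<epsilon>) (Suc i) j h p = a \<epsilon> * G1 \<epsilon> p" if "p \<in> U" for \<epsilon> p
    using partial_cong(1)[OF assms(1) that, of "DD (a \<epsilon>) (b \<epsilon>) i j h" "G \<epsilon>"] G(2) G1 that
    by (simp add: DD_Suc(1) D1_def)
  then show ?case using family_scale[OF G1(1) assms(3)] by blast
qed

lemma family_bounded:
  assumes "family U F" "open U" "0 \<in> U" "(p \<longlongrightarrow> 0) (at_right 0)"
  shows "(\<lambda>\<epsilon>. F \<epsilon> (p \<epsilon>)) \<in> O[at_right 0](\<lambda>_. 1)"
  using assms(1)
proof induction
  case (base h c)
  have "isCont h 0"
    using smooth_imp_continuous_on[OF base(1)] assms(2,3) by (simp add: continuous_on_eq_continuous_at)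
  then have "((\<lambda>\<epsilon>. h (p \<epsilon>)) \<longlongrightarrow> h 0) (at_right 0)" using assms(4) by (rule isCont_tendsto_compose)
  from landau_o.big.mult[OF base(2) tendsto_bounded[OF this]] show ?case by simp
next
  case (add F G)
  then show ?case by (intro sum_in_bigo)
qed

text \<open>In each product of the form at least one entry carries a factor s. Hence the coefficient
  has no term of order 1, and the bracket gives the slope in s = sqrt(\<epsilon>).\<close>

lemma lyapunov_form_scaled:
  assumes "f 2 0 = s * F20" "f 3 0 = s * F30" "f 1 1 = s * F11" "f 1 2 = s * F12" "f 0 2 = F02"
    and "g 2 0 = s * G20" "g 3 0 = s * G30" "g 1 1 = G11" "g 1 2 = G12" "g 0 2 = s * G02" "g 2 1 = s * G21" "g 0 3 = s * G03"
  shows "lyapunov_form \<omega> (\<lambda>i j. (c * f i j + s * d * g i j) / \<omega>) g =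
    s * (((c * F30 + s * (d * G30)) / \<omega> + (c * F12 + d * G12) / \<omega> + G21 + G03) / 16
      + ((c * F11 + d * G11) / \<omega> * (s * ((c * F20 + s * (d * G20)) / \<omega>) + (c * F02 + s * (s * (d * G02))) / \<omega>)
         - G11 * (G20 + G02) - s * ((c * F20 + s * (d * G20)) / \<omega> * G20) + (c * F02 + s * (s * (d * G02))) / \<omega> * G02) / (16 * \<omega>))"
  unfolding lyapunov_form_def assms
  by (simp add: algebra_simps add_divide_distrib diff_divide_distrib)

text \<open>S is the limit of the difference of the v-derivatives \<open>D2\<close> of C and D, and
  K the limit of (C - D)/\<epsilon>. The summand \<chi>p - \<chi>m of S produces the extra term of
  \<open>lyapunov_slope\<close>.\<close>

lemma slope_identity:
  fixes \<alpha> \<beta> \<delta> \<zeta>p \<zeta>m \<eta>p \<eta>m \<chi>p \<chi>m p1 p2 p3 :: real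
  defines "D \<equiv> \<alpha> - \<delta>" and "w \<equiv> \<beta> * \<delta> + \<alpha>"
  defines "N \<equiv> \<delta> * (\<zeta>m + \<chi>m) - \<alpha> * (\<zeta>p + \<chi>p)" and "Z \<equiv> \<delta> * \<zeta>m - \<alpha> * \<zeta>p"
  defines "S \<equiv> - (Z / w) * (1 + \<beta>) + \<chi>p - \<chi>m" and "K \<equiv> 2 * N / (D * p1)"
  assumes "D \<noteq> 0" "w \<noteq> 0" "p1 \<noteq> 0"
  shows "(p1\<^sup>2 * (\<eta>p - \<eta>m) * D\<^sup>2 / w + 3 * p2 * S + p3 * K
     - p1\<^sup>2 * (1 + \<beta>) * D\<^sup>2 / w\<^sup>2 * (\<alpha> * \<eta>p - \<delta> * \<eta>m) - p1 * (1 + \<beta>) * D / (2 * w) * (2 * p1 * S + p2 * K)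
     - p2 / p1 * (2 * p1 * S + p2 * K)) / 16 =
    D * p1\<^sup>2 / (16 * w\<^sup>2)
           * ((\<beta> + 1)\<^sup>2 * (\<delta> * \<zeta>m - \<alpha> * \<zeta>p) - D\<^sup>2 * (\<eta>m + \<beta> * \<eta>p))
         + (\<beta> + 1) * p2 / (16 * w) * (\<delta> * \<chi>m - \<alpha> * \<chi>p)
         + 1 / 8 * (p3 / (p1 * D) - p2\<^sup>2 / (p1\<^sup>2 * D) - (\<beta> + 1) * p2 / w) * N
     + (\<chi>p - \<chi>m) / 16 * (p2 - (\<beta> + 1) * D * p1\<^sup>2 / w)"
proof -
  have e1: "w * (\<eta>p - \<eta>m) - (1 + \<beta>) * (\<alpha> * \<eta>p - \<delta> * \<eta>m) = - D * (\<eta>m + \<beta> * \<eta>p)"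
    by (simp add: D_def w_def algebra_simps)
  have e2: "\<delta> * \<chi>m - \<alpha> * \<chi>p = N - Z" by (simp add: N_def Z_def algebra_simps)
  define H where "H = \<eta>m + \<beta> * \<eta>p"
  define Y where "Y = \<alpha> * \<eta>p - \<delta> * \<eta>m"
  define Q where "Q = \<eta>p - \<eta>m"
  \<comment> \<open>After this substitution \<eta>p and \<eta>m occur only through Y and H, and Y
    cancels.\<close>
  have Q: "Q = ((1 + \<beta>) * Y - D * H) / w"
    using e1 assms(8) by (simp add: Q_def Y_def H_def field_simps)
  have "(p1\<^sup>2 * Q * D\<^sup>2 / w + 3 * p2 * S + p3 * K
     - p1\<^sup>2 * (1 + \<beta>) * D\<^sup>2 / w\<^sup>2 * Y - p1 * (1 + \<beta>) * D / (2 * w) * (2 * p1 * S + p2 * K)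
     - p2 / p1 * (2 * p1 * S + p2 * K)) / 16 =
    D * p1\<^sup>2 / (16 * w\<^sup>2) * ((\<beta> + 1)\<^sup>2 * Z - D\<^sup>2 * H)
         + (\<beta> + 1) * p2 / (16 * w) * (N - Z)
         + 1 / 8 * (p3 / (p1 * D) - p2\<^sup>2 / (p1\<^sup>2 * D) - (\<beta> + 1) * p2 / w) * N
     + (\<chi>p - \<chi>m) / 16 * (p2 - (\<beta> + 1) * D * p1\<^sup>2 / w)"
    unfolding Q S_def K_def using assms(7-9)
    by (simp add: divide_simps) (simp add: power2_eq_square algebra_simps)
  then show ?thesis
    unfolding Q_def Y_def H_def e2 Z_def[symmetric] .
qed

text \<open>The limiting frequency o' is an irrational expression known through its square. The
  proof groups the factors so that it occurs only in even powers or in quotients with a0.\<close>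

lemma limit_identity:
  fixes \<alpha> \<beta> \<delta> \<zeta>p \<zeta>m \<eta>p \<eta>m \<chi>p \<chi>m p1 p2 p3 o' D w K :: real
  defines "c0 \<equiv> 2 * w / D" and "Z \<equiv> \<delta> * \<zeta>m - \<alpha> * \<zeta>p"
  defines "dd \<equiv> 2 * Z / D" and "a0 \<equiv> o' / c0"
  defines "S \<equiv> - (Z / w) * (1 + \<beta>) + \<chi>p - \<chi>m"
  assumes D: "D \<noteq> 0" and w: "w \<noteq> 0" and p1: "p1 \<noteq> 0" and o: "o' \<noteq> 0" "o' * o' = 2 * p1 * w"
  defines "G02 \<equiv> 2 * p1 * S + p2 * K"
  defines "G20 \<equiv> 2 * \<alpha> / D * (a0 * a0 * (2 * \<eta>p)) + - 2 * \<delta> / D * (a0 * a0 * (2 * \<eta>m))"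
  shows "(0 / o' + (c0 * (p2 * (a0 * \<zeta>p - a0 * \<zeta>m)) + dd * (p2 * (a0 * (1 + \<beta>)))) / o'
        + p1 * (a0 * a0 * (2 * \<eta>p) - a0 * a0 * (2 * \<eta>m)) + (3 * p2 * S + p3 * K)) / 16
      + ((c0 * (p1 * (a0 * \<zeta>p - a0 * \<zeta>m)) + dd * (p1 * (a0 * (1 + \<beta>)))) / o' * (c0 * (p2 * (- D)) / o')
         - p1 * (a0 * (1 + \<beta>)) * (G20 + G02) + c0 * (p2 * (- D)) / o' * G02) / (16 * o')
    = (p1\<^sup>2 * (\<eta>p - \<eta>m) * D\<^sup>2 / w + 3 * p2 * S + p3 * K
     - p1\<^sup>2 * (1 + \<beta>) * D\<^sup>2 / w\<^sup>2 * (\<alpha> * \<eta>p - \<delta> * \<eta>m) - p1 * (1 + \<beta>) * D / (2 * w) * (2 * p1 * S + p2 * K)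
     - p2 / p1 * (2 * p1 * S + p2 * K)) / 16"
proof -
  have c0: "c0 \<noteq> 0" using D w by (simp add: c0_def)
  have a0: "a0 / o' = D / (2 * w)" "c0 * a0 / o' = 1" "dd * a0 / o' = Z / w"
    using o D w c0 by (simp_all add: a0_def c0_def dd_def)
  have aa: "a0 * a0 = p1 * D\<^sup>2 / (2 * w)"
  proof -
    have "a0 * a0 = (o' * o') / (c0 * c0)" by (simp add: a0_def)
    also have "\<dots> = p1 * D\<^sup>2 / (2 * w)" unfolding o(2) c0_def using D w by (simp add: field_simps power2_eq_square)
    finally show ?thesis .
  qed
  have e1: "(c0 * (p * (a0 * \<zeta>p - a0 * \<zeta>m)) + dd * (p * (a0 * (1 + \<beta>)))) / o' = p * (\<zeta>p - \<zeta>m) + p * (1 + \<beta>) * (Z / w)" for p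
  proof -
    have "(c0 * (p * (a0 * \<zeta>p - a0 * \<zeta>m)) + dd * (p * (a0 * (1 + \<beta>)))) / o'
      = p * (\<zeta>p - \<zeta>m) * (c0 * a0 / o') + p * (1 + \<beta>) * (dd * a0 / o')"
      by (simp add: algebra_simps add_divide_distrib diff_divide_distrib)
    then show ?thesis unfolding a0 by simp
  qed
  have e2: "c0 * (p2 * (- D)) / o' / o' = - (p2 / p1)"
    unfolding divide_divide_eq_left o(2) c0_def using D w p1 by simp
  \<comment> \<open>The outer factor 1/o' is moved onto Y/o' and a0, which turns them into the
    rational quantities computed above.\<close>
  have split: "(X * (Y / o') - p1 * (a0 * (1 + \<beta>)) * Q + Y / o' * R) / (16 * o')
      = (X * (Y / o' / o') - p1 * (1 + \<beta>) * (a0 / o') * Q + Y / o' / o' * R) / 16" for X Y Q R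
    by (simp add: add_divide_distrib diff_divide_distrib mult_ac)
  show ?thesis
    unfolding split e1 e2 a0(1) G02_def G20_def aa
    using D w p1 by (simp add: field_simps power2_eq_square)
qed

lemma ap_power: "(r \<longlongrightarrow> 0) (at_right 0) \<Longrightarrow> ap r X L \<Longrightarrow> ap r (\<lambda>\<epsilon>. X \<epsilon> ^ n) (L ^ n)"
  by (induction n) (auto intro: ap_const ap_mult)

text \<open>\<pi> is the Hopf point (x, y, \<mu>) as a function of \<epsilon>, and v its coordinate
  y/\<epsilon>; no reference to a particular branch remains.\<close>

locale hopf_asymptotics = pws +
  fixes \<pi> :: "real \<Rightarrow> real \<times> real \<times> real" and v :: "real \<Rightarrow> real"
  assumes pi_O: "(\<lambda>\<epsilon>. norm (\<pi> \<epsilon>)) \<in> O[at_right 0](\<lambda>\<epsilon>. \<epsilon>)"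
    and equilibrium: "eventually (\<lambda>\<epsilon>. mix A B (v \<epsilon>) (\<pi> \<epsilon>) = 0) (at_right 0)"
    and trace_zero: "eventually (\<lambda>\<epsilon>. J11 (v \<epsilon>) (\<pi> \<epsilon>) + J22 \<epsilon> (v \<epsilon>) (\<pi> \<epsilon>) = 0) (at_right 0)"
begin

text \<open>Only the third derivative of \<open>\<phi>\<close> need not be Lipschitz, hence the second summand.\<close>

definition "r \<epsilon> = sqrt \<epsilon> + \<bar>d3 (v \<epsilon>) - d3 vs\<bar>"

section \<open>Rates of convergence at the Hopf points\<close>

lemma eps_pos: "eventually (\<lambda>\<epsilon>::real. \<epsilon> > 0) (at_right 0)"
  by (simp add: eventually_at_right_less)

lemma sqrt_to_0: "(sqrt \<longlongrightarrow> 0) (at_right 0)"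
  using tendsto_real_sqrt[of "\<lambda>x. x" 0 "at_right 0"] by (simp add: tendsto_ident_at)

lemma eps_O_sqrt: "(\<lambda>\<epsilon>. \<epsilon>) \<in> O[at_right 0](sqrt)"
proof -
  have "eventually (\<lambda>\<epsilon>. dist (sqrt \<epsilon>) 0 < 1) (at_right 0)" by (rule tendstoD[OF sqrt_to_0]) simp
  then have "eventually (\<lambda>\<epsilon>. norm \<epsilon> \<le> 1 * norm (sqrt \<epsilon>)) (at_right 0)"
    using eps_pos
  proof eventually_elim
    case (elim \<epsilon>)
    have "sqrt \<epsilon> * sqrt \<epsilon> \<le> sqrt \<epsilon> * 1" using elim by (intro mult_left_mono) auto
    then show ?case using elim by simp
  qed
  then show ?thesis by (rule bigoI)
qed

lemma sqrt_O_r: "sqrt \<in> O[at_right 0](r)"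
proof (rule bigoI[of _ 1])
  show "eventually (\<lambda>\<epsilon>. norm (sqrt \<epsilon>) \<le> 1 * norm (r \<epsilon>)) (at_right 0)"
    using eps_pos by eventually_elim (simp add: r_def)
qed

lemma eps_O_r: "(\<lambda>\<epsilon>. \<epsilon>) \<in> O[at_right 0](r)"
  by (rule landau_o.big_trans[OF eps_O_sqrt sqrt_O_r])

lemma pi_to_0: "(\<pi> \<longlongrightarrow> 0) (at_right 0)"
proof -
  have "(\<lambda>\<epsilon>::real. \<epsilon>) \<in> o[at_right 0](\<lambda>_. 1)"
    by (intro smalloI_tendsto) (auto simp: tendsto_ident_at)
  from smalloD_tendsto[OF landau_o.big_small_trans[OF pi_O this]]
  have "((\<lambda>\<epsilon>. norm (\<pi> \<epsilon>)) \<longlongrightarrow> 0) (at_right 0)" by simp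
  then show ?thesis by (rule tendsto_norm_zero_cancel)
qed

lemma v_O: "(\<lambda>\<epsilon>. v \<epsilon> - vs) \<in> O[at_right 0](\<lambda>\<epsilon>. \<epsilon>)"
proof -
  obtain K r where K: "K > 0" "r > 0" "ball 0 r \<subseteq> U"
    "\<And>p v. p \<in> ball 0 r \<Longrightarrow> mix A B v p = 0 \<Longrightarrow> \<bar>\<phi> v - \<kappa>\<bar> \<le> K * norm p \<and> \<bar>v - vs\<bar> \<le> K * norm p"
    using phi_estimate by blast
  have "eventually (\<lambda>\<epsilon>. dist (\<pi> \<epsilon>) 0 < r) (at_right 0)" by (rule tendstoD[OF pi_to_0 K(2)])
  then have "eventually (\<lambda>\<epsilon>. norm (v \<epsilon> - vs) \<le> K * norm (norm (\<pi> \<epsilon>))) (at_right 0)"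
    using equilibrium
  proof eventually_elim
    case (elim \<epsilon>)
    then show ?case using K(4)[of "\<pi> \<epsilon>" "v \<epsilon>"] by simp
  qed
  then have "(\<lambda>\<epsilon>. v \<epsilon> - vs) \<in> O[at_right 0](\<lambda>\<epsilon>. norm (\<pi> \<epsilon>))" by (rule bigoI)
  then show ?thesis using pi_O by (rule landau_o.big_trans)
qed

lemma v_to_vs: "(v \<longlongrightarrow> vs) (at_right 0)"
proof -
  have "(\<lambda>\<epsilon>::real. \<epsilon>) \<in> o[at_right 0](\<lambda>_. 1)"
    by (intro smalloI_tendsto) (auto simp: tendsto_ident_at)
  from smalloD_tendsto[OF landau_o.big_small_trans[OF v_O this]]
  show ?thesis by (simp add: LIM_zero_iff)
qed

lemma r_to_0: "(r \<longlongrightarrow> 0) (at_right 0)"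
proof -
  have "((\<lambda>\<epsilon>. sqrt \<epsilon> + \<bar>d3 (v \<epsilon>) - d3 vs\<bar>) \<longlongrightarrow> 0 + \<bar>d3 vs - d3 vs\<bar>) (at_right 0)"
    by (intro tendsto_intros sqrt_to_0 isCont_tendsto_compose[OF phi_cont(4) v_to_vs])
  then show ?thesis by (simp add: r_def[abs_def])
qed

lemma r_O_sqrt:
  assumes "4 \<le> k"
  shows "r \<in> O[at_right 0](sqrt)"
proof -
  have "Cn_on 4 UNIV \<phi>"
    using reg assms unfolding regularization_function_def Ck_on_def by (metis numeral_eq_enat)
  from Cn_on_higher_deriv(1)[OF this, of 3 vs]
  have "(d3 has_real_derivative deriv d3 vs) (at vs)" by (simp add: numeral_3_eq_3)
  from has_real_derivative_bigo[OF this v_to_vs landau_o.big_trans[OF v_O eps_O_sqrt]]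
  have "(\<lambda>\<epsilon>. \<bar>d3 (v \<epsilon>) - d3 vs\<bar>) \<in> O[at_right 0](sqrt)" by simp
  then show ?thesis unfolding r_def[abs_def] by (intro sum_in_bigo) simp_all
qed

lemmas ap_intros = ap_const ap_add ap_diff ap_mult[OF r_to_0]

lemma ap_sqrt_0: "ap r (\<lambda>\<epsilon>. sqrt \<epsilon>) 0"
  using sqrt_O_r by (simp add: ap_def)

lemma ap_eps_0: "ap r (\<lambda>\<epsilon>. \<epsilon>) 0"
  using eps_O_r by (simp add: ap_def)

lemma ap_of_derivative: "(f has_real_derivative f') (at vs) \<Longrightarrow> ap r (\<lambda>\<epsilon>. f (v \<epsilon>)) (f vs)"
  unfolding ap_def by (rule has_real_derivative_bigo[OF _ v_to_vs landau_o.big_trans[OF v_O eps_O_r]])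

lemma ap_phi: "ap r (\<lambda>\<epsilon>. \<phi> (v \<epsilon>)) (\<phi> vs)" "ap r (\<lambda>\<epsilon>. d1 (v \<epsilon>)) (d1 vs)" "ap r (\<lambda>\<epsilon>. d2 (v \<epsilon>)) (d2 vs)"
  "ap r (\<lambda>\<epsilon>. d3 (v \<epsilon>)) (d3 vs)"
proof -
  show "ap r (\<lambda>\<epsilon>. \<phi> (v \<epsilon>)) (\<phi> vs)" "ap r (\<lambda>\<epsilon>. d1 (v \<epsilon>)) (d1 vs)" "ap r (\<lambda>\<epsilon>. d2 (v \<epsilon>)) (d2 vs)"
    by (rule ap_of_derivative[OF phi_derivs(1)] ap_of_derivative[OF phi_derivs(2)] ap_of_derivative[OF phi_derivs(3)])+
  show "ap r (\<lambda>\<epsilon>. d3 (v \<epsilon>)) (d3 vs)"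
    unfolding ap_def
  proof (rule bigoI[of _ 1])
    show "eventually (\<lambda>\<epsilon>. norm (d3 (v \<epsilon>) - d3 vs) \<le> 1 * norm (r \<epsilon>)) (at_right 0)"
      using eps_pos by eventually_elim (simp add: r_def)
  qed
qed

lemma pi_in_U: "eventually (\<lambda>\<epsilon>. \<pi> \<epsilon> \<in> U) (at_right 0)"
  using topological_tendstoD[OF pi_to_0 openU zeroU] .

lemma ap_smooth:
  assumes "Ck_on \<infinity> U h"
  shows "ap r (\<lambda>\<epsilon>. h (\<pi> \<epsilon>)) (h 0)"
proof -
  obtain K \<rho> where K: "K > 0" "\<rho> > 0" "ball 0 \<rho> \<subseteq> U" "\<And>q. q \<in> ball 0 \<rho> \<Longrightarrow> \<bar>h q - h 0\<bar> \<le> K * norm q"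
    using smooth_lipschitz_at[OF openU zeroU assms] by metis
  have "eventually (\<lambda>\<epsilon>. dist (\<pi> \<epsilon>) 0 < \<rho>) (at_right 0)" by (rule tendstoD[OF pi_to_0 K(2)])
  then have "eventually (\<lambda>\<epsilon>. norm (h (\<pi> \<epsilon>) - h 0) \<le> K * norm (norm (\<pi> \<epsilon>))) (at_right 0)"
  proof eventually_elim
    case (elim \<epsilon>)
    then show ?case using K(4)[of "\<pi> \<epsilon>"] by simp
  qed
  then have "(\<lambda>\<epsilon>. h (\<pi> \<epsilon>) - h 0) \<in> O[at_right 0](\<lambda>\<epsilon>. norm (\<pi> \<epsilon>))" by (rule bigoI)
  then show ?thesis
    unfolding ap_def by (rule landau_o.big_trans) (rule landau_o.big_trans[OF pi_O eps_O_r])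
qed

lemma ap_mix:
  assumes "ap r (\<lambda>\<epsilon>. F \<epsilon> (\<pi> \<epsilon>)) L" "ap r (\<lambda>\<epsilon>. H \<epsilon> (\<pi> \<epsilon>)) M"
  shows "ap r (\<lambda>\<epsilon>. mix (F \<epsilon>) (H \<epsilon>) (v \<epsilon>) (\<pi> \<epsilon>)) ((1 + \<kappa>) * L + (1 - \<kappa>) * M)"
  unfolding mix_def vs(2)[symmetric] by (intro ap_intros ap_phi assms)

lemma ap_mix_smooth:
  "Ck_on \<infinity> U f \<Longrightarrow> Ck_on \<infinity> U g \<Longrightarrow> ap r (\<lambda>\<epsilon>. mix f g (v \<epsilon>) (\<pi> \<epsilon>)) (mix f g vs 0)"
  using ap_mix[of "\<lambda>_. f" "f 0" "\<lambda>_. g" "g 0", OF ap_smooth ap_smooth] by (simp add: mix_def vs)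

lemma bounded_mix:
  assumes "(\<lambda>\<epsilon>. F \<epsilon> (\<pi> \<epsilon>)) \<in> O[at_right 0](\<lambda>_. 1)" "(\<lambda>\<epsilon>. H \<epsilon> (\<pi> \<epsilon>)) \<in> O[at_right 0](\<lambda>_. 1)"
  shows "(\<lambda>\<epsilon>. mix (F \<epsilon>) (H \<epsilon>) (v \<epsilon>) (\<pi> \<epsilon>)) \<in> O[at_right 0](\<lambda>_. 1)"
proof -
  have "(\<lambda>\<epsilon>. 2 * \<bar>F \<epsilon> (\<pi> \<epsilon>)\<bar> + 2 * \<bar>H \<epsilon> (\<pi> \<epsilon>)\<bar>) \<in> O[at_right 0](\<lambda>_. 1)"
    using assms by (intro sum_in_bigo) simp_all
  moreover have "(\<lambda>\<epsilon>. mix (F \<epsilon>) (H \<epsilon>) (v \<epsilon>) (\<pi> \<epsilon>)) \<in> O[at_right 0](\<lambda>\<epsilon>. 2 * \<bar>F \<epsilon> (\<pi> \<epsilon>)\<bar> + 2 * \<bar>H \<epsilon> (\<pi> \<epsilon>)\<bar>)"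
    by (rule bigoI[of _ 1]) (use mix_bound in \<open>auto intro!: always_eventually simp: abs_of_nonneg\<close>)
  ultimately show ?thesis using landau_o.big_trans by blast
qed

text \<open>Here and in the next four lines the constants of \<open>first_lyapunov_rescaled\<close>
  become functions of \<epsilon>.\<close>

definition "c \<epsilon> = J21 (v \<epsilon>) (\<pi> \<epsilon>)"
definition "d \<epsilon> = J22 \<epsilon> (v \<epsilon>) (\<pi> \<epsilon>)"
definition "\<omega> \<epsilon> = sqrt (\<epsilon> * J11 (v \<epsilon>) (\<pi> \<epsilon>) * d \<epsilon> - \<epsilon> * J12 \<epsilon> (v \<epsilon>) (\<pi> \<epsilon>) * c \<epsilon>)"
definition "a \<epsilon> = \<omega> \<epsilon> / c \<epsilon>"
definition "b \<epsilon> = - d \<epsilon> / c \<epsilon>"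

text \<open>The limits: \<open>c0\<close> of c, \<open>2 * Z / (\<alpha> - \<delta>)\<close> of d,
  \<open>\<omega>0\<close> of \<omega>, and \<open>K0\<close> of (C - D)/\<epsilon>.
  \<open>NN\<close> is the quantity assumed to be nonzero in the theorem.\<close>

abbreviation "c0 \<equiv> 2 * \<Omega> / (\<alpha> - \<delta>)"
abbreviation "Z \<equiv> \<delta> * \<zeta>m - \<alpha> * \<zeta>p"
abbreviation "NN \<equiv> \<delta> * (\<zeta>m + \<chi>m) - \<alpha> * (\<zeta>p + \<chi>p)"
abbreviation "\<omega>0 \<equiv> sqrt (2 * d1 vs * \<Omega>)"
abbreviation "K0 \<equiv> 2 * NN / ((\<alpha> - \<delta>) * d1 vs)"

lemma sp: "Ck_on \<infinity> U (px A)" "Ck_on \<infinity> U (px B)" "Ck_on \<infinity> U (px C)" "Ck_on \<infinity> U (px D)"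
  "Ck_on \<infinity> U (py A)" "Ck_on \<infinity> U (py B)" "Ck_on \<infinity> U (py C)" "Ck_on \<infinity> U (py D)"
  "Ck_on \<infinity> U (px (px C))" "Ck_on \<infinity> U (px (px D))"
  by (intro smooth_partial smooth)+

section \<open>Limits of the linear part\<close>

lemma c0: "c0 \<noteq> 0" using Om alpha_delta by simp

lemma omega0: "\<omega>0 > 0" "\<omega>0 * \<omega>0 = 2 * d1 vs * \<Omega>"
  using d1_vs Om by simp_all

lemma ap_c: "ap r c c0"
  using ap_mix_smooth[OF sp(3,4)] unfolding c_def[abs_def] J21_def mix_C_x .

lemma ap_J11: "ap r (\<lambda>\<epsilon>. J11 (v \<epsilon>) (\<pi> \<epsilon>)) (- (2 * Z / (\<alpha> - \<delta>)))"
proof -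
  have "mix (px A) (px B) vs 0 = - (2 * Z / (\<alpha> - \<delta>))"
    by (simp add: mix_def A0 B0 vs kappa diff_divide_distrib algebra_simps)
  then show ?thesis using ap_mix_smooth[OF sp(1,2)] by (simp add: J11_def)
qed

text \<open>Smoothness alone does not control the summand of \<open>J22\<close> that is divided by
  \<epsilon>. The vanishing trace replaces d by - \<open>J11\<close>, which has a limit.\<close>

lemma ap_d: "ap r d (2 * Z / (\<alpha> - \<delta>))"
proof -
  have "ap r (\<lambda>\<epsilon>. 0 - J11 (v \<epsilon>) (\<pi> \<epsilon>)) (0 - (- (2 * Z / (\<alpha> - \<delta>))))"
    by (intro ap_diff ap_const ap_J11)
  then have "ap r (\<lambda>\<epsilon>. 0 - J11 (v \<epsilon>) (\<pi> \<epsilon>)) (2 * Z / (\<alpha> - \<delta>))" by simp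
  then show ?thesis
    by (rule ap_cong) (use trace_zero in eventually_elim, simp add: d_def)
qed

text \<open>The definition of \<open>J22\<close> is solved for the quotient, all other terms of
  which now have known limits.\<close>

lemma ap_CD: "ap r (\<lambda>\<epsilon>. (C (\<pi> \<epsilon>) - D (\<pi> \<epsilon>)) / \<epsilon>) K0"
proof -
  have l: "mix (py C) (py D) vs 0 = 2 * (\<alpha> * \<chi>p - \<delta> * \<chi>m) / (\<alpha> - \<delta>)"
    by (simp add: mix_def C0 D0 vs kappa diff_divide_distrib algebra_simps)
  have "ap r (\<lambda>\<epsilon>. (d \<epsilon> - mix (py C) (py D) (v \<epsilon>) (\<pi> \<epsilon>)) / d1 (v \<epsilon>))
     ((2 * Z / (\<alpha> - \<delta>) - 2 * (\<alpha> * \<chi>p - \<delta> * \<chi>m) / (\<alpha> - \<delta>)) / d1 vs)"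
    unfolding l[symmetric] using d1_vs
    by (intro ap_divide[OF r_to_0] ap_diff ap_d ap_mix_smooth sp ap_phi) auto
  moreover have "(2 * Z / (\<alpha> - \<delta>) - 2 * (\<alpha> * \<chi>p - \<delta> * \<chi>m) / (\<alpha> - \<delta>)) / d1 vs = K0"
    unfolding diff_divide_distrib[symmetric] divide_divide_eq_left by (simp add: algebra_simps)
  ultimately have "ap r (\<lambda>\<epsilon>. (d \<epsilon> - mix (py C) (py D) (v \<epsilon>) (\<pi> \<epsilon>)) / d1 (v \<epsilon>)) K0" by simp
  moreover have "eventually (\<lambda>\<epsilon>. d1 (v \<epsilon>) > 0) (at_right 0)"
    by (rule order_tendstoD(1)[OF ap_tendsto[OF r_to_0 ap_phi(2)] d1_vs])
  then have "eventually (\<lambda>\<epsilon>. (C (\<pi> \<epsilon>) - D (\<pi> \<epsilon>)) / \<epsilon> = (d \<epsilon> - mix (py C) (py D) (v \<epsilon>) (\<pi> \<epsilon>)) / d1 (v \<epsilon>)) (at_right 0)"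
    by eventually_elim (simp add: d_def J22_def)
  ultimately show ?thesis by (rule ap_cong)
qed

lemma ap_omega: "ap r \<omega> \<omega>0"
proof -
  have "ap r (\<lambda>\<epsilon>. \<epsilon> * mix (py A) (py B) (v \<epsilon>) (\<pi> \<epsilon>) + d1 (v \<epsilon>) * (A (\<pi> \<epsilon>) - B (\<pi> \<epsilon>)))
      (0 * mix (py A) (py B) vs 0 + d1 vs * (A 0 - B 0))"
    by (intro ap_intros ap_eps_0 ap_mix_smooth sp ap_phi ap_smooth smooth)
  then have "ap r (\<lambda>\<epsilon>. \<epsilon> * mix (py A) (py B) (v \<epsilon>) (\<pi> \<epsilon>) + d1 (v \<epsilon>) * (A (\<pi> \<epsilon>) - B (\<pi> \<epsilon>)))
      (d1 vs * (\<delta> - \<alpha>))" by (simp add: A0 B0)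
  then have j12: "ap r (\<lambda>\<epsilon>. \<epsilon> * J12 \<epsilon> (v \<epsilon>) (\<pi> \<epsilon>)) (d1 vs * (\<delta> - \<alpha>))"
    by (rule ap_cong) (use eps_pos in eventually_elim, simp add: J12_def distrib_left)
  have "ap r (\<lambda>\<epsilon>. \<epsilon> * J11 (v \<epsilon>) (\<pi> \<epsilon>) * d \<epsilon> - \<epsilon> * J12 \<epsilon> (v \<epsilon>) (\<pi> \<epsilon>) * c \<epsilon>)
     (0 * (- (2 * Z / (\<alpha> - \<delta>))) * (2 * Z / (\<alpha> - \<delta>)) - d1 vs * (\<delta> - \<alpha>) * c0)"
    by (intro ap_diff ap_mult[OF r_to_0] ap_eps_0 ap_J11 ap_d ap_c j12)
  moreover have "0 * (- (2 * Z / (\<alpha> - \<delta>))) * (2 * Z / (\<alpha> - \<delta>)) - d1 vs * (\<delta> - \<alpha>) * c0 = 2 * d1 vs * \<Omega>"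
  proof -
    have "0 * p * q - d1 vs * (\<delta> - \<alpha>) * (2 * w / (\<alpha> - \<delta>)) = 2 * d1 vs * w" for p q w
    proof -
      have "x * (- e) * (2 * w / e) = - (x * (2 * w))" if "e \<noteq> 0" for x e :: real
        using that by simp
      from this[OF alpha_delta(2), of "d1 vs"] show ?thesis unfolding minus_diff_eq by simp
    qed
    then show ?thesis .
  qed
  ultimately have "ap r (\<lambda>\<epsilon>. \<epsilon> * J11 (v \<epsilon>) (\<pi> \<epsilon>) * d \<epsilon> - \<epsilon> * J12 \<epsilon> (v \<epsilon>) (\<pi> \<epsilon>) * c \<epsilon>) (2 * d1 vs * \<Omega>)" by simp
  from ap_sqrt[OF r_to_0 this] show ?thesis unfolding \<omega>_def[abs_def] using d1_vs Om by simp
qed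

lemma ap_a: "ap r a (\<omega>0 / c0)"
  unfolding a_def[abs_def] by (intro ap_divide[OF r_to_0] ap_omega ap_c c0)

lemma ap_b: "ap r b (- (Z / \<Omega>))"
proof -
  have "ap r (\<lambda>\<epsilon>. (0 - d \<epsilon>) / c \<epsilon>) ((0 - 2 * Z / (\<alpha> - \<delta>)) / c0)"
    by (intro ap_divide[OF r_to_0] ap_diff ap_const ap_d ap_c c0)
  moreover have "(0 - 2 * Z / (\<alpha> - \<delta>)) / c0 = - (Z / \<Omega>)"
  proof -
    have "(0 - 2 * z / D) / (2 * w / D) = - (z / w)" if "D \<noteq> 0" for z w D :: real using that by simp
    from this[OF alpha_delta(2)] show ?thesis .
  qed
  ultimately show ?thesis unfolding b_def[abs_def] by simp
qed

lemma bounded_a: "a \<in> O[at_right 0](\<lambda>_. 1)" and bounded_b: "b \<in> O[at_right 0](\<lambda>_. 1)"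
  by (rule tendsto_bounded[OF ap_tendsto[OF r_to_0 ap_a]], rule tendsto_bounded[OF ap_tendsto[OF r_to_0 ap_b]])

section \<open>Limits and bounds of the jets\<close>

lemma bounded_DD:
  assumes "Ck_on \<infinity> U h"
  shows "(\<lambda>\<epsilon>. DD (a \<epsilon>) (b \<epsilon>) i j h (\<pi> \<epsilon>)) \<in> O[at_right 0](\<lambda>_. 1)"
proof -
  obtain G where G: "family U G" "\<And>\<epsilon> p. p \<in> U \<Longrightarrow> DD (a \<epsilon>) (b \<epsilon>) i j h p = G \<epsilon> p"
    using family_DD[OF openU assms bounded_a bounded_b] by blast
  have "eventually (\<lambda>\<epsilon>. DD (a \<epsilon>) (b \<epsilon>) i j h (\<pi> \<epsilon>) = G \<epsilon> (\<pi> \<epsilon>)) (at_right 0)"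
    using pi_in_U by eventually_elim (rule G(2))
  from landau_o.big.in_cong[OF this] show ?thesis
    using family_bounded[OF G(1) openU zeroU pi_to_0] by blast
qed

text \<open>Apart from the values of the functions themselves, these are the orders whose limits
  enter the result. For the last one, a is constant in the point and comes out of the inner
  derivative.\<close>

lemma DD_leading:
  assumes "Ck_on \<infinity> U h"
  shows "ap r (\<lambda>\<epsilon>. DD (a \<epsilon>) (b \<epsilon>) 1 0 h (\<pi> \<epsilon>)) (\<omega>0 / c0 * px h 0)"
    and "ap r (\<lambda>\<epsilon>. DD (a \<epsilon>) (b \<epsilon>) 0 1 h (\<pi> \<epsilon>)) (- (Z / \<Omega>) * px h 0 + py h 0)"
    and "ap r (\<lambda>\<epsilon>. DD (a \<epsilon>) (b \<epsilon>) 2 0 h (\<pi> \<epsilon>)) (\<omega>0 / c0 * (\<omega>0 / c0) * px (px h) 0)"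
proof -
  show "ap r (\<lambda>\<epsilon>. DD (a \<epsilon>) (b \<epsilon>) 1 0 h (\<pi> \<epsilon>)) (\<omega>0 / c0 * px h 0)"
    unfolding One_nat_def DD_Suc D1_def by (intro ap_mult[OF r_to_0] ap_a ap_smooth smooth_partial assms)
  show "ap r (\<lambda>\<epsilon>. DD (a \<epsilon>) (b \<epsilon>) 0 1 h (\<pi> \<epsilon>)) (- (Z / \<Omega>) * px h 0 + py h 0)"
    unfolding One_nat_def DD_Suc D2_def by (intro ap_add ap_mult[OF r_to_0] ap_b ap_smooth smooth_partial assms)
  have "ap r (\<lambda>\<epsilon>. a \<epsilon> * a \<epsilon> * px (px h) (\<pi> \<epsilon>)) (\<omega>0 / c0 * (\<omega>0 / c0) * px (px h) 0)"
    by (intro ap_mult[OF r_to_0] ap_a ap_smooth smooth_partial assms)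
  moreover have "eventually (\<lambda>\<epsilon>. DD (a \<epsilon>) (b \<epsilon>) 2 0 h (\<pi> \<epsilon>) = a \<epsilon> * a \<epsilon> * px (px h) (\<pi> \<epsilon>)) (at_right 0)"
    using pi_in_U
    by eventually_elim (simp add: numeral_2_eq_2 DD_Suc D1_def[abs_def] partial_cmult(1)[OF smooth_partial(1)[OF assms]])
  ultimately show "ap r (\<lambda>\<epsilon>. DD (a \<epsilon>) (b \<epsilon>) 2 0 h (\<pi> \<epsilon>)) (\<omega>0 / c0 * (\<omega>0 / c0) * px (px h) 0)"
    by (rule ap_cong)
qed

lemma bounded_mix_DD:
  "Ck_on \<infinity> U f \<Longrightarrow> Ck_on \<infinity> U g \<Longrightarrow>
    (\<lambda>\<epsilon>. mix (DD (a \<epsilon>) (b \<epsilon>) i j f) (DD (a \<epsilon>) (b \<epsilon>) i j g) (v \<epsilon>) (\<pi> \<epsilon>)) \<in> O[at_right 0](\<lambda>_. 1)"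
  by (rule bounded_mix) (rule bounded_DD, assumption)+

text \<open>Disposes of the terms that keep a positive power of sqrt(\<epsilon>): boundedness is
  enough for them.\<close>

lemma ap_small:
  assumes "X \<in> O[at_right 0](\<lambda>_. 1)" "n > 0"
  shows "ap r (\<lambda>\<epsilon>. sqrt \<epsilon> ^ n * X \<epsilon>) 0"
  by (rule ap_zero_mult[OF _ assms(1)]) (use ap_power[OF r_to_0 ap_sqrt_0, of n] assms(2) in \<open>simp add: zero_power\<close>)

lemma bounded_d1_diff:
  assumes "Ck_on \<infinity> U f" "Ck_on \<infinity> U g"
  shows "(\<lambda>\<epsilon>. m * d1 (v \<epsilon>) * (DD (a \<epsilon>) (b \<epsilon>) i j f (\<pi> \<epsilon>) - DD (a \<epsilon>) (b \<epsilon>) i j g (\<pi> \<epsilon>))) \<in> O[at_right 0](\<lambda>_. 1)"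
proof -
  have "(\<lambda>\<epsilon>. m * d1 (v \<epsilon>)) \<in> O[at_right 0](\<lambda>_. 1)"
    by (rule tendsto_bounded[OF ap_tendsto[OF r_to_0 ap_mult[OF r_to_0 ap_const ap_phi(2)]]])
  moreover have "(\<lambda>\<epsilon>. DD (a \<epsilon>) (b \<epsilon>) i j f (\<pi> \<epsilon>) - DD (a \<epsilon>) (b \<epsilon>) i j g (\<pi> \<epsilon>)) \<in> O[at_right 0](\<lambda>_. 1)"
    by (intro sum_in_bigo bounded_DD assms)
  ultimately have "(\<lambda>\<epsilon>. m * d1 (v \<epsilon>) * (DD (a \<epsilon>) (b \<epsilon>) i j f (\<pi> \<epsilon>) - DD (a \<epsilon>) (b \<epsilon>) i j g (\<pi> \<epsilon>))) \<in> O[at_right 0](\<lambda>_. 1 * 1)"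
    by (rule landau_o.big.mult)
  then show ?thesis by (simp only: mult_1_left)
qed

abbreviation "M f g i j \<epsilon> \<equiv> mix (DD (a \<epsilon>) (b \<epsilon>) i j f) (DD (a \<epsilon>) (b \<epsilon>) i j g) (v \<epsilon>) (\<pi> \<epsilon>)"
abbreviation "\<Delta> f g i j \<epsilon> \<equiv> DD (a \<epsilon>) (b \<epsilon>) i j f (\<pi> \<epsilon>) - DD (a \<epsilon>) (b \<epsilon>) i j g (\<pi> \<epsilon>)"
abbreviation "CD \<epsilon> \<equiv> (C (\<pi> \<epsilon>) - D (\<pi> \<epsilon>)) / \<epsilon>"

text \<open>F and G belong to the first and the second component, and the digits count the
  derivatives in w and in v. The powers of sqrt(\<epsilon>) pulled out are those of
  \<open>lyapunov_form_scaled\<close>.\<close>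

definition "F20 \<epsilon> = sqrt \<epsilon> ^ 1 * M A B 2 0 \<epsilon>"
definition "F30 \<epsilon> = sqrt \<epsilon> ^ 2 * M A B 3 0 \<epsilon>"
definition "F11 \<epsilon> = sqrt \<epsilon> ^ 2 * M A B 1 1 \<epsilon> + d1 (v \<epsilon>) * \<Delta> A B 1 0 \<epsilon>"
definition "F12 \<epsilon> = sqrt \<epsilon> ^ 4 * M A B 1 2 \<epsilon> + sqrt \<epsilon> ^ 2 * (2 * d1 (v \<epsilon>) * \<Delta> A B 1 1 \<epsilon>) + d2 (v \<epsilon>) * \<Delta> A B 1 0 \<epsilon>"
definition "F02 \<epsilon> = sqrt \<epsilon> ^ 4 * M A B 0 2 \<epsilon> + sqrt \<epsilon> ^ 2 * (2 * d1 (v \<epsilon>) * \<Delta> A B 0 1 \<epsilon>) + d2 (v \<epsilon>) * (A (\<pi> \<epsilon>) - B (\<pi> \<epsilon>))"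
definition "G20 \<epsilon> = M C D 2 0 \<epsilon>"
definition "G30 \<epsilon> = sqrt \<epsilon> ^ 1 * M C D 3 0 \<epsilon>"
definition "G11 \<epsilon> = sqrt \<epsilon> ^ 2 * M C D 1 1 \<epsilon> + d1 (v \<epsilon>) * \<Delta> C D 1 0 \<epsilon>"
definition "G12 \<epsilon> = sqrt \<epsilon> ^ 4 * M C D 1 2 \<epsilon> + sqrt \<epsilon> ^ 2 * (2 * d1 (v \<epsilon>) * \<Delta> C D 1 1 \<epsilon>) + d2 (v \<epsilon>) * \<Delta> C D 1 0 \<epsilon>"
definition "G02 \<epsilon> = sqrt \<epsilon> ^ 2 * M C D 0 2 \<epsilon> + 2 * d1 (v \<epsilon>) * \<Delta> C D 0 1 \<epsilon> + d2 (v \<epsilon>) * CD \<epsilon>"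
definition "G21 \<epsilon> = sqrt \<epsilon> ^ 2 * M C D 2 1 \<epsilon> + d1 (v \<epsilon>) * \<Delta> C D 2 0 \<epsilon>"
definition "G03 \<epsilon> = sqrt \<epsilon> ^ 4 * M C D 0 3 \<epsilon> + sqrt \<epsilon> ^ 2 * (3 * d1 (v \<epsilon>) * \<Delta> C D 0 2 \<epsilon>) + 3 * d2 (v \<epsilon>) * \<Delta> C D 0 1 \<epsilon>
   + d3 (v \<epsilon>) * CD \<epsilon>"

text \<open>In g 0 2 and g 0 3 the undifferentiated difference C - D is rewritten as \<epsilon>
  times \<open>CD\<close>, which provides their factor sqrt(\<epsilon>).\<close>

lemma mj_scaled:
  assumes "\<epsilon> > 0"
  defines "f \<equiv> mj A B (v \<epsilon>) (\<pi> \<epsilon>) (sqrt \<epsilon>) (a \<epsilon>) (b \<epsilon>)"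
    and "g \<equiv> \<lambda>i j. mj C D (v \<epsilon>) (\<pi> \<epsilon>) (sqrt \<epsilon>) (a \<epsilon>) (b \<epsilon>) i j / sqrt \<epsilon>"
  shows "f 2 0 = sqrt \<epsilon> * F20 \<epsilon>" "f 3 0 = sqrt \<epsilon> * F30 \<epsilon>" "f 1 1 = sqrt \<epsilon> * F11 \<epsilon>" "f 1 2 = sqrt \<epsilon> * F12 \<epsilon>" "f 0 2 = F02 \<epsilon>"
    "g 2 0 = sqrt \<epsilon> * G20 \<epsilon>" "g 3 0 = sqrt \<epsilon> * G30 \<epsilon>" "g 1 1 = G11 \<epsilon>" "g 1 2 = G12 \<epsilon>" "g 0 2 = sqrt \<epsilon> * G02 \<epsilon>"
    "g 2 1 = sqrt \<epsilon> * G21 \<epsilon>" "g 0 3 = sqrt \<epsilon> * G03 \<epsilon>"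
proof -
  define s where "s = sqrt \<epsilon>"
  have s: "s > 0" "\<epsilon> = s * s" using assms(1) by (simp_all add: s_def)
  have pw: "s ^ 4 = s * (s * (s * s))" "s ^ 6 = s * (s * (s * (s * (s * s))))"
    by (simp_all add: eval_nat_numeral)
  show "f 2 0 = sqrt \<epsilon> * F20 \<epsilon>" "f 3 0 = sqrt \<epsilon> * F30 \<epsilon>" "f 1 1 = sqrt \<epsilon> * F11 \<epsilon>" "f 1 2 = sqrt \<epsilon> * F12 \<epsilon>" "f 0 2 = F02 \<epsilon>"
    unfolding f_def mj_simps F20_def F30_def F11_def F12_def F02_def s_def[symmetric]
    by (simp_all add: power2_eq_square power3_eq_cube algebra_simps)
  show "g 2 0 = sqrt \<epsilon> * G20 \<epsilon>" "g 3 0 = sqrt \<epsilon> * G30 \<epsilon>" "g 1 1 = G11 \<epsilon>" "g 1 2 = G12 \<epsilon>" "g 0 2 = sqrt \<epsilon> * G02 \<epsilon>"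
    "g 2 1 = sqrt \<epsilon> * G21 \<epsilon>" "g 0 3 = sqrt \<epsilon> * G03 \<epsilon>"
    unfolding g_def mj_simps G20_def G30_def G11_def G12_def G02_def G21_def G03_def s_def[symmetric]
    using s(1) unfolding s(2) pw
    by (simp_all add: power2_eq_square power3_eq_cube field_simps)
qed

lemma ap_jets:
  "ap r F20 0" "ap r F30 0" "ap r G30 0"
  "ap r F11 (d1 vs * (\<omega>0 / c0 * \<zeta>p - \<omega>0 / c0 * \<zeta>m))"
  "ap r F12 (d2 vs * (\<omega>0 / c0 * \<zeta>p - \<omega>0 / c0 * \<zeta>m))"
  "ap r F02 (d2 vs * (- (\<alpha> - \<delta>)))"
  "ap r G20 (2 * \<alpha> / (\<alpha> - \<delta>) * (\<omega>0 / c0 * (\<omega>0 / c0) * (2 * \<eta>p)) + - 2 * \<delta> / (\<alpha> - \<delta>) * (\<omega>0 / c0 * (\<omega>0 / c0) * (2 * \<eta>m)))"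
  "ap r G11 (d1 vs * (\<omega>0 / c0 * (1 + \<beta>)))"
  "ap r G12 (d2 vs * (\<omega>0 / c0 * (1 + \<beta>)))"
  "ap r G21 (d1 vs * (\<omega>0 / c0 * (\<omega>0 / c0) * (2 * \<eta>p) - \<omega>0 / c0 * (\<omega>0 / c0) * (2 * \<eta>m)))"
  "ap r G02 (2 * d1 vs * (- (Z / \<Omega>) * (1 + \<beta>) + \<chi>p - \<chi>m) + d2 vs * K0)"
  "ap r G03 (3 * d2 vs * (- (Z / \<Omega>) * (1 + \<beta>) + \<chi>p - \<chi>m) + d3 vs * K0)"
proof -
  note bm = bounded_mix_DD[OF smooth(1,2)] bounded_mix_DD[OF smooth(3,4)]
  note bd = bounded_d1_diff[OF smooth(1,2)] bounded_d1_diff[OF smooth(3,4)]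
  note lA = DD_leading[OF smooth(1), unfolded A0] and lB = DD_leading[OF smooth(2), unfolded B0]
    and lC = DD_leading[OF smooth(3), unfolded C0] and lD = DD_leading[OF smooth(4), unfolded D0]
  have n: "0 < (1::nat)" "0 < (2::nat)" "0 < (4::nat)" by simp_all
  have eq: "ap r X L \<Longrightarrow> L = L' \<Longrightarrow> ap r X L'" for X L L' by simp
  show "ap r F20 0" "ap r F30 0" "ap r G30 0"
    unfolding F20_def[abs_def] F30_def[abs_def] G30_def[abs_def]
    by (rule ap_small[OF bm(1) n(1)] ap_small[OF bm(1) n(2)] ap_small[OF bm(2) n(1)])+
  show "ap r F11 (d1 vs * (\<omega>0 / c0 * \<zeta>p - \<omega>0 / c0 * \<zeta>m))"
    unfolding F11_def[abs_def]
    by (rule eq[OF ap_add[OF ap_small[OF bm(1) n(2)] ap_mult[OF r_to_0 ap_phi(2) ap_diff[OF lA(1) lB(1)]]]]) simp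
  show "ap r F12 (d2 vs * (\<omega>0 / c0 * \<zeta>p - \<omega>0 / c0 * \<zeta>m))"
    unfolding F12_def[abs_def]
    by (rule eq[OF ap_add[OF ap_add[OF ap_small[OF bm(1) n(3)] ap_small[OF bd(1) n(2)]]
            ap_mult[OF r_to_0 ap_phi(3) ap_diff[OF lA(1) lB(1)]]]]) simp
  show "ap r F02 (d2 vs * (- (\<alpha> - \<delta>)))"
    unfolding F02_def[abs_def]
    by (rule eq[OF ap_add[OF ap_add[OF ap_small[OF bm(1) n(3)] ap_small[OF bd(1) n(2)]]
            ap_mult[OF r_to_0 ap_phi(3) ap_diff[OF ap_smooth[OF smooth(1)] ap_smooth[OF smooth(2)]]]]])
      (simp add: A0 B0)
  show "ap r G20 (2 * \<alpha> / (\<alpha> - \<delta>) * (\<omega>0 / c0 * (\<omega>0 / c0) * (2 * \<eta>p)) + - 2 * \<delta> / (\<alpha> - \<delta>) * (\<omega>0 / c0 * (\<omega>0 / c0) * (2 * \<eta>m)))"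
    unfolding G20_def[abs_def] kappa(2,3)[symmetric] by (rule ap_mix, rule lC(3), rule lD(3))
  show "ap r G11 (d1 vs * (\<omega>0 / c0 * (1 + \<beta>)))"
    unfolding G11_def[abs_def]
    by (rule eq[OF ap_add[OF ap_small[OF bm(2) n(2)] ap_mult[OF r_to_0 ap_phi(2) ap_diff[OF lC(1) lD(1)]]]])
      (simp add: distrib_left)
  show "ap r G12 (d2 vs * (\<omega>0 / c0 * (1 + \<beta>)))"
    unfolding G12_def[abs_def]
    by (rule eq[OF ap_add[OF ap_add[OF ap_small[OF bm(2) n(3)] ap_small[OF bd(2) n(2)]]
            ap_mult[OF r_to_0 ap_phi(3) ap_diff[OF lC(1) lD(1)]]]]) (simp add: distrib_left)
  show "ap r G21 (d1 vs * (\<omega>0 / c0 * (\<omega>0 / c0) * (2 * \<eta>p) - \<omega>0 / c0 * (\<omega>0 / c0) * (2 * \<eta>m)))"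
    unfolding G21_def[abs_def]
    by (rule eq[OF ap_add[OF ap_small[OF bm(2) n(2)] ap_mult[OF r_to_0 ap_phi(2) ap_diff[OF lC(3) lD(3)]]]]) simp
  have S: "- (Z / \<Omega>) * 1 + \<chi>p - (- (Z / \<Omega>) * - \<beta> + \<chi>m) = - (Z / \<Omega>) * (1 + \<beta>) + \<chi>p - \<chi>m"
    by (simp add: distrib_left)
  show "ap r G02 (2 * d1 vs * (- (Z / \<Omega>) * (1 + \<beta>) + \<chi>p - \<chi>m) + d2 vs * K0)"
    unfolding G02_def[abs_def]
    by (rule eq[OF ap_add[OF ap_add[OF ap_small[OF bm(2) n(2)]
              ap_mult[OF r_to_0 ap_mult[OF r_to_0 ap_const ap_phi(2)] ap_diff[OF lC(2) lD(2)]]]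
            ap_mult[OF r_to_0 ap_phi(3) ap_CD]]]) (simp only: S add_0)
  show "ap r G03 (3 * d2 vs * (- (Z / \<Omega>) * (1 + \<beta>) + \<chi>p - \<chi>m) + d3 vs * K0)"
    unfolding G03_def[abs_def]
    by (rule eq[OF ap_add[OF ap_add[OF ap_add[OF ap_small[OF bm(2) n(3)] ap_small[OF bd(2) n(2)]]
              ap_mult[OF r_to_0 ap_mult[OF r_to_0 ap_const ap_phi(3)] ap_diff[OF lC(2) lD(2)]]]
            ap_mult[OF r_to_0 ap_phi(4) ap_CD]]]) (simp only: S add_0)
qed

end

context hopf_asymptotics
begin

definition "Lv \<epsilon> = ((c \<epsilon> * F30 \<epsilon> + sqrt \<epsilon> * (d \<epsilon> * G30 \<epsilon>)) / \<omega> \<epsilon> + (c \<epsilon> * F12 \<epsilon> + d \<epsilon> * G12 \<epsilon>) / \<omega> \<epsilon> + G21 \<epsilon> + G03 \<epsilon>) / 16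
      + ((c \<epsilon> * F11 \<epsilon> + d \<epsilon> * G11 \<epsilon>) / \<omega> \<epsilon> *
           (sqrt \<epsilon> * ((c \<epsilon> * F20 \<epsilon> + sqrt \<epsilon> * (d \<epsilon> * G20 \<epsilon>)) / \<omega> \<epsilon>)
             + (c \<epsilon> * F02 \<epsilon> + sqrt \<epsilon> * (sqrt \<epsilon> * (d \<epsilon> * G02 \<epsilon>))) / \<omega> \<epsilon>)
         - G11 \<epsilon> * (G20 \<epsilon> + G02 \<epsilon>)
         - sqrt \<epsilon> * ((c \<epsilon> * F20 \<epsilon> + sqrt \<epsilon> * (d \<epsilon> * G20 \<epsilon>)) / \<omega> \<epsilon> * G20 \<epsilon>)
         + (c \<epsilon> * F02 \<epsilon> + sqrt \<epsilon> * (sqrt \<epsilon> * (d \<epsilon> * G02 \<epsilon>))) / \<omega> \<epsilon> * G02 \<epsilon>) / (16 * \<omega> \<epsilon>)"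

abbreviation "slope \<equiv> lyapunov_slope \<alpha> \<beta> \<delta> \<zeta>p \<zeta>m \<eta>p \<eta>m \<chi>p \<chi>m \<phi>"

lemma ap_Lv: "ap r Lv slope"
proof -
  let ?a0 = "\<omega>0 / c0" and ?dd = "2 * Z / (\<alpha> - \<delta>)" and ?S = "- (Z / \<Omega>) * (1 + \<beta>) + \<chi>p - \<chi>m"
  let ?f11 = "d1 vs * (?a0 * \<zeta>p - ?a0 * \<zeta>m)" and ?f12 = "d2 vs * (?a0 * \<zeta>p - ?a0 * \<zeta>m)"
    and ?f02 = "d2 vs * (- (\<alpha> - \<delta>))"
    and ?g20 = "2 * \<alpha> / (\<alpha> - \<delta>) * (?a0 * ?a0 * (2 * \<eta>p)) + - 2 * \<delta> / (\<alpha> - \<delta>) * (?a0 * ?a0 * (2 * \<eta>m))"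
    and ?g11 = "d1 vs * (?a0 * (1 + \<beta>))" and ?g12 = "d2 vs * (?a0 * (1 + \<beta>))"
    and ?g21 = "d1 vs * (?a0 * ?a0 * (2 * \<eta>p) - ?a0 * ?a0 * (2 * \<eta>m))"
    and ?g02 = "2 * d1 vs * ?S + d2 vs * K0" and ?g03 = "3 * d2 vs * ?S + d3 vs * K0"
  have o: "\<omega>0 \<noteq> 0" by (rule less_imp_neq[OF omega0(1), symmetric])
  have o16: "16 * \<omega>0 \<noteq> 0" by (rule no_zero_divisors[OF zero_neq_numeral[symmetric] o])
  \<comment> \<open>The limit has the shape of \<open>Lv\<close>, zeros included, so that the rules
    for \<open>ap\<close> apply term by term; only then is it simplified.\<close>
  have "ap r Lv (((c0 * 0 + 0 * (?dd * 0)) / \<omega>0 + (c0 * ?f12 + ?dd * ?g12) / \<omega>0 + ?g21 + ?g03) / 16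
      + ((c0 * ?f11 + ?dd * ?g11) / \<omega>0 *
           (0 * ((c0 * 0 + 0 * (?dd * ?g20)) / \<omega>0) + (c0 * ?f02 + 0 * (0 * (?dd * ?g02))) / \<omega>0)
         - ?g11 * (?g20 + ?g02) - 0 * ((c0 * 0 + 0 * (?dd * ?g20)) / \<omega>0 * ?g20)
         + (c0 * ?f02 + 0 * (0 * (?dd * ?g02))) / \<omega>0 * ?g02) / (16 * \<omega>0))"
    unfolding Lv_def[abs_def]
    by (intro ap_divide[OF r_to_0 _ _ o] ap_divide[OF r_to_0 _ _ o16]
        ap_divide[OF r_to_0 _ ap_const[of r 16] zero_neq_numeral[symmetric]]
        ap_add ap_diff ap_mult[OF r_to_0] ap_c ap_d ap_omega ap_sqrt_0 ap_jets ap_const)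
  then have 1: "ap r Lv ((0 / \<omega>0 + (c0 * ?f12 + ?dd * ?g12) / \<omega>0 + ?g21 + ?g03) / 16
      + ((c0 * ?f11 + ?dd * ?g11) / \<omega>0 * (c0 * ?f02 / \<omega>0)
         - ?g11 * (?g20 + ?g02) + c0 * ?f02 / \<omega>0 * ?g02) / (16 * \<omega>0))"
    by (simp only: mult_zero_left mult_zero_right add_0_left add_0_right diff_zero)
  have w: "\<Omega> \<noteq> 0" "d1 vs \<noteq> 0" using Om d1_vs by simp_all
  have "(0 / \<omega>0 + (c0 * ?f12 + ?dd * ?g12) / \<omega>0 + ?g21 + ?g03) / 16
      + ((c0 * ?f11 + ?dd * ?g11) / \<omega>0 * (c0 * ?f02 / \<omega>0)
         - ?g11 * (?g20 + ?g02) + c0 * ?f02 / \<omega>0 * ?g02) / (16 * \<omega>0) = slope"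
    unfolding limit_identity[OF alpha_delta(2) w o omega0(2)]
    unfolding slope_identity[OF alpha_delta(2) w]
    by (simp only: lyapunov_slope_def a2_def Let_def phi_H)
  then show ?thesis using 1 by simp
qed

lemma first_lyapunov_expansion:
  assumes "eventually (\<lambda>\<epsilon>. H \<epsilon> = first_lyapunov (rescaled_field Xp Xm \<phi> \<epsilon> (snd (snd (\<pi> \<epsilon>))))
     (fst (\<pi> \<epsilon>) / sqrt \<epsilon>, fst (snd (\<pi> \<epsilon>)) / \<epsilon>) \<and> v \<epsilon> = fst (snd (\<pi> \<epsilon>)) / \<epsilon>) (at_right 0)"
  shows "(\<lambda>\<epsilon>. H \<epsilon> - slope * sqrt \<epsilon>) \<in> O[at_right 0](\<lambda>\<epsilon>. sqrt \<epsilon> * r \<epsilon>)"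
proof -
  have "eventually (\<lambda>\<epsilon>. c \<epsilon> \<noteq> 0) (at_right 0)"
    by (rule tendsto_imp_eventually_ne[OF ap_tendsto[OF r_to_0 ap_c] c0])
  then have "eventually (\<lambda>\<epsilon>. H \<epsilon> - slope * sqrt \<epsilon> = sqrt \<epsilon> * (Lv \<epsilon> - slope)) (at_right 0)"
    using assms pi_in_U eps_pos
  proof eventually_elim
    case (elim \<epsilon>)
    obtain x y \<mu> where p: "\<pi> \<epsilon> = (x, y, \<mu>)" by (cases "\<pi> \<epsilon>")
    have v: "v \<epsilon> = y / \<epsilon>" and u: "(x, y, \<mu>) \<in> U" using elim(2,3) by (simp_all add: p)
    have "H \<epsilon> = lyapunov_form (\<omega> \<epsilon>)
      (\<lambda>i j. (c \<epsilon> * mj A B (v \<epsilon>) (\<pi> \<epsilon>) (sqrt \<epsilon>) (a \<epsilon>) (b \<epsilon>) i j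
           + sqrt \<epsilon> * d \<epsilon> * (mj C D (v \<epsilon>) (\<pi> \<epsilon>) (sqrt \<epsilon>) (a \<epsilon>) (b \<epsilon>) i j / sqrt \<epsilon>)) / \<omega> \<epsilon>)
      (\<lambda>i j. mj C D (v \<epsilon>) (\<pi> \<epsilon>) (sqrt \<epsilon>) (a \<epsilon>) (b \<epsilon>) i j / sqrt \<epsilon>)"
      using elim(2) first_lyapunov_rescaled[OF elim(4) u] elim(1)
      unfolding a_def b_def c_def d_def \<omega>_def v p by simp
    also have "\<dots> = sqrt \<epsilon> * Lv \<epsilon>"
      unfolding Lv_def by (rule lyapunov_form_scaled) (rule mj_scaled[OF elim(4)])+
    finally show ?case by (simp add: algebra_simps)
  qed
  from landau_o.big.in_cong[OF this]
  show ?thesis using landau_o.big.mult[OF landau_o.big_refl[of sqrt "at_right 0"] ap_Lv[unfolded ap_def]] by blast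
qed

end

text \<open>E is arbitrary. Its defining bounds and \<open>\<mu>\<^sub>H\<close> = O(\<epsilon>)
  make the Hopf point O(\<epsilon>), and the imaginary eigenvalue makes the trace vanish; this is
  what \<open>hopf_asymptotics\<close> asks for.\<close>

lemma (in pws) hopf_lyapunov_expansion:
  assumes hopf: "hopf_of_family \<alpha> \<beta> \<delta> Xp Xm \<phi> E \<mu>\<^sub>H"
  defines "slope \<equiv> lyapunov_slope \<alpha> \<beta> \<delta> \<zeta>p \<zeta>m \<eta>p \<eta>m \<chi>p \<chi>m \<phi>"
  shows "(\<lambda>\<epsilon>. hopf_lyapunov Xp Xm \<phi> E \<mu>\<^sub>H \<epsilon> - slope * sqrt \<epsilon>) \<in> o[at_right 0](\<lambda>\<epsilon>. sqrt \<epsilon>)"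
    and "4 \<le> k \<Longrightarrow> (\<lambda>\<epsilon>. hopf_lyapunov Xp Xm \<phi> E \<mu>\<^sub>H \<epsilon> - slope * sqrt \<epsilon>) \<in> O[at_right 0](\<lambda>\<epsilon>. \<epsilon>)"
proof -
  define \<pi> where "\<pi> \<epsilon> = (fst (E \<epsilon> (\<mu>\<^sub>H \<epsilon>)), snd (E \<epsilon> (\<mu>\<^sub>H \<epsilon>)), \<mu>\<^sub>H \<epsilon>)" for \<epsilon>
  define v where "v \<epsilon> = snd (E \<epsilon> (\<mu>\<^sub>H \<epsilon>)) / \<epsilon>" for \<epsilon>
  have eps_pos: "eventually (\<lambda>\<epsilon>::real. \<epsilon> > 0) (at_right 0)" by (simp add: eventually_at_right_less)
  obtain \<epsilon>\<^sub>0 \<mu>\<^sub>0 \<rho> K where fam: "\<epsilon>\<^sub>0 > 0" "\<mu>\<^sub>0 > 0" and fam': "\<And>\<epsilon> \<mu>. \<epsilon> \<in> {0<..<\<epsilon>\<^sub>0} \<Longrightarrow> \<mu> \<in> {-\<mu>\<^sub>0<..<\<mu>\<^sub>0} \<Longrightarrow>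
      E \<epsilon> \<mu> \<in> ball 0 \<rho> \<and> regularized_field Xp Xm \<phi> \<epsilon> \<mu> (E \<epsilon> \<mu>) = 0 \<and>
        (\<forall>p\<in>ball 0 \<rho>. regularized_field Xp Xm \<phi> \<epsilon> \<mu> p = 0 \<longrightarrow> p = E \<epsilon> \<mu>) \<and>
        \<bar>fst (E \<epsilon> \<mu>) - \<beta> * \<delta> / (\<beta> * \<delta> + \<alpha>) * \<mu>\<bar> \<le> K * (\<mu>\<^sup>2 + \<epsilon>) \<and>
        \<bar>snd (E \<epsilon> \<mu>)\<bar> \<le> K * \<epsilon>"
    using hopf unfolding hopf_of_family_def equilibrium_family_def by blast
  obtain M where M: "M > 0" "eventually (\<lambda>\<epsilon>. norm (\<mu>\<^sub>H \<epsilon>) \<le> M * norm \<epsilon>) (at_right 0)"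
    using hopf unfolding hopf_of_family_def by (auto elim: landau_o.bigE)
  have small: "eventually (\<lambda>\<epsilon>. \<epsilon> \<in> {0<..<min (min \<epsilon>\<^sub>0 1) (\<mu>\<^sub>0 / M)}) (at_right 0)"
    using fam M(1) by (intro eventually_at_right_real) auto
  have good: "eventually (\<lambda>\<epsilon>. \<epsilon> \<in> {0<..<\<epsilon>\<^sub>0} \<and> \<mu>\<^sub>H \<epsilon> \<in> {-\<mu>\<^sub>0<..<\<mu>\<^sub>0} \<and> \<bar>\<mu>\<^sub>H \<epsilon>\<bar> \<le> M * \<epsilon> \<and> \<epsilon> < 1) (at_right 0)"
    using small M(2)
  proof eventually_elim
    case (elim \<epsilon>)
    have "M * \<epsilon> < \<mu>\<^sub>0" using elim(1) M(1) by (simp add: field_simps)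
    then show ?case using elim by (auto simp: abs_le_iff)
  qed
  have pi_O: "(\<lambda>\<epsilon>. norm (\<pi> \<epsilon>)) \<in> O[at_right 0](\<lambda>\<epsilon>. \<epsilon>)"
  \<comment> \<open>The first two summands bound x, the third y and the last \<mu>; \<epsilon> < 1
    turns (M \<epsilon>)^2 into at most M^2 \<epsilon>. The sign of K is unknown, hence the absolute
    values.\<close>
  proof (rule bigoI[of _ "\<bar>\<beta> * \<delta> / \<Omega>\<bar> * M + \<bar>K\<bar> * (M\<^sup>2 + 1) + \<bar>K\<bar> + M"])
    show "eventually (\<lambda>\<epsilon>. norm (norm (\<pi> \<epsilon>)) \<le> (\<bar>\<beta> * \<delta> / \<Omega>\<bar> * M + \<bar>K\<bar> * (M\<^sup>2 + 1) + \<bar>K\<bar> + M) * norm \<epsilon>) (at_right 0)"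
      using good
    proof eventually_elim
      case (elim \<epsilon>)
      let ?x = "fst (E \<epsilon> (\<mu>\<^sub>H \<epsilon>))" and ?y = "snd (E \<epsilon> (\<mu>\<^sub>H \<epsilon>))" and ?m = "\<mu>\<^sub>H \<epsilon>" and ?c = "\<beta> * \<delta> / \<Omega>"
      have e: "\<epsilon> > 0" "\<epsilon> < 1" and m: "\<bar>?m\<bar> \<le> M * \<epsilon>" using elim by auto
      have f: "\<bar>?x - ?c * ?m\<bar> \<le> K * (?m\<^sup>2 + \<epsilon>)" "\<bar>?y\<bar> \<le> K * \<epsilon>" using fam'[of \<epsilon> ?m] elim by auto
      have "?m\<^sup>2 \<le> (M * \<epsilon>)\<^sup>2" using m by (metis abs_ge_zero power2_abs power_mono)
      also have "\<dots> \<le> M\<^sup>2 * \<epsilon>" using e mult_left_mono[of "\<epsilon> * \<epsilon>" \<epsilon> "M\<^sup>2"] by (simp add: power2_eq_square mult_ac mult_left_le)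
      finally have m2: "?m\<^sup>2 + \<epsilon> \<le> (M\<^sup>2 + 1) * \<epsilon>" by (simp add: distrib_right)
      have "\<bar>?x\<bar> \<le> \<bar>?c\<bar> * \<bar>?m\<bar> + K * (?m\<^sup>2 + \<epsilon>)"
        using f(1) unfolding abs_mult[symmetric] by linarith
      moreover have "\<bar>?c\<bar> * \<bar>?m\<bar> \<le> \<bar>?c\<bar> * (M * \<epsilon>)" using m by (intro mult_left_mono) auto
      moreover have "K * (?m\<^sup>2 + \<epsilon>) \<le> \<bar>K\<bar> * ((M\<^sup>2 + 1) * \<epsilon>)" using m2 e by (intro mult_mono) auto
      moreover have "K * \<epsilon> \<le> \<bar>K\<bar> * \<epsilon>" using e by (intro mult_right_mono) auto
      moreover have "norm (\<pi> \<epsilon>) \<le> \<bar>?x\<bar> + \<bar>?y\<bar> + \<bar>?m\<bar>" unfolding \<pi>_def by (rule abs_le_norm3(4))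
      ultimately have "norm (\<pi> \<epsilon>) \<le> \<bar>?c\<bar> * (M * \<epsilon>) + \<bar>K\<bar> * ((M\<^sup>2 + 1) * \<epsilon>) + \<bar>K\<bar> * \<epsilon> + M * \<epsilon>"
        using f(2) m by linarith
      then show ?case using e by (simp add: distrib_right mult.assoc)
    qed
  qed
  have "(\<lambda>\<epsilon>::real. \<epsilon>) \<in> o[at_right 0](\<lambda>_. 1)"
    by (intro smalloI_tendsto) (auto simp: tendsto_ident_at)
  from smalloD_tendsto[OF landau_o.big_small_trans[OF pi_O this]]
  have "((\<lambda>\<epsilon>. norm (\<pi> \<epsilon>)) \<longlongrightarrow> 0) (at_right 0)" by simp
  then have "(\<pi> \<longlongrightarrow> 0) (at_right 0)" by (rule tendsto_norm_zero_cancel)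
  from topological_tendstoD[OF this openU zeroU]
  have piU: "eventually (\<lambda>\<epsilon>. \<pi> \<epsilon> \<in> U) (at_right 0)" .
  have eq: "eventually (\<lambda>\<epsilon>. mix A B (v \<epsilon>) (\<pi> \<epsilon>) = 0) (at_right 0)"
    using good
  proof eventually_elim
    case (elim \<epsilon>)
    have "regularized_field Xp Xm \<phi> \<epsilon> (\<mu>\<^sub>H \<epsilon>) (E \<epsilon> (\<mu>\<^sub>H \<epsilon>)) = 0" using fam'[of \<epsilon> "\<mu>\<^sub>H \<epsilon>"] elim by auto
    then show ?case
      using regularized_field_eq[of \<epsilon> "\<mu>\<^sub>H \<epsilon>" "fst (E \<epsilon> (\<mu>\<^sub>H \<epsilon>))" "snd (E \<epsilon> (\<mu>\<^sub>H \<epsilon>))"]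
      by (simp add: \<pi>_def v_def zero_prod_def)
  qed
  have hb: "eventually (\<lambda>\<epsilon>. hopf_bifurcation (regularized_field Xp Xm \<phi> \<epsilon>) (E \<epsilon>) (\<mu>\<^sub>H \<epsilon>)) (at_right 0)"
    using hopf unfolding hopf_of_family_def by blast
  have tr: "eventually (\<lambda>\<epsilon>. J11 (v \<epsilon>) (\<pi> \<epsilon>) + J22 \<epsilon> (v \<epsilon>) (\<pi> \<epsilon>) = 0) (at_right 0)"
    using hb piU
  proof eventually_elim
    case (elim \<epsilon>)
    obtain l where ev: "eventually (\<lambda>\<mu>. regularized_field Xp Xm \<phi> \<epsilon> \<mu> (E \<epsilon> \<mu>) = 0 \<and>
        jacobian_eigenvalue (regularized_field Xp Xm \<phi> \<epsilon> \<mu>) (E \<epsilon> \<mu>) (l \<mu>)) (nhds (\<mu>\<^sub>H \<epsilon>))"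
      and l: "Re (l (\<mu>\<^sub>H \<epsilon>)) = 0" "Im (l (\<mu>\<^sub>H \<epsilon>)) > 0"
      using elim(1) unfolding hopf_bifurcation_def by blast
    have "jacobian_eigenvalue (regularized_field Xp Xm \<phi> \<epsilon> (\<mu>\<^sub>H \<epsilon>)) (E \<epsilon> (\<mu>\<^sub>H \<epsilon>)) (l (\<mu>\<^sub>H \<epsilon>))"
      using eventually_nhds_x_imp_x[OF ev] by blast
    from jacobian_eigenvalue_imaginary[OF this l]
    show ?case
      using jacobian_entries(1,4)[OF elim(2)[unfolded \<pi>_def], of \<epsilon>] by (simp add: \<pi>_def v_def)
  qed
  interpret h: hopf_asymptotics \<alpha> \<beta> \<delta> \<zeta>p \<zeta>m \<eta>p \<eta>m \<chi>p \<chi>m A B C D U \<phi> k \<pi> v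
    by (rule hopf_asymptotics.intro[OF pws_axioms hopf_asymptotics_axioms.intro[OF pi_O eq tr]])
  have main: "(\<lambda>\<epsilon>. hopf_lyapunov Xp Xm \<phi> E \<mu>\<^sub>H \<epsilon> - slope * sqrt \<epsilon>) \<in> O[at_right 0](\<lambda>\<epsilon>. sqrt \<epsilon> * h.r \<epsilon>)"
    unfolding slope_def
    by (rule h.first_lyapunov_expansion) (simp add: \<pi>_def v_def hopf_lyapunov_def Let_def)
  have "h.r \<in> o[at_right 0](\<lambda>_. 1)" using h.r_to_0 by (intro smalloI_tendsto) auto
  from landau_o.big_small_mult[OF landau_o.big_refl[of sqrt "at_right 0"] this]
  have "(\<lambda>\<epsilon>. sqrt \<epsilon> * h.r \<epsilon>) \<in> o[at_right 0](\<lambda>\<epsilon>. sqrt \<epsilon>)" by simp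
  with main show "(\<lambda>\<epsilon>. hopf_lyapunov Xp Xm \<phi> E \<mu>\<^sub>H \<epsilon> - slope * sqrt \<epsilon>) \<in> o[at_right 0](\<lambda>\<epsilon>. sqrt \<epsilon>)"
    by (rule landau_o.big_small_trans)
  show "(\<lambda>\<epsilon>. hopf_lyapunov Xp Xm \<phi> E \<mu>\<^sub>H \<epsilon> - slope * sqrt \<epsilon>) \<in> O[at_right 0](\<lambda>\<epsilon>. \<epsilon>)" if "4 \<le> k"
  proof -
    have "(\<lambda>\<epsilon>. sqrt \<epsilon> * h.r \<epsilon>) \<in> O[at_right 0](\<lambda>\<epsilon>. sqrt \<epsilon> * sqrt \<epsilon>)"
      by (rule landau_o.big.mult[OF landau_o.big_refl h.r_O_sqrt[OF that]])
    moreover have "(\<lambda>\<epsilon>. sqrt \<epsilon> * sqrt \<epsilon>) \<in> O[at_right 0](\<lambda>\<epsilon>. \<epsilon>)"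
      by (rule bigoI[of _ 1]) (use eps_pos in eventually_elim, simp)
    ultimately show ?thesis using main landau_o.big_trans by blast
  qed
qed

section \<open>The vector fields\<close>

lemma Cn_on_subset: "Cn_on n S f \<Longrightarrow> T \<subseteq> S \<Longrightarrow> Cn_on n T f"
proof (induction n arbitrary: f)
  case 0
  then show ?case by (auto intro: continuous_on_subset)
next
  case (Suc n)
  have "Cn_on n T (\<lambda>x. frechet_derivative f (at x) v)" for v
    by (rule Suc.IH) (use Suc.prems in auto)
  then show ?case using Suc.prems by auto
qed

lemma smooth_subset: "Ck_on \<infinity> S f \<Longrightarrow> T \<subseteq> S \<Longrightarrow> Ck_on \<infinity> T f"
  by (rule smoothI) (rule Cn_on_subset[OF smoothD])

lemma remainder_on_3:
  assumes "remainder_on [m1, m2, m3] U h"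
  obtains c1 c2 c3 where "Ck_on \<infinity> U c1" "Ck_on \<infinity> U c2" "Ck_on \<infinity> U c3"
    "\<And>p. p \<in> U \<Longrightarrow> h p = c1 p * m1 p + c2 p * m2 p + c3 p * m3 p"
proof -
  obtain cs where cs: "length cs = length [m1, m2, m3]" "\<forall>c\<in>set cs. Ck_on \<infinity> U c"
    "\<forall>p\<in>U. h p = (\<Sum>i<length [m1, m2, m3]. (cs ! i) p * ([m1, m2, m3] ! i) p)"
    using assms unfolding remainder_on_def by blast
  obtain c1 c2 c3 where c: "cs = [c1, c2, c3]" using cs(1) by (auto simp: length_Suc_conv)
  show ?thesis
    by (rule that[of c1 c2 c3]) (use cs(2,3) in \<open>auto simp: c numeral_2_eq_2 add.assoc\<close>)
qed

lemma remainder_on_4: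
  assumes "remainder_on [m1, m2, m3, m4] U h"
  obtains c1 c2 c3 c4 where "Ck_on \<infinity> U c1" "Ck_on \<infinity> U c2" "Ck_on \<infinity> U c3" "Ck_on \<infinity> U c4"
    "\<And>p. p \<in> U \<Longrightarrow> h p = c1 p * m1 p + c2 p * m2 p + c3 p * m3 p + c4 p * m4 p"
proof -
  obtain cs where cs: "length cs = length [m1, m2, m3, m4]" "\<forall>c\<in>set cs. Ck_on \<infinity> U c"
    "\<forall>p\<in>U. h p = (\<Sum>i<length [m1, m2, m3, m4]. (cs ! i) p * ([m1, m2, m3, m4] ! i) p)"
    using assms unfolding remainder_on_def by blast
  obtain c1 c2 c3 c4 where c: "cs = [c1, c2, c3, c4]" using cs(1) by (auto simp: length_Suc_conv)
  show ?thesis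
    by (rule that[of c1 c2 c3 c4]) (use cs(2,3) in \<open>auto simp: c eval_nat_numeral add.assoc\<close>)
qed

lemma smooth_coordinates:
  assumes "open U"
  shows "Ck_on \<infinity> U (\<lambda>p :: real \<times> real \<times> real. fst p)"
    "Ck_on \<infinity> U (\<lambda>p :: real \<times> real \<times> real. fst (snd p))"
    "Ck_on \<infinity> U (\<lambda>p :: real \<times> real \<times> real. snd (snd p))"
  by (intro smooth_linear assms bounded_linear_intros)+

section \<open>Taylor coefficients read off along the axes\<close>

lemma partials_on_axes:
  assumes "Ck_on \<infinity> U h" "open U"
  shows "(t, 0, 0) \<in> U \<Longrightarrow> ((\<lambda>t. h (t, 0, 0)) has_real_derivative px h (t, 0, 0)) (at t)"
    "(0, t, 0) \<in> U \<Longrightarrow> ((\<lambda>t. h (0, t, 0)) has_real_derivative py h (0, t, 0)) (at t)"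
    "(0, 0, t) \<in> U \<Longrightarrow> ((\<lambda>t. h (0, 0, t)) has_real_derivative pm h (0, 0, t)) (at t)"
proof -
  show "((\<lambda>t. h (t, 0, 0)) has_real_derivative px h (t, 0, 0)) (at t)" if "(t, 0, 0) \<in> U"
    by (rule DERIV_cong[OF has_real_derivative_smooth_compose[OF assms(1) that DERIV_ident DERIV_const DERIV_const]]) simp
  show "((\<lambda>t. h (0, t, 0)) has_real_derivative py h (0, t, 0)) (at t)" if "(0, t, 0) \<in> U"
    by (rule DERIV_cong[OF has_real_derivative_smooth_compose[OF assms(1) that DERIV_const DERIV_ident DERIV_const]]) simp
  show "((\<lambda>t. h (0, 0, t)) has_real_derivative pm h (0, 0, t)) (at t)" if "(0, 0, t) \<in> U"
    by (rule DERIV_cong[OF has_real_derivative_smooth_compose[OF assms(1) that DERIV_const DERIV_const DERIV_ident]]) simp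
qed

lemma open_axes:
  assumes "open (U :: (real \<times> real \<times> real) set)"
  shows "open {t. (t, 0, 0) \<in> U}" "open {t. (0, t, 0) \<in> U}" "open {t. (0, 0, t) \<in> U}"
proof -
  have "open ((\<lambda>t. (t, 0, 0)) -` U)" "open ((\<lambda>t. (0, t, 0)) -` U)" "open ((\<lambda>t. (0, 0, t)) -` U)"
    by (intro open_vimage assms continuous_intros)+
  then show "open {t. (t, 0, 0) \<in> U}" "open {t. (0, t, 0) \<in> U}" "open {t. (0, 0, t) \<in> U}"
    by (simp_all add: vimage_def)
qed

text \<open>On an axis most monomials of the remainders vanish, and a differentiable function has
  its partial derivative as derivative along the axis.\<close>

lemma partials_at_origin:
  assumes "Ck_on \<infinity> U h" "open U" "(0, 0, 0) \<in> U"
  shows "(\<And>t. (t, 0, 0) \<in> U \<Longrightarrow> h (t, 0, 0) = f t) \<Longrightarrow> (f has_real_derivative f') (at 0) \<Longrightarrow> px h 0 = f'"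
    "(\<And>t. (0, t, 0) \<in> U \<Longrightarrow> h (0, t, 0) = f t) \<Longrightarrow> (f has_real_derivative f') (at 0) \<Longrightarrow> py h 0 = f'"
    "(\<And>t. (0, 0, t) \<in> U \<Longrightarrow> h (0, 0, t) = f t) \<Longrightarrow> (f has_real_derivative f') (at 0) \<Longrightarrow> pm h 0 = f'"
proof -
  have z: "(0 :: real \<times> real \<times> real) = (0, 0, 0)" by (simp add: zero_prod_def)
  note pa = partials_on_axes[OF assms(1,2), of 0]
  show "px h 0 = f'" if e: "\<And>t. (t, 0, 0) \<in> U \<Longrightarrow> h (t, 0, 0) = f t" and f: "(f has_real_derivative f') (at 0)"
  proof -
    have "((\<lambda>t. h (t, 0, 0)) has_real_derivative f') (at 0)"
      by (rule has_field_derivative_transform_within_open[OF f open_axes(1)[OF assms(2)]]) (use e assms(3) in auto)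
    from DERIV_unique[OF pa(1)[OF assms(3)] this] show ?thesis by (simp add: z)
  qed
  show "py h 0 = f'" if e: "\<And>t. (0, t, 0) \<in> U \<Longrightarrow> h (0, t, 0) = f t" and f: "(f has_real_derivative f') (at 0)"
  proof -
    have "((\<lambda>t. h (0, t, 0)) has_real_derivative f') (at 0)"
      by (rule has_field_derivative_transform_within_open[OF f open_axes(2)[OF assms(2)]]) (use e assms(3) in auto)
    from DERIV_unique[OF pa(2)[OF assms(3)] this] show ?thesis by (simp add: z)
  qed
  show "pm h 0 = f'" if e: "\<And>t. (0, 0, t) \<in> U \<Longrightarrow> h (0, 0, t) = f t" and f: "(f has_real_derivative f') (at 0)"
  proof -
    have "((\<lambda>t. h (0, 0, t)) has_real_derivative f') (at 0)"
      by (rule has_field_derivative_transform_within_open[OF f open_axes(3)[OF assms(2)]]) (use e assms(3) in auto)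
    from DERIV_unique[OF pa(3)[OF assms(3)] this] show ?thesis by (simp add: z)
  qed
qed

text \<open>On the x-axis the remainders of both second components reduce to a smooth multiple of
  t^3, which does not reach the second derivative at 0.\<close>

lemma second_partial_at_origin:
  assumes h: "Ck_on \<infinity> U h" and k: "Ck_on \<infinity> U k" and U: "open U" "(0, 0, 0) \<in> U"
    and e: "\<And>t. (t, 0, 0) \<in> U \<Longrightarrow> h (t, 0, 0) = m * t + n * t\<^sup>2 + k (t, 0, 0) * t ^ 3"
  shows "px h 0 = m" "px (px h) 0 = 2 * n"
proof -
  have d: "((\<lambda>t. m * t + n * t\<^sup>2 + k (t, 0, 0) * t ^ 3) has_real_derivative
      m + 2 * n * t + (px k (t, 0, 0) * t ^ 3 + k (t, 0, 0) * (3 * t\<^sup>2))) (at t)" if "(t, 0, 0) \<in> U" for t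
    by (auto intro!: derivative_eq_intros partials_on_axes(1)[OF k U(1) that])
  have p: "px h (t, 0, 0) = m + 2 * n * t + (px k (t, 0, 0) * t ^ 3 + k (t, 0, 0) * (3 * t\<^sup>2))" if t: "(t, 0, 0) \<in> U" for t
  proof -
    have "((\<lambda>t. h (t, 0, 0)) has_real_derivative m + 2 * n * t + (px k (t, 0, 0) * t ^ 3 + k (t, 0, 0) * (3 * t\<^sup>2))) (at t)"
      by (rule has_field_derivative_transform_within_open[OF d[OF t] open_axes(1)[OF U(1)]]) (use e t in auto)
    from DERIV_unique[OF partials_on_axes(1)[OF h U(1) t] this] show ?thesis .
  qed
  have z: "(0 :: real \<times> real \<times> real) = (0, 0, 0)" by (simp add: zero_prod_def)
  show "px h 0 = m" using p[OF U(2)] by (simp add: z)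
  have "((\<lambda>t. m + 2 * n * t + (px k (t, 0, 0) * t ^ 3 + k (t, 0, 0) * (3 * t\<^sup>2))) has_real_derivative 2 * n) (at 0)"
    by (auto intro!: derivative_eq_intros partials_on_axes(1)[OF k U] partials_on_axes(1)[OF smooth_partial(1)[OF k] U])
  from partials_at_origin(1)[OF smooth_partial(1)[OF h] U p this] show "px (px h) 0 = 2 * n" .
qed

lemma first_component:
  assumes U: "open U" "(0, 0, 0) \<in> U"
    and r: "remainder_on [(\<lambda>(x, y, \<mu>). x\<^sup>2), (\<lambda>(x, y, \<mu>). y), (\<lambda>(x, y, \<mu>). \<mu>)] U
          (\<lambda>(x, y, \<mu>). fst (X (x, y) \<mu>) - (\<delta> + \<zeta> * x))"
  defines "A \<equiv> \<lambda>(x, y, \<mu>). fst (X (x, y) \<mu>)"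
  shows "Ck_on \<infinity> U A" "A 0 = \<delta>" "px A 0 = \<zeta>"
proof -
  obtain c1 c2 c3 where c: "Ck_on \<infinity> U c1" "Ck_on \<infinity> U c2" "Ck_on \<infinity> U c3" and
    h: "\<And>p. p \<in> U \<Longrightarrow> (\<lambda>(x, y, \<mu>). fst (X (x, y) \<mu>) - (\<delta> + \<zeta> * x)) p
      = c1 p * (\<lambda>(x, y, \<mu>). x\<^sup>2) p + c2 p * (\<lambda>(x, y, \<mu>). y) p + c3 p * (\<lambda>(x, y, \<mu>). \<mu>) p"
    using remainder_on_3[OF r] by blast
  have A: "A p = \<delta> + \<zeta> * fst p + (c1 p * (fst p)\<^sup>2 + c2 p * fst (snd p) + c3 p * snd (snd p))" if "p \<in> U" for p
    using h[OF that] by (cases p) (simp add: A_def)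
  have "Ck_on \<infinity> U (\<lambda>p. \<delta> + \<zeta> * fst p + (c1 p * (fst p)\<^sup>2 + c2 p * fst (snd p) + c3 p * snd (snd p)))"
    by (intro smooth_add smooth_mult smooth_power smooth_const smooth_coordinates U c)
  then show sm: "Ck_on \<infinity> U A" by (rule iffD2[OF smooth_cong[OF U(1)], rotated]) (rule A)
  show "A 0 = \<delta>" using A[OF U(2)] by (simp add: zero_prod_def)
  have "((\<lambda>t. \<delta> + \<zeta> * t + c1 (t, 0, 0) * t\<^sup>2) has_real_derivative \<zeta>) (at 0)"
    by (auto intro!: derivative_eq_intros partials_on_axes(1)[OF c(1) U])
  then show "px A 0 = \<zeta>" by (rule partials_at_origin(1)[OF sm U, rotated]) (use A in auto)
qed

lemma upper_second_component:
  assumes U: "open U" "(0, 0, 0) \<in> U"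
    and r: "remainder_on [(\<lambda>(x, y, \<mu>). x * y), (\<lambda>(x, y, \<mu>). \<mu> * x), (\<lambda>(x, y, \<mu>). \<mu> * y), (\<lambda>(x, y, \<mu>). x ^ 3)] U
          (\<lambda>(x, y, \<mu>). snd (X (x, y) \<mu>) - (x + \<eta> * x\<^sup>2 + \<xi> * y))"
  defines "C \<equiv> \<lambda>(x, y, \<mu>). snd (X (x, y) \<mu>)"
  shows "Ck_on \<infinity> U C" "C 0 = 0" "px C 0 = 1" "py C 0 = \<xi>" "pm C 0 = 0" "px (px C) 0 = 2 * \<eta>"
proof -
  obtain c1 c2 c3 c4 where c: "Ck_on \<infinity> U c1" "Ck_on \<infinity> U c2" "Ck_on \<infinity> U c3" "Ck_on \<infinity> U c4" and
    h: "\<And>p. p \<in> U \<Longrightarrow> (\<lambda>(x, y, \<mu>). snd (X (x, y) \<mu>) - (x + \<eta> * x\<^sup>2 + \<xi> * y)) p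
      = c1 p * (\<lambda>(x, y, \<mu>). x * y) p + c2 p * (\<lambda>(x, y, \<mu>). \<mu> * x) p + c3 p * (\<lambda>(x, y, \<mu>). \<mu> * y) p
        + c4 p * (\<lambda>(x, y, \<mu>). x ^ 3) p"
    using remainder_on_4[OF r] by blast
  have C: "C p = fst p + \<eta> * (fst p)\<^sup>2 + \<xi> * fst (snd p) + (c1 p * (fst p * fst (snd p)) + c2 p * (snd (snd p) * fst p)
      + c3 p * (snd (snd p) * fst (snd p)) + c4 p * fst p ^ 3)" if "p \<in> U" for p
    using h[OF that] by (cases p) (simp add: C_def)
  have "Ck_on \<infinity> U (\<lambda>p. fst p + \<eta> * (fst p)\<^sup>2 + \<xi> * fst (snd p) + (c1 p * (fst p * fst (snd p)) + c2 p * (snd (snd p) * fst p)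
      + c3 p * (snd (snd p) * fst (snd p)) + c4 p * fst p ^ 3))"
    by (intro smooth_add smooth_mult smooth_power smooth_const smooth_coordinates U c)
  then show sm: "Ck_on \<infinity> U C" by (rule iffD2[OF smooth_cong[OF U(1)], rotated]) (rule C)
  show "C 0 = 0" using C[OF U(2)] by (simp add: zero_prod_def)
  show "px C 0 = 1" "px (px C) 0 = 2 * \<eta>"
    by (rule second_partial_at_origin[OF sm c(4) U, of 1 \<eta>]; use C in auto)+
  have "((\<lambda>t. \<xi> * t) has_real_derivative \<xi>) (at 0)" by (auto intro!: derivative_eq_intros)
  then show "py C 0 = \<xi>"
    by (rule partials_at_origin(2)[OF sm U, rotated]) (use C in auto)
  have "((\<lambda>t. 0) has_real_derivative 0) (at (0::real))" by simp
  then show "pm C 0 = 0"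
    by (rule partials_at_origin(3)[OF sm U, rotated]) (use C in auto)
qed

lemma lower_second_component:
  assumes U: "open U" "(0, 0, 0) \<in> U"
    and r: "remainder_on [(\<lambda>(x, y, \<mu>). x * y), (\<lambda>(x, y, \<mu>). \<mu> * y), (\<lambda>(x, y, \<mu>). \<mu> * (x - \<mu>)), (\<lambda>(x, y, \<mu>). (x - \<mu>) ^ 3)] U
          (\<lambda>(x, y, \<mu>). snd (X (x, y) \<mu>) - (- \<beta> * (x - \<mu>) + \<eta> * (x - \<mu>)\<^sup>2 + \<xi> * y))"
  defines "D \<equiv> \<lambda>(x, y, \<mu>). snd (X (x, y) \<mu>)"
  shows "Ck_on \<infinity> U D" "D 0 = 0" "px D 0 = - \<beta>" "py D 0 = \<xi>" "pm D 0 = \<beta>" "px (px D) 0 = 2 * \<eta>"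
proof -
  obtain c1 c2 c3 c4 where c: "Ck_on \<infinity> U c1" "Ck_on \<infinity> U c2" "Ck_on \<infinity> U c3" "Ck_on \<infinity> U c4" and
    h: "\<And>p. p \<in> U \<Longrightarrow> (\<lambda>(x, y, \<mu>). snd (X (x, y) \<mu>) - (- \<beta> * (x - \<mu>) + \<eta> * (x - \<mu>)\<^sup>2 + \<xi> * y)) p
      = c1 p * (\<lambda>(x, y, \<mu>). x * y) p + c2 p * (\<lambda>(x, y, \<mu>). \<mu> * y) p + c3 p * (\<lambda>(x, y, \<mu>). \<mu> * (x - \<mu>)) p
        + c4 p * (\<lambda>(x, y, \<mu>). (x - \<mu>) ^ 3) p"
    using remainder_on_4[OF r] by blast
  have D: "D p = - \<beta> * (fst p - snd (snd p)) + \<eta> * (fst p - snd (snd p))\<^sup>2 + \<xi> * fst (snd p)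
      + (c1 p * (fst p * fst (snd p)) + c2 p * (snd (snd p) * fst (snd p))
      + c3 p * (snd (snd p) * (fst p - snd (snd p))) + c4 p * (fst p - snd (snd p)) ^ 3)" if "p \<in> U" for p
    using h[OF that] by (cases p) (simp add: D_def)
  have "Ck_on \<infinity> U (\<lambda>p. - \<beta> * (fst p - snd (snd p)) + \<eta> * (fst p - snd (snd p))\<^sup>2 + \<xi> * fst (snd p)
      + (c1 p * (fst p * fst (snd p)) + c2 p * (snd (snd p) * fst (snd p))
      + c3 p * (snd (snd p) * (fst p - snd (snd p))) + c4 p * (fst p - snd (snd p)) ^ 3))"
    by (intro smooth_add smooth_mult smooth_power smooth_diff smooth_const smooth_coordinates U c)
  then show sm: "Ck_on \<infinity> U D" by (rule iffD2[OF smooth_cong[OF U(1)], rotated]) (rule D)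
  show "D 0 = 0" using D[OF U(2)] by (simp add: zero_prod_def)
  show "px D 0 = - \<beta>" "px (px D) 0 = 2 * \<eta>"
    by (rule second_partial_at_origin[OF sm c(4) U, of "- \<beta>" \<eta>]; use D in auto)+
  have "((\<lambda>t. \<xi> * t) has_real_derivative \<xi>) (at 0)" by (auto intro!: derivative_eq_intros)
  then show "py D 0 = \<xi>"
    by (rule partials_at_origin(2)[OF sm U, rotated]) (use D in auto)
  \<comment> \<open>On the \<mu>-axis x - \<mu> equals - t, so the linear term becomes \<beta> t and
    every other term is at least quadratic.\<close>
  have "((\<lambda>t. - \<beta> * (0 - t) + \<eta> * (0 - t)\<^sup>2 + (c3 (0, 0, t) * (t * (0 - t)) + c4 (0, 0, t) * (0 - t) ^ 3)) has_real_derivative \<beta>) (at 0)"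
    by (auto intro!: derivative_eq_intros partials_on_axes(3)[OF c(3) U] partials_on_axes(3)[OF c(4) U])
  then show "pm D 0 = \<beta>"
    by (rule partials_at_origin(3)[OF sm U, rotated]) (use D in auto)
qed

theorem theorem7p5:
  fixes \<alpha> \<beta> \<delta> \<zeta>p \<zeta>m \<eta>p \<eta>m \<chi>p \<chi>m :: real
    and Xp Xm :: "real \<times> real \<Rightarrow> real \<Rightarrow> real \<times> real"
    and k :: enat
  assumes "\<delta> \<in> {1, -1}" and "\<alpha> * \<beta> \<noteq> 0"
    and "upper_field \<delta> \<zeta>p \<eta>p \<chi>p Xp" and "lower_field \<alpha> \<beta> \<zeta>m \<eta>m \<chi>m Xm"
    and "\<beta> * \<delta> + \<alpha> > 0" and "\<alpha> * \<delta> < 0"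
    and "\<delta> * (\<zeta>m + \<chi>m) - \<alpha> * (\<zeta>p + \<chi>p) \<noteq> 0"
    and "3 \<le> k"
  shows "(\<forall>\<phi>. regularization_function k \<phi> \<longrightarrow>
            (\<exists>E \<mu>\<^sub>H. hopf_of_family \<alpha> \<beta> \<delta> Xp Xm \<phi> E \<mu>\<^sub>H) \<and>
            (\<forall>E \<mu>\<^sub>H. hopf_of_family \<alpha> \<beta> \<delta> Xp Xm \<phi> E \<mu>\<^sub>H \<longrightarrow>
               (\<lambda>\<epsilon>. hopf_lyapunov Xp Xm \<phi> E \<mu>\<^sub>H \<epsilon>
                     - lyapunov_slope \<alpha> \<beta> \<delta> \<zeta>p \<zeta>m \<eta>p \<eta>m \<chi>p \<chi>m \<phi> * sqrt \<epsilon>) \<in> o[at_right 0](\<lambda>\<epsilon>. sqrt \<epsilon>) \<and>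
               (4 \<le> k \<longrightarrow>
                  (\<lambda>\<epsilon>. hopf_lyapunov Xp Xm \<phi> E \<mu>\<^sub>H \<epsilon>
                     - lyapunov_slope \<alpha> \<beta> \<delta> \<zeta>p \<zeta>m \<eta>p \<eta>m \<chi>p \<chi>m \<phi> * sqrt \<epsilon>) \<in> O[at_right 0](\<lambda>\<epsilon>. \<epsilon>)))) \<and>
         (\<exists>\<phi>. regularization_function k \<phi> \<and> a2 \<alpha> \<beta> \<delta> \<zeta>p \<zeta>m \<eta>p \<eta>m \<chi>p \<chi>m \<phi> < 0) \<and>
         (\<exists>\<phi>. regularization_function k \<phi> \<and> a2 \<alpha> \<beta> \<delta> \<zeta>p \<zeta>m \<eta>p \<eta>m \<chi>p \<chi>m \<phi> = 0) \<and>
         (\<exists>\<phi>. regularization_function k \<phi> \<and> a2 \<alpha> \<beta> \<delta> \<zeta>p \<zeta>m \<eta>p \<eta>m \<chi>p \<chi>m \<phi> > 0) \<and>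
         (\<exists>\<phi>. regularization_function k \<phi> \<and> lyapunov_slope \<alpha> \<beta> \<delta> \<zeta>p \<zeta>m \<eta>p \<eta>m \<chi>p \<chi>m \<phi> < 0) \<and>
         (\<exists>\<phi>. regularization_function k \<phi> \<and> lyapunov_slope \<alpha> \<beta> \<delta> \<zeta>p \<zeta>m \<eta>p \<eta>m \<chi>p \<chi>m \<phi> = 0) \<and>
         (\<exists>\<phi>. regularization_function k \<phi> \<and> lyapunov_slope \<alpha> \<beta> \<delta> \<zeta>p \<zeta>m \<eta>p \<eta>m \<chi>p \<chi>m \<phi> > 0)"
proof -
  have k1: "1 \<le> k" using order_trans[OF _ assms(8), of 1] by (auto simp: numeral_eq_enat one_enat_def)
  obtain U1 where U1: "open U1" "(0, 0, 0) \<in> U1"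
    and r1: "remainder_on [(\<lambda>(x, y, \<mu>). x\<^sup>2), (\<lambda>(x, y, \<mu>). y), (\<lambda>(x, y, \<mu>). \<mu>)] U1
          (\<lambda>(x, y, \<mu>). fst (Xp (x, y) \<mu>) - (\<delta> + \<zeta>p * x))"
      "remainder_on [(\<lambda>(x, y, \<mu>). x * y), (\<lambda>(x, y, \<mu>). \<mu> * x), (\<lambda>(x, y, \<mu>). \<mu> * y), (\<lambda>(x, y, \<mu>). x ^ 3)] U1
          (\<lambda>(x, y, \<mu>). snd (Xp (x, y) \<mu>) - (x + \<eta>p * x\<^sup>2 + \<chi>p * y))"
    using assms(3) unfolding upper_field_def by blast
  obtain U2 where U2: "open U2" "(0, 0, 0) \<in> U2"
    and r2: "remainder_on [(\<lambda>(x, y, \<mu>). x\<^sup>2), (\<lambda>(x, y, \<mu>). y), (\<lambda>(x, y, \<mu>). \<mu>)] U2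
          (\<lambda>(x, y, \<mu>). fst (Xm (x, y) \<mu>) - (\<alpha> + \<zeta>m * x))"
      "remainder_on [(\<lambda>(x, y, \<mu>). x * y), (\<lambda>(x, y, \<mu>). \<mu> * y), (\<lambda>(x, y, \<mu>). \<mu> * (x - \<mu>)), (\<lambda>(x, y, \<mu>). (x - \<mu>) ^ 3)] U2
          (\<lambda>(x, y, \<mu>). snd (Xm (x, y) \<mu>) - (- \<beta> * (x - \<mu>) + \<eta>m * (x - \<mu>)\<^sup>2 + \<chi>m * y))"
    using assms(4) unfolding lower_field_def by blast
  define A where "A = (\<lambda>(x, y, \<mu>). fst (Xp (x, y) \<mu>))"
  define B where "B = (\<lambda>(x, y, \<mu>). fst (Xm (x, y) \<mu>))"
  define C where "C = (\<lambda>(x, y, \<mu>). snd (Xp (x, y) \<mu>))"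
  define D where "D = (\<lambda>(x, y, \<mu>). snd (Xm (x, y) \<mu>))"
  note Af = first_component[OF U1 r1(1), folded A_def] and Bf = first_component[OF U2 r2(1), folded B_def]
    and Cf = upper_second_component[OF U1 r1(2), folded C_def] and Df = lower_second_component[OF U2 r2(2), folded D_def]
  \<comment> \<open>The locale rebuilds the fields from their components; this identifies them with
    the given ones.\<close>
  have X: "(\<lambda>(x, y) \<mu>. (A (x, y, \<mu>), C (x, y, \<mu>))) = Xp" "(\<lambda>(x, y) \<mu>. (B (x, y, \<mu>), D (x, y, \<mu>))) = Xm"
    by (auto simp: A_def B_def C_def D_def)
  have "beta": "\<beta> \<noteq> 0" using assms(2) by auto
  have pws: "pws \<alpha> \<beta> \<delta> \<zeta>p \<zeta>m \<eta>p \<eta>m \<chi>p \<chi>m A B C D (U1 \<inter> U2) \<phi> k" if "regularization_function k \<phi>" for \<phi>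
  proof
    show "open (U1 \<inter> U2)" "0 \<in> U1 \<inter> U2" using U1 U2 by (auto simp: zero_prod_def)
    show "Ck_on \<infinity> (U1 \<inter> U2) A" "Ck_on \<infinity> (U1 \<inter> U2) B" "Ck_on \<infinity> (U1 \<inter> U2) C" "Ck_on \<infinity> (U1 \<inter> U2) D"
      by (rule smooth_subset[OF Af(1)] smooth_subset[OF Bf(1)] smooth_subset[OF Cf(1)] smooth_subset[OF Df(1)], blast)+
  qed (fact assms Af Bf Cf Df "beta" that)+
  note pws' = pws.hopf_of_family_exists[OF pws, unfolded X] pws.hopf_lyapunov_expansion[OF pws, unfolded X]
  note all_values = a2_lyapunov_slope_all_values[OF assms(6) k1 assms(7)]
  have a2: "\<exists>\<phi>. regularization_function k \<phi> \<and> a2 \<alpha> \<beta> \<delta> \<zeta>p \<zeta>m \<eta>p \<eta>m \<chi>p \<chi>m \<phi> = w" for w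
    by (rule all_values(1))
  have slope: "\<exists>\<phi>. regularization_function k \<phi> \<and> lyapunov_slope \<alpha> \<beta> \<delta> \<zeta>p \<zeta>m \<eta>p \<eta>m \<chi>p \<chi>m \<phi> = w" for w
    by (rule all_values(2))
  \<comment> \<open>Since every real value is attained, -1 and 1 serve as witnesses for the two
    signs.\<close>
  have 2: "\<exists>\<phi>. regularization_function k \<phi> \<and> a2 \<alpha> \<beta> \<delta> \<zeta>p \<zeta>m \<eta>p \<eta>m \<chi>p \<chi>m \<phi> < 0"
    "\<exists>\<phi>. regularization_function k \<phi> \<and> a2 \<alpha> \<beta> \<delta> \<zeta>p \<zeta>m \<eta>p \<eta>m \<chi>p \<chi>m \<phi> > 0"
    using a2[of "-1"] a2[of 1] by force+
  have 3: "\<exists>\<phi>. regularization_function k \<phi> \<and> lyapunov_slope \<alpha> \<beta> \<delta> \<zeta>p \<zeta>m \<eta>p \<eta>m \<chi>p \<chi>m \<phi> < 0"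
    "\<exists>\<phi>. regularization_function k \<phi> \<and> lyapunov_slope \<alpha> \<beta> \<delta> \<zeta>p \<zeta>m \<eta>p \<eta>m \<chi>p \<chi>m \<phi> > 0"
    using slope[of "-1"] slope[of 1] by force+
  show ?thesis by (intro conjI allI impI pws' 2 3 a2 slope)
qed

end
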